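(* Let $\alpha>0$. Given an initial film height $h_0\in H^1(S^1)$ with $0<C_0\le h_0(\theta)$ for all $\theta\in S^1$ (for some constant $C_0$), there exist a positive time $T>0$, constants $0<C_1\le C_2$, and a function $h$ with $C_1\le h(t,\theta)\le C_2$ for all $t\in[0,T]$, $\theta\in S^1$, which is a positive weak solution on $[0,T]$ of $$\partial_t h+\partial_\theta\Big(h^{\alpha+2}\,|\partial_\theta h+\partial_\theta^3h|^{\alpha-1}(\partial_\theta h+\partial_\theta^3 h)\Big)=0,\quad t>0,\ \theta\in S^1,\qquad h(0,\cdot)=h_0,$$ in the following sense: (i) $h\in L_{\alpha+1}\big((0,T);W^3_{\alpha+1}(S^1)\big)\cap C\big([0,T];H^1(S^1)\big)$ and $\partial_t h\in L_{\frac{\alpha+1}{\alpha}}\big((0,T);(W^1_{\alpha+1}(S^1))'\big)$; (ii) for all $\varphi\in L_{\alpha+1}\big((0,T);W^1_{\alpha+1}(S^1)\big)$, $$\int_0^T\langle\partial_th(t),\varphi(t)\rangle_{W^1_{\alpha+1}(S^1)}\,dt=\int_0^T\int_{S^1}h^{\alpha+2}\,\psi(\partial_\theta h+\partial_\theta^3h)\,\partial_\theta\varphi\,d\theta\,dt;$$ (iii) $h(0,\theta)=h_0(\theta)$ for all $\theta\in S^1$. In addition, this solution satisfies: (iv) (conservation of mass) $\|h(t)\|_{L_1(S^1)}=\|h_0\|_{L_1(S^1)}$ for all $t\in[0,T]$; (v) (energy dissipation) for all $t\in[0,T]$, $$E[h](t)+\int_0^t\int_{S^1}|h|^{\alpha+2}\,|\partial_\theta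 h+\partial_\theta^3h|^{\alpha+1}\,d\theta\,ds=E[h_0].$$
   Context: $S^1$ is identified with $[0,2\pi]$ with periodic boundary conditions, so functions on $S^1$ are $2\pi$-periodic functions on $\mathbb{R}$ (real-valued here). $L_p(S^1)$, $W^k_p(S^1)$, $H^k(S^1)=W^k_2(S^1)$ are the usual Lebesgue and Sobolev spaces of $2\pi$-periodic functions; a prime denotes the dual space and $\langle\cdot,\cdot\rangle_{W^1_{\alpha+1}(S^1)}$ the duality pairing between $(W^1_{\alpha+1}(S^1))'$ and $W^1_{\alpha+1}(S^1)$. We write $\psi(s)=|s|^{\alpha-1}s$ for $s\in\mathbb{R}$ (with $\psi(0)=0$). The energy is $E[v]=\frac12\int_{S^1}\big((\partial_\theta v)^2-v^2\big)\,d\theta$, and $E[h](t)=E[h(t,\cdot)]$. *)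

theory Defs
  imports "HOL-Analysis.Analysis"
begin

text \<open>Functions on the circle are \<open>2\<pi>\<close>-periodic functions on the real line, and integrals over
  the circle are integrals over \<open>[0, 2\<pi>]\<close>.  Elements of function spaces are represented by
  functions; the norms below are then seminorms that vanish exactly on the functions that are
  zero almost everywhere.\<close>

definition periodic :: "(real \<Rightarrow> real) \<Rightarrow> bool" where
  "periodic u \<longleftrightarrow> (\<forall>x. u (x + 2 * pi) = u x)"

definition smooth :: "(real \<Rightarrow> real) \<Rightarrow> bool" where
  "smooth \<phi> \<longleftrightarrow> (\<forall>n x. (deriv ^^ n) \<phi> differentiable (at x))"

definition Lp_circle :: "real \<Rightarrow> (real \<Rightarrow> real) set" where
  "Lp_circle p = {u. periodic u \<and> u \<in> borel_measurable lebesgue \<and>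
     set_integrable lebesgue {0..2 * pi} (\<lambda>\<theta>. \<bar>u \<theta>\<bar> powr p)}"

definition Lp_circle_norm :: "real \<Rightarrow> (real \<Rightarrow> real) \<Rightarrow> real" where
  "Lp_circle_norm p u = (LINT \<theta>:{0..2 * pi}|lebesgue. \<bar>u \<theta>\<bar> powr p) powr (1 / p)"

definition has_weak_deriv :: "nat \<Rightarrow> (real \<Rightarrow> real) \<Rightarrow> (real \<Rightarrow> real) \<Rightarrow> bool" where
  "has_weak_deriv j u v \<longleftrightarrow> u \<in> Lp_circle 1 \<and> v \<in> Lp_circle 1 \<and>
     (\<forall>\<phi>. smooth \<phi> \<and> periodic \<phi> \<longrightarrow>
        (LINT \<theta>:{0..2 * pi}|lebesgue. u \<theta> * (deriv ^^ j) \<phi> \<theta>) =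
        (- 1) ^ j * (LINT \<theta>:{0..2 * pi}|lebesgue. v \<theta> * \<phi> \<theta>))"

text \<open>The weak derivative is unique up to null sets; \<open>weak_deriv\<close> picks a representative, which
  is meaningful only if a weak derivative exists.\<close>

definition weak_deriv :: "nat \<Rightarrow> (real \<Rightarrow> real) \<Rightarrow> real \<Rightarrow> real" where
  "weak_deriv j u = (SOME v. has_weak_deriv j u v)"

text \<open>For \<open>k \<ge> 1\<close> every class in \<open>W\<^sup>k\<^sub>p\<close> of the circle has exactly one continuous
  representative, and we take that one.  This gives pointwise statements about such functions
  their usual meaning.\<close>

definition sobolev :: "nat \<Rightarrow> real \<Rightarrow> (real \<Rightarrow> real) set" where
  "sobolev k p = {u \<in> Lp_circle p. (k \<ge> 1 \<longrightarrow> continuous_on UNIV u) \<and>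
     (\<forall>j\<le>k. \<exists>v \<in> Lp_circle p. has_weak_deriv j u v)}"

definition sobolev_norm :: "nat \<Rightarrow> real \<Rightarrow> (real \<Rightarrow> real) \<Rightarrow> real" where
  "sobolev_norm k p u =
     (\<Sum>j\<le>k. LINT \<theta>:{0..2 * pi}|lebesgue. \<bar>weak_deriv j u \<theta>\<bar> powr p) powr (1 / p)"

text \<open>A seminormed space of real-valued functions is given by its carrier \<open>X\<close> and its seminorm
  \<open>N\<close>.  Only the values on \<open>X\<close> of a functional in \<open>dual_space X N\<close> matter; the duality pairing
  is application.\<close>

definition dual_space :: "('b \<Rightarrow> real) set \<Rightarrow> (('b \<Rightarrow> real) \<Rightarrow> real) \<Rightarrow> (('b \<Rightarrow> real) \<Rightarrow> real) set" where
  "dual_space X N = {l.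
     (\<forall>u\<in>X. \<forall>v\<in>X. \<forall>a b. l (\<lambda>x. a * u x + b * v x) = a * l u + b * l v) \<and>
     (\<exists>C. \<forall>u\<in>X. \<bar>l u\<bar> \<le> C * N u)}"

definition dual_norm :: "('b \<Rightarrow> real) set \<Rightarrow> (('b \<Rightarrow> real) \<Rightarrow> real) \<Rightarrow> (('b \<Rightarrow> real) \<Rightarrow> real) \<Rightarrow> real" where
  "dual_norm X N l = (SUP u \<in> {u \<in> X. N u \<le> 1}. \<bar>l u\<bar>)"

text \<open>The Bochner space \<open>L\<^sub>q(I; X)\<close>: strongly measurable functions, that is, almost everywhere
  limits in \<open>X\<close> of simple functions, whose norm is in \<open>L\<^sub>q(I)\<close>.  The library's Bochner
  integration needs the Banach space to be a type, which is impossible here because the space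
  depends on the real exponent.\<close>

definition Lp_bochner ::
  "real set \<Rightarrow> real \<Rightarrow> ('b \<Rightarrow> real) set \<Rightarrow> (('b \<Rightarrow> real) \<Rightarrow> real) \<Rightarrow> (real \<Rightarrow> 'b \<Rightarrow> real) set" where
  "Lp_bochner I q X N = {f.
     (AE t in lebesgue_on I. f t \<in> X) \<and>
     (\<exists>s. (\<forall>n. simple_function (lebesgue_on I) (s n) \<and> s n ` I \<subseteq> X) \<and>
          (AE t in lebesgue_on I. (\<lambda>n. N (\<lambda>x. s n t x - f t x)) \<longlonglongrightarrow> 0)) \<and>
     integrable (lebesgue_on I) (\<lambda>t. N (f t) powr q)}"

definition continuous_into ::
  "real set \<Rightarrow> ('b \<Rightarrow> real) set \<Rightarrow> (('b \<Rightarrow> real) \<Rightarrow> real) \<Rightarrow> (real \<Rightarrow> 'b \<Rightarrow> real) set" where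
  "continuous_into I X N = {f. \<forall>t\<in>I. f t \<in> X \<and>
     ((\<lambda>s. N (\<lambda>x. f s x - f t x)) \<longlongrightarrow> 0) (at t within I)}"

text \<open>\<open>g\<close> is the distributional time derivative on \<open>(0, T)\<close>, with values in the dual of \<open>X\<close>, of the
  function \<open>h\<close>, where \<open>h t\<close> acts on \<open>X\<close> by integration over the circle.  The identity
  \<open>\<integral> \<eta>'(t) h(t) dt = - \<integral> \<eta>(t) g(t) dt\<close> in the dual space is written out by evaluating both
  sides at \<open>w \<in> X\<close>.\<close>

definition has_weak_time_deriv ::
  "real \<Rightarrow> (real \<Rightarrow> real) set \<Rightarrow> (real \<Rightarrow> real \<Rightarrow> real) \<Rightarrow> (real \<Rightarrow> (real \<Rightarrow> real) \<Rightarrow> real) \<Rightarrow> bool" where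
  "has_weak_time_deriv T X h g \<longleftrightarrow>
     (\<forall>\<eta>. smooth \<eta> \<and> compact (closure {t. \<eta> t \<noteq> 0}) \<and> closure {t. \<eta> t \<noteq> 0} \<subseteq> {0<..<T} \<longrightarrow>
       (\<forall>w\<in>X.
         (LINT t:{0<..<T}|lebesgue.
            deriv \<eta> t * (LINT \<theta>:{0..2 * pi}|lebesgue. h t \<theta> * w \<theta>)) =
         - (LINT t:{0<..<T}|lebesgue. \<eta> t * g t w)))"

definition \<psi> :: "real \<Rightarrow> real \<Rightarrow> real" where
  "\<psi> \<alpha> s = \<bar>s\<bar> powr (\<alpha> - 1) * s"

definition energy :: "(real \<Rightarrow> real) \<Rightarrow> real" where
  "energy v = 1 / 2 * (LINT \<theta>:{0..2 * pi}|lebesgue. (weak_deriv 1 v \<theta>)\<^sup>2 - (v \<theta>)\<^sup>2)"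

text \<open>\<open>ht\<close> plays the role of \<open>\<partial>\<^sub>t h\<close>.\<close>

definition weak_solution ::
  "real \<Rightarrow> (real \<Rightarrow> real) \<Rightarrow> real \<Rightarrow> (real \<Rightarrow> real \<Rightarrow> real) \<Rightarrow> bool" where
  "weak_solution \<alpha> h0 T h \<longleftrightarrow>
     h \<in> Lp_bochner {0<..<T} (\<alpha> + 1) (sobolev 3 (\<alpha> + 1)) (sobolev_norm 3 (\<alpha> + 1)) \<and>
     h \<in> continuous_into {0..T} (sobolev 1 2) (sobolev_norm 1 2) \<and>
     (\<exists>ht.
        has_weak_time_deriv T (sobolev 1 (\<alpha> + 1)) h ht \<and>
        ht \<in> Lp_bochner {0<..<T} ((\<alpha> + 1) / \<alpha>)
               (dual_space (sobolev 1 (\<alpha> + 1)) (sobolev_norm 1 (\<alpha> + 1)))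
               (dual_norm (sobolev 1 (\<alpha> + 1)) (sobolev_norm 1 (\<alpha> + 1))) \<and>
        (\<forall>\<phi> \<in> Lp_bochner {0<..<T} (\<alpha> + 1) (sobolev 1 (\<alpha> + 1)) (sobolev_norm 1 (\<alpha> + 1)).
           (LINT t:{0<..<T}|lebesgue. ht t (\<phi> t)) =
           (LINT t:{0<..<T}|lebesgue. LINT \<theta>:{0..2 * pi}|lebesgue.
              h t \<theta> powr (\<alpha> + 2) * \<psi> \<alpha> (weak_deriv 1 (h t) \<theta> + weak_deriv 3 (h t) \<theta>)
                * weak_deriv 1 (\<phi> t) \<theta>))) \<and>
     (\<forall>\<theta>. h 0 \<theta> = h0 \<theta>)"

end

theory Submission
  imports Defs "HOL-Complex_Analysis.Great_Picard"
begin

text \<open>The equation is discretised by an explicit Euler scheme in time, with derivatives replaced by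
  difference quotients of box averages of width \<open>e\<close>. For fixed \<open>e\<close> these operators are bounded on
  continuous functions, so if the time step is small in terms of \<open>e\<close>, the scheme dissipates a discrete
  energy up to a vanishing error. This bounds the iterates \<open>h\<^sub>n\<close> in \<open>H\<^sup>1\<close>, their discrete version \<open>z\<^sub>n\<close> of
  \<open>\<partial>h + \<partial>\<^sup>3h\<close> in \<open>L\<^sub>p\<close> and the fluxes \<open>J\<^sub>n\<close> in \<open>L\<^sub>q\<close>, where \<open>p = \<alpha> + 1\<close> and \<open>q = (\<alpha> + 1) / \<alpha>\<close>. The iterates
  are then equicontinuous in time and space; for a short time they stay positive, and by Ascoli's
  argument they converge uniformly to some \<open>h\<close>. Convex combinations of \<open>z\<^sub>n\<close> and \<open>J\<^sub>n\<close> converge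
  strongly to limits \<open>z = \<partial>h + \<partial>\<^sup>3h\<close> and \<open>J\<close> with \<open>\<partial>\<^sub>th + \<partial>J = 0\<close>.

  Testing the scheme with box averages of the limit and then letting their width tend to zero yields
  the energy balance of \<open>h\<close> with dissipation \<open>\<integral>J z\<close>. Compared with the discrete energy inequality it
  bounds the upper limit of \<open>\<integral>J\<^sub>n z\<^sub>n\<close> by \<open>\<integral>J z\<close>, and Minty's monotonicity argument identifies
  \<open>J = h powr (\<alpha> + 2) * \<psi> \<alpha> z\<close>. The energy balance also makes \<open>h\<close> continuous in time with values in
  \<open>H\<^sup>1\<close>, since the norms converge.\<close>

section \<open>Powers and uniform convexity\<close>

text \<open>For continuous \<open>u\<close>, \<open>dsm e u\<close> and
  \<open>dq e (dq e (dq e u))\<close> are exactly the first and third derivatives of the triple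
  average \<open>avg3 e u\<close>. The scheme mollifies twice with this symmetric kernel, once in
  the flux divergence and once in \<open>zz e\<close>, and averages and quotients of all widths
  commute. Hence discrete integration by parts has no error, and the energy being dissipated is that
  of the iterate itself. It is only evaluated through a second, independent width, which may be sent
  to zero with the iterate fixed (a priori bounds) or after the limit of the iterates (energy
  balance). The obstacle is the product of two merely weakly convergent sequences, flux and
  \<open>z\<close>. At a fixed second width the flux is paired with strongly convergent functions
  only. A single sequence of weights serves both sequences, so every term that is linear in one of
  them passes to the limit, while the mobility converges uniformly. Derivatives are carried by the
  relation \<open>prim v u\<close>: \<open>u\<close> is an indefinite integral of
  \<open>v\<close>.\<close>

lemma continuous_on_abs_powr [continuous_intros]:
  fixes f :: "'a::topological_space \<Rightarrow> real"
  assumes "p > 0" "continuous_on S f"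
  shows "continuous_on S (\<lambda>x. \<bar>f x\<bar> powr p)"
  using assms by (intro continuous_on_powr' continuous_intros) auto

lemma psi_alt: "\<psi> \<alpha> s = sgn s * \<bar>s\<bar> powr \<alpha>"
  by (cases "s = 0") (auto simp: \<psi>_def powr_diff sgn_if)

lemma abs_psi: "\<bar>\<psi> \<alpha> s\<bar> = \<bar>s\<bar> powr \<alpha>"
  by (cases "s = 0") (auto simp: psi_alt abs_mult)

lemma psi_mult_self: "\<psi> \<alpha> s * s = \<bar>s\<bar> powr (\<alpha> + 1)"
  by (cases "s = 0") (auto simp: psi_alt powr_add sgn_if)

lemma continuous_on_psi [continuous_intros]:
  fixes f :: "'a::topological_space \<Rightarrow> real"
  assumes "\<alpha> > 0" "continuous_on S f"
  shows "continuous_on S (\<lambda>x. \<psi> \<alpha> (f x))"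
proof -
  have "\<psi> \<alpha> s = (max s 0) powr \<alpha> - (max (-s) 0) powr \<alpha>" for s
    by (auto simp: psi_alt sgn_if max_def)
  moreover have "continuous_on S (\<lambda>x. (max (f x) 0) powr \<alpha> - (max (- f x) 0) powr \<alpha>)"
    using assms by (intro continuous_intros continuous_on_powr') (auto simp: max_def)
  ultimately show ?thesis by simp
qed

lemma borel_measurable_psi [measurable]: "\<psi> \<alpha> \<in> borel_measurable borel"
  unfolding \<psi>_def by measurable

lemma psi_mono:
  assumes "\<alpha> > 0" "a \<le> b"
  shows "\<psi> \<alpha> a \<le> \<psi> \<alpha> b"
proof -
  consider "a \<ge> 0" | "b \<le> 0" | "a < 0" "b > 0" by linarith
  thus ?thesis
  proof cases
    case 1 then show ?thesis using assms by (cases "a = 0"; cases "b = 0") (auto simp: psi_alt intro!: powr_mono2)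
  next
    case 2 then show ?thesis using assms by (cases "a = 0"; cases "b = 0") (auto simp: psi_alt intro!: powr_mono2)
  next
    case 3 then show ?thesis by (auto simp: psi_alt intro: order_trans[of _ 0])
  qed
qed

lemma psi_monotone:
  assumes "\<alpha> > 0" shows "(\<psi> \<alpha> a - \<psi> \<alpha> b) * (a - b) \<ge> 0"
  using psi_mono[OF assms, of a b] psi_mono[OF assms, of b a]
  by (cases "a \<le> b") (auto simp: mult_nonpos_nonpos)

lemma psi_scale: "s > 0 \<Longrightarrow> \<psi> \<alpha> (s * a) = s powr \<alpha> * \<psi> \<alpha> a"
  by (auto simp: psi_alt sgn_mult abs_mult powr_mult)

text \<open>By homogeneity the claim reduces to the unit circle. There the points where
  \<open>F\<close> is at least \<delta> times the power sum form a compact set on which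
  \<open>F\<close>, hence \<open>G\<close>, is positive, so \<open>F / G\<close> is bounded. With a
  convexity gap as \<open>G\<close> this gives uniform convexity; with the power of
  \<open>a - b\<close> as \<open>G\<close> it gives continuity of nonlinear maps in L_p.\<close>

lemma homogeneous_absorb:
  fixes F G :: "real \<Rightarrow> real \<Rightarrow> real"
  assumes p: "p > 0" and \<delta>: "\<delta> > 0"
    and cF: "continuous_on UNIV (\<lambda>x. F (fst x) (snd x))"
    and cG: "continuous_on UNIV (\<lambda>x. G (fst x) (snd x))"
    and hF: "\<And>s a b. s > 0 \<Longrightarrow> F (s * a) (s * b) = s powr p * F a b"
    and hG: "\<And>s a b. s > 0 \<Longrightarrow> G (s * a) (s * b) = s powr p * G a b"
    and G0: "\<And>a b. G a b \<ge> 0"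
    and FG: "\<And>a b. F a b > 0 \<Longrightarrow> G a b > 0"
  shows "\<exists>C\<ge>0. \<forall>a b. F a b \<le> \<delta> * (\<bar>a\<bar> powr p + \<bar>b\<bar> powr p) + C * G a b"
proof -
  define P where "P = (\<lambda>a b::real. \<bar>a\<bar> powr p + \<bar>b\<bar> powr p)"
  have cP: "continuous_on UNIV (\<lambda>x. P (fst x) (snd x))"
    unfolding P_def using p by (intro continuous_intros)
  have hP: "s > 0 \<Longrightarrow> P (s * a) (s * b) = s powr p * P a b" for s a b
    by (auto simp: P_def abs_mult powr_mult algebra_simps)
  define K where "K = {x \<in> sphere (0::real\<times>real) 1. \<delta> * P (fst x) (snd x) \<le> F (fst x) (snd x)}"
  have "closed {x. \<delta> * P (fst x) (snd x) \<le> F (fst x) (snd x)}"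
    using cP cF by (intro closed_Collect_le continuous_intros) auto
  hence "compact (sphere (0::real\<times>real) 1 \<inter> {x. \<delta> * P (fst x) (snd x) \<le> F (fst x) (snd x)})"
    by (intro compact_Int_closed) auto
  hence K: "compact K" unfolding K_def by (simp add: Int_def)
  have KG: "G (fst x) (snd x) > 0" if "x \<in> K" for x
  proof -
    have "x \<noteq> 0" using that by (auto simp: K_def)
    hence "P (fst x) (snd x) > 0" using p
      by (cases x) (auto simp: P_def zero_prod_def add_pos_nonneg add_nonneg_pos)
    thus ?thesis using that \<delta> FG by (auto simp: K_def) (meson less_le_trans mult_pos_pos)
  qed
  have "\<exists>C\<ge>0. \<forall>x\<in>K. F (fst x) (snd x) \<le> C * G (fst x) (snd x)"
  proof (cases "K = {}")
    case False
    have "continuous_on K (\<lambda>x. F (fst x) (snd x) / G (fst x) (snd x))"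
      using KG cF cG by (intro continuous_intros) (auto intro: continuous_on_subset simp: less_imp_neq[THEN not_sym])
      
    then obtain x0 where "x0 \<in> K" and
      x0: "\<And>y. y \<in> K \<Longrightarrow> F (fst y) (snd y) / G (fst y) (snd y) \<le> F (fst x0) (snd x0) / G (fst x0) (snd x0)"
      using continuous_attains_sup[OF K False] by blast
    show ?thesis
    proof (intro exI[of _ "max 0 (F (fst x0) (snd x0) / G (fst x0) (snd x0))"] conjI ballI)
      fix y assume y: "y \<in> K"
      have "F (fst y) (snd y) / G (fst y) (snd y) \<le> max 0 (F (fst x0) (snd x0) / G (fst x0) (snd x0))"
        using x0[OF y] by simp
      thus "F (fst y) (snd y) \<le> max 0 (F (fst x0) (snd x0) / G (fst x0) (snd x0)) * G (fst y) (snd y)"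
        using KG[OF y] by (simp only: pos_divide_le_eq)
    qed simp
  qed auto
  then obtain C where C: "C \<ge> 0" "\<And>x. x \<in> K \<Longrightarrow> F (fst x) (snd x) \<le> C * G (fst x) (snd x)" by blast
  have sph: "F a b \<le> \<delta> * P a b + C * G a b" if "(a, b) \<in> sphere 0 1" for a b
  proof (cases "(a,b) \<in> K")
    case True
    have "0 \<le> \<delta> * P a b" using \<delta> by (simp add: P_def)
    with C(2)[OF True] show ?thesis by simp
  next
    case False
    hence "F a b \<le> \<delta> * P a b" using that by (auto simp: K_def)
    moreover have "0 \<le> C * G a b" using C(1) G0 by simp
    ultimately show ?thesis by linarith
  qed
  have "F a b \<le> \<delta> * P a b + C * G a b" for a b
  proof (cases "(a, b) = (0, 0)")
    case True
    \<comment> \<open>The origin is not reached by scaling from the circle; homogeneity with the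
      factor 2 forces \<open>F\<close> to vanish there.\<close>
    have "F 0 0 = 2 powr p * F 0 0" using hF[of 2 0 0] by simp
    moreover have "2 powr p > (1::real)" using p by simp
    ultimately have "F 0 0 = 0" by auto
    thus ?thesis using True \<delta> C(1) G0[of 0 0] by (simp add: P_def)
  next
    case False
    define s where "s = norm (a, b)"
    have s: "s > 0" using False by (simp add: s_def zero_prod_def[symmetric])
    have "(a/s, b/s) \<in> sphere 0 1"
    proof -
      have "(a/s, b/s) = (1/s) *\<^sub>R (a, b)" by simp
      thus ?thesis using s unfolding s_def by (simp only: mem_sphere_0 norm_scaleR) simp
    qed
    from sph[OF this] have "s powr p * F (a/s) (b/s) \<le> s powr p * (\<delta> * P (a/s) (b/s) + C * G (a/s) (b/s))"
      by (intro mult_left_mono) auto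
    also have "\<dots> = \<delta> * (s powr p * P (a/s) (b/s)) + C * (s powr p * G (a/s) (b/s))" by (simp add: algebra_simps)
    finally show ?thesis using hF[OF s, of "a/s" "b/s"] hG[OF s, of "a/s" "b/s"] hP[OF s, of "a/s" "b/s"] s by simp
  qed
  thus ?thesis using C(1) unfolding P_def by blast
qed

text \<open>The mean value theorem on both halves compares the two increments, because the
  derivative is strictly increasing. Differentiability is used only inside the intervals, so
  \<open>y = 0\<close> is covered.\<close>

lemma midpoint_powr_less_nonneg:
  fixes x y :: real
  assumes p: "p > 1" and xy: "0 \<le> y" "y < x"
  shows "((x + y) / 2) powr p < (x powr p + y powr p) / 2"
proof -
  define m where "m = (x + y) / 2"
  have m: "y < m" "m < x" using xy by (auto simp: m_def)
  have d: "((\<lambda>x. x powr p) has_real_derivative p * t powr (p - 1)) (at t)" if "t > 0" for t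
    using that by (rule has_real_derivative_powr)
  have c: "continuous_on {u..v} (\<lambda>x. x powr p)" if "u \<ge> 0" for u v :: real
    using that p by (intro continuous_on_powr' continuous_intros) auto
  obtain s where s: "m < s" "s < x" "x powr p - m powr p = (x - m) * (p * s powr (p - 1))"
  proof (rule MVT[of m x "\<lambda>x. x powr p", elim_format])
    show "continuous_on {m..x} (\<lambda>x. x powr p)" using m xy by (intro c) auto
    show "\<And>t. m < t \<Longrightarrow> t < x \<Longrightarrow> (\<lambda>x. x powr p) differentiable (at t)"
      using d m xy by (meson dual_order.strict_trans order_le_less_trans real_differentiable_def)
  qed (use m in auto, metis DERIV_unique d le_less_trans m(1) order.strict_trans xy(1))
  obtain r where r: "y < r" "r < m" "m powr p - y powr p = (m - y) * (p * r powr (p - 1))"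
  proof (rule MVT[of y m "\<lambda>x. x powr p", elim_format])
    show "continuous_on {y..m} (\<lambda>x. x powr p)" using m xy by (intro c) auto
    show "\<And>t. y < t \<Longrightarrow> t < m \<Longrightarrow> (\<lambda>x. x powr p) differentiable (at t)"
      using d m xy by (meson dual_order.strict_trans order_le_less_trans real_differentiable_def)
  qed (use m in auto, metis DERIV_unique d le_less_trans xy(1))
  have "r powr (p - 1) < s powr (p - 1)" using r s xy p by (intro powr_less_mono2) auto
  moreover have "x - m = m - y" by (simp add: m_def field_simps)
  ultimately have "m powr p - y powr p < x powr p - m powr p"
    using r(3) s(3) m p by (simp add: mult_strict_left_mono)
  thus ?thesis by (simp add: m_def)
qed

lemma midpoint_abs_powr_less:
  fixes a b :: real
  assumes p: "p > 1" and ab: "a \<noteq> b"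
  shows "\<bar>(a + b) / 2\<bar> powr p < (\<bar>a\<bar> powr p + \<bar>b\<bar> powr p) / 2"
proof (cases "\<bar>a\<bar> = \<bar>b\<bar>")
  case True
  hence "a = - b" "b \<noteq> 0" using ab by auto
  thus ?thesis using p by simp
next
  case False
  have "\<bar>(a + b) / 2\<bar> powr p \<le> ((\<bar>a\<bar> + \<bar>b\<bar>) / 2) powr p"
    using p by (intro powr_mono2) auto
  also have "\<dots> < (\<bar>a\<bar> powr p + \<bar>b\<bar> powr p) / 2"
    using midpoint_powr_less_nonneg[OF p, of "\<bar>a\<bar>" "\<bar>b\<bar>"] midpoint_powr_less_nonneg[OF p, of "\<bar>b\<bar>" "\<bar>a\<bar>"] False
    by (cases "\<bar>a\<bar> < \<bar>b\<bar>") (auto simp: add.commute)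
  finally show ?thesis .
qed

lemma midpoint_abs_powr_le:
  fixes a b :: real
  assumes p: "p > 1"
  shows "\<bar>(a + b) / 2\<bar> powr p \<le> (\<bar>a\<bar> powr p + \<bar>b\<bar> powr p) / 2"
  using midpoint_abs_powr_less[OF p, of a b] by (cases "a = b") auto

text \<open>\<open>homogeneous_absorb\<close> with the midpoint gap as \<open>G\<close>, which is
  positive off the diagonal by strict convexity. Thanks to the small term with \<delta>, one
  inequality covers all \<open>p > 1\<close>, below and above 2 alike.\<close>

lemma uniform_convexity_powr:
  assumes p: "p > 1" and \<delta>: "\<delta> > 0"
  obtains C where "C \<ge> 0" "\<And>a b::real. \<bar>a - b\<bar> powr p \<le> \<delta> * (\<bar>a\<bar> powr p + \<bar>b\<bar> powr p)
     + C * ((\<bar>a\<bar> powr p + \<bar>b\<bar> powr p) / 2 - \<bar>(a + b) / 2\<bar> powr p)"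
proof -
  have "\<exists>C\<ge>0. \<forall>a b::real. \<bar>a - b\<bar> powr p \<le> \<delta> * (\<bar>a\<bar> powr p + \<bar>b\<bar> powr p)
     + C * ((\<bar>a\<bar> powr p + \<bar>b\<bar> powr p) / 2 - \<bar>(a + b) / 2\<bar> powr p)"
  proof (rule homogeneous_absorb[of p \<delta> "\<lambda>a b. \<bar>a - b\<bar> powr p"])
    fix s a b :: real assume s: "s > 0"
    have 1: "s * a - s * b = s * (a - b)" "(s * a + s * b) / 2 = s * ((a + b) / 2)" by (simp_all add: algebra_simps)
    show "\<bar>s * a - s * b\<bar> powr p = s powr p * \<bar>a - b\<bar> powr p"
      using s by (simp add: 1 abs_mult powr_mult)
    show "(\<bar>s * a\<bar> powr p + \<bar>s * b\<bar> powr p) / 2 - \<bar>(s * a + s * b) / 2\<bar> powr p =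
       s powr p * ((\<bar>a\<bar> powr p + \<bar>b\<bar> powr p) / 2 - \<bar>(a + b) / 2\<bar> powr p)"
      unfolding 1 using s by (simp only: abs_mult powr_mult abs_of_pos) (simp add: algebra_simps)
  next
    fix a b :: real
    show "(\<bar>a\<bar> powr p + \<bar>b\<bar> powr p) / 2 - \<bar>(a + b) / 2\<bar> powr p \<ge> 0"
      using midpoint_abs_powr_le[OF p, of a b] by simp
    assume "\<bar>a - b\<bar> powr p > 0"
    hence "a \<noteq> b" by auto
    thus "(\<bar>a\<bar> powr p + \<bar>b\<bar> powr p) / 2 - \<bar>(a + b) / 2\<bar> powr p > 0"
      using midpoint_abs_powr_less[OF p, of a b] by simp
  next
    show "continuous_on UNIV (\<lambda>x::real\<times>real. \<bar>fst x - snd x\<bar> powr p)"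
      "continuous_on UNIV (\<lambda>x::real\<times>real. (\<bar>fst x\<bar> powr p + \<bar>snd x\<bar> powr p) / 2 - \<bar>(fst x + snd x) / 2\<bar> powr p)"
      using p by (intro continuous_on_abs_powr continuous_intros; simp)+
  qed (use p \<delta> in auto)
  thus ?thesis using that by blast
qed

lemma abs_powr_add_le:
  fixes a b :: real
  assumes "p > 0"
  shows "\<bar>a + b\<bar> powr p \<le> 2 powr p * (\<bar>a\<bar> powr p + \<bar>b\<bar> powr p)"
proof -
  have "\<bar>a + b\<bar> powr p \<le> (2 * max \<bar>a\<bar> \<bar>b\<bar>) powr p" using assms by (intro powr_mono2) auto
  also have "\<dots> = 2 powr p * max \<bar>a\<bar> \<bar>b\<bar> powr p" by (simp add: powr_mult)
  also have "\<dots> \<le> 2 powr p * (\<bar>a\<bar> powr p + \<bar>b\<bar> powr p)" by (intro mult_left_mono) (auto simp: max_def)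
  finally show ?thesis .
qed

text \<open>The tangent line below a convex function, obtained from Young's inequality for
  \<open>b\<close> and \<open>\<psi> (p - 1) a\<close>. The conjugate exponent
  \<open>p / (p - 1)\<close> explains the separate case \<open>p = 1\<close>. Integrated, this
  becomes \<open>Jensen_avg\<close>.\<close>

lemma abs_powr_tangent:
  fixes a b :: real
  assumes p: "p \<ge> 1"
  shows "\<bar>a\<bar> powr p + p * \<psi> (p - 1) a * (b - a) \<le> \<bar>b\<bar> powr p"
proof (cases "p = 1")
  case True
  thus ?thesis by (auto simp: psi_alt sgn_if)
next
  case False
  with p have p: "p > 1" by simp
  define q where "q = p / (p - 1)"
  have q: "q > 1" "1/p + 1/q = 1" using p by (auto simp: q_def field_simps)
  have "\<bar>b\<bar> * \<bar>\<psi> (p-1) a\<bar> \<le> \<bar>b\<bar> powr p / p + \<bar>\<psi> (p-1) a\<bar> powr q / q"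
    using p q by (intro Youngs_inequality) auto
  also have "\<bar>\<psi> (p-1) a\<bar> powr q = \<bar>a\<bar> powr p" using p by (simp add: abs_psi powr_powr q_def)
  finally have 1: "p * (\<bar>b\<bar> * \<bar>\<psi> (p-1) a\<bar>) \<le> \<bar>b\<bar> powr p + (p - 1) * \<bar>a\<bar> powr p"
    using p by (simp add: q_def field_simps)
  have 2: "p * (\<psi> (p-1) a * b) \<le> p * (\<bar>b\<bar> * \<bar>\<psi> (p-1) a\<bar>)"
    using p by (intro mult_left_mono) (auto simp: abs_mult[symmetric] mult.commute)
  have 3: "\<psi> (p-1) a * a = \<bar>a\<bar> powr p" using psi_mult_self[of "p-1" a] by simp
  have "p * \<psi> (p-1) a * (b - a) = p * (\<psi> (p-1) a * b) - p * (\<psi> (p-1) a * a)" by (simp add: algebra_simps)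
  with 1 2 3 show ?thesis by (simp add: algebra_simps)
qed

section \<open>Lebesgue spaces and convex combinations\<close>

text \<open>Sizes are measured by \<open>Ip\<close>, the \<open>p\<close>-th power of the norm; in
  place of the triangle inequality stands \<open>Ip_add_le\<close>, with the constant
  \<open>2 powr p\<close> of \<open>abs_powr_add_le\<close>.\<close>

definition Lpf :: "'a measure \<Rightarrow> real \<Rightarrow> ('a \<Rightarrow> real) \<Rightarrow> bool" where
  "Lpf M p u \<longleftrightarrow> u \<in> borel_measurable M \<and> integrable M (\<lambda>x. \<bar>u x\<bar> powr p)"

abbreviation Ip :: "'a measure \<Rightarrow> real \<Rightarrow> ('a \<Rightarrow> real) \<Rightarrow> real" where
  "Ip M p u \<equiv> integral\<^sup>L M (\<lambda>x. \<bar>u x\<bar> powr p)"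

lemma LpfI: "u \<in> borel_measurable M \<Longrightarrow> integrable M (\<lambda>x. \<bar>u x\<bar> powr p) \<Longrightarrow> Lpf M p u"
  by (simp add: Lpf_def)

lemma Lpf_measurable: "Lpf M p u \<Longrightarrow> u \<in> borel_measurable M"
  by (simp add: Lpf_def)

lemma Lpf_integrable: "Lpf M p u \<Longrightarrow> integrable M (\<lambda>x. \<bar>u x\<bar> powr p)"
  by (simp add: Lpf_def)

lemma Lpf_dominated:
  assumes "integrable M f" "u \<in> borel_measurable M" "AE x in M. \<bar>u x\<bar> powr p \<le> f x"
  shows "Lpf M p u"
proof (rule LpfI)
  show "integrable M (\<lambda>x. \<bar>u x\<bar> powr p)"
  proof (rule Bochner_Integration.integrable_bound[OF assms(1)])
    show "AE x in M. norm (\<bar>u x\<bar> powr p) \<le> norm (f x)"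
      using assms(3) by eventually_elim auto
  qed (use assms(2) in measurable)
qed fact

lemma Lpf_add:
  assumes "p > 0" "Lpf M p u" "Lpf M p v"
  shows "Lpf M p (\<lambda>x. u x + v x)"
  using assms abs_powr_add_le[OF assms(1)]
  by (intro Lpf_dominated[of M "\<lambda>x. 2 powr p * (\<bar>u x\<bar> powr p + \<bar>v x\<bar> powr p)"]) (auto simp: Lpf_def)

lemma Lpf_cmult:
  assumes "Lpf M p u"
  shows "Lpf M p (\<lambda>x. c * u x)"
  using assms by (auto simp: Lpf_def abs_mult powr_mult)

lemma Lpf_minus: "Lpf M p u \<Longrightarrow> Lpf M p (\<lambda>x. - u x)"
  by (auto simp: Lpf_def)

lemma Lpf_diff:
  assumes "p > 0" "Lpf M p u" "Lpf M p v"
  shows "Lpf M p (\<lambda>x. u x - v x)"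
  using Lpf_add[OF assms(1,2) Lpf_minus[OF assms(3)]] by simp

lemma Lpf_zero: "p > 0 \<Longrightarrow> Lpf M p (\<lambda>x. 0)"
  by (simp add: Lpf_def)

lemma Lpf_sum:
  assumes "p > 0" "\<And>i. i \<in> S \<Longrightarrow> Lpf M p (u i)"
  shows "Lpf M p (\<lambda>x. \<Sum>i\<in>S. u i x)"
  using assms(2)
proof (induction S rule: infinite_finite_induct)
  case (insert i S)
  thus ?case using Lpf_add[OF assms(1), of M "u i" "\<lambda>x. \<Sum>i\<in>S. u i x"] by simp
qed (use assms(1) in \<open>auto intro: Lpf_zero\<close>)

lemma Lpf_bounded:
  assumes "finite_measure M" "u \<in> borel_measurable M" "\<And>x. x \<in> space M \<Longrightarrow> \<bar>u x\<bar> \<le> B" "p > 0"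
  shows "Lpf M p u"
proof -
  interpret finite_measure M by fact
  show ?thesis using assms
    by (intro Lpf_dominated[of M "\<lambda>x. B powr p"]) (auto intro!: powr_mono2)
qed

lemma abs_le_1_powr: "p \<ge> 1 \<Longrightarrow> \<bar>x::real\<bar> \<le> 1 + \<bar>x\<bar> powr p"
proof -
  assume p: "p \<ge> 1"
  show ?thesis
  proof (cases "\<bar>x\<bar> \<le> 1")
    case True then show ?thesis by (simp add: add_increasing2)
  next
    case False
    hence "\<bar>x\<bar> powr 1 \<le> \<bar>x\<bar> powr p" using p by (intro powr_mono) auto
    thus ?thesis using False by simp
  qed
qed

lemma Lpf_imp_integrable:
  assumes "finite_measure M" "Lpf M p u" "p \<ge> 1"
  shows "integrable M u"
proof -
  interpret finite_measure M by fact
  show ?thesis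
  proof (rule Bochner_Integration.integrable_bound[of M "\<lambda>x. 1 + \<bar>u x\<bar> powr p"])
    show "AE x in M. norm (u x) \<le> norm (1 + \<bar>u x\<bar> powr p)"
      using abs_le_1_powr[OF assms(3)] by (auto simp: abs_of_nonneg add_nonneg_nonneg)
  qed (use assms in \<open>auto simp: Lpf_def\<close>)
qed

lemma Lpf_mult_integrable:
  assumes "Lpf M p u" "Lpf M q v" and p: "p > 1" and q: "q > 1" "1/p + 1/q = 1"
  shows "integrable M (\<lambda>x. u x * v x)"
proof (rule Bochner_Integration.integrable_bound[of M "\<lambda>x. \<bar>u x\<bar> powr p / p + \<bar>v x\<bar> powr q / q"])
  show "AE x in M. norm (u x * v x) \<le> norm (\<bar>u x\<bar> powr p / p + \<bar>v x\<bar> powr q / q)"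
  proof (rule AE_I2)
    fix x
    show "norm (u x * v x) \<le> norm (\<bar>u x\<bar> powr p / p + \<bar>v x\<bar> powr q / q)"
      using Youngs_inequality[of p q "\<bar>u x\<bar>" "\<bar>v x\<bar>"] p q by (simp add: abs_mult)
  qed
qed (use assms in \<open>auto simp: Lpf_def\<close>)

lemma Ip_cong_AE:
  "u \<in> borel_measurable M \<Longrightarrow> v \<in> borel_measurable M \<Longrightarrow> AE x in M. u x = v x \<Longrightarrow> Ip M p u = Ip M p v"
  by (rule integral_cong_AE) (auto elim: eventually_mono)

lemma Ip_nonneg: "Ip M p u \<ge> 0"
  by (intro Bochner_Integration.integral_nonneg) auto

lemma Hoelder_inequality:
  assumes u: "Lpf M p u" and v: "Lpf M q v" and p: "p > 1" and q: "q > 1" "1/p + 1/q = 1"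
  shows "\<bar>LINT x|M. u x * v x\<bar> \<le> Ip M p u powr (1/p) * Ip M q v powr (1/q)"
proof -
  have int: "integrable M (\<lambda>x. \<bar>u x * v x\<bar>)"
    using Lpf_mult_integrable[OF assms] by auto
  have "\<bar>LINT x|M. u x * v x\<bar> \<le> (LINT x|M. \<bar>u x * v x\<bar>)"
    using integral_abs_bound by blast
  also have "\<dots> \<le> Ip M p u powr (1/p) * Ip M q v powr (1/q)"
  proof (cases "Ip M p u = 0 \<or> Ip M q v = 0")
    case True
    hence "AE x in M. u x * v x = 0"
    proof
      assume "Ip M p u = 0"
      hence "AE x in M. \<bar>u x\<bar> powr p = 0"
        using integral_nonneg_eq_0_iff_AE[OF Lpf_integrable[OF u]] by auto
      thus ?thesis by eventually_elim auto
    next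
      assume "Ip M q v = 0"
      hence "AE x in M. \<bar>v x\<bar> powr q = 0"
        using integral_nonneg_eq_0_iff_AE[OF Lpf_integrable[OF v]] by auto
      thus ?thesis by eventually_elim auto
    qed
    hence "(LINT x|M. \<bar>u x * v x\<bar>) = 0"
      by (intro integral_eq_zero_AE) auto
    thus ?thesis by simp
  next
    case False
    define A B where "A = Ip M p u powr (1/p)" and "B = Ip M q v powr (1/q)"
    have pos: "Ip M p u > 0" "Ip M q v > 0" using False Ip_nonneg[of M u p] Ip_nonneg[of M v q] by linarith+
    have AB: "A > 0" "B > 0" using pos by (auto simp: A_def B_def)
    have ApBq: "A powr p = Ip M p u" "B powr q = Ip M q v"
      using pos p q by (auto simp: A_def B_def powr_powr)
    have "(LINT x|M. \<bar>u x * v x\<bar>) \<le> (LINT x|M. A * B * (\<bar>u x\<bar> powr p / (p * A powr p) + \<bar>v x\<bar> powr q / (q * B powr q)))"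
    proof (intro integral_mono)
      fix x
      have "\<bar>u x * v x\<bar> = A * B * ((\<bar>u x\<bar> / A) * (\<bar>v x\<bar> / B))" using AB by (simp add: abs_mult)
      also have "\<dots> \<le> A * B * ((\<bar>u x\<bar> / A) powr p / p + (\<bar>v x\<bar> / B) powr q / q)"
        using AB p q by (intro mult_left_mono Youngs_inequality) auto
      also have "\<dots> = A * B * (\<bar>u x\<bar> powr p / (p * A powr p) + \<bar>v x\<bar> powr q / (q * B powr q))"
        using AB by (simp add: powr_divide mult.commute)
      finally show "\<bar>u x * v x\<bar> \<le> A * B * (\<bar>u x\<bar> powr p / (p * A powr p) + \<bar>v x\<bar> powr q / (q * B powr q))" .
    qed (use int u v in \<open>auto simp: Lpf_def\<close>)
    also have "\<dots> = A * B * (Ip M p u / (p * A powr p) + Ip M q v / (q * B powr q))"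
      using u v by (simp add: Lpf_def)
    also have "\<dots> = A * B * (1/p + 1/q)" using pos by (simp add: ApBq)
    finally show ?thesis using q by (simp add: A_def B_def)
  qed
  finally show ?thesis .
qed

section \<open>Convergence in L_p and continuity of nonlinear maps\<close>

abbreviation Lp_conv :: "'a measure \<Rightarrow> real \<Rightarrow> (nat \<Rightarrow> 'a \<Rightarrow> real) \<Rightarrow> ('a \<Rightarrow> real) \<Rightarrow> bool" where
  "Lp_conv M p f u \<equiv> (\<lambda>n. Ip M p (\<lambda>x. f n x - u x)) \<longlonglongrightarrow> 0"

lemma Lp_conv_mult:
  assumes u: "\<And>n. Lpf M p (u n)" "Lpf M p u0" "Lp_conv M p u u0"
    and v: "\<And>n. Lpf M q (v n)" "Lpf M q v0" "Lp_conv M q v v0"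
    and p: "p > 1" and q: "q > 1" "1/p + 1/q = 1"
  shows "(\<lambda>n. LINT x|M. u n x * v n x) \<longlonglongrightarrow> (LINT x|M. u0 x * v0 x)"
proof -
  let ?d = "\<lambda>n x. u n x - u0 x" and ?e = "\<lambda>n x. v n x - v0 x"
  have p0: "p > 0" "q > 0" using p q by auto
  have d: "Lpf M p (?d n)" "Lpf M q (?e n)" for n using u v p q by (auto intro!: Lpf_diff)
  have 1: "\<bar>(LINT x|M. u n x * v n x) - (LINT x|M. u0 x * v0 x)\<bar>
     \<le> Ip M p (?d n) powr (1/p) * Ip M q (?e n) powr (1/q)
     + Ip M p (?d n) powr (1/p) * Ip M q v0 powr (1/q)
     + Ip M p u0 powr (1/p) * Ip M q (?e n) powr (1/q)" for n
  proof -
    have i: "integrable M (\<lambda>x. ?d n x * ?e n x)" "integrable M (\<lambda>x. ?d n x * v0 x)" "integrable M (\<lambda>x. u0 x * ?e n x)"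
       "integrable M (\<lambda>x. u n x * v n x)" "integrable M (\<lambda>x. u0 x * v0 x)"
      using d u v p q by (auto intro!: Lpf_mult_integrable[of M p _ q])
    have "(LINT x|M. u n x * v n x) - (LINT x|M. u0 x * v0 x) =
      (LINT x|M. ?d n x * ?e n x + ?d n x * v0 x + u0 x * ?e n x)"
      using i by (subst Bochner_Integration.integral_diff[symmetric]) (auto intro!: Bochner_Integration.integral_cong simp: algebra_simps)
    also have "\<dots> = (LINT x|M. ?d n x * ?e n x) + (LINT x|M. ?d n x * v0 x) + (LINT x|M. u0 x * ?e n x)"
      using i by simp
    finally show ?thesis
      using Hoelder_inequality[OF d(1)[of n] d(2)[of n] p q] Hoelder_inequality[OF d(1)[of n] v(2) p q]
        Hoelder_inequality[OF u(2) d(2)[of n] p q] by linarith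
  qed
  have tu: "(\<lambda>n. Ip M p (?d n) powr (1/p)) \<longlonglongrightarrow> 0 powr (1/p)"
    and tv: "(\<lambda>n. Ip M q (?e n) powr (1/q)) \<longlonglongrightarrow> 0 powr (1/q)"
    using p q by (intro tendsto_powr'[OF u(3)] tendsto_powr'[OF v(3)] tendsto_const; simp add: Ip_nonneg)+
  have "(\<lambda>n. (LINT x|M. u n x * v n x) - (LINT x|M. u0 x * v0 x)) \<longlonglongrightarrow> 0"
  proof (rule Lim_null_comparison)
    show "(\<lambda>n. Ip M p (?d n) powr (1/p) * Ip M q (?e n) powr (1/q)
     + Ip M p (?d n) powr (1/p) * Ip M q v0 powr (1/q)
     + Ip M p u0 powr (1/p) * Ip M q (?e n) powr (1/q)) \<longlonglongrightarrow> 0"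
      using tu tv by (auto intro!: tendsto_add_zero tendsto_mult_zero tendsto_mult_left_zero tendsto_mult_right_zero)
  qed (use 1 in auto)
  thus ?thesis by (simp add: LIM_zero_iff)
qed

text \<open>For estimates with an auxiliary parameter \<open>m\<close>: at fixed \<open>m\<close>
  the bound is followed along \<open>n\<close>, and afterwards \<open>m\<close> makes its limit
  small.\<close>

lemma tendsto_zero_diagonal:
  fixes D :: "nat \<Rightarrow> real"
  assumes "\<And>n. 0 \<le> D n" "\<And>m n. D n \<le> U m n" "\<And>m. U m \<longlonglongrightarrow> u m" "u \<longlonglongrightarrow> 0"
  shows "D \<longlonglongrightarrow> 0"
proof (rule LIMSEQ_I)
  fix \<epsilon> :: real assume "\<epsilon> > 0"
  then obtain m where m: "u m < \<epsilon>"
    using order_tendstoD(2)[OF assms(4)] by (auto simp: eventually_sequentially)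
  obtain N where N: "\<And>n. n \<ge> N \<Longrightarrow> U m n < \<epsilon>"
    using order_tendstoD(2)[OF assms(3) m] by (auto simp: eventually_sequentially)
  have "norm (D n - 0) < \<epsilon>" if "n \<ge> N" for n using N[OF that] assms(1)[of n] assms(2)[of n m] by simp
  thus "\<exists>N. \<forall>n\<ge>N. norm (D n - 0) < \<epsilon>" by blast
qed

text \<open>A homogeneous \<open>F\<close> that vanishes on the diagonal satisfies a bound by a
  small multiple of the power of \<open>b\<close> plus a large multiple of the power of
  \<open>a - b\<close>. After integration the second part vanishes along \<open>n\<close>, and then
  the small factor is sent to zero. No subsequence and no pointwise convergence enter.\<close>

lemma homogeneous_conv:
  fixes F :: "real \<Rightarrow> real \<Rightarrow> real"
  assumes p: "p > 0" and cF: "continuous_on UNIV (\<lambda>x. F (fst x) (snd x))"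
    and hF: "\<And>s a b. s > 0 \<Longrightarrow> F (s * a) (s * b) = s powr p * F a b" and F0: "\<And>a b. F a b \<ge> 0" "\<And>a. F a a = 0"
    and f: "\<And>n. Lpf M p (f n)" "Lpf M p g" "Lp_conv M p f g"
  shows "(\<lambda>n. LINT x|M. F (f n x) (g x)) \<longlonglongrightarrow> 0"
proof -
  have "\<exists>C\<ge>0. \<forall>a b. F a b \<le> \<delta> * \<bar>b\<bar> powr p + C * \<bar>a - b\<bar> powr p" if \<delta>: "\<delta> > 0" for \<delta>
  proof -
    \<comment> \<open>The divisor pays for trading the power of \<open>a\<close> for powers of
      \<open>a - b\<close> and \<open>b\<close>, so that only the fixed function \<open>g\<close>
      carries the small factor.\<close>
    define d where "d = \<delta> / (2 powr p + 1)"
    have k: "2 powr p + 1 > (0::real)" by (simp add: add_nonneg_pos)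
    hence d: "d > 0" "d * (2 powr p + 1) = \<delta>" using \<delta> by (simp_all add: d_def)
    have "\<exists>C\<ge>0. \<forall>a b. F a b \<le> d * (\<bar>a\<bar> powr p + \<bar>b\<bar> powr p) + C * \<bar>a - b\<bar> powr p"
    proof (rule homogeneous_absorb[OF p d(1) cF])
      show "continuous_on UNIV (\<lambda>x::real \<times> real. \<bar>fst x - snd x\<bar> powr p)" using p by (intro continuous_intros)
      show "\<bar>s * a - s * b\<bar> powr p = s powr p * \<bar>a - b\<bar> powr p" if "s > 0" for s a b :: real
        using that by (simp add: abs_mult powr_mult flip: right_diff_distrib)
      show "\<bar>a - b\<bar> powr p > 0" if "F a b > 0" for a b using that F0(2) by (cases "a = b") auto
    qed (use hF in auto)
    then obtain C where C: "C \<ge> 0" "\<And>a b. F a b \<le> d * (\<bar>a\<bar> powr p + \<bar>b\<bar> powr p) + C * \<bar>a - b\<bar> powr p" by blast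
    have "F a b \<le> \<delta> * \<bar>b\<bar> powr p + (C + d * 2 powr p) * \<bar>a - b\<bar> powr p" for a b
    proof -
      have "d * \<bar>a\<bar> powr p \<le> d * (2 powr p * (\<bar>a - b\<bar> powr p + \<bar>b\<bar> powr p))"
        using abs_powr_add_le[OF p, of "a - b" b] d by (intro mult_left_mono) auto
      thus ?thesis using C(2)[of a b] unfolding d(2)[symmetric] by (simp add: algebra_simps)
    qed
    thus ?thesis using C d by (intro exI[of _ "C + d * 2 powr p"]) auto
  qed
  hence "\<forall>m::nat. \<exists>C\<ge>0. \<forall>a b. F a b \<le> 1 / real (Suc m) * \<bar>b\<bar> powr p + C * \<bar>a - b\<bar> powr p"
    by (metis divide_pos_pos of_nat_0_less_iff zero_less_Suc zero_less_one)
  then obtain C where C: "\<And>m. C m \<ge> 0" "\<And>m a b. F a b \<le> 1 / real (Suc m) * \<bar>b\<bar> powr p + C m * \<bar>a - b\<bar> powr p" by metis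
  have D: "Lpf M p (\<lambda>x. f n x - g x)" for n by (intro Lpf_diff p f)
  let ?U = "\<lambda>m n. 1 / real (Suc m) * Ip M p g + C m * Ip M p (\<lambda>x. f n x - g x)"
  have 1: "(LINT x|M. F (f n x) (g x)) \<le> ?U m n" for m n
  proof -
    have i: "integrable M (\<lambda>x. 1 / real (Suc m) * \<bar>g x\<bar> powr p + C m * \<bar>f n x - g x\<bar> powr p)"
      using D f by (intro Bochner_Integration.integrable_add integrable_mult_right) (auto simp: Lpf_def)
    have "(\<lambda>x. (f n x, g x)) \<in> borel_measurable M" using f by (intro borel_measurable_Pair Lpf_measurable)
    from measurable_compose[OF this borel_measurable_continuous_onI[OF cF]]
    have "integrable M (\<lambda>x. F (f n x) (g x))"
      by (intro Bochner_Integration.integrable_bound[OF i] AE_I2) (use C F0 in \<open>auto simp: abs_of_nonneg order_trans[OF C(2) abs_ge_self]\<close>)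
    hence "(LINT x|M. F (f n x) (g x)) \<le> (LINT x|M. 1 / real (Suc m) * \<bar>g x\<bar> powr p + C m * \<bar>f n x - g x\<bar> powr p)"
      using i C(2) by (intro integral_mono)
    thus ?thesis using Lpf_integrable[OF D[of n]] Lpf_integrable[OF f(2)] by (simp del: of_nat_Suc)
  qed
  have 2: "?U m \<longlonglongrightarrow> 1 / real (Suc m) * Ip M p g + C m * 0" for m by (intro tendsto_intros f)
  have 3: "(\<lambda>m. 1 / real (Suc m) * Ip M p g + C m * 0) \<longlonglongrightarrow> 0"
    using tendsto_mult_left_zero[OF LIMSEQ_inverse_real_of_nat, of "Ip M p g"] by (simp add: inverse_eq_divide)
  show ?thesis by (rule tendsto_zero_diagonal[OF _ 1 2 3]) (simp add: F0)
qed

lemma Lp_conv_Ip: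
  assumes u: "\<And>n. Lpf M p (u n)" "Lpf M p u0" "Lp_conv M p u u0" and p: "p > 0"
  shows "(\<lambda>n. Ip M p (u n)) \<longlonglongrightarrow> Ip M p u0"
proof (rule LIM_zero_cancel, rule Lim_null_comparison)
  show "(\<lambda>n. LINT x|M. \<bar>\<bar>u n x\<bar> powr p - \<bar>u0 x\<bar> powr p\<bar>) \<longlonglongrightarrow> 0"
  proof (rule homogeneous_conv[OF p _ _ _ _ u])
    show "continuous_on UNIV (\<lambda>x::real \<times> real. \<bar>\<bar>fst x\<bar> powr p - \<bar>snd x\<bar> powr p\<bar>)" using p by (intro continuous_intros)
    show "\<bar>\<bar>s * a\<bar> powr p - \<bar>s * b\<bar> powr p\<bar> = s powr p * \<bar>\<bar>a\<bar> powr p - \<bar>b\<bar> powr p\<bar>" if "s > 0" for s a b :: real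
      using that by (simp add: abs_mult powr_mult flip: right_diff_distrib)
  qed auto
  have "\<bar>Ip M p (u n) - Ip M p u0\<bar> \<le> (LINT x|M. \<bar>\<bar>u n x\<bar> powr p - \<bar>u0 x\<bar> powr p\<bar>)" for n
    using u integral_abs_bound[of M "\<lambda>x. \<bar>u n x\<bar> powr p - \<bar>u0 x\<bar> powr p"] by (simp add: Lpf_def)
  thus "\<forall>\<^sub>F n in sequentially. norm (Ip M p (u n) - Ip M p u0) \<le> (LINT x|M. \<bar>\<bar>u n x\<bar> powr p - \<bar>u0 x\<bar> powr p\<bar>)" by simp
qed

text \<open>\<psi> is homogeneous of degree \<alpha>, so the integrand has degree
  \<open>\<alpha> + 1\<close> and \<open>homogeneous_conv\<close> applies: the nonlinearity is
  continuous from L_p into the space with the conjugate exponent.\<close>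

lemma psi_conv:
  assumes \<alpha>: "\<alpha> > 0" and f: "\<And>n. Lpf M (\<alpha> + 1) (f n)" "Lpf M (\<alpha> + 1) g" "Lp_conv M (\<alpha> + 1) f g"
  shows "Lp_conv M ((\<alpha> + 1) / \<alpha>) (\<lambda>n x. \<psi> \<alpha> (f n x)) (\<lambda>x. \<psi> \<alpha> (g x))"
proof (rule homogeneous_conv[OF _ _ _ _ _ f])
  show "continuous_on UNIV (\<lambda>x::real \<times> real. \<bar>\<psi> \<alpha> (fst x) - \<psi> \<alpha> (snd x)\<bar> powr ((\<alpha> + 1) / \<alpha>))" using \<alpha> by (intro continuous_intros) auto
  show "\<bar>\<psi> \<alpha> (s * a) - \<psi> \<alpha> (s * b)\<bar> powr ((\<alpha> + 1) / \<alpha>) = s powr (\<alpha> + 1) * \<bar>\<psi> \<alpha> a - \<psi> \<alpha> b\<bar> powr ((\<alpha> + 1) / \<alpha>)" if "s > 0" for s a b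
    using that \<alpha> by (simp add: psi_scale abs_mult powr_mult powr_powr flip: right_diff_distrib)
qed (use \<alpha> in auto)

lemma Lp_conv_uniform:
  fixes g :: "nat \<Rightarrow> 'a \<Rightarrow> real"
  assumes M: "finite_measure M" and s: "s > 0"
    and u: "\<And>\<epsilon>. \<epsilon> > 0 \<Longrightarrow> eventually (\<lambda>n. \<forall>x\<in>space M. \<bar>g n x - g0 x\<bar> \<le> \<epsilon>) sequentially"
    and m: "\<And>n. g n \<in> borel_measurable M" "g0 \<in> borel_measurable M"
  shows "Lp_conv M s g g0"
proof (rule LIMSEQ_I)
  interpret finite_measure M by fact
  fix r :: real assume r: "r > 0"
  define \<mu> where "\<mu> = measure M (space M) + 1"
  have \<mu>: "\<mu> > 0" by (simp add: \<mu>_def add_nonneg_pos)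
  define \<epsilon> where "\<epsilon> = (r / (2 * \<mu>)) powr (1 / s)"
  have "\<epsilon> > 0" using r \<mu> by (simp add: \<epsilon>_def)
  from u[OF this] obtain N where N: "\<And>n x. n \<ge> N \<Longrightarrow> x \<in> space M \<Longrightarrow> \<bar>g n x - g0 x\<bar> \<le> \<epsilon>"
    by (auto simp: eventually_sequentially)
  have "norm (Ip M s (\<lambda>x. g n x - g0 x) - 0) < r" if n: "n \<ge> N" for n
  proof -
    have L: "Lpf M s (\<lambda>x. g n x - g0 x)"
      using N[OF n] m s by (intro Lpf_bounded[OF M, where B = \<epsilon>]) auto
    have "Ip M s (\<lambda>x. g n x - g0 x) \<le> (LINT x|M. \<epsilon> powr s)"
      using L N[OF n] s by (intro integral_mono) (auto simp: Lpf_def intro!: powr_mono2)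
    also have "\<dots> = measure M (space M) * (r / (2 * \<mu>))" using r \<mu> s by (simp add: \<epsilon>_def powr_powr)
    also have "\<dots> \<le> \<mu> * (r / (2 * \<mu>))" using r \<mu> by (intro mult_right_mono) (auto simp: \<mu>_def)
    also have "\<dots> < r" using r \<mu> by simp
    finally show ?thesis using Ip_nonneg[of M "\<lambda>x. g n x - g0 x" s] by (simp only: real_norm_def diff_zero abs_of_nonneg)
  qed
  thus "\<exists>N. \<forall>n\<ge>N. norm (Ip M s (\<lambda>x. g n x - g0 x) - 0) < r" by blast
qed

lemma Ip_add_le:
  assumes p: "p > 0" and uv: "Lpf M p u" "Lpf M p v"
  shows "Ip M p (\<lambda>x. u x + v x) \<le> 2 powr p * (Ip M p u + Ip M p v)"
proof -
  have "Ip M p (\<lambda>x. u x + v x) \<le> (LINT x|M. 2 powr p * (\<bar>u x\<bar> powr p + \<bar>v x\<bar> powr p))"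
    using Lpf_add[OF p uv] uv abs_powr_add_le[OF p] by (intro integral_mono) (auto simp: Lpf_def)
  thus ?thesis using uv by (simp add: Lpf_def)
qed

lemma Lp_conv_add:
  assumes p: "p > 0" and L: "\<And>n. Lpf M p (f n)" "\<And>n. Lpf M p (g n)" "Lpf M p u" "Lpf M p v"
    and c: "Lp_conv M p f u" "Lp_conv M p g v"
  shows "Lp_conv M p (\<lambda>n x. f n x + g n x) (\<lambda>x. u x + v x)"
proof (rule tendsto_sandwich[OF _ _ tendsto_const])
  let ?b = "\<lambda>n. 2 powr p * (Ip M p (\<lambda>x. f n x - u x) + Ip M p (\<lambda>x. g n x - v x))"
  show "\<forall>\<^sub>F n in sequentially. Ip M p (\<lambda>x. f n x + g n x - (u x + v x)) \<le> ?b n"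
    unfolding add_diff_add using p L by (intro always_eventually allI Ip_add_le Lpf_diff)
  show "?b \<longlonglongrightarrow> 0" using tendsto_mult_right_zero[OF tendsto_add_zero[OF c]] .
qed (auto simp: Ip_nonneg)

lemma Lp_conv_perturb:
  assumes p: "p > 0" and L: "\<And>n. Lpf M p (f n)" "\<And>n. Lpf M p (g n)" "Lpf M p u"
    and c: "(\<lambda>n. Ip M p (\<lambda>x. f n x - g n x)) \<longlonglongrightarrow> 0" "Lp_conv M p g u"
  shows "Lp_conv M p f u"
  using Lp_conv_add[of p M "\<lambda>n x. f n x - g n x" g "\<lambda>x. 0" u] Lpf_diff[OF p L(1,2)] Lpf_zero[OF p, of M] assms by simp

lemma Lpf_mult_bounded:
  assumes g: "Lpf M q g" and [measurable]: "a \<in> borel_measurable M" and a: "\<And>x. x \<in> space M \<Longrightarrow> \<bar>a x\<bar> \<le> B" and q: "q > 0"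
  shows "Lpf M q (\<lambda>x. a x * g x)" "Ip M q (\<lambda>x. a x * g x) \<le> B powr q * Ip M q g"
    "\<And>x. x \<in> space M \<Longrightarrow> \<bar>a x * g x\<bar> powr q \<le> B powr q * \<bar>g x\<bar> powr q"
proof -
  have [measurable]: "g \<in> borel_measurable M" using g by (rule Lpf_measurable)
  show b: "\<bar>a x * g x\<bar> powr q \<le> B powr q * \<bar>g x\<bar> powr q" if "x \<in> space M" for x
    unfolding abs_mult powr_mult using a[OF that] q by (intro mult_right_mono powr_mono2) auto
  show L: "Lpf M q (\<lambda>x. a x * g x)"
    by (rule Lpf_dominated[where f = "\<lambda>x. B powr q * \<bar>g x\<bar> powr q"]) (use g b in \<open>auto simp: Lpf_def\<close>)
  have "Ip M q (\<lambda>x. a x * g x) \<le> (LINT x|M. B powr q * \<bar>g x\<bar> powr q)"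
    using L g b by (intro integral_mono) (auto simp: Lpf_def)
  thus "Ip M q (\<lambda>x. a x * g x) \<le> B powr q * Ip M q g" by simp
qed

text \<open>Splitting \<open>a n * f n - c * g\<close> into \<open>a n * (f n - g)\<close> and
  \<open>(a n - c) * g\<close>: the first part is small by the uniform bound, the second by
  dominated convergence, for which pointwise convergence of the coefficients suffices.\<close>

lemma Lp_conv_mult_bounded:
  assumes q: "q > 0" and f: "\<And>n. Lpf M q (f n)" "Lpf M q g" "Lp_conv M q f g"
    and a: "\<And>n. a n \<in> borel_measurable M" "c \<in> borel_measurable M"
      "\<And>n x. x \<in> space M \<Longrightarrow> \<bar>a n x\<bar> \<le> B" "\<And>x. x \<in> space M \<Longrightarrow> \<bar>c x\<bar> \<le> B" "\<And>x. x \<in> space M \<Longrightarrow> (\<lambda>n. a n x) \<longlonglongrightarrow> c x"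
  shows "Lp_conv M q (\<lambda>n x. a n x * f n x) (\<lambda>x. c x * g x)"
proof -
  have D: "Lpf M q (\<lambda>x. f n x - g x)" for n by (intro Lpf_diff q f)
  have b: "\<bar>a n x - c x\<bar> \<le> 2 * B" if "x \<in> space M" for n x using a(3)[OF that, of n] a(4)[OF that] by linarith
  have am: "(\<lambda>x. a n x - c x) \<in> borel_measurable M" for n using a by measurable
  note E = Lpf_mult_bounded[OF f(2) am b q]
  have l1: "Lp_conv M q (\<lambda>n x. a n x * (f n x - g x)) (\<lambda>x. 0)"
  proof (rule tendsto_sandwich[OF _ _ tendsto_const tendsto_mult_right_zero[OF f(3)]])
    show "\<forall>\<^sub>F n in sequentially. Ip M q (\<lambda>x. a n x * (f n x - g x) - 0) \<le> B powr q * Ip M q (\<lambda>x. f n x - g x)"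
      using Lpf_mult_bounded(2)[OF D a(1,3) q] by simp
  qed (simp add: Ip_nonneg)
  have "(\<lambda>n. LINT x|M. \<bar>(a n x - c x) * g x - 0\<bar> powr q) \<longlonglongrightarrow> (LINT x|M. 0)"
  proof (rule integral_dominated_convergence[where w = "\<lambda>x. (2 * B) powr q * \<bar>g x\<bar> powr q"])
    show "integrable M (\<lambda>x. (2 * B) powr q * \<bar>g x\<bar> powr q)" using f(2) by (simp add: Lpf_def)
    show "AE x in M. norm (\<bar>(a n x - c x) * g x - 0\<bar> powr q) \<le> (2 * B) powr q * \<bar>g x\<bar> powr q" for n
      using E(3) by (intro AE_I2) simp
    show "AE x in M. (\<lambda>n. \<bar>(a n x - c x) * g x - 0\<bar> powr q) \<longlonglongrightarrow> 0"
    proof (intro AE_I2)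
      fix x assume "x \<in> space M"
      hence "(\<lambda>n. (a n x - c x) * g x - 0) \<longlonglongrightarrow> (c x - c x) * g x - 0" by (intro tendsto_intros a)
      hence "(\<lambda>n. \<bar>(a n x - c x) * g x - 0\<bar> powr q) \<longlonglongrightarrow> \<bar>0\<bar> powr q" using q by (intro tendsto_powr2 tendsto_rabs) auto
      thus "(\<lambda>n. \<bar>(a n x - c x) * g x - 0\<bar> powr q) \<longlonglongrightarrow> 0" using q by simp
    qed
  qed (use Lpf_measurable[OF E(1)] in simp_all)
  hence l2: "Lp_conv M q (\<lambda>n x. (a n x - c x) * g x) (\<lambda>x. 0)" by simp
  have "Lp_conv M q (\<lambda>n x. a n x * (f n x - g x) + (a n x - c x) * g x) (\<lambda>x. 0 + 0)"
    by (intro Lp_conv_add q l1 l2 E(1) Lpf_mult_bounded(1)[OF D a(1,3) q] Lpf_zero)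
  thus ?thesis by (simp add: algebra_simps)
qed

lemma Lp_L1_bound:
  assumes M: "finite_measure M" and u: "Lpf M p u" and p: "p > 1"
  shows "(LINT x|M. \<bar>u x\<bar>) \<le> Ip M p u powr (1/p) * measure M (space M) powr ((p - 1) / p)"
proof -
  interpret finite_measure M by fact
  let ?q = "p / (p - 1)"
  have q: "?q > 1" "1/p + 1/?q = 1" using p by (auto simp: field_simps)
  have "Lpf M p (\<lambda>x. \<bar>u x\<bar>)" using u by (simp add: Lpf_def borel_measurable_abs)
  moreover have "Lpf M ?q (\<lambda>x. 1)" using q by (intro Lpf_bounded[OF M, where B = 1]) auto
  ultimately show ?thesis using Hoelder_inequality[of M p "\<lambda>x. \<bar>u x\<bar>" ?q "\<lambda>x. 1"] p q by simp
qed

text \<open>The limit is given explicitly as the pointwise \<open>lim\<close> of a subsequence. In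
  this form Borel measurability on a larger space and periodicity at every point are inherited from
  the sequence, which an unspecified representative would not guarantee.\<close>

lemma Lp_complete:
  assumes M: "finite_measure M" and p: "p > 1" and u: "\<And>n. Lpf M p (u n)"
    and cauchy: "\<And>e. e > 0 \<Longrightarrow> \<exists>N. \<forall>m\<ge>N. \<forall>n\<ge>N. Ip M p (\<lambda>x. u m x - u n x) < e"
  obtains r where "Lpf M p (\<lambda>x. lim (\<lambda>n. u (r n) x))" "Lp_conv M p u (\<lambda>x. lim (\<lambda>n. u (r n) x))"
proof -
  have d: "Lpf M p (\<lambda>x. u m x - u n x)" for m n using u p by (auto intro!: Lpf_diff)
  have [measurable]: "u n \<in> borel_measurable M" for n using u by (simp add: Lpf_def)
  obtain r where sm: "strict_mono r" and r: "AE x in M. Cauchy (\<lambda>i. u (r i) x)"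
  proof (rule cauchy_L1_AE_cauchy_subseq[of M u])
    show "integrable M (u n)" for n using Lpf_imp_integrable[OF M u] p by simp
    fix e :: real assume e: "e > 0"
    define c where "c = measure M (space M) powr ((p - 1) / p) + 1"
    have c: "c > 0" by (simp add: c_def add_nonneg_pos)
    obtain N where N: "\<And>m n. m \<ge> N \<Longrightarrow> n \<ge> N \<Longrightarrow> Ip M p (\<lambda>x. u m x - u n x) < (e / c) powr p"
      using cauchy[of "(e / c) powr p"] e c by auto
    have "(LINT x|M. norm (u m x - u n x)) < e" if "m \<ge> N" "n \<ge> N" for m n
    proof -
      let ?I = "Ip M p (\<lambda>x. u m x - u n x) powr (1/p)"
      have "?I < ((e / c) powr p) powr (1/p)" using N[OF that] p Ip_nonneg by (intro powr_less_mono2) auto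
      hence "?I < e / c" using p e c by (simp add: powr_powr)
      hence "?I * c < e" using c by (simp add: pos_less_divide_eq)
      moreover have "?I * (c - 1) \<le> ?I * c" by (intro mult_left_mono) auto
      moreover have "(LINT x|M. norm (u m x - u n x)) \<le> ?I * (c - 1)" using Lp_L1_bound[OF M d p, of m n] by (simp add: c_def)
      ultimately show ?thesis by linarith
    qed
    thus "\<exists>N. \<forall>i\<ge>N. \<forall>j\<ge>N. (LINT x|M. norm (u i x - u j x)) < e" by blast
  qed
  define v where "v = (\<lambda>x. lim (\<lambda>n. u (r n) x))"
  have [measurable]: "v \<in> borel_measurable M" unfolding v_def by measurable
  have AEc: "AE x in M. (\<lambda>n. u (r n) x) \<longlonglongrightarrow> v x"
    using r by eventually_elim (simp add: v_def Cauchy_convergent_iff convergent_LIMSEQ_iff)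
  \<comment> \<open>Cauchy in L_p gives Cauchy in L_1 and so an almost everywhere convergent
    subsequence; Fatou's lemma along it turns the Cauchy estimate into one against the
    limit.\<close>
  have fatou: "integrable M (\<lambda>x. \<bar>u m x - v x\<bar> powr p) \<and> Ip M p (\<lambda>x. u m x - v x) \<le> e"
    if e: "e > 0" and m: "\<And>n. n \<ge> K \<Longrightarrow> Ip M p (\<lambda>x. u m x - u n x) < e" for m K e
  proof -
    have "(\<integral>\<^sup>+x. ennreal (\<bar>u m x - v x\<bar> powr p) \<partial>M) = (\<integral>\<^sup>+x. liminf (\<lambda>n. ennreal (\<bar>u m x - u (r n) x\<bar> powr p)) \<partial>M)"
    proof (rule nn_integral_cong_AE)
      show "AE x in M. ennreal (\<bar>u m x - v x\<bar> powr p) = liminf (\<lambda>n. ennreal (\<bar>u m x - u (r n) x\<bar> powr p))"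
        using AEc
      proof eventually_elim
        case (elim x)
        have "(\<lambda>n. ennreal (\<bar>u m x - u (r n) x\<bar> powr p)) \<longlonglongrightarrow> ennreal (\<bar>u m x - v x\<bar> powr p)"
          using elim p by (intro tendsto_ennrealI tendsto_powr' tendsto_intros) auto
        from lim_imp_Liminf[OF trivial_limit_sequentially this] show ?case by simp
      qed
    qed
    also have "\<dots> \<le> liminf (\<lambda>n. \<integral>\<^sup>+x. ennreal (\<bar>u m x - u (r n) x\<bar> powr p) \<partial>M)"
      by (intro nn_integral_liminf) measurable
    also have "\<dots> \<le> ennreal e"
    proof (intro Liminf_le eventually_sequentiallyI[of K])
      fix n assume "n \<ge> K"
      hence "Ip M p (\<lambda>x. u m x - u (r n) x) \<le> e" using m[of "r n"] seq_suble[OF sm, of n] by simp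
      thus "(\<integral>\<^sup>+x. ennreal (\<bar>u m x - u (r n) x\<bar> powr p) \<partial>M) \<le> ennreal e"
        using d[of m "r n"] by (subst nn_integral_eq_integral) (auto simp: Lpf_def intro: ennreal_leI)
    qed simp
    finally have le: "(\<integral>\<^sup>+x. ennreal (\<bar>u m x - v x\<bar> powr p) \<partial>M) \<le> ennreal e" .
    hence "integrable M (\<lambda>x. \<bar>u m x - v x\<bar> powr p)"
      by (intro integrableI_nonneg) (auto simp: less_top[symmetric] top_unique)
    thus ?thesis using le e by (subst (asm) nn_integral_eq_integral) auto
  qed
  obtain K where "\<forall>m\<ge>K. \<forall>n\<ge>K. Ip M p (\<lambda>x. u m x - u n x) < 1" using cauchy[of 1] by auto
  hence "Lpf M p (\<lambda>x. u K x - v x)" using fatou[of 1 K K] by (auto simp: Lpf_def)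
  from Lpf_diff[OF _ u[of K] this] p have Lv: "Lpf M p v" by simp
  have "Lp_conv M p u v"
  proof (rule LIMSEQ_I)
    fix e :: real assume e: "e > 0"
    obtain K where K: "\<forall>m\<ge>K. \<forall>n\<ge>K. Ip M p (\<lambda>x. u m x - u n x) < e/2" using cauchy[of "e/2"] e by auto
    have "norm (Ip M p (\<lambda>x. u m x - v x) - 0) < e" if "m \<ge> K" for m
      using fatou[of "e/2" K m] K that e Ip_nonneg[of M "\<lambda>x. u m x - v x" p] by (simp only: real_norm_def diff_zero abs_of_nonneg) force
    thus "\<exists>K. \<forall>m\<ge>K. norm (Ip M p (\<lambda>x. u m x - v x) - 0) < e" by blast
  qed
  with Lv that show ?thesis unfolding v_def by blast
qed

section \<open>Convex combinations of tails and their strong convergence\<close>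

definition convw :: "nat \<Rightarrow> (nat \<Rightarrow> real) set" where
  "convw n = {w. (\<forall>k. 0 \<le> w k) \<and> (\<forall>k<n. w k = 0) \<and> finite {k. w k \<noteq> 0} \<and> (\<Sum>k | w k \<noteq> 0. w k) = 1}"

definition comb :: "(nat \<Rightarrow> real) \<Rightarrow> (nat \<Rightarrow> 'a \<Rightarrow> real) \<Rightarrow> 'a \<Rightarrow> real" where
  "comb w u x = (\<Sum>k | w k \<noteq> 0. w k * u k x)"

lemma comb_superset:
  assumes "finite S" "{k. w k \<noteq> 0} \<subseteq> S"
  shows "comb w u x = (\<Sum>k\<in>S. w k * u k x)"
  unfolding comb_def using assms by (intro sum.mono_neutral_left) auto

abbreviation wsum :: "(nat \<Rightarrow> real) \<Rightarrow> (nat \<Rightarrow> real) \<Rightarrow> real" where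
  "wsum w a \<equiv> \<Sum>k | w k \<noteq> 0. w k * a k"

text \<open>Weights in \<open>convw n\<close> ignore all indices below \<open>n\<close>, so
  averaging does not change the limit of a sequence that already converges. This is how every
  convergent term of the scheme is combined with the averaged ones.\<close>

lemma convw_tendsto:
  fixes a :: "nat \<Rightarrow> real"
  assumes w: "\<And>n. w n \<in> convw n" and a: "a \<longlonglongrightarrow> l"
  shows "(\<lambda>n. wsum (w n) a) \<longlonglongrightarrow> l"
proof (rule LIMSEQ_I)
  fix e :: real assume e: "e > 0"
  obtain N where N: "\<And>n. n \<ge> N \<Longrightarrow> \<bar>a n - l\<bar> < e / 2"
    using LIMSEQ_D[OF a, of "e/2"] e by auto
  have "norm ((wsum (w n) a) - l) < e" if n: "n \<ge> N" for n
  proof -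
    have w1: "(\<Sum>k | w n k \<noteq> 0. w n k) = 1" "\<And>k. 0 \<le> w n k" "\<And>k. w n k \<noteq> 0 \<Longrightarrow> k \<ge> n"
      using w[of n] unfolding convw_def by (auto simp: not_less[symmetric])
    have "(wsum (w n) a) - l = (wsum (w n) (\<lambda>k. (a k - l)))"
      by (simp add: right_diff_distrib sum_subtractf sum_distrib_right[symmetric] w1(1))
    also have "\<bar>\<dots>\<bar> \<le> (\<Sum>k | w n k \<noteq> 0. \<bar>w n k * (a k - l)\<bar>)" by (rule sum_abs)
    also have "\<dots> \<le> (wsum (w n) (\<lambda>k. (e / 2)))"
    proof (intro sum_mono)
      fix k assume "k \<in> {k. w n k \<noteq> 0}"
      hence "\<bar>a k - l\<bar> \<le> e / 2" using w1(3)[of k] N[of k] n by simp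
      hence "w n k * \<bar>a k - l\<bar> \<le> w n k * (e / 2)" using w1(2) by (rule mult_left_mono)
      thus "\<bar>w n k * (a k - l)\<bar> \<le> w n k * (e / 2)" using w1(2)[of k] by (simp add: abs_mult)
    qed
    also have "\<dots> = e / 2" using w1(1) by (simp only: sum_distrib_right[symmetric])
    finally show ?thesis using e by simp
  qed
  thus "\<exists>N. \<forall>n\<ge>N. norm ((wsum (w n) a) - l) < e" by blast
qed

lemma convw_midpoint:
  assumes "w \<in> convw m" "v \<in> convw n" "m \<le> n"
  shows "(\<lambda>k. (w k + v k) / 2) \<in> convw m"
    "comb (\<lambda>k. (w k + v k) / 2) u x = (comb w u x + comb v u x) / 2"
proof -
  let ?S = "{k. w k \<noteq> 0} \<union> {k. v k \<noteq> 0}"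
  have fin: "finite ?S" and sub: "{k. (w k + v k) / 2 \<noteq> 0} \<subseteq> ?S"
    using assms by (auto simp: convw_def)
  have S: "{k. w k \<noteq> 0} \<subseteq> ?S" "{k. v k \<noteq> 0} \<subseteq> ?S" by auto
  have "(\<Sum>k | (w k + v k) / 2 \<noteq> 0. (w k + v k) / 2) = comb (\<lambda>k. (w k + v k) / 2) (\<lambda>k x. 1) x"
    by (simp add: comb_def)
  also have "\<dots> = (\<Sum>k\<in>?S. (w k + v k) / 2)"
    using comb_superset[OF fin sub, of "\<lambda>k x. 1" x] by simp
  also have "\<dots> = ((\<Sum>k\<in>?S. w k) + (\<Sum>k\<in>?S. v k)) / 2" by (simp add: sum.distrib sum_divide_distrib[symmetric])
  also have "\<dots> = (comb w (\<lambda>k x. 1) x + comb v (\<lambda>k x. 1) x) / 2"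
    using comb_superset[OF fin S(1), of "\<lambda>k x. 1" x] comb_superset[OF fin S(2), of "\<lambda>k x. 1" x] by simp
  also have "\<dots> = 1" using assms by (simp add: comb_def convw_def)
  finally have "(\<Sum>k | (w k + v k) / 2 \<noteq> 0. (w k + v k) / 2) = 1" .
  moreover have "finite {k. (w k + v k) / 2 \<noteq> 0}" using fin sub by (rule rev_finite_subset)
  ultimately show "(\<lambda>k. (w k + v k) / 2) \<in> convw m"
    using assms by (auto simp: convw_def intro: divide_nonneg_pos add_nonneg_nonneg)
  show "comb (\<lambda>k. (w k + v k) / 2) u x = (comb w u x + comb v u x) / 2"
    unfolding comb_superset[OF fin sub] comb_superset[OF fin S(1)] comb_superset[OF fin S(2)]
    by (simp add: algebra_simps sum.distrib add_divide_distrib sum_divide_distrib)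
qed

lemma Lpf_comb: "p > 0 \<Longrightarrow> (\<And>n. Lpf M p (u n)) \<Longrightarrow> Lpf M p (comb w u)"
  unfolding comb_def[abs_def] by (intro Lpf_sum Lpf_cmult)

text \<open>\<open>uniform_convexity_powr\<close> is integrated: its \<delta> part is absorbed by
  the common bound \<open>K\<close>, its \<open>C\<close> part by the smallness of the midpoint
  gap.\<close>

lemma uniform_convexity_Cauchy:
  fixes v :: "nat \<Rightarrow> 'a \<Rightarrow> real"
  assumes p: "p > 1" and v: "\<And>n. Lpf M p (v n)" "\<And>n. Ip M p (v n) \<le> K"
    and gap: "\<And>e. e > 0 \<Longrightarrow> \<exists>N. \<forall>m\<ge>N. \<forall>n\<ge>N.
      (Ip M p (v m) + Ip M p (v n)) / 2 - Ip M p (\<lambda>x. (v m x + v n x) / 2) < e"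
    and e: "e > 0"
  shows "\<exists>N. \<forall>m\<ge>N. \<forall>n\<ge>N. Ip M p (\<lambda>x. v m x - v n x) < e"
proof -
  have K: "K \<ge> 0" using v(2)[of 0] Ip_nonneg[of M "v 0" p] by linarith
  define \<delta> where "\<delta> = e / (4 * (K + 1))"
  have \<delta>: "\<delta> > 0" using e K by (simp add: \<delta>_def)
  obtain C where C: "C \<ge> 0" "\<And>a b::real. \<bar>a - b\<bar> powr p \<le> \<delta> * (\<bar>a\<bar> powr p + \<bar>b\<bar> powr p)
     + C * ((\<bar>a\<bar> powr p + \<bar>b\<bar> powr p) / 2 - \<bar>(a + b) / 2\<bar> powr p)"
    using uniform_convexity_powr[OF p \<delta>] by metis
  obtain N where N: "\<And>m n. m \<ge> N \<Longrightarrow> n \<ge> N \<Longrightarrow>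
      (Ip M p (v m) + Ip M p (v n)) / 2 - Ip M p (\<lambda>x. (v m x + v n x) / 2) < e / (2 * (C + 1))"
  proof -
    have "e / (2 * (C + 1)) > 0" using C e by simp
    from gap[OF this] that show ?thesis by blast
  qed
  have "Ip M p (\<lambda>x. v m x - v n x) < e" if "m \<ge> N" "n \<ge> N" for m n
  proof -
    have i: "Lpf M p (\<lambda>x. v m x - v n x)" "Lpf M p (\<lambda>x. (v m x + v n x) / 2)"
      using p Lpf_cmult[OF Lpf_add[OF _ v(1)[of m] v(1)[of n]], of "1/2"] by (auto intro!: Lpf_diff v)
    have "Ip M p (\<lambda>x. v m x - v n x) \<le> (LINT x|M. \<delta> * (\<bar>v m x\<bar> powr p + \<bar>v n x\<bar> powr p)
     + C * ((\<bar>v m x\<bar> powr p + \<bar>v n x\<bar> powr p) / 2 - \<bar>(v m x + v n x) / 2\<bar> powr p))"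
      using i v C by (intro integral_mono Bochner_Integration.integrable_add integrable_mult_right
        Bochner_Integration.integrable_diff integrable_divide) (auto simp: Lpf_def)
    also have "\<dots> = \<delta> * (Ip M p (v m) + Ip M p (v n)) + C * ((Ip M p (v m) + Ip M p (v n)) / 2 - Ip M p (\<lambda>x. (v m x + v n x) / 2))"
      using i v unfolding Lpf_def
      by (subst Bochner_Integration.integral_add Bochner_Integration.integral_diff integral_mult_right_zero integral_divide_zero
        | intro Bochner_Integration.integrable_add integrable_mult_right
        Bochner_Integration.integrable_diff integrable_divide | blast | simp only:)+
    also have "\<dots> \<le> \<delta> * (K + K) + C * (e / (2 * (C + 1)))"
      using \<delta> C N[OF that] v(2)[of m] v(2)[of n] by (intro add_mono mult_left_mono) auto
    also have "\<dots> < e"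
    proof -
      have "\<delta> * (K + K) < e / 2" using e K by (simp add: \<delta>_def field_simps)
      moreover have "C * (e / (2 * (C + 1))) \<le> e / 2" using e C by (simp add: field_simps)
      ultimately show ?thesis by linarith
    qed
    finally show ?thesis .
  qed
  thus ?thesis by blast
qed

text \<open>A substitute for weak compactness: nearly norm-minimal convex combinations of the tails form,
  by uniform convexity, a Cauchy sequence.\<close>

lemma convex_combinations_converge:
  assumes M: "finite_measure M" and p: "p > 1" and q: "q > 1"
    and u: "\<And>n. Lpf M p (u n)" "\<And>n. Ip M p (u n) \<le> K"
    and v: "\<And>n. Lpf M q (v n)" "\<And>n. Ip M q (v n) \<le> K"
  obtains w r s where "\<And>n. w n \<in> convw n"
    "Lpf M p (\<lambda>x. lim (\<lambda>n. comb (w (r n)) u x))" "Lp_conv M p (\<lambda>n. comb (w n) u) (\<lambda>x. lim (\<lambda>n. comb (w (r n)) u x))"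
    "Lpf M q (\<lambda>x. lim (\<lambda>n. comb (w (s n)) v x))" "Lp_conv M q (\<lambda>n. comb (w n) v) (\<lambda>x. lim (\<lambda>n. comb (w (s n)) v x))"
proof -
  \<comment> \<open>Minimising the sum of both functionals yields one weight sequence that works for
    \<open>u\<close> and \<open>v\<close> simultaneously.\<close>
  define F where "F = (\<lambda>w. Ip M p (comb w u) + Ip M q (comb w v))"
  have F0: "F w \<ge> 0" for w unfolding F_def by (intro add_nonneg_nonneg Ip_nonneg)
  have L: "Lpf M p (comb w u)" "Lpf M q (comb w v)" for w using p q u v by (auto intro!: Lpf_comb)
  define i where "i = (\<lambda>n. Inf (F ` convw n))"
  define e where "e = (\<lambda>n k::nat. if k = n then 1 else 0 :: real)"
  have e: "e n \<in> convw n" for n by (auto simp: e_def convw_def)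
  have Fe: "F (e n) \<le> 2 * K" for n
  proof -
    have "comb (e n) u = u n" "comb (e n) v = v n" by (rule ext, simp add: comb_def e_def)+
    thus ?thesis using u(2)[of n] v(2)[of n] by (simp add: F_def)
  qed
  have bdd: "bdd_below (F ` convw n)" for n using F0 by (auto intro!: bdd_belowI)
  have iF: "i n \<le> F w" if "w \<in> convw n" for w n unfolding i_def using bdd that by (auto intro: cInf_lower)
  have sub: "convw n \<subseteq> convw m" if "m \<le> n" for m n using that by (auto simp: convw_def)
  have inc: "incseq i"
    unfolding i_def by (intro incseq_SucI cInf_superset_mono bdd image_mono sub) (use e in auto)
  have ibd: "i n \<le> 2 * K" for n using iF[OF e] Fe order_trans by blast
  obtain L0 where L0: "i \<longlonglongrightarrow> L0" "\<And>n. i n \<le> L0" using incseq_convergent[OF inc, of "2 * K"] ibd by blast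
  let ?s = "\<lambda>n. 1 / real (Suc n)"
  have s0: "?s \<longlonglongrightarrow> 0" using LIMSEQ_inverse_real_of_nat by (simp add: inverse_eq_divide)
  have "\<exists>w\<in>convw n. F w < i n + ?s n" for n
    using cInf_lessD[of "F ` convw n" "i n + ?s n"] e[of n] by (auto simp: i_def)
  then obtain w where w: "\<And>n. w n \<in> convw n" "\<And>n. F (w n) < i n + ?s n" by metis
  have FK: "F (w n) \<le> 2 * K + 1" for n
  proof -
    have "?s n \<le> 1" by simp
    with w(2)[of n] ibd[of n] show ?thesis by linarith
  qed
  let ?m = "\<lambda>m n k. (w m k + w n k) / 2"
  have mid: "comb (?m m n) f = (\<lambda>x. (comb (w m) f x + comb (w n) f x) / 2)" "?m m n \<in> convw (min m n)"
    for m n and f :: "nat \<Rightarrow> 'a \<Rightarrow> real"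
  proof -
    have "w m \<in> convw (min m n)" "w n \<in> convw (min m n)"
      using w(1)[of m] w(1)[of n] sub[of "min m n" m] sub[of "min m n" n] by auto
    note c = convw_midpoint[OF this order_refl]
    show "?m m n \<in> convw (min m n)" by (rule c(1))
    show "comb (?m m n) f = (\<lambda>x. (comb (w m) f x + comb (w n) f x) / 2)" by (rule ext, rule c(2))
  qed
  \<comment> \<open>A midpoint of \<open>w m\<close> and \<open>w n\<close> still belongs to
    \<open>convw (min m n)\<close>, so its value is at least \<open>i (min m n)\<close>, while the
    values at \<open>w m\<close> and \<open>w n\<close> hardly exceed the limit of the increasing
    infima \<open>i\<close>.\<close>
  have gap: "\<exists>N. \<forall>m\<ge>N. \<forall>n\<ge>N. (F (w m) + F (w n)) / 2 - F (?m m n) < \<epsilon>" if \<epsilon>: "\<epsilon> > 0" for \<epsilon>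
  proof -
    have "(\<lambda>n. L0 - i n + ?s n) \<longlonglongrightarrow> L0 - L0 + 0" by (intro tendsto_intros L0 s0)
    hence "eventually (\<lambda>n. L0 - i n + ?s n < \<epsilon> / 2) sequentially" using \<epsilon> by (intro order_tendstoD(2)) auto
    then obtain N where N: "\<And>n. n \<ge> N \<Longrightarrow> L0 - i n + ?s n < \<epsilon> / 2" unfolding eventually_sequentially by blast
    have "(F (w m) + F (w n)) / 2 - F (?m m n) < \<epsilon>" if "m \<ge> N" "n \<ge> N" for m n
    proof -
      have s: "0 < ?s k" for k by simp
      have b: "F (w k) < L0 + \<epsilon> / 2" if "k \<ge> N" for k using N[OF that] w(2)[of k] L0(2)[of k] by linarith
      have "L0 - \<epsilon> / 2 < F (?m m n)" using iF[OF mid(2)[of m n]] N[of "min m n"] s[of "min m n"] that by linarith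
      moreover have "F (w m) + F (w n) < 2 * (L0 + \<epsilon> / 2)" using add_strict_mono[OF b[OF that(1)] b[OF that(2)]] by simp
      ultimately show ?thesis by (simp add: field_simps)
    qed
    thus ?thesis by blast
  qed
  \<comment> \<open>Symmetric in the two summands of \<open>F\<close>. The midpoint gap of the other
    summand is nonnegative by convexity (\<open>half\<close>), so the total gap bounds the gap of
    each summand.\<close>
  have main: "\<exists>N. \<forall>m\<ge>N. \<forall>n\<ge>N. Ip M s (\<lambda>x. comb (w m) f x - comb (w n) f x) < \<epsilon>"
    if s: "s > 1" "s' > 1" and f: "\<And>w. Lpf M s (comb w f)" and g: "\<And>w. Lpf M s' (comb w g)"
      and F: "\<And>w. F w = Ip M s (comb w f) + Ip M s' (comb w g)" and "\<epsilon> > 0" for s s' \<epsilon> and f g :: "nat \<Rightarrow> 'a \<Rightarrow> real"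
  proof (rule uniform_convexity_Cauchy[of s M "\<lambda>n. comb (w n) f" "2 * K + 1", OF s(1) f _ _ \<open>\<epsilon> > 0\<close>])
    show "Ip M s (comb (w n) f) \<le> 2 * K + 1" for n using FK[of n] Ip_nonneg[of M "comb (w n) g" s'] unfolding F by linarith
    fix e :: real assume "e > 0"
    from gap[OF this] obtain N where N: "\<And>m n. m \<ge> N \<Longrightarrow> n \<ge> N \<Longrightarrow> (F (w m) + F (w n)) / 2 - F (?m m n) < e" by blast
    have half: "Ip M s' (\<lambda>x. (comb (w m) g x + comb (w n) g x) / 2) \<le> (Ip M s' (comb (w m) g) + Ip M s' (comb (w n) g)) / 2" for m n
    proof -
      have "Ip M s' (\<lambda>x. (comb (w m) g x + comb (w n) g x) / 2) \<le> (LINT x|M. (\<bar>comb (w m) g x\<bar> powr s' + \<bar>comb (w n) g x\<bar> powr s') / 2)"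
        using midpoint_abs_powr_le[OF s(2)] g[of "?m m n", unfolded mid] g[of "w m"] g[of "w n"] by (intro integral_mono) (auto simp: Lpf_def)
      thus ?thesis using g[of "w m"] g[of "w n"] by (simp add: Lpf_def)
    qed
    have "(Ip M s (comb (w m) f) + Ip M s (comb (w n) f)) / 2 - Ip M s (\<lambda>x. (comb (w m) f x + comb (w n) f x) / 2) < e"
      if "m \<ge> N" "n \<ge> N" for m n
      using N[OF that] half[of m n] unfolding F mid by argo
    thus "\<exists>N. \<forall>m\<ge>N. \<forall>n\<ge>N. (Ip M s (comb (w m) f) + Ip M s (comb (w n) f)) / 2 - Ip M s (\<lambda>x. (comb (w m) f x + comb (w n) f x) / 2) < e"
      by blast
  qed
  obtain r where r: "Lpf M p (\<lambda>x. lim (\<lambda>n. comb (w (r n)) u x))" "Lp_conv M p (\<lambda>n. comb (w n) u) (\<lambda>x. lim (\<lambda>n. comb (w (r n)) u x))"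
    by (rule Lp_complete[OF M p L(1) main[OF p q L F_def[THEN fun_cong]]], assumption, rule that)
  obtain s where "Lpf M q (\<lambda>x. lim (\<lambda>n. comb (w (s n)) v x))" "Lp_conv M q (\<lambda>n. comb (w n) v) (\<lambda>x. lim (\<lambda>n. comb (w (s n)) v x))"
    by (rule Lp_complete[OF M q L(2) main[OF q p L(2,1)]]) (auto simp: F_def intro: that)
  thus ?thesis by (rule that[OF w(1) r])
qed

section \<open>Integration over the circle\<close>

text \<open>All analysis is done with Lebesgue measure on Borel sets, where product measurability is
  convenient; \<open>lebesgue_on_Iv\<close> translates to the completed measure of the
  definitions.\<close>

definition Iv :: "real \<Rightarrow> real \<Rightarrow> real measure" where
  "Iv a b = restrict_space lborel {a..b}"

abbreviation circ :: "real measure" where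
  "circ \<equiv> Iv 0 (2 * pi)"

abbreviation circ_integral :: "(real \<Rightarrow> real) \<Rightarrow> real" (binder "\<integral>" 10) where
  "circ_integral f \<equiv> integral\<^sup>L circ f"

abbreviation L2sq :: "(real \<Rightarrow> real) \<Rightarrow> real" where
  "L2sq u \<equiv> \<integral>x. (u x)\<^sup>2"

abbreviation borel2 :: "(real \<times> real) measure" where
  "borel2 \<equiv> borel \<Otimes>\<^sub>M borel"

lemma space_Iv [simp]: "space (Iv a b) = {a..b}"
  by (simp add: Iv_def space_restrict_space)

lemma measurable_Iv [measurable (raw)]: "f \<in> measurable borel N \<Longrightarrow> f \<in> measurable (Iv a b) N"
  unfolding Iv_def by (intro measurable_restrict_space1) simp

lemma integral_Iv: "(LINT x|Iv a b. f x) = (LINT x|lborel. indicator {a..b} x * f x)" for f :: "real \<Rightarrow> real"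
  unfolding Iv_def by (subst integral_restrict_space) auto

lemma integrable_Iv: "integrable (Iv a b) f \<longleftrightarrow> integrable lborel (\<lambda>x. indicator {a..b} x * f x)" for f :: "real \<Rightarrow> real"
  unfolding Iv_def by (subst integrable_restrict_space) auto

lemma nn_integral_Iv: "(\<integral>\<^sup>+x. f x \<partial>Iv a b) = (\<integral>\<^sup>+x. f x * indicator {a..b} x \<partial>lborel)"
  unfolding Iv_def by (subst nn_integral_restrict_space) auto

lemma emeasure_Iv: "emeasure (Iv a b) {a..b} = ennreal (b - a)"
  unfolding Iv_def by (subst emeasure_restrict_space) (auto simp: ennreal_neg emeasure_lborel_Icc_eq)

lemma finite_measure_Iv: "finite_measure (Iv a b)"
  by (rule finite_measureI) (simp add: emeasure_Iv)

lemma integral_Iv_const: "a \<le> b \<Longrightarrow> (LINT x|Iv a b. c) = (b - a) * (c::real)"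
  by (simp add: emeasure_Iv measure_def)

lemma integrable_Iv_const [simp]: "integrable (Iv a b) (\<lambda>x. c::real)"
  using finite_measure.integrable_const[OF finite_measure_Iv] .

lemma integral_Iv_singleton: "(LINT x|Iv a a. f x) = (0::real)"
proof -
  have "AE x in lborel. indicator {a} x * f x = 0"
    by (rule AE_I[of _ _ "{a}"]) (auto simp: indicator_def)
  thus ?thesis unfolding integral_Iv by (intro integral_eq_zero_AE) simp
qed

lemma indicator_shift: "indicator {a + c..b + c} (x + c) = (indicator {a..b} x :: 'a :: zero_neq_one)" for a b c x :: real
  by (auto simp: indicator_def)

lemma integral_Iv_shift:
  fixes f :: "real \<Rightarrow> real"
  shows "(LINT x|Iv a b. f (x + c)) = (LINT x|Iv (a + c) (b + c). f x)"
  unfolding integral_Iv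
  by (subst lborel_integral_real_affine[of 1 _ c]) (auto simp: add.commute[of c] indicator_shift)

lemma integrable_Iv_shift:
  fixes f :: "real \<Rightarrow> real"
  shows "integrable (Iv a b) (\<lambda>x. f (x + c)) \<longleftrightarrow> integrable (Iv (a + c) (b + c)) f"
  unfolding integrable_Iv
  by (subst lborel_integrable_real_affine_iff[of 1 _ c, symmetric]) (auto simp: add.commute[of c] indicator_shift)

lemma nn_integral_Iv_shift:
  assumes [measurable]: "f \<in> borel_measurable borel"
  shows "(\<integral>\<^sup>+x. f (x + c) \<partial>Iv a b) = (\<integral>\<^sup>+x. f x \<partial>Iv (a + c) (b + c))"
  unfolding nn_integral_Iv
  by (subst nn_integral_real_affine[of _ 1 c]) (auto simp: add.commute[of c] indicator_shift)

lemma integral_Iv_reflect: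
  fixes f :: "real \<Rightarrow> real"
  shows "(LINT x|Iv (- e) e. f (- x)) = (LINT x|Iv (- e) e. f x)"
proof -
  have "indicator {- e..e} (- x) = (indicator {-e..e} x :: real)" for x :: real by (auto simp: indicator_def)
  thus ?thesis unfolding integral_Iv
    by (subst (2) lborel_integral_real_affine[of "-1" _ 0]) auto
qed

lemma nn_integral_Iv_split:
  assumes [measurable]: "f \<in> borel_measurable borel" and "a \<le> b" "b \<le> c"
  shows "(\<integral>\<^sup>+x. f x \<partial>Iv a c) = (\<integral>\<^sup>+x. f x \<partial>Iv a b) + (\<integral>\<^sup>+x. f x \<partial>Iv b c)"
proof -
  have "(\<integral>\<^sup>+x. f x \<partial>Iv a c) = (\<integral>\<^sup>+x. f x * indicator {a..b} x + f x * indicator {b..c} x \<partial>lborel)"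
    unfolding nn_integral_Iv
  proof (rule nn_integral_cong_AE)
    show "AE x in lborel. f x * indicator {a..c} x = f x * indicator {a..b} x + f x * indicator {b..c} x"
      by (rule AE_I[of _ _ "{b}"]) (use assms in \<open>auto simp: indicator_def\<close>)
  qed
  thus ?thesis by (simp add: nn_integral_add nn_integral_Iv)
qed

lemma integrable_Iv_set: "integrable (Iv a b) f \<longleftrightarrow> set_integrable lborel {a..b} f" for f :: "real \<Rightarrow> real"
  by (simp add: integrable_Iv set_integrable_def)

lemma integrable_Iv_subset: "integrable (Iv a d) f \<Longrightarrow> a \<le> b \<Longrightarrow> c \<le> d \<Longrightarrow> integrable (Iv b c) f" for f :: "real \<Rightarrow> real"
  unfolding integrable_Iv_set by (erule set_integrable_subset) auto

lemma integral_Iv_split: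
  fixes f :: "real \<Rightarrow> real"
  assumes "integrable (Iv a c) f" and ab: "a \<le> b" "b \<le> c"
  shows "(LINT x|Iv a c. f x) = (LINT x|Iv a b. f x) + (LINT x|Iv b c. f x)"
proof -
  have i: "integrable (Iv a b) f" "integrable (Iv b c) f"
    using assms by (auto intro: integrable_Iv_subset)
  have "(LINT x|Iv a c. f x) = (LINT x|lborel. indicator {a..b} x * f x + indicator {b..c} x * f x)"
    unfolding integral_Iv
  proof (rule integral_cong_AE)
    show "AE x in lborel. indicator {a..c} x * f x = indicator {a..b} x * f x + indicator {b..c} x * f x"
      by (rule AE_I[of _ _ "{b}"]) (use ab in \<open>auto simp: indicator_def\<close>)
  qed (use assms i in \<open>auto simp: integrable_Iv\<close>)
  thus ?thesis using i by (simp add: integral_Iv integrable_Iv)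
qed

section \<open>Integrals of periodic functions over one period\<close>

lemma periodic_of_int:
  assumes "\<And>x. g (x + 2 * pi) = g x"
  shows "g (x + 2 * pi * of_int k) = g x"
proof -
  have nat: "g (x + 2 * pi * real n) = g x" for n x
  proof (induction n)
    case (Suc n)
    have "g (x + 2 * pi * real (Suc n)) = g ((x + 2 * pi * real n) + 2 * pi)" by (simp add: algebra_simps)
    thus ?case using assms Suc by simp
  qed simp
  show ?thesis
  proof (cases "k \<ge> 0")
    case True then show ?thesis using nat[of x "nat k"] by simp
  next
    case False
    hence "g ((x + 2 * pi * of_int k) + 2 * pi * real (nat (- k))) = g (x + 2 * pi * of_int k)" by (intro nat)
    thus ?thesis using False by (simp add: algebra_simps)
  qed
qed

lemma period_shift: "x + 2 * pi * of_int (- \<lfloor>x / (2 * pi)\<rfloor>) \<in> {0..2 * pi}"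
  using floor_divide_lower[of "2 * pi" x] floor_divide_upper[of "2 * pi" x] by (auto simp: algebra_simps)

text \<open>The shift is reduced to one in \<open>[0, 2 * pi]\<close>, and the shifted interval is
  cut at \<open>2 * pi\<close>. The version for nonnegative functions comes first because it yields
  integrability of shifted functions as well as the value of the integral.\<close>

lemma nn_integral_periodic:
  assumes [measurable]: "f \<in> borel_measurable borel" and per: "\<And>x. f (x + 2 * pi) = f x"
  shows "(\<integral>\<^sup>+x. f (x + c) \<partial>circ) = (\<integral>\<^sup>+x. f x \<partial>circ)"
proof -
  define a where "a = c + 2 * pi * of_int (- \<lfloor>c / (2 * pi)\<rfloor>)"
  have a: "0 \<le> a" "a \<le> 2 * pi" using period_shift[of c] by (auto simp: a_def)
  have "f (x + c) = f (x + a)" for x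
    using periodic_of_int[of f "x + c" "- \<lfloor>c / (2 * pi)\<rfloor>", OF per] unfolding a_def by (metis add.assoc)
  hence "(\<integral>\<^sup>+x. f (x + c) \<partial>circ) = (\<integral>\<^sup>+x. f (x + a) \<partial>circ)" by simp
  also have "\<dots> = (\<integral>\<^sup>+x. f x \<partial>Iv a (2 * pi + a))" by (subst nn_integral_Iv_shift) auto
  also have "\<dots> = (\<integral>\<^sup>+x. f x \<partial>Iv a (2 * pi)) + (\<integral>\<^sup>+x. f x \<partial>Iv (2 * pi) (2 * pi + a))"
    using a by (intro nn_integral_Iv_split) auto
  also have "(\<integral>\<^sup>+x. f x \<partial>Iv (2 * pi) (2 * pi + a)) = (\<integral>\<^sup>+x. f x \<partial>Iv 0 a)"
    using nn_integral_Iv_shift[of f 0 a "2 * pi"] per by (simp add: add.commute)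
  also have "(\<integral>\<^sup>+x. f x \<partial>Iv a (2 * pi)) + (\<integral>\<^sup>+x. f x \<partial>Iv 0 a) = (\<integral>\<^sup>+x. f x \<partial>circ)"
    using a by (subst add.commute) (intro nn_integral_Iv_split[symmetric], auto)
  finally show ?thesis .
qed

definition Lper :: "(real \<Rightarrow> real) \<Rightarrow> bool" where
  "Lper u \<longleftrightarrow> u \<in> borel_measurable borel \<and> periodic u \<and> integrable circ u"

lemma periodicD: "periodic u \<Longrightarrow> u (x + 2 * pi) = u x"
  by (simp add: periodic_def)

lemma integrable_periodic:
  assumes "Lper u"
  shows "integrable circ (\<lambda>x. u (x + c))"
proof -
  have [measurable]: "u \<in> borel_measurable borel" and per: "\<And>x. u (x + 2 * pi) = u x" and i: "integrable circ u"
    using assms by (auto simp: Lper_def periodic_def)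
  have "(\<integral>\<^sup>+x. ennreal (norm (u (x + c))) \<partial>circ) = (\<integral>\<^sup>+x. ennreal (norm (u x)) \<partial>circ)"
    using per by (intro nn_integral_periodic[of "\<lambda>x. ennreal (norm (u x))"]) auto
  also have "\<dots> < \<infinity>" using i by (simp add: integrable_iff_bounded)
  finally show ?thesis by (simp add: integrable_iff_bounded)
qed

lemma Lper_shift: "Lper u \<Longrightarrow> Lper (\<lambda>x. u (x + c))"
proof -
  assume u: "Lper u"
  have [measurable]: "u \<in> borel_measurable borel" using u by (simp add: Lper_def)
  have "periodic (\<lambda>x. u (x + c))" using u unfolding Lper_def periodic_def by (metis add.assoc add.commute)
  thus ?thesis using integrable_periodic[OF u, of c] by (simp add: Lper_def)
qed

lemma integral_periodic:
  assumes "Lper u"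
  shows "(\<integral>x. u (x + c)) = (\<integral>x. u x)"
proof -
  have [measurable]: "u \<in> borel_measurable borel" and per: "\<And>x. u (x + 2 * pi) = u x" and i: "integrable circ u"
    using assms by (auto simp: Lper_def periodic_def)
  have "(\<integral>\<^sup>+x. ennreal (u (x + c)) \<partial>circ) = (\<integral>\<^sup>+x. ennreal (u x) \<partial>circ)"
    "(\<integral>\<^sup>+x. ennreal (- u (x + c)) \<partial>circ) = (\<integral>\<^sup>+x. ennreal (- u x) \<partial>circ)"
    using per nn_integral_periodic[of "\<lambda>x. ennreal (u x)" c] nn_integral_periodic[of "\<lambda>x. ennreal (- u x)" c] by auto
  thus ?thesis
    using i integrable_periodic[OF assms, of c] by (simp add: real_lebesgue_integral_def)
qed

lemma integral_Iv_periodic: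
  assumes "Lper u"
  shows "integrable (Iv a (a + 2 * pi)) u" "(LINT x|Iv a (a + 2 * pi). u x) = (\<integral>x. u x)"
  using integrable_periodic[OF assms, of a] integral_periodic[OF assms, of a]
  by (simp_all add: integrable_Iv_shift integral_Iv_shift add.commute)

section \<open>Indefinite integrals, box averages and difference quotients\<close>

definition locint :: "(real \<Rightarrow> real) \<Rightarrow> bool" where
  "locint u \<longleftrightarrow> (\<forall>a b. integrable (Iv a b) u)"

lemma integrable_Iv_union:
  "integrable (Iv a b) f \<Longrightarrow> integrable (Iv b c) f \<Longrightarrow> a \<le> b \<Longrightarrow> b \<le> c \<Longrightarrow> integrable (Iv a c) f" for f :: "real \<Rightarrow> real"
  unfolding integrable_Iv_set using set_integrable_Un[of lborel "{a..b}" f "{b..c}"] by (simp add: ivl_disj_un_two_touch)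

lemma Lper_locint: "Lper u \<Longrightarrow> locint u"
proof -
  assume u: "Lper u"
  have *: "integrable (Iv a (a + 2 * pi * real n)) u" for a n
  proof (induction n)
    case 0
    show ?case using integrable_Iv_subset[OF integral_Iv_periodic(1)[OF u, of a], of a a] by simp
  next
    case (Suc n)
    show ?case
      using integrable_Iv_union[OF Suc integral_Iv_periodic(1)[OF u, of "a + 2 * pi * real n"]]
      by (simp add: algebra_simps)
  qed
  show ?thesis unfolding locint_def
  proof (intro allI)
    fix a b
    obtain n :: nat where "(b - a) / (2 * pi) \<le> real n" using real_arch_simple by blast
    hence "b \<le> a + 2 * pi * real n" by (simp add: field_simps)
    thus "integrable (Iv a b) u" using *[of a n] by (rule integrable_Iv_subset[rotated 2]) simp
  qed
qed

lemma continuous_locint: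
  assumes "continuous_on UNIV u" shows "locint u"
  unfolding locint_def integrable_Iv
  using borel_integrable_atLeastAtMost'[OF continuous_on_subset[OF assms subset_UNIV]] by (auto simp: set_integrable_def)

text \<open>Expresses that \<open>U\<close> is locally absolutely continuous with derivative
  \<open>u\<close>, without differentiating anything. For continuous periodic \<open>U\<close> and
  \<open>Lper u\<close> it is equivalent to \<open>u\<close> being the weak derivative of
  \<open>U\<close> (\<open>prim_wderiv\<close>, \<open>wderiv_prim\<close>).\<close>

definition prim :: "(real \<Rightarrow> real) \<Rightarrow> (real \<Rightarrow> real) \<Rightarrow> bool" where
  "prim u U \<longleftrightarrow> (\<forall>a b. a \<le> b \<longrightarrow> integrable (Iv a b) u \<and> (LINT x|Iv a b. u x) = U b - U a)"

lemma locint_prim: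
  assumes "locint u" obtains U where "prim u U"
proof
  define U where "U = (\<lambda>x. if x \<ge> 0 then LINT y|Iv 0 x. u y else - (LINT y|Iv x 0. u y))"
  have i: "integrable (Iv a b) u" for a b using assms by (simp add: locint_def)
  show "prim u U"
    unfolding prim_def
  proof (intro allI impI conjI i)
    fix a b :: real assume "a \<le> b"
    then consider "0 \<le> a" "a \<le> b" | "a < 0" "0 \<le> b" | "a \<le> b" "b < 0" by linarith
    thus "(LINT x|Iv a b. u x) = U b - U a"
    proof cases
      case 1 then show ?thesis using integral_Iv_split[OF i, of 0 a b] by (simp add: U_def)
    next
      case 2 then show ?thesis using integral_Iv_split[OF i, of a 0 b] by (simp add: U_def)
    next
      case 3 then show ?thesis using integral_Iv_split[OF i, of a b 0] by (simp add: U_def)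
    qed
  qed
qed

lemma prim_locint: "prim u U \<Longrightarrow> locint u"
  unfolding locint_def
proof (intro allI)
  fix a b assume "prim u U"
  thus "integrable (Iv a b) u"
    using integrable_Iv_subset[of a "max a b" u a b] by (auto simp: prim_def)
qed

lemma prim_integral: "prim u U \<Longrightarrow> a \<le> b \<Longrightarrow> (LINT x|Iv a b. u x) = U b - U a"
  by (simp add: prim_def)

definition avg :: "real \<Rightarrow> (real \<Rightarrow> real) \<Rightarrow> real \<Rightarrow> real" where
  "avg e u x = (LINT y|Iv (- e) e. u (x + y)) / (2 * e)"

definition dq :: "real \<Rightarrow> (real \<Rightarrow> real) \<Rightarrow> real \<Rightarrow> real" where
  "dq e u x = (u (x + e) - u (x - e)) / (2 * e)"

lemma avg_Iv: "avg e u x = (LINT y|Iv (x - e) (x + e). u y) / (2 * e)"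
  using integral_Iv_shift[of "-e" e u x] by (simp add: avg_def add.commute)

text \<open>The basic exact identity: a box average of a derivative is a centred difference quotient
  of the function. All commutation rules below come from applying it to primitives.\<close>

lemma prim_avg: "prim u U \<Longrightarrow> e > 0 \<Longrightarrow> avg e u x = dq e U x"
  by (simp add: avg_Iv dq_def prim_integral)

lemma prim_shift: "prim u U \<Longrightarrow> prim (\<lambda>x. u (x + c)) (\<lambda>x. U (x + c))"
  by (simp add: prim_def integral_Iv_shift integrable_Iv_shift)

lemma prim_lin:
  assumes "prim u U" "prim v V"
  shows "prim (\<lambda>x. a * u x + b * v x) (\<lambda>x. a * U x + b * V x)"
    unfolding prim_def
proof (intro allI impI conjI)
  fix s t :: real assume "s \<le> t"
  hence "integrable (Iv s t) u" "integrable (Iv s t) v" "(LINT x|Iv s t. u x) = U t - U s" "(LINT x|Iv s t. v x) = V t - V s"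
    using assms by (auto simp: prim_def)
  thus "integrable (Iv s t) (\<lambda>x. a * u x + b * v x)"
    "(LINT x|Iv s t. a * u x + b * v x) = a * U t + b * V t - (a * U s + b * V s)"
    by (simp, simp only: Bochner_Integration.integral_add integrable_mult_right integral_mult_right_zero right_diff_distrib)
qed

lemma prim_dq: "prim u U \<Longrightarrow> prim (dq e u) (dq e U)"
  using prim_lin[OF prim_shift[of u U e] prim_shift[of u U "- e"], of "1 / (2 * e)" "- 1 / (2 * e)"]
  by (simp add: dq_def[abs_def] diff_divide_distrib)

lemma prim_HK:
  assumes "prim u U" "a \<le> b"
  shows "set_integrable lborel {a..b} u" "U b = U a + integral {a..b} u"
proof -
  show si: "set_integrable lborel {a..b} u" using assms by (simp add: prim_def integrable_Iv_set)
  have "integral {a..b} u = (LINT x|Iv a b. u x)"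
    using set_borel_integral_eq_integral(2)[OF si] by (simp add: integral_Iv set_lebesgue_integral_def)
  thus "U b = U a + integral {a..b} u" using prim_integral[OF assms] by simp
qed

lemma prim_continuous:
  assumes "prim u U" shows "continuous_on UNIV U"
proof -
  have "isCont U x" for x
  proof -
    let ?a = "x - 1" and ?b = "x + 1"
    have eq: "U y = U ?a + integral {?a..y} u" if "y \<in> {?a..?b}" for y using prim_HK[OF assms, of ?a y] that by simp
    have "continuous_on {?a..?b} (\<lambda>y. U ?a + integral {?a..y} u)"
      using set_borel_integral_eq_integral(1)[OF prim_HK(1)[OF assms, of ?a ?b]]
      by (intro continuous_intros indefinite_integral_continuous_1) simp
    moreover have "continuous_on {?a..?b} U \<longleftrightarrow> continuous_on {?a..?b} (\<lambda>y. U ?a + integral {?a..y} u)"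
      by (rule continuous_on_cong[OF refl eq])
    ultimately show "isCont U x" using continuous_on_interior[of "{?a..?b}" U x] by simp
  qed
  thus ?thesis by (simp add: continuous_on_eq_continuous_at)
qed

lemma prim_deriv:
  assumes "prim u U" "continuous_on UNIV u"
  shows "(U has_real_derivative u x) (at x)"
proof -
  let ?a = "x - 1" and ?b = "x + 1"
  have eq: "U y = U ?a + integral {?a..y} u" if "y \<in> {?a..?b}" for y using prim_HK[OF assms(1), of ?a y] that by simp
  have c: "continuous_on {?a..?b} u" using assms(2) by (rule continuous_on_subset) simp
  have "((\<lambda>y. integral {?a..y} u) has_real_derivative u x) (at x within {?a..?b})"
    using integral_has_real_derivative[OF c, of x] by simp
  hence "((\<lambda>y. U ?a + integral {?a..y} u) has_real_derivative u x) (at x within {?a..?b})"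
    by (auto intro!: derivative_eq_intros)
  hence "(U has_real_derivative u x) (at x within {?a..?b})"
    by (rule has_field_derivative_transform_within[of _ _ _ _ 1]) (use eq[symmetric] in simp_all)
  moreover have "at x within {?a..?b} = at x" by (rule at_within_interior) (simp add: interior_atLeastAtMost_real)
  ultimately show ?thesis by simp
qed

lemma deriv_prim:
  assumes "\<And>x. (U has_real_derivative u x) (at x)" "continuous_on UNIV u"
  shows "prim u U"
  unfolding prim_def
proof (intro allI impI conjI)
  fix a b :: real assume ab: "a \<le> b"
  show "integrable (Iv a b) u" using continuous_locint[OF assms(2)] by (simp add: locint_def)
  show "(LINT x|Iv a b. u x) = U b - U a"
    unfolding integral_Iv
    using integral_FTC_Icc_real[OF ab, of U u] assms by (simp add: mult.commute continuous_on_eq_continuous_at)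
qed

lemma dq_continuous: "continuous_on UNIV u \<Longrightarrow> continuous_on UNIV (dq e u)"
proof (cases "e = 0")
  case False
  assume u: "continuous_on UNIV u"
  show ?thesis unfolding dq_def[abs_def] using False
    by (intro continuous_intros continuous_on_compose2[OF u]) auto
qed (simp add: dq_def[abs_def])

lemma avg_continuous: "locint u \<Longrightarrow> e > 0 \<Longrightarrow> continuous_on UNIV (avg e u)"
proof -
  assume u: "locint u" and e: "e > 0"
  obtain U where U: "prim u U" using locint_prim[OF u] by blast
  have "avg e u = dq e U" using prim_avg[OF U e] by (rule ext)
  thus ?thesis using dq_continuous[OF prim_continuous[OF U]] by simp
qed

lemma avg_deriv:
  assumes "continuous_on UNIV u" "e > 0"
  shows "(avg e u has_real_derivative dq e u x) (at x)"
proof -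
  obtain U where U: "prim u U" using locint_prim[OF continuous_locint[OF assms(1)]] by blast
  have d: "(U has_real_derivative u y) (at y)" for y using prim_deriv[OF U assms(1)] .
  have "((\<lambda>x. dq e U x) has_real_derivative dq e u x) (at x)"
    unfolding dq_def using assms(2)
    by (auto intro!: derivative_eq_intros DERIV_chain2[OF d] simp: field_simps)
  moreover have "avg e u = dq e U" using prim_avg[OF U assms(2)] by (rule ext)
  ultimately show ?thesis by simp
qed

lemma prim_avg_avg:
  assumes "prim u U" "e > 0" shows "prim (avg e u) (avg e U)"
proof (rule deriv_prim)
  show "continuous_on UNIV (avg e u)" using assms prim_locint avg_continuous by blast
  show "(avg e U has_real_derivative avg e u x) (at x)" for x
    using avg_deriv[OF prim_continuous[OF assms(1)] assms(2)] prim_avg[OF assms] by simp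
qed

lemma dq_commute: "dq e (dq d u) = dq d (dq e u)"
  by (auto simp: dq_def fun_eq_iff divide_simps algebra_simps)

text \<open>Both sides equal a double quotient of a primitive of \<open>u\<close>. The second form
  exchanges the widths between average and quotient, which is what later moves all differences to
  one chosen width.\<close>

lemma avg_locint_dq:
  assumes "locint u" "e > 0" "d > 0"
  shows "avg e (dq d u) = dq d (avg e u)" "avg e (dq d u) = dq e (avg d u)"
proof -
  obtain U where U: "prim u U" using locint_prim[OF assms(1)] by blast
  have "avg e (dq d u) = dq e (dq d U)" using prim_avg[OF prim_dq[OF U] assms(2)] by auto
  moreover have "avg e u = dq e U" "avg d u = dq d U" using prim_avg[OF U] assms by auto
  ultimately show "avg e (dq d u) = dq d (avg e u)" "avg e (dq d u) = dq e (avg d u)"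
    using dq_commute[of e d U] by auto
qed

lemma avg_commute:
  assumes "locint u" "e > 0" "d > 0"
  shows "avg e (avg d u) = avg d (avg e u)"
proof -
  obtain U where U: "prim u U" using locint_prim[OF assms(1)] by blast
  have cU: "locint U" using prim_continuous[OF U] continuous_locint by blast
  have "avg e (avg d u) = dq e (avg d U)" using prim_avg[OF prim_avg_avg[OF U assms(3)] assms(2)] by auto
  also have "\<dots> = avg d (dq e U)" using avg_locint_dq(1)[OF cU assms(3,2)] by simp
  also have "dq e U = avg e u" using prim_avg[OF U assms(2)] by auto
  finally show ?thesis .
qed

definition Lpc :: "real \<Rightarrow> (real \<Rightarrow> real) \<Rightarrow> bool" where
  "Lpc p u \<longleftrightarrow> u \<in> borel_measurable borel \<and> periodic u \<and> integrable circ (\<lambda>x. \<bar>u x\<bar> powr p)"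

abbreviation cper :: "(real \<Rightarrow> real) \<Rightarrow> bool" where
  "cper u \<equiv> continuous_on UNIV u \<and> periodic u"

lemma Lpc_measurable: "Lpc p u \<Longrightarrow> u \<in> borel_measurable borel"
  by (simp add: Lpc_def)

lemma Lpc_periodic: "Lpc p u \<Longrightarrow> periodic u"
  by (simp add: Lpc_def)

lemma Lpc_Lpf: "Lpc p u \<Longrightarrow> Lpf circ p u"
  by (auto simp: Lpc_def intro!: LpfI)

lemma LpcI: "u \<in> borel_measurable borel \<Longrightarrow> periodic u \<Longrightarrow> Lpf circ p u \<Longrightarrow> Lpc p u"
  by (simp add: Lpc_def Lpf_def)

lemma Lpc_Lper: "p \<ge> 1 \<Longrightarrow> Lpc p u \<Longrightarrow> Lper u"
  using Lpf_imp_integrable[OF finite_measure_Iv Lpc_Lpf[of p u]] Lpc_measurable[of p u] Lpc_periodic[of p u]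
  by (simp add: Lper_def)

lemma Lper_Lpc: "Lper u \<Longrightarrow> Lpc 1 u"
  by (simp add: Lpc_def Lper_def)

lemma periodic_add: "periodic u \<Longrightarrow> periodic v \<Longrightarrow> periodic (\<lambda>x. u x + v x)"
  by (simp add: periodic_def)

lemma periodic_diff: "periodic u \<Longrightarrow> periodic v \<Longrightarrow> periodic (\<lambda>x. u x - v x)"
  by (simp add: periodic_def)

lemma Lpc_add: "p > 0 \<Longrightarrow> Lpc p u \<Longrightarrow> Lpc p v \<Longrightarrow> Lpc p (\<lambda>x. u x + v x)"
  by (rule LpcI) (auto simp: Lpc_measurable Lpc_periodic Lpc_Lpf intro!: periodic_add Lpf_add borel_measurable_add)

lemma Lpc_diff: "p > 0 \<Longrightarrow> Lpc p u \<Longrightarrow> Lpc p v \<Longrightarrow> Lpc p (\<lambda>x. u x - v x)"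
  by (rule LpcI) (auto simp: Lpc_measurable Lpc_periodic Lpc_Lpf intro!: periodic_diff Lpf_diff borel_measurable_diff)

lemma Lpc_cmult: "Lpc p u \<Longrightarrow> Lpc p (\<lambda>x. c * u x)"
  by (rule LpcI) (auto simp: Lpc_def periodic_def intro!: Lpf_cmult LpfI)

lemma Lpc_zero: "p > 0 \<Longrightarrow> Lpc p (\<lambda>x. 0)"
  by (simp add: Lpc_def periodic_def)

lemma cper_bounded:
  assumes "cper u" obtains B where "B \<ge> 0" "\<And>x. \<bar>u x\<bar> \<le> B"
proof -
  have "compact (u ` {0..2 * pi})"
    using assms continuous_on_subset by (intro compact_continuous_image) auto
  then obtain B where B: "\<And>y. y \<in> u ` {0..2 * pi} \<Longrightarrow> \<bar>y\<bar> \<le> B"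
    using compact_imp_bounded bounded_real by metis
  have "\<bar>u x\<bar> \<le> B" for x
  proof -
    have "u (x + 2 * pi * of_int (- \<lfloor>x / (2 * pi)\<rfloor>)) = u x" by (rule periodic_of_int) (use assms in \<open>simp add: periodic_def\<close>)
    thus ?thesis using B period_shift[of x] by (metis imageI)
  qed
  thus ?thesis using that[of "max 0 B"] by (meson max.cobounded1 max.coboundedI2)
qed

lemma cper_Lpc: "cper u \<Longrightarrow> p > 0 \<Longrightarrow> Lpc p u"
proof -
  assume u: "cper u" and p: "p > 0"
  obtain B where "\<And>x. \<bar>u x\<bar> \<le> B" using cper_bounded[OF u] by blast
  moreover have "u \<in> borel_measurable borel" using u by (intro borel_measurable_continuous_onI) simp
  ultimately have "Lpf circ p u" using p by (intro Lpf_bounded[OF finite_measure_Iv, of _ _ _ B]) auto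
  thus "Lpc p u" using u by (intro LpcI borel_measurable_continuous_onI) auto
qed

lemma cper_Lper: "cper u \<Longrightarrow> Lper u"
  using cper_Lpc[of u 1] Lpc_Lper[of 1 u] by simp

lemma cper_locint: "cper u \<Longrightarrow> locint u"
  by (simp add: continuous_locint)

lemma dq_periodic: "periodic u \<Longrightarrow> periodic (dq e u)"
proof -
  assume u: "periodic u"
  have "dq e u (x + 2 * pi) = dq e u x" for x
    using periodicD[OF u, of "x + e"] periodicD[OF u, of "x - e"] by (simp add: dq_def algebra_simps)
  thus ?thesis by (simp add: periodic_def)
qed

lemma avg_periodic: "periodic u \<Longrightarrow> periodic (avg e u)"
proof -
  assume u: "periodic u"
  have "u (x + 2 * pi + y) = u (x + y)" for x y using periodicD[OF u, of "x + y"] by (simp add: algebra_simps)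
  thus ?thesis by (simp add: avg_def periodic_def)
qed

lemma cper_dq: "cper u \<Longrightarrow> cper (dq e u)"
  by (simp add: dq_continuous dq_periodic)

lemma cper_avg: "Lper u \<Longrightarrow> e > 0 \<Longrightarrow> cper (avg e u)"
  using avg_continuous[OF Lper_locint] avg_periodic by (auto simp: Lper_def)

lemma cper_avg': "cper u \<Longrightarrow> e > 0 \<Longrightarrow> cper (avg e u)"
  using cper_avg[OF cper_Lper] .

lemma avg_integrable: "locint u \<Longrightarrow> integrable (Iv (- e) e) (\<lambda>y. u (x + y))"
  using integrable_Iv_shift[of "-e" e u x] by (simp add: locint_def add.commute)

lemma avg_lin:
  assumes "locint u" "locint v"
  shows "avg e (\<lambda>x. a * u x + b * v x) x = a * avg e u x + b * avg e v x"
  using avg_integrable[OF assms(1), of e x] avg_integrable[OF assms(2), of e x]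
  by (simp add: avg_def add_divide_distrib)

lemma avg_diff: "locint u \<Longrightarrow> locint v \<Longrightarrow> avg e (\<lambda>x. u x - v x) x = avg e u x - avg e v x"
  using avg_lin[of u v e 1 "- 1" x] by simp

lemma avg_cmult: "avg e (\<lambda>x. c * u x) x = c * avg e u x"
  by (simp add: avg_def)

lemma locint_lin: "locint u \<Longrightarrow> locint v \<Longrightarrow> locint (\<lambda>x. a * u x + b * v x)"
  by (simp add: locint_def)

lemma locint_diff: "locint u \<Longrightarrow> locint v \<Longrightarrow> locint (\<lambda>x. u x - v x)"
  by (simp add: locint_def)

lemma locint_abs: "locint u \<Longrightarrow> locint (\<lambda>x. \<bar>u x\<bar>)"
  by (simp add: locint_def)

lemma locint_avg: "locint u \<Longrightarrow> e > 0 \<Longrightarrow> locint (avg e u)"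
  by (simp add: avg_continuous continuous_locint)

lemma avg_mono:
  assumes "locint u" "locint v" "e > 0" "\<And>y. \<bar>y - x\<bar> \<le> e \<Longrightarrow> u y \<le> v y"
  shows "avg e u x \<le> avg e v x"
  unfolding avg_def using assms
  by (intro divide_right_mono integral_mono avg_integrable) (auto simp: abs_le_iff)

lemma avg_const: "e > 0 \<Longrightarrow> avg e (\<lambda>x. c) x = c"
  using integral_Iv_const[of "- e" e c] by (simp add: avg_def del: lebesgue_integral_const)

lemma locint_const: "locint (\<lambda>x. c)"
  by (simp add: locint_def)

lemma abs_avg_le: "locint u \<Longrightarrow> e > 0 \<Longrightarrow> \<bar>avg e u x\<bar> \<le> avg e (\<lambda>x. \<bar>u x\<bar>) x"
  using integral_abs_bound[of "Iv (-e) e" "\<lambda>y. u (x + y)"]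
  by (simp add: avg_def divide_right_mono)

lemma avg_bound:
  assumes "locint u" "e > 0" "\<And>y. \<bar>y - x\<bar> \<le> e \<Longrightarrow> \<bar>u y\<bar> \<le> B"
  shows "\<bar>avg e u x\<bar> \<le> B"
proof -
  have "avg e (\<lambda>x. \<bar>u x\<bar>) x \<le> avg e (\<lambda>x. B) x" using assms by (intro avg_mono locint_abs locint_const) auto
  thus ?thesis using abs_avg_le[OF assms(1,2), of x] avg_const[OF assms(2), of B x] by linarith
qed

lemma avg_near:
  assumes "locint u" "e > 0" "\<And>y. \<bar>y - x\<bar> \<le> e \<Longrightarrow> \<bar>u y - u x\<bar> \<le> B"
  shows "\<bar>avg e u x - u x\<bar> \<le> B"
proof -
  have "avg e (\<lambda>y. u y - u x) x = avg e u x - u x"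
    using avg_diff[OF assms(1) locint_const] avg_const[OF assms(2)] by simp
  moreover have "\<bar>avg e (\<lambda>y. u y - u x) x\<bar> \<le> B"
    using assms by (intro avg_bound locint_diff locint_const) auto
  ultimately show ?thesis by simp
qed

lemma dq_bound:
  assumes "e > 0" "\<And>y. \<bar>u y\<bar> \<le> B"
  shows "\<bar>dq e u x\<bar> \<le> B / e"
proof -
  have "\<bar>u (x + e) - u (x - e)\<bar> \<le> 2 * B" using assms(2)[of "x + e"] assms(2)[of "x - e"] by linarith
  hence "\<bar>u (x + e) - u (x - e)\<bar> / (2 * e) \<le> 2 * B / (2 * e)" using assms(1) by (intro divide_right_mono) auto
  thus ?thesis using assms(1) by (simp add: dq_def abs_divide)
qed

lemma dq_lin: "dq e (\<lambda>x. a * u x + b * v x) x = a * dq e u x + b * dq e v x"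
  by (simp add: dq_def diff_divide_distrib add_divide_distrib algebra_simps)

lemma Lper_powr: "Lpc p u \<Longrightarrow> Lper (\<lambda>x. \<bar>u x\<bar> powr p)"
  by (auto simp: Lpc_def Lper_def periodic_def)

text \<open>The average of the tangent inequality taken at the point \<open>avg e u x\<close>, where
  the linear term averages to zero.\<close>

lemma Jensen_avg:
  assumes l: "locint u" "locint (\<lambda>x. \<bar>u x\<bar> powr p)" and p: "p \<ge> 1" and e: "e > 0"
  shows "\<bar>avg e u x\<bar> powr p \<le> avg e (\<lambda>x. \<bar>u x\<bar> powr p) x"
proof -
  let ?a = "avg e u x"
  let ?c = "p * \<psi> (p - 1) ?a"
  have c: "locint (\<lambda>y. (\<bar>?a\<bar> powr p - ?c * ?a) * 1 + ?c * u y)"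
    using l by (intro locint_lin locint_const)
  have "avg e (\<lambda>y. (\<bar>?a\<bar> powr p - ?c * ?a) * 1 + ?c * u y) x \<le> avg e (\<lambda>x. \<bar>u x\<bar> powr p) x"
  proof (intro avg_mono c l e)
    fix y
    show "(\<bar>?a\<bar> powr p - ?c * ?a) * 1 + ?c * u y \<le> \<bar>u y\<bar> powr p"
      using abs_powr_tangent[OF p, of ?a "u y"] by (simp add: algebra_simps)
  qed
  also have "avg e (\<lambda>y. (\<bar>?a\<bar> powr p - ?c * ?a) * 1 + ?c * u y) x = \<bar>?a\<bar> powr p"
    by (subst avg_lin) (use l e in \<open>auto simp: locint_const avg_const\<close>)
  finally show ?thesis .
qed

section \<open>Duality of averages and quotients on the circle\<close>

lemma circ_pair_sigma_finite: "pair_sigma_finite (Iv a b) (Iv c d)"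
  by (simp add: pair_sigma_finite_def finite_measure_Iv finite_measure.axioms(1))

lemma measurable_Iv_pair [measurable (raw)]:
  "f \<in> borel_measurable borel2 \<Longrightarrow> f \<in> borel_measurable (Iv a b \<Otimes>\<^sub>M Iv c d)"
proof -
  have "(\<lambda>x. (fst x, snd x)) \<in> measurable (Iv a b \<Otimes>\<^sub>M Iv c d) borel2"
    by (intro measurable_Pair measurable_compose[OF measurable_fst measurable_Iv] measurable_compose[OF measurable_snd measurable_Iv]) simp_all
  hence "(\<lambda>x. x) \<in> measurable (Iv a b \<Otimes>\<^sub>M Iv c d) borel2" by simp
  thus "f \<in> borel_measurable borel2 \<Longrightarrow> f \<in> borel_measurable (Iv a b \<Otimes>\<^sub>M Iv c d)"
    using measurable_comp[of "\<lambda>x. x" "Iv a b \<Otimes>\<^sub>M Iv c d" "borel \<Otimes>\<^sub>M borel" f borel] by (simp add: comp_def)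
qed

lemma Lper_mult_bounded:
  assumes u: "Lper u" and v: "Lper v" "\<And>x. \<bar>v x\<bar> \<le> B"
  shows "Lper (\<lambda>x. u x * v x)" "(\<integral>x. \<bar>u x * v x\<bar>) \<le> B * (\<integral>x. \<bar>u x\<bar>)"
proof -
  have b: "\<bar>u x * v x\<bar> \<le> B * \<bar>u x\<bar>" for x
    using mult_left_mono[OF v(2)[of x], of "\<bar>u x\<bar>"] by (simp add: abs_mult mult.commute)
  have iB: "integrable circ (\<lambda>x. B * \<bar>u x\<bar>)" using u by (simp add: Lper_def)
  have i: "integrable circ (\<lambda>x. u x * v x)"
    by (rule Bochner_Integration.integrable_bound[OF iB]) (use u v b in \<open>auto simp: Lper_def intro: order_trans[OF _ abs_ge_self]\<close>)
  thus "Lper (\<lambda>x. u x * v x)" using u v by (simp add: Lper_def periodic_def borel_measurable_times)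
  have "(\<integral>x. \<bar>u x * v x\<bar>) \<le> (\<integral>x. B * \<bar>u x\<bar>)" using i iB b by (intro integral_mono) auto
  thus "(\<integral>x. \<bar>u x * v x\<bar>) \<le> B * (\<integral>x. \<bar>u x\<bar>)" by simp
qed

text \<open>Fubini, translation invariance on the circle and the symmetry of the box under
  reflection.\<close>

lemma avg_adjoint_bounded:
  assumes u: "Lper u" and v: "Lper v" "\<And>x. \<bar>v x\<bar> \<le> B"
  shows "(\<integral>x. avg e u x * v x) = (\<integral>x. u x * avg e v x)"
proof -
  interpret pair_sigma_finite circ "Iv (- e) e" by (rule circ_pair_sigma_finite)
  \<comment> \<open>Needed for \<open>u\<close> shifted against \<open>v\<close> and for
    \<open>v\<close> shifted against \<open>u\<close>, since Fubini is applied once in each form;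
    the inner integral is bounded independently of the shift.\<close>
  have I: "integrable (circ \<Otimes>\<^sub>M Iv (- e) e) (\<lambda>(x, y). f (x + y) * g x)"
    if fg: "Lper f" "Lper g" and P: "\<And>y. Lper (\<lambda>x. f (x + y) * g x)" "\<And>y. (\<integral>x. \<bar>f (x + y) * g x\<bar>) \<le> C" for f g C
  proof (rule integrableI_bounded)
    have [measurable]: "f \<in> borel_measurable borel" "g \<in> borel_measurable borel" using fg by (auto simp: Lper_def)
    show "(\<lambda>(x, y). f (x + y) * g x) \<in> borel_measurable (circ \<Otimes>\<^sub>M Iv (- e) e)" by measurable
    have "(\<integral>\<^sup>+z. ennreal (norm (case z of (x, y) \<Rightarrow> f (x + y) * g x)) \<partial>(circ \<Otimes>\<^sub>M Iv (- e) e))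
        = (\<integral>\<^sup>+y. \<integral>\<^sup>+x. ennreal \<bar>f (x + y) * g x\<bar> \<partial>circ \<partial>Iv (- e) e)"
      by (subst nn_integral_snd[symmetric]) auto
    also have "\<dots> \<le> (\<integral>\<^sup>+y. ennreal C \<partial>Iv (- e) e)"
    proof (rule nn_integral_mono)
      fix y
      have "(\<integral>\<^sup>+x. ennreal \<bar>f (x + y) * g x\<bar> \<partial>circ) = ennreal (\<integral>x. \<bar>f (x + y) * g x\<bar>)"
        using P(1)[of y] by (intro nn_integral_eq_integral) (auto simp: Lper_def)
      thus "(\<integral>\<^sup>+x. ennreal \<bar>f (x + y) * g x\<bar> \<partial>circ) \<le> ennreal C" using P(2)[of y] by (simp add: ennreal_leI)
    qed
    also have "\<dots> < \<infinity>" by (simp add: emeasure_Iv ennreal_mult_less_top)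
    finally show "(\<integral>\<^sup>+z. ennreal (norm (case z of (x, y) \<Rightarrow> f (x + y) * g x)) \<partial>(circ \<Otimes>\<^sub>M Iv (- e) e)) < \<infinity>" .
  qed
  have "Lper (\<lambda>x. \<bar>u x\<bar>)" using u by (simp add: Lper_def periodic_def borel_measurable_abs)
  from integral_periodic[OF this] have i1: "integrable (circ \<Otimes>\<^sub>M Iv (- e) e) (\<lambda>(x, y). u (x + y) * v x)"
    using Lper_mult_bounded[OF Lper_shift[OF u] v] by (intro I[OF u v(1)]) auto
  have vu: "Lper (\<lambda>x. v (x + c) * u x)" "(\<integral>x. \<bar>v (x + c) * u x\<bar>) \<le> B * (\<integral>x. \<bar>u x\<bar>)" for c
    using Lper_mult_bounded[OF u Lper_shift[OF v(1)] v(2)] by (simp_all add: mult.commute)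
  have "(\<integral>x. avg e u x * v x) = (\<integral>x. LINT y|Iv (- e) e. u (x + y) * v x) / (2 * e)"
    by (simp add: avg_def)
  also have "(\<integral>x. LINT y|Iv (- e) e. u (x + y) * v x) = (LINT y|Iv (- e) e. LINT x|circ. u (x + y) * v x)"
    by (rule Fubini_integral[OF i1, symmetric])
  also have "\<dots> = (LINT y|Iv (- e) e. LINT x|circ. v (x + (- y)) * u x)"
  proof (rule Bochner_Integration.integral_cong[OF refl])
    fix y
    show "(\<integral>x. u (x + y) * v x) = (\<integral>x. v (x + (- y)) * u x)"
      using integral_periodic[OF vu(1)[of "- y"], of y] by (simp add: mult.commute)
  qed
  also have "\<dots> = (LINT y|Iv (- e) e. LINT x|circ. v (x + y) * u x)"
    by (rule integral_Iv_reflect[of e "\<lambda>y. \<integral>x. v (x + y) * u x"])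
  also have "\<dots> = (\<integral>x. LINT y|Iv (- e) e. v (x + y) * u x)"
    by (rule Fubini_integral[OF I[OF v(1) u vu]])
  also have "\<dots> / (2 * e) = (\<integral>x. u x * avg e v x)"
    by (simp add: avg_def mult.commute)
  finally show ?thesis .
qed

lemma integral_avg: "Lper u \<Longrightarrow> e > 0 \<Longrightarrow> (\<integral>x. avg e u x) = (\<integral>x. u x)"
  using avg_adjoint_bounded[of u "\<lambda>x. 1" 1 e] by (simp add: avg_const periodic_def Lper_def)

lemma Lpc_avg:
  assumes u: "Lpc p u" and p: "p \<ge> 1" and e: "e > 0"
  shows "Lpc p (avg e u)" "Ip circ p (avg e u) \<le> Ip circ p u"
proof -
  have c: "cper (avg e u)" using cper_avg[OF Lpc_Lper[OF p u] e] .
  show 1: "Lpc p (avg e u)" using cper_Lpc[OF c] p by simp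
  have i: "integrable circ (avg e (\<lambda>x. \<bar>u x\<bar> powr p))"
    using cper_Lper[OF cper_avg[OF Lper_powr[OF u] e]] by (simp add: Lper_def)
  have "Ip circ p (avg e u) \<le> (\<integral>x. avg e (\<lambda>x. \<bar>u x\<bar> powr p) x)"
    using 1 i Jensen_avg[OF Lper_locint[OF Lpc_Lper[OF p u]] Lper_locint[OF Lper_powr[OF u]] p e] by (intro integral_mono) (auto simp: Lpc_def)
  also have "\<dots> = Ip circ p u" by (rule integral_avg[OF Lper_powr[OF u] e])
  finally show "Ip circ p (avg e u) \<le> Ip circ p u" .
qed

lemma dq_adjoint:
  assumes u: "u \<in> borel_measurable borel" "periodic u" and v: "v \<in> borel_measurable borel" "periodic v"
    and i: "\<And>c. integrable circ (\<lambda>x. u x * v (x + c))"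
  shows "(\<integral>x. dq e u x * v x) = - (\<integral>x. u x * dq e v x)"
proof -
  have L: "Lper (\<lambda>x. u x * v (x + c))" for c
  proof -
    have "v (x + 2 * pi + c) = v (x + c)" for x using periodicD[OF v(2), of "x + c"] by (simp add: algebra_simps)
    thus ?thesis using u v i by (simp add: Lper_def periodic_def)
  qed
  have s: "(\<integral>x. u (x + c) * v x) = (\<integral>x. u x * v (x - c))" "integrable circ (\<lambda>x. u (x + c) * v x)" for c
    using integral_periodic[OF L[of "- c"], of c] integrable_periodic[OF L[of "- c"], of c] by simp_all
  have "(\<integral>x. dq e u x * v x) = (\<integral>x. (u (x + e) * v x - u (x + (- e)) * v x) / (2 * e))"
    by (simp add: dq_def algebra_simps)
  also have "\<dots> = ((\<integral>x. u (x + e) * v x) - (\<integral>x. u (x + (- e)) * v x)) / (2 * e)"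
    using s(2)[of e] s(2)[of "- e"] by simp
  also have "\<dots> = ((\<integral>x. u x * v (x + (- e))) - (\<integral>x. u x * v (x + e))) / (2 * e)"
    using s(1)[of e] s(1)[of "- e"] by simp
  also have "\<dots> = (\<integral>x. (u x * v (x + (- e)) - u x * v (x + e)) / (2 * e))"
    using i[of e] i[of "- e"] by simp
  also have "\<dots> = (\<integral>x. - (u x * dq e v x))"
    by (intro Bochner_Integration.integral_cong) (auto simp: dq_def minus_divide_left right_diff_distrib)
  finally show ?thesis by simp
qed

lemma cper_mult_integrable:
  assumes "Lper u" "cper v" shows "integrable circ (\<lambda>x. u x * v (x + c))"
proof -
  obtain B where B: "\<And>x. \<bar>v x\<bar> \<le> B" using cper_bounded[OF assms(2)] by blast
  have [measurable]: "v \<in> borel_measurable borel" using assms by (intro borel_measurable_continuous_onI) auto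
  show ?thesis
  proof (rule Bochner_Integration.integrable_bound)
    show "integrable circ (\<lambda>x. B * \<bar>u x\<bar>)" using assms by (auto simp: Lper_def)
    show "AE x in circ. norm (u x * v (x + c)) \<le> norm (B * \<bar>u x\<bar>)"
    proof (rule AE_I2)
      fix x
      have "B \<ge> 0" using B[of 0] by linarith
      thus "norm (u x * v (x + c)) \<le> norm (B * \<bar>u x\<bar>)"
        using mult_left_mono[OF B[of "x + c"], of "\<bar>u x\<bar>"] by (simp add: abs_mult mult.commute)
    qed
  qed (use assms in \<open>auto simp: Lper_def\<close>)
qed

lemma dq_adjoint_cper:
  assumes "Lper u" "cper v"
  shows "(\<integral>x. dq e u x * v x) = - (\<integral>x. u x * dq e v x)"
  using assms cper_mult_integrable[OF assms] cper_Lper[OF assms(2)] by (intro dq_adjoint) (auto simp: Lper_def)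

lemma avg_adjoint_cper:
  assumes "Lper u" "cper v"
  shows "(\<integral>x. avg e u x * v x) = (\<integral>x. u x * avg e v x)"
proof -
  obtain B where B: "\<And>x. \<bar>v x\<bar> \<le> B" using cper_bounded[OF assms(2)] by blast
  show ?thesis using assms cper_Lper[OF assms(2)] B by (intro avg_adjoint_bounded) (auto simp: Lper_def)
qed

section \<open>Convergence of box averages in L_p\<close>

lemma nn_integral_avg_le:
  assumes [measurable]: "f \<in> borel_measurable borel" and e: "0 < e" "e \<le> 1"
  shows "(\<integral>\<^sup>+x. \<integral>\<^sup>+y. f (x + y) \<partial>Iv (- e) e \<partial>circ) \<le> ennreal (2 * e) * (\<integral>\<^sup>+x. f x \<partial>Iv (- 1) (2 * pi + 1))"
proof -
  interpret pair_sigma_finite circ "Iv (- e) e" by (rule circ_pair_sigma_finite)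
  have "(\<integral>\<^sup>+x. \<integral>\<^sup>+y. f (x + y) \<partial>Iv (- e) e \<partial>circ) = (\<integral>\<^sup>+y. \<integral>\<^sup>+x. f (x + y) \<partial>circ \<partial>Iv (- e) e)"
    by (subst Fubini[of "\<lambda>(x, y). f (x + y)", simplified, symmetric]) auto
  also have "\<dots> = (\<integral>\<^sup>+y. \<integral>\<^sup>+x. f x \<partial>Iv y (2 * pi + y) \<partial>Iv (- e) e)"
    by (subst nn_integral_Iv_shift) auto
  also have "\<dots> \<le> (\<integral>\<^sup>+y. (\<integral>\<^sup>+x. f x \<partial>Iv (- 1) (2 * pi + 1)) \<partial>Iv (- e) e)"
  proof (rule nn_integral_mono)
    fix y assume "y \<in> space (Iv (- e) e)"
    hence "-1 \<le> y" "y \<le> 1" using e by auto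
    thus "(\<integral>\<^sup>+x. f x \<partial>Iv y (2 * pi + y)) \<le> (\<integral>\<^sup>+x. f x \<partial>Iv (- 1) (2 * pi + 1))"
      unfolding nn_integral_Iv by (intro nn_integral_mono mult_left_mono) (auto simp: indicator_def)
  qed
  also have "\<dots> = ennreal (2 * e) * (\<integral>\<^sup>+x. f x \<partial>Iv (- 1) (2 * pi + 1))"
    by (simp add: emeasure_Iv mult.commute)
  finally show ?thesis .
qed

text \<open>A measurable function is almost everywhere a limit of continuous ones; cutting these off
  at level \<open>k\<close> provides a dominating function. The approximant is continuous on the
  whole line but need not be periodic.\<close>

lemma continuous_approx_Lp:
  assumes u: "u \<in> borel_measurable borel" and i: "integrable (Iv a b) (\<lambda>x. \<bar>u x\<bar> powr p)" and p: "p > 0" and \<delta>: "\<delta> > 0"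
  obtains g where "continuous_on UNIV g" "Lpf (Iv a b) p (\<lambda>x. u x - g x)" "Ip (Iv a b) p (\<lambda>x. u x - g x) < \<delta>"
proof -
  note [measurable] = u
  define cl where "cl = (\<lambda>k::nat. \<lambda>x::real. max (- real k) (min (real k) x))"
  have cl: "\<bar>cl k x\<bar> \<le> real k" "\<bar>x - cl k x\<bar> \<le> \<bar>x\<bar>" "real k \<ge> \<bar>x\<bar> \<Longrightarrow> cl k x = x" for k x by (auto simp: cl_def)
  have ccl: "continuous_on UNIV (cl k)" for k unfolding cl_def by (intro continuous_intros)
  have [measurable]: "cl k \<in> borel_measurable borel" for k using ccl by (rule borel_measurable_continuous_onI)
  have "(\<lambda>k. Ip (Iv a b) p (\<lambda>x. u x - cl k (u x))) \<longlonglongrightarrow> (LINT x|Iv a b. 0)"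
  proof (rule integral_dominated_convergence[OF _ _ i])
    show "AE x in Iv a b. (\<lambda>k. \<bar>u x - cl k (u x)\<bar> powr p) \<longlonglongrightarrow> 0"
    proof (rule AE_I2)
      fix x
      obtain K :: nat where "\<bar>u x\<bar> \<le> real K" using real_arch_simple by blast
      hence "\<forall>\<^sub>F k in sequentially. \<bar>u x - cl k (u x)\<bar> powr p = 0"
        by (intro eventually_sequentiallyI[of K]) (simp add: cl(3))
      thus "(\<lambda>k. \<bar>u x - cl k (u x)\<bar> powr p) \<longlonglongrightarrow> 0" by (rule tendsto_eventually)
    qed
    show "AE x in Iv a b. norm (\<bar>u x - cl k (u x)\<bar> powr p) \<le> \<bar>u x\<bar> powr p" for k
      using cl p by (intro AE_I2) (auto intro!: powr_mono2)
  qed auto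
  from order_tendstoD(2)[OF this, of \<delta>] \<delta> obtain k where k: "Ip (Iv a b) p (\<lambda>x. u x - cl k (u x)) < \<delta>"
    by (auto simp: eventually_sequentially)
  have "(\<lambda>x. u x) measurable_on UNIV" using u by (intro lebesgue_measurable_imp_measurable_on) (auto intro: measurable_completion)
  then obtain N g where N: "negligible N" and g: "\<And>n. continuous_on UNIV (g n)" and gl: "\<And>x. x \<notin> N \<Longrightarrow> (\<lambda>n. g n x) \<longlonglongrightarrow> u x"
    unfolding measurable_on_def by auto
  let ?f = "\<lambda>n x. u x - cl k (g n x)" and ?B = "\<lambda>x. 2 powr p * (\<bar>u x\<bar> powr p + real k powr p)"
  have c: "continuous_on UNIV (\<lambda>x. cl k (g n x))" for n using continuous_on_compose2[OF ccl g] by simp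
  have [measurable]: "g n \<in> borel_measurable borel" for n using g by (rule borel_measurable_continuous_onI)
  have iB: "integrable (Iv a b) ?B" using i by simp
  have le: "\<bar>?f n x\<bar> powr p \<le> ?B x" for n x
  proof -
    have "\<bar>- cl k (g n x)\<bar> powr p \<le> real k powr p" using cl(1) p by (intro powr_mono2) auto
    thus ?thesis using order_trans[OF abs_powr_add_le[OF p, of "u x" "- cl k (g n x)"]] by simp
  qed
  have "(\<lambda>n. Ip (Iv a b) p (?f n)) \<longlonglongrightarrow> Ip (Iv a b) p (\<lambda>x. u x - cl k (u x))"
  proof (rule integral_dominated_convergence[OF _ _ iB])
    have "AE x in lebesgue. x \<notin> N" using N by (simp add: AE_not_in negligible_iff_null_sets)
    hence "AE x in lborel. x \<notin> N" by (simp add: AE_completion_iff)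
    hence "AE x in Iv a b. x \<notin> N" unfolding Iv_def by (subst AE_restrict_space_iff) auto
    thus "AE x in Iv a b. (\<lambda>n. \<bar>?f n x\<bar> powr p) \<longlonglongrightarrow> \<bar>u x - cl k (u x)\<bar> powr p"
    proof eventually_elim
      case (elim x)
      have "(\<lambda>n. cl k (g n x)) \<longlonglongrightarrow> cl k (u x)"
        using ccl[of k] gl[OF elim] by (auto simp: continuous_on_eq_continuous_at intro: isCont_tendsto_compose)
      thus ?case using p by (intro tendsto_powr' tendsto_intros) auto
    qed
  qed (use le in auto)
  from order_tendstoD(2)[OF this k] obtain n where n: "Ip (Iv a b) p (?f n) < \<delta>"
    by (auto simp: eventually_sequentially)
  show ?thesis by (rule that[OF c _ n]) (use le in \<open>auto intro!: Lpf_dominated[OF iB]\<close>)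
qed

text \<open>A contraction estimate for functions that are not periodic, such as the errors of
  \<open>continuous_approx_Lp\<close>. Averages of width at most 1 see only the enlarged
  interval.\<close>

lemma Ip_avg_le_local:
  assumes f: "f \<in> borel_measurable borel" and l: "locint f" "locint (\<lambda>x. \<bar>f x\<bar> powr p)" and p: "p \<ge> 1" and e: "0 < e" "e \<le> 1"
  shows "Ip circ p (avg e f) \<le> Ip (Iv (- 1) (2 * pi + 1)) p f"
proof -
  note [measurable] = f
  have "(\<integral>\<^sup>+x. ennreal (\<bar>avg e f x\<bar> powr p) \<partial>circ) \<le> (\<integral>\<^sup>+x. ennreal (1 / (2 * e)) * (\<integral>\<^sup>+y. ennreal (\<bar>f (x + y)\<bar> powr p) \<partial>Iv (- e) e) \<partial>circ)"
  proof (rule nn_integral_mono)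
    fix x
    have "ennreal (\<bar>avg e f x\<bar> powr p) \<le> ennreal (avg e (\<lambda>x. \<bar>f x\<bar> powr p) x)"
      using Jensen_avg[OF l p e(1)] by (rule ennreal_leI)
    also have "\<dots> = ennreal (1 / (2 * e)) * ennreal (LINT y|Iv (- e) e. \<bar>f (x + y)\<bar> powr p)"
      using e by (simp add: avg_def ennreal_mult'[symmetric])
    also have "ennreal (LINT y|Iv (- e) e. \<bar>f (x + y)\<bar> powr p) = (\<integral>\<^sup>+y. ennreal (\<bar>f (x + y)\<bar> powr p) \<partial>Iv (- e) e)"
      using avg_integrable[OF l(2)] by (intro nn_integral_eq_integral[symmetric]) auto
    finally show "ennreal (\<bar>avg e f x\<bar> powr p) \<le> ennreal (1 / (2 * e)) * (\<integral>\<^sup>+y. ennreal (\<bar>f (x + y)\<bar> powr p) \<partial>Iv (- e) e)" .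
  qed
  also have "\<dots> = ennreal (1 / (2 * e)) * (\<integral>\<^sup>+x. \<integral>\<^sup>+y. ennreal (\<bar>f (x + y)\<bar> powr p) \<partial>Iv (- e) e \<partial>circ)"
  proof (intro nn_integral_cmult sigma_finite_measure.borel_measurable_nn_integral)
    show "sigma_finite_measure (Iv (- e) e)" by (simp add: finite_measure_Iv finite_measure.axioms(1))
    show "(\<lambda>(x, y). ennreal (\<bar>f (x + y)\<bar> powr p)) \<in> borel_measurable (circ \<Otimes>\<^sub>M Iv (- e) e)" by measurable
  qed
  also have "\<dots> \<le> ennreal (1 / (2 * e)) * (ennreal (2 * e) * (\<integral>\<^sup>+x. ennreal (\<bar>f x\<bar> powr p) \<partial>Iv (- 1) (2 * pi + 1)))"
    using nn_integral_avg_le[of "\<lambda>x. ennreal (\<bar>f x\<bar> powr p)" e] e by (intro mult_left_mono) auto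
  also have "\<dots> = (\<integral>\<^sup>+x. ennreal (\<bar>f x\<bar> powr p) \<partial>Iv (- 1) (2 * pi + 1))"
    using e by (simp add: mult.assoc[symmetric] ennreal_mult'[symmetric])
  also have "\<dots> = ennreal (Ip (Iv (- 1) (2 * pi + 1)) p f)"
    using l by (intro nn_integral_eq_integral) (auto simp: locint_def)
  finally have le: "(\<integral>\<^sup>+x. ennreal (\<bar>avg e f x\<bar> powr p) \<partial>circ) \<le> ennreal (Ip (Iv (- 1) (2 * pi + 1)) p f)" .
  show ?thesis
  proof (cases "integrable circ (\<lambda>x. \<bar>avg e f x\<bar> powr p)")
    case True
    hence "(\<integral>\<^sup>+x. ennreal (\<bar>avg e f x\<bar> powr p) \<partial>circ) = ennreal (Ip circ p (avg e f))"
      by (intro nn_integral_eq_integral) auto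
    with le show ?thesis by (simp add: Ip_nonneg)
  next
    case False
    thus ?thesis by (simp add: not_integrable_integral_eq Ip_nonneg)
  qed
qed

text \<open>Density: on a continuous \<open>g m\<close> the averages converge uniformly, and the
  error \<open>u - g m\<close> stays small under averaging by
  \<open>Ip_avg_le_local\<close>.\<close>

lemma Lp_conv_avg:
  assumes u: "Lpc p u" and p: "p \<ge> 1" and e: "\<And>n. e n > 0" "e \<longlonglongrightarrow> 0"
  shows "Lp_conv circ p (\<lambda>n. avg (e n) u) u"
proof -
  have p0: "p > 0" using p by simp
  define K where "K = (2::real) powr p"
  have K: "K \<ge> 0" by (simp add: K_def)
  have [measurable]: "u \<in> borel_measurable borel" using u by (rule Lpc_measurable)
  have lu: "locint u" "locint (\<lambda>x. \<bar>u x\<bar> powr p)" using u p by (auto intro: Lper_locint Lpc_Lper Lper_powr)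
  let ?J = "Iv (- 1) (2 * pi + 1)" and ?s = "\<lambda>m. 1 / real (Suc m)"
  have "\<exists>g. continuous_on UNIV g \<and> Ip ?J p (\<lambda>x. u x - g x) < ?s m" for m
    by (rule continuous_approx_Lp[of u "- 1" "2 * pi + 1" p "?s m"]) (use lu p0 in \<open>auto simp: locint_def\<close>)
  then obtain g where g: "\<And>m. continuous_on UNIV (g m)" "\<And>m. Ip ?J p (\<lambda>x. u x - g m x) < ?s m" by metis
  have [measurable]: "g m \<in> borel_measurable borel" for m using g(1) by (rule borel_measurable_continuous_onI)
  have lg: "locint (g m)" for m using g(1) by (rule continuous_locint)
  let ?f = "\<lambda>m x. u x - g m x"
  have lf: "locint (?f m)" for m using lu lg by (intro locint_diff)
  have cL: "Lpf (Iv a b) p w" if "continuous_on UNIV w" for w a b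
    using continuous_locint[OF continuous_on_abs_powr[OF p0 that]] borel_measurable_continuous_onI[OF that]
    by (intro LpfI measurable_Iv) (auto simp: locint_def)
  have fL: "Lpf (Iv a b) p (?f m)" for m a b using lu by (intro Lpf_diff p0 LpfI cL g) (auto simp: locint_def)
  hence lfp: "locint (\<lambda>x. \<bar>?f m x\<bar> powr p)" for m by (simp add: locint_def Lpf_def)
  have fcle: "Ip circ p (?f m) \<le> ?s m" for m
  proof -
    have "Ip circ p (?f m) \<le> Ip ?J p (?f m)"
      using Lpf_integrable[OF fL[of 0 "2 * pi" m]] Lpf_integrable[OF fL[of "- 1" "2 * pi + 1" m]]
      unfolding integral_Iv integrable_Iv by (intro integral_mono) (auto simp: indicator_def)
    thus ?thesis using g(2)[of m] by linarith
  qed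
  let ?W = "\<lambda>m n. Ip circ p (\<lambda>x. avg (e n) (g m) x - g m x)"
  have ca: "continuous_on UNIV (avg (e n) w)" if "locint w" for n w using that e(1) by (rule avg_continuous)
  have W: "?W m \<longlonglongrightarrow> 0" for m
  proof (rule Lp_conv_uniform[OF finite_measure_Iv p0])
    fix \<epsilon> :: real assume \<epsilon>: "\<epsilon> > 0"
    have "uniformly_continuous_on {- 1..2 * pi + 1} (g m)"
      using g(1) by (intro compact_uniformly_continuous) (auto intro: continuous_on_subset)
    then obtain d where d: "d > 0" "\<And>x y. x \<in> {- 1..2 * pi + 1} \<Longrightarrow> y \<in> {- 1..2 * pi + 1} \<Longrightarrow> \<bar>y - x\<bar> < d \<Longrightarrow> \<bar>g m y - g m x\<bar> < \<epsilon>"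
      unfolding uniformly_continuous_on_def using \<epsilon> by (auto simp: dist_real_def)
    have "eventually (\<lambda>n. e n < min 1 d) sequentially" using e(2) d(1) by (intro order_tendstoD(2)) auto
    thus "eventually (\<lambda>n. \<forall>x\<in>space circ. \<bar>avg (e n) (g m) x - g m x\<bar> \<le> \<epsilon>) sequentially"
    proof eventually_elim
      case (elim n)
      have "\<bar>g m y - g m x\<bar> < \<epsilon>" if "x \<in> {0..2 * pi}" "\<bar>y - x\<bar> \<le> e n" for x y
        using that elim by (intro d(2)) (auto simp: abs_le_iff)
      thus ?case by (intro ballI avg_near[OF lg e(1)]) (auto intro: less_imp_le)
    qed
  qed (use ca[OF lg] in \<open>auto intro: measurable_Iv borel_measurable_continuous_onI\<close>)
  let ?D = "\<lambda>n. Ip circ p (\<lambda>x. avg (e n) u x - u x)"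
  \<comment> \<open>The contraction estimate requires width at most 1. For the finitely many larger
    widths the bound is the quantity itself, which does not affect the limit.\<close>
  define U where "U = (\<lambda>m n. if e n \<le> 1 then K * (?s m + K * (?W m n + ?s m)) else ?D n)"
  have "?D n \<le> U m n" for m n
  proof (cases "e n \<le> 1")
    case True
    have eq: "avg (e n) u x - u x = avg (e n) (?f m) x + ((avg (e n) (g m) x - g m x) + - ?f m x)" for x
      using avg_diff[OF lu(1) lg[of m], of "e n" x] by simp
    have La: "Lpf circ p (avg (e n) (?f m))" "Lpf circ p (\<lambda>x. avg (e n) (g m) x - g m x)"
      by (intro cL ca lf lg g continuous_on_diff)+
    note Lf = Lpf_minus[OF fL[of 0 "2 * pi" m]]
    have "?D n \<le> K * (Ip circ p (avg (e n) (?f m)) + Ip circ p (\<lambda>x. (avg (e n) (g m) x - g m x) + - ?f m x))"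
      unfolding eq K_def by (rule Ip_add_le[OF p0 La(1) Lpf_add[OF p0 La(2) Lf]])
    also have "\<dots> \<le> K * (Ip circ p (avg (e n) (?f m)) + K * (?W m n + Ip circ p (?f m)))"
      using Ip_add_le[OF p0 La(2) Lf, folded K_def] K by (intro mult_left_mono add_left_mono) (simp_all del: minus_diff_eq)
    also have "\<dots> \<le> K * (?s m + K * (?W m n + ?s m))"
      using K fcle[of m] Ip_avg_le_local[of "?f m" p "e n"] lf lfp p e(1) True g(2)[of m] by (intro mult_left_mono add_mono) auto
    finally show ?thesis using True by (simp add: U_def)
  qed (simp add: U_def)
  moreover have "U m \<longlonglongrightarrow> K * (?s m + K * (0 + ?s m))" for m
  proof (rule Lim_transform_eventually)
    show "(\<lambda>n. K * (?s m + K * (?W m n + ?s m))) \<longlonglongrightarrow> K * (?s m + K * (0 + ?s m))" by (intro tendsto_intros W)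
    have "eventually (\<lambda>n. e n < 1) sequentially" using e(2) by (rule order_tendstoD) simp
    thus "eventually (\<lambda>n. K * (?s m + K * (?W m n + ?s m)) = U m n) sequentially" by eventually_elim (simp add: U_def)
  qed
  moreover have "(\<lambda>m. K * (?s m + K * (0 + ?s m))) \<longlonglongrightarrow> 0"
  proof -
    have "?s \<longlonglongrightarrow> 0" using LIMSEQ_inverse_real_of_nat by (simp add: inverse_eq_divide)
    hence "(\<lambda>m. K * (?s m + K * (0 + ?s m))) \<longlonglongrightarrow> K * (0 + K * (0 + 0))" by (intro tendsto_intros)
    thus ?thesis by simp
  qed
  ultimately show ?thesis by (rule tendsto_zero_diagonal[rotated]) (rule Ip_nonneg)
qed

lemma Lp_conv_avg_of:
  assumes f: "\<And>n. Lpc p (f n)" and u: "Lpc p u" and fu: "Lp_conv circ p f u" and p: "p \<ge> 1" and e: "\<And>n. e n > 0" "e \<longlonglongrightarrow> 0"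
  shows "Lp_conv circ p (\<lambda>n. avg (e n) (f n)) u"
proof -
  have p0: "p > 0" using p by simp
  have "(\<lambda>n. Ip circ p (\<lambda>x. avg (e n) (f n) x - avg (e n) u x)) \<longlonglongrightarrow> 0"
  proof (rule tendsto_sandwich[OF _ _ tendsto_const fu])
    have l: "locint (f n)" "locint u" for n using f u p by (auto intro: Lper_locint Lpc_Lper)
    have "Ip circ p (\<lambda>x. avg (e n) (f n) x - avg (e n) u x) \<le> Ip circ p (\<lambda>x. f n x - u x)" for n
      using Lpc_avg(2)[OF Lpc_diff[OF p0 f u] p e(1)[of n]] avg_diff[OF l] by simp
    thus "\<forall>\<^sub>F n in sequentially. Ip circ p (\<lambda>x. avg (e n) (f n) x - avg (e n) u x) \<le> Ip circ p (\<lambda>x. f n x - u x)" by simp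
  qed (simp add: Ip_nonneg)
  thus ?thesis using f u p e by (intro Lp_conv_perturb[OF p0 _ _ _ _ Lp_conv_avg[OF u p e]] Lpc_Lpf Lpc_avg(1))
qed

text \<open>Three averages, one for each derivative that occurs in \<open>z\<close>: every
  derivative of \<open>avg3 e u\<close> up to order three is a bounded operator on continuous
  functions.\<close>

definition avg3 :: "real \<Rightarrow> (real \<Rightarrow> real) \<Rightarrow> real \<Rightarrow> real" where
  "avg3 e u = avg e (avg e (avg e u))"

lemma Lpc_avg3:
  assumes u: "Lpc p u" and p: "p \<ge> 1" and e: "e > 0"
  shows "Lpc p (avg3 e u)" "Ip circ p (avg3 e u) \<le> Ip circ p u"
proof -
  note 1 = Lpc_avg[OF u p e]
  note 2 = Lpc_avg[OF 1(1) p e]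
  note 3 = Lpc_avg[OF 2(1) p e]
  show "Lpc p (avg3 e u)" "Ip circ p (avg3 e u) \<le> Ip circ p u" using 1 2 3 by (auto simp: avg3_def)
qed

lemma Lp_conv_avg3:
  assumes u: "Lpc p u" and p: "p \<ge> 1" and e: "\<And>n. e n > 0" "e \<longlonglongrightarrow> 0"
  shows "Lp_conv circ p (\<lambda>n. avg3 (e n) u) u"
  unfolding avg3_def
  by (intro Lp_conv_avg_of[OF _ u _ p e] Lp_conv_avg[OF u p e] Lpc_avg u p e)

lemma cper_uniform:
  assumes "cper u" "\<epsilon> > 0"
  obtains d where "d > 0" "\<And>x y. \<bar>y - x\<bar> \<le> d \<Longrightarrow> \<bar>u y - u x\<bar> \<le> \<epsilon>"
proof -
  have "uniformly_continuous_on {- 1..2 * pi + 1} u"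
    using assms(1) by (intro compact_uniformly_continuous) (auto intro: continuous_on_subset)
  then obtain d where d: "d > 0" "\<And>x y. x \<in> {- 1..2 * pi + 1} \<Longrightarrow> y \<in> {- 1..2 * pi + 1} \<Longrightarrow> \<bar>y - x\<bar> < d \<Longrightarrow> \<bar>u y - u x\<bar> < \<epsilon>"
    unfolding uniformly_continuous_on_def using assms(2) by (auto simp: dist_real_def)
  show ?thesis
  proof (rule that)
    show "min (d / 2) 1 > 0" using d by simp
    fix x y :: real assume xy: "\<bar>y - x\<bar> \<le> min (d / 2) 1"
    define k where "k = - \<lfloor>x / (2 * pi)\<rfloor>"
    have "\<bar>u (y + 2 * pi * of_int k) - u (x + 2 * pi * of_int k)\<bar> < \<epsilon>"
      using period_shift[of x, folded k_def] xy d(1) by (intro d(2)) (auto simp: abs_le_iff min_def split: if_splits)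
    thus "\<bar>u y - u x\<bar> \<le> \<epsilon>"
      using assms(1) periodic_of_int[of u x k] periodic_of_int[of u y k] by (simp add: periodic_def)
  qed
qed

lemma avg_uniform:
  assumes "cper u" "\<epsilon> > 0"
  obtains d where "d > 0" "\<And>e x. 0 < e \<Longrightarrow> e \<le> d \<Longrightarrow> \<bar>avg e u x - u x\<bar> \<le> \<epsilon>"
proof -
  obtain d where "d > 0" "\<And>x y. \<bar>y - x\<bar> \<le> d \<Longrightarrow> \<bar>u y - u x\<bar> \<le> \<epsilon>" using cper_uniform[OF assms] by blast
  thus ?thesis using avg_near[OF cper_locint[OF assms(1)]] by (intro that[of d]) auto
qed

section \<open>Smooth periodic test functions and the fundamental lemma\<close>

lemma smooth_deriv: "smooth \<phi> \<Longrightarrow> smooth (deriv \<phi>)"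
  unfolding smooth_def by (metis comp_apply funpow_Suc_right)

lemma smooth_DERIV: "smooth \<phi> \<Longrightarrow> (\<phi> has_real_derivative deriv \<phi> x) (at x)"
  unfolding smooth_def using DERIV_deriv_iff_real_differentiable by (metis funpow_0)

lemma smooth_continuous: "smooth \<phi> \<Longrightarrow> continuous_on UNIV \<phi>"
  using smooth_DERIV DERIV_isCont by (metis continuous_at_imp_continuous_on)

lemma deriv_periodic:
  assumes "\<And>x. (\<phi> has_real_derivative \<phi>' x) (at x)" "periodic \<phi>"
  shows "periodic \<phi>'"
  unfolding periodic_def
proof
  fix x
  have "((\<lambda>x. \<phi> (x + 2 * pi)) has_real_derivative \<phi>' (x + 2 * pi)) (at x)"
    using assms(1)[of "x + 2 * pi"] by (simp add: DERIV_shift)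
  hence "(\<phi> has_real_derivative \<phi>' (x + 2 * pi)) (at x)" using assms(2) by (simp add: periodic_def)
  thus "\<phi>' (x + 2 * pi) = \<phi>' x" using assms(1) DERIV_unique by blast
qed

lemma smooth_deriv_periodic: "smooth \<phi> \<Longrightarrow> periodic \<phi> \<Longrightarrow> periodic (deriv \<phi>)"
  by (rule deriv_periodic[OF smooth_DERIV])

lemma deriv_avg:
  assumes "smooth \<phi>" "e > 0" shows "deriv (avg e \<phi>) = avg e (deriv \<phi>)"
proof
  fix x
  have "prim (deriv \<phi>) \<phi>" using smooth_DERIV[OF assms(1)] smooth_continuous[OF smooth_deriv[OF assms(1)]] by (rule deriv_prim)
  hence "avg e (deriv \<phi>) x = dq e \<phi> x" using assms by (intro prim_avg)
  moreover have "(avg e \<phi> has_real_derivative dq e \<phi> x) (at x)" using avg_deriv[OF smooth_continuous[OF assms(1)] assms(2)] .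
  ultimately show "deriv (avg e \<phi>) x = avg e (deriv \<phi>) x" by (simp add: DERIV_imp_deriv)
qed

lemma smooth_funpow: "smooth \<phi> \<Longrightarrow> smooth ((deriv ^^ n) \<phi>)"
  by (induction n) (auto intro: smooth_deriv)

lemma smooth_avg:
  assumes "smooth \<phi>" "e > 0" shows "smooth (avg e \<phi>)"
proof -
  have eq: "(deriv ^^ n) (avg e \<phi>) = avg e ((deriv ^^ n) \<phi>)" for n
    by (induction n) (auto simp: deriv_avg[OF smooth_funpow[OF assms(1)] assms(2)])
  show ?thesis unfolding smooth_def eq
    using avg_deriv[OF smooth_continuous[OF smooth_funpow[OF assms(1)]] assms(2)] real_differentiable_def by blast
qed

text \<open>Trigonometric polynomials centred at \<open>a\<close>. In this form, an even part and
  sine times an even part, they are closed under differentiation, which gives smoothness in the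
  sense of iterated \<open>deriv\<close>.\<close>

definition trigf :: "real \<Rightarrow> real poly \<Rightarrow> real poly \<Rightarrow> real \<Rightarrow> real" where
  "trigf a P R x = poly P (cos (x - a)) + sin (x - a) * poly R (cos (x - a))"

lemma trigf_DERIV:
  "(trigf a P R has_real_derivative trigf a ([:0, 1:] * R - [:1, 0, - 1:] * pderiv R) (- pderiv P) x) (at x)"
proof -
  have s: "sin (x - a) * (y * sin (x - a)) = y - cos (x - a) * (cos (x - a) * y)" for y
    using sin_squared_eq[of "x - a"] by algebra
  have "(trigf a P R has_real_derivative
     poly (pderiv P) (cos (x - a)) * (- sin (x - a)) + (cos (x - a) * poly R (cos (x - a)) + sin (x - a) * (poly (pderiv R) (cos (x - a)) * (- sin (x - a))))) (at x)"
    unfolding trigf_def by (rule derivative_eq_intros DERIV_chain2[OF poly_DERIV] refl | simp)+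
  also have "poly (pderiv P) (cos (x - a)) * (- sin (x - a)) + (cos (x - a) * poly R (cos (x - a)) + sin (x - a) * (poly (pderiv R) (cos (x - a)) * (- sin (x - a))))
    = trigf a ([:0, 1:] * R - [:1, 0, - 1:] * pderiv R) (- pderiv P) x"
    using s[of "poly (pderiv R) (cos (x - a))"] by (simp add: trigf_def algebra_simps)
  finally show ?thesis .
qed

lemma smooth_trigf: "smooth (trigf a P R)"
proof -
  have "\<exists>P' R'. (deriv ^^ n) (trigf a P R) = trigf a P' R'" for n
  proof (induction n)
    case (Suc n)
    then obtain P' R' where "(deriv ^^ n) (trigf a P R) = trigf a P' R'" by blast
    thus ?case using DERIV_imp_deriv[OF trigf_DERIV] by (simp, metis ext)
  qed auto
  thus ?thesis unfolding smooth_def using trigf_DERIV real_differentiable_def by metis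
qed

lemma periodic_trigf: "periodic (trigf a P R)"
proof -
  have "cos (x + 2 * pi - a) = cos (x - a)" "sin (x + 2 * pi - a) = sin (x - a)" for x
    using cos_periodic[of "x - a"] sin_periodic[of "x - a"] by (simp_all add: algebra_simps)
  thus ?thesis by (simp add: periodic_def trigf_def)
qed

text \<open>If \<open>V\<close> is positive at \<open>a\<close>, powers of
  \<open>1 + cos (x - a) - cos \<delta>\<close> concentrate there: the base is at most 1 in absolute
  value outside the \<delta>-neighbourhood, nonnegative inside, and at least \<open>r > 1\<close> on
  the half-size neighbourhood. The integral would grow like \<open>r ^ n\<close> instead of
  vanishing.\<close>

lemma continuous_test_pos:
  assumes V: "cper V" and test: "\<And>\<phi>. smooth \<phi> \<Longrightarrow> periodic \<phi> \<Longrightarrow> (\<integral>x. V x * \<phi> x) = 0"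
  shows "V a \<le> 0"
proof (rule ccontr)
  assume "\<not> V a \<le> 0"
  define m where "m = V a / 2"
  have m: "m > 0" using \<open>\<not> V a \<le> 0\<close> by (simp add: m_def)
  obtain d where d: "d > 0" "\<And>x y. \<bar>y - x\<bar> \<le> d \<Longrightarrow> \<bar>V y - V x\<bar> \<le> m" using cper_uniform[OF V m] by blast
  define \<delta> where "\<delta> = min d 1"
  have \<delta>: "0 < \<delta>" "\<delta> \<le> 1" "\<delta> < pi" using d(1) pi_gt3 by (auto simp: \<delta>_def)
  have Vm: "V x \<ge> m" if "\<bar>x - a\<bar> \<le> \<delta>" for x
  proof -
    have "\<bar>V a - V x\<bar> \<le> m" using d(2)[where x = x and y = a] that by (simp add: \<delta>_def abs_minus_commute)
    thus ?thesis unfolding m_def by linarith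
  qed
  obtain B where B: "B \<ge> 0" "\<And>x. \<bar>V x\<bar> \<le> B" using cper_bounded[OF V] by blast
  define r where "r = 1 + cos (\<delta> / 2) - cos \<delta>"
  have r: "r > 1" using cos_monotone_0_pi[of "\<delta>/2" \<delta>] \<delta> by (simp add: r_def)
  define \<phi> where "\<phi> = (\<lambda>n x. (1 + cos (x - a) - cos \<delta>) ^ n)"
  have \<phi>: "\<phi> n = trigf a ([:1 - cos \<delta>, 1:] ^ n) 0" for n
    by (auto simp: \<phi>_def trigf_def fun_eq_iff algebra_simps)
  have lower: "V x * \<phi> n x \<ge> indicator {a - \<delta>/2..a + \<delta>/2} x * (m * r ^ n) - B" if "\<bar>x - a\<bar> \<le> pi" for x n
  proof -
    have ce: "cos (x - a) = cos \<bar>x - a\<bar>" by (simp add: abs_if cos_minus[of "a - x", symmetric])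
    consider "\<bar>x - a\<bar> \<le> \<delta> / 2" | "\<delta> / 2 < \<bar>x - a\<bar>" "\<bar>x - a\<bar> \<le> \<delta>" | "\<bar>x - a\<bar> > \<delta>" by linarith
    thus ?thesis
    proof cases
      case 1
      have "cos (\<delta>/2) \<le> cos (x - a)" unfolding ce using 1 \<delta> by (intro cos_monotone_0_pi_le) auto
      hence "r ^ n \<le> \<phi> n x" unfolding \<phi>_def r_def using r[unfolded r_def] by (intro power_mono) auto
      hence "m * r ^ n \<le> V x * \<phi> n x" using Vm[of x] 1 m r \<delta> by (intro mult_mono) auto
      moreover have "indicator {a - \<delta>/2..a + \<delta>/2} x = (1::real)"
      proof -
        have "a - \<delta>/2 \<le> x \<and> x \<le> a + \<delta>/2" using 1 by linarith
        thus ?thesis by simp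
      qed
      ultimately show ?thesis using B by simp
    next
      case 2
      have "cos \<delta> \<le> cos (x - a)" unfolding ce using 2 \<delta> by (intro cos_monotone_0_pi_le) auto
      hence "\<phi> n x \<ge> 0" by (simp add: \<phi>_def)
      hence "V x * \<phi> n x \<ge> 0" using Vm[of x] 2 m by simp
      moreover have "indicator {a - \<delta>/2..a + \<delta>/2} x = (0::real)" using 2 by (auto simp: indicator_def abs_if split: if_splits)
      ultimately show ?thesis using B by simp
    next
      case 3
      have "cos (x - a) \<le> cos \<delta>" unfolding ce using 3 \<delta> that by (intro cos_monotone_0_pi_le) auto
      moreover have "cos \<delta> \<le> 1" "- 1 \<le> cos (x - a)" by auto
      moreover have "cos \<delta> \<ge> 0" using \<delta> pi_gt3 by (intro cos_ge_zero) auto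
      ultimately have "\<bar>1 + cos (x - a) - cos \<delta>\<bar> \<le> 1" by linarith
      hence "\<bar>\<phi> n x\<bar> \<le> 1" by (simp add: \<phi>_def power_abs power_le_one)
      hence "\<bar>V x * \<phi> n x\<bar> \<le> B * 1" unfolding abs_mult using B by (intro mult_mono) auto
      moreover have "indicator {a - \<delta>/2..a + \<delta>/2} x = (0::real)" using 3 \<delta> by (auto simp: indicator_def abs_if split: if_splits)
      ultimately show ?thesis by simp
    qed
  qed
  have V\<phi>: "cper (\<lambda>x. V x * \<phi> n x)" for n
    using V smooth_continuous[OF smooth_trigf] periodic_trigf by (auto simp: \<phi> periodic_def intro!: continuous_intros)
  have "m * r ^ n * \<delta> \<le> B * (2 * pi)" for n
  proof -
    let ?J = "Iv (a - pi) (a - pi + 2 * pi)"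
    have i: "integrable ?J (\<lambda>x. V x * \<phi> n x)" "(LINT x|?J. V x * \<phi> n x) = 0"
      using integral_Iv_periodic[OF cper_Lper[OF V\<phi>], of "a - pi" n] test[of "\<phi> n"] smooth_trigf periodic_trigf
      by (auto simp: \<phi>)
    have ind: "integrable ?J (\<lambda>x. indicator {a - \<delta>/2..a + \<delta>/2} x * (m * r ^ n))"
      by (intro finite_measure.integrable_const_bound[OF finite_measure_Iv, of _ "m * r ^ n"]) (use m r in \<open>auto simp: indicator_def\<close>)
    have "(LINT x|?J. indicator {a - \<delta>/2..a + \<delta>/2} x * (m * r ^ n) - B) \<le> (LINT x|?J. V x * \<phi> n x)"
      using lower ind i by (intro integral_mono) (auto simp: abs_le_iff)
    hence "(LINT x|?J. indicator {a - \<delta>/2..a + \<delta>/2} x * (m * r ^ n)) \<le> (LINT x|?J. B)" using ind i by simp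
    also have "(LINT x|?J. B) = B * (2 * pi)" by (subst integral_Iv_const) auto
    also have "(LINT x|?J. indicator {a - \<delta>/2..a + \<delta>/2} x * (m * r ^ n)) = (LINT x|Iv (a - \<delta>/2) (a + \<delta>/2). m * r ^ n)"
      unfolding integral_Iv using \<delta> by (intro Bochner_Integration.integral_cong) (auto simp: indicator_def)
    also have "\<dots> = m * r ^ n * \<delta>" using \<delta> by (subst integral_Iv_const) auto
    finally show ?thesis .
  qed
  hence le: "r ^ n \<le> B * (2 * pi) / (m * \<delta>)" for n using m \<delta> by (simp add: field_simps)
  obtain n where "B * (2 * pi) / (m * \<delta>) < r ^ n" using real_arch_pow[OF r] by blast
  with le[of n] show False by simp
qed

lemma continuous_test_zero:
  assumes V: "cper V" and test: "\<And>\<phi>. smooth \<phi> \<Longrightarrow> periodic \<phi> \<Longrightarrow> (\<integral>x. V x * \<phi> x) = 0"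
  shows "V a = 0"
proof -
  have "- V a \<le> 0"
  proof (rule continuous_test_pos[of "\<lambda>x. - V x" a])
    show "cper (\<lambda>x. - V x)" using V by (auto simp: periodic_def intro: continuous_intros)
  qed (use test in simp)
  thus ?thesis using continuous_test_pos[OF assms, of a] by simp
qed

lemma Lper_test_avg_zero:
  assumes v: "Lper v" and test: "\<And>\<phi>. smooth \<phi> \<Longrightarrow> periodic \<phi> \<Longrightarrow> (\<integral>x. v x * \<phi> x) = 0" and e: "e > 0"
  shows "avg e v x = 0"
proof (rule continuous_test_zero[OF cper_avg[OF v e]])
  fix \<phi> assume \<phi>: "smooth \<phi>" "periodic \<phi>"
  hence "(\<integral>x. avg e v x * \<phi> x) = (\<integral>x. v x * avg e \<phi> x)"
    using smooth_continuous by (intro avg_adjoint_cper[OF v]) auto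
  also have "\<dots> = 0" using \<phi> e by (intro test smooth_avg avg_periodic)
  finally show "(\<integral>x. avg e v x * \<phi> x) = 0" .
qed

text \<open>The averages of \<open>v\<close> are continuous and inherit the vanishing tests, since
  averages of test functions are test functions. So they are identically zero, and they converge to
  \<open>v\<close> in L_1.\<close>

lemma Lper_test_zero:
  assumes v: "Lper v" and test: "\<And>\<phi>. smooth \<phi> \<Longrightarrow> periodic \<phi> \<Longrightarrow> (\<integral>x. v x * \<phi> x) = 0"
  shows "AE x in circ. v x = 0"
proof -
  have "Lp_conv circ 1 (\<lambda>n. avg (1 / real (Suc n)) v) v"
    by (rule Lp_conv_avg[OF Lper_Lpc[OF v]]) (use LIMSEQ_Suc[OF lim_1_over_n] in simp_all)
  hence "(\<lambda>n::nat. \<integral>x. \<bar>v x\<bar>) \<longlonglongrightarrow> 0"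
    using Lper_test_avg_zero[OF assms] by simp
  hence "(\<integral>x. \<bar>v x\<bar>) = 0" by (simp add: LIMSEQ_const_iff)
  thus ?thesis using v by (subst (asm) integral_nonneg_eq_0_iff_AE) (auto simp: Lper_def)
qed

section \<open>Weak derivatives\<close>

definition eqc :: "(real \<Rightarrow> real) \<Rightarrow> (real \<Rightarrow> real) \<Rightarrow> bool" where
  "eqc u v \<longleftrightarrow> (AE x in lebesgue. x \<in> {0..2 * pi} \<longrightarrow> u x = v x)"

lemma AE_lebesgue_iff_lborel: "(AE x in lebesgue. P x) \<longleftrightarrow> (AE x in lborel. P x)"
  by (simp add: AE_completion_iff)

lemma AE_Iv_iff: "(AE x in Iv a b. P x) \<longleftrightarrow> (AE x in lborel. x \<in> {a..b} \<longrightarrow> P x)"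
  unfolding Iv_def by (subst AE_restrict_space_iff) auto

lemma eqc_circ: "eqc u v \<longleftrightarrow> (AE x in circ. u x = v x)"
  by (simp add: eqc_def AE_Iv_iff AE_lebesgue_iff_lborel)

lemma eqc_sym: "eqc u v \<Longrightarrow> eqc v u"
  unfolding eqc_def by (auto elim: eventually_mono)

lemma eqc_trans: "eqc u v \<Longrightarrow> eqc v w \<Longrightarrow> eqc u w"
  unfolding eqc_def by (erule (1) eventually_elim2) auto

lemma eqc_refl: "eqc u u"
  by (simp add: eqc_def)

lemma borel_imp_lebesgue: "u \<in> borel_measurable borel \<Longrightarrow> u \<in> borel_measurable lebesgue"
  by (intro measurable_completion) simp

lemma AE_Iv_lebesgue_on: "AE x in Iv a b. P x \<Longrightarrow> S \<in> {{a<..<b}, {a..b}} \<Longrightarrow> AE x in lebesgue_on S. P x"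
  by (subst AE_restrict_space_iff) (auto simp: AE_Iv_iff AE_lebesgue_iff_lborel elim!: eventually_mono)

text \<open>The bridge to the completed Lebesgue measure of the definitions. \<open>f\<close> has to
  agree with the Borel function \<open>g\<close> only almost everywhere, so it may contain
  \<open>weak_deriv\<close>, a choice among Lebesgue measurable functions; \<open>S\<close> may be
  open or closed.\<close>

lemma lebesgue_on_Iv:
  fixes f g :: "real \<Rightarrow> real"
  assumes g: "g \<in> borel_measurable (Iv a b)" and eq: "AE x in Iv a b. f x = g x" and S: "S \<in> {{a<..<b}, {a..b}}"
  shows "integrable (lebesgue_on S) f \<longleftrightarrow> integrable (Iv a b) g" "(LINT x:S|lebesgue. f x) = (LINT x|Iv a b. g x)"
    "f \<in> borel_measurable (lebesgue_on S)" "set_integrable lebesgue S f \<longleftrightarrow> integrable (Iv a b) g"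
proof -
  let ?F = "\<lambda>x. indicator S x * f x" and ?G = "\<lambda>x. indicator {a..b} x * g x"
  have Sm: "S \<inter> space lebesgue \<in> sets lebesgue" using S by auto
  have G: "?G \<in> borel_measurable lborel"
    using g unfolding Iv_def by (subst (asm) borel_measurable_restrict_space_iff) auto
  have "AE x in lborel. x \<noteq> a" "AE x in lborel. x \<noteq> b" by (rule AE_lborel_singleton)+
  hence eq': "AE x in lebesgue. ?G x = ?F x"
    using eq unfolding AE_Iv_iff AE_lebesgue_iff_lborel by eventually_elim (use S in \<open>auto simp: indicator_def\<close>)
  have G': "?G \<in> borel_measurable lebesgue" using G by (rule measurable_completion)
  have F': "?F \<in> borel_measurable lebesgue" by (rule borel_measurable_AE[OF G' eq'])
  show "f \<in> borel_measurable (lebesgue_on S)"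
    using F' by (subst borel_measurable_restrict_space_iff[OF Sm]) simp
  have 1: "integrable (lebesgue_on S) f \<longleftrightarrow> integrable lebesgue ?F" by (subst integrable_restrict_space[OF Sm]) simp
  also have "\<dots> \<longleftrightarrow> integrable lebesgue ?G" using eq' by (intro integrable_cong_AE F' G') (auto elim: eventually_mono)
  finally show 2: "integrable (lebesgue_on S) f \<longleftrightarrow> integrable (Iv a b) g"
    using G by (simp add: integrable_completion integrable_Iv)
  show "set_integrable lebesgue S f \<longleftrightarrow> integrable (Iv a b) g" using 1 2 by (simp add: set_integrable_def)
  have "(LINT x:S|lebesgue. f x) = (LINT x|lebesgue. ?F x)" by (simp add: set_lebesgue_integral_def)
  also have "\<dots> = (LINT x|lebesgue. ?G x)" using eq' by (intro integral_cong_AE F' G') (auto elim: eventually_mono)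
  finally show "(LINT x:S|lebesgue. f x) = (LINT x|Iv a b. g x)"
    using G by (simp add: integral_completion integral_Iv)
qed

lemma set_integrable_eqc:
  assumes "v \<in> borel_measurable borel" "eqc u v"
  shows "set_integrable lebesgue {0..2 * pi} u \<longleftrightarrow> integrable circ v" "(LINT x:{0..2 * pi}|lebesgue. u x) = (\<integral>x. v x)"
  using lebesgue_on_Iv(2,4)[of v 0 "2 * pi" u "{0..2 * pi}"] assms by (simp_all add: eqc_circ)

lemma Lpc_Lp_circle: "Lpc p u \<Longrightarrow> u \<in> Lp_circle p"
  unfolding Lp_circle_def Lpc_def
  by (auto simp: set_integrable_eqc(1)[OF _ eqc_refl] borel_imp_lebesgue)

lemma Lp_circle_rep:
  assumes "v \<in> Lp_circle p"
  obtains v' where "Lpc p v'" "eqc v v'"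
proof -
  have v: "periodic v" "v \<in> borel_measurable lebesgue" "set_integrable lebesgue {0..2 * pi} (\<lambda>\<theta>. \<bar>v \<theta>\<bar> powr p)"
    using assms by (auto simp: Lp_circle_def)
  obtain v0 where v0: "v0 \<in> borel_measurable lborel" "AE x in lborel. v x = v0 x"
    using completion_ex_borel_measurable_real[OF v(2)] by blast
  have [measurable]: "v0 \<in> borel_measurable borel" using v0 by simp
  \<comment> \<open>A Borel version of \<open>v\<close> is read off on one half-open period and
    repeated. Agreement is lost at most on a null set, which includes the endpoint
    \<open>2 * pi\<close>.\<close>
  define v' where "v' = (\<lambda>x. v0 (x - 2 * pi * of_int \<lfloor>x / (2 * pi)\<rfloor>))"
  have [measurable]: "v' \<in> borel_measurable borel" unfolding v'_def by measurable
  have "\<lfloor>(x + 2 * pi) / (2 * pi)\<rfloor> = \<lfloor>x / (2 * pi)\<rfloor> + 1" for x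
    by (simp add: add_divide_distrib)
  hence per: "periodic v'" by (simp add: periodic_def v'_def algebra_simps)
  have "AE x in lborel. x \<noteq> 2 * pi" by (rule AE_lborel_singleton)
  hence "AE x in lborel. x \<in> {0..2 * pi} \<longrightarrow> v x = v' x"
    using v0(2)
  proof eventually_elim
    case (elim x)
    show ?case
    proof
      assume "x \<in> {0..2 * pi}"
      hence "0 \<le> x / (2 * pi)" "x / (2 * pi) < 1" using elim by auto
      hence "\<lfloor>x / (2 * pi)\<rfloor> = 0" by linarith
      thus "v x = v' x" using elim by (simp add: v'_def)
    qed
  qed
  hence e: "eqc v v'" by (simp add: eqc_def AE_lebesgue_iff_lborel)
  have "eqc (\<lambda>x. \<bar>v x\<bar> powr p) (\<lambda>x. \<bar>v' x\<bar> powr p)" using e unfolding eqc_def by (auto elim: eventually_mono)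
  hence "integrable circ (\<lambda>x. \<bar>v' x\<bar> powr p)"
    using v(2,3) by (subst set_integrable_eqc(1)[symmetric]) auto
  thus ?thesis using that[of v'] e per by (simp add: Lpc_def)
qed

lemma LINT_mult_eqc:
  assumes "u \<in> Lp_circle q" "Lpc p u'" "eqc u u'" "continuous_on UNIV w"
  shows "(LINT x:{0..2 * pi}|lebesgue. u x * w x) = (\<integral>x. u' x * w x)"
proof (rule set_integrable_eqc(2))
  have [measurable]: "w \<in> borel_measurable borel" using assms(4) by (rule borel_measurable_continuous_onI)
  show "(\<lambda>x. u' x * w x) \<in> borel_measurable borel" using assms(2) by (auto simp: Lpc_def)
  show "eqc (\<lambda>x. u x * w x) (\<lambda>x. u' x * w x)" using assms(3) unfolding eqc_def by (auto elim: eventually_mono)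
qed

definition wderiv :: "nat \<Rightarrow> (real \<Rightarrow> real) \<Rightarrow> (real \<Rightarrow> real) \<Rightarrow> bool" where
  "wderiv j u v \<longleftrightarrow> Lper u \<and> Lper v \<and> (\<forall>\<phi>. smooth \<phi> \<and> periodic \<phi> \<longrightarrow>
     (\<integral>x. u x * (deriv ^^ j) \<phi> x) = (- 1) ^ j * (\<integral>x. v x * \<phi> x))"

lemma has_weak_deriv_iff:
  assumes "u \<in> Lp_circle 1" "Lper u'" "eqc u u'" "v \<in> Lp_circle 1" "Lper v'" "eqc v v'"
  shows "has_weak_deriv j u v \<longleftrightarrow> wderiv j u' v'"
proof -
  have "(LINT x:{0..2 * pi}|lebesgue. u x * (deriv ^^ j) \<phi> x) = (\<integral>x. u' x * (deriv ^^ j) \<phi> x)"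
    "(LINT x:{0..2 * pi}|lebesgue. v x * \<phi> x) = (\<integral>x. v' x * \<phi> x)" if "smooth \<phi>" for \<phi>
    using LINT_mult_eqc[OF assms(1) Lper_Lpc[OF assms(2)] assms(3) smooth_continuous[OF smooth_funpow[OF that]]]
      LINT_mult_eqc[OF assms(4) Lper_Lpc[OF assms(5)] assms(6) smooth_continuous[OF that]] by auto
  thus ?thesis using assms by (auto simp: has_weak_deriv_def wderiv_def)
qed

lemma wderiv_has_weak_deriv: "wderiv j u v \<Longrightarrow> has_weak_deriv j u v"
  using has_weak_deriv_iff[of u u v v j] Lpc_Lp_circle[OF Lper_Lpc] by (auto simp: wderiv_def eqc_refl)

lemma wderiv_unique:
  assumes "wderiv j u v" "wderiv j u w" shows "eqc v w"
proof -
  have v: "Lper v" and w: "Lper w" using assms by (auto simp: wderiv_def)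
  have L: "Lper (\<lambda>x. v x - w x)" using v w by (auto simp: Lper_def periodic_def)
  have "AE x in circ. v x - w x = 0"
  proof (rule Lper_test_zero[OF L])
    fix \<phi> assume \<phi>: "smooth \<phi>" "periodic \<phi>"
    have c: "cper \<phi>" using \<phi> smooth_continuous by auto
    have "(- 1) ^ j * (\<integral>x. v x * \<phi> x) = (- 1) ^ j * (\<integral>x. w x * \<phi> x)"
    proof -
      have "(\<integral>x. u x * (deriv ^^ j) \<phi> x) = (- 1) ^ j * (\<integral>x. v x * \<phi> x)"
        "(\<integral>x. u x * (deriv ^^ j) \<phi> x) = (- 1) ^ j * (\<integral>x. w x * \<phi> x)"
        using assms \<phi> by (auto simp: wderiv_def)
      thus ?thesis by simp
    qed
    hence "(\<integral>x. v x * \<phi> x) = (\<integral>x. w x * \<phi> x)" by simp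
    thus "(\<integral>x. (v x - w x) * \<phi> x) = 0"
      using cper_mult_integrable[OF v c, of 0] cper_mult_integrable[OF w c, of 0] by (simp add: left_diff_distrib)
  qed
  thus ?thesis by (simp add: eqc_circ)
qed

lemma has_weak_deriv_rep:
  assumes "has_weak_deriv j u v" "Lper u'" "eqc u u'"
  obtains v' where "Lper v'" "eqc v v'" "wderiv j u' v'"
proof -
  have uv: "u \<in> Lp_circle 1" "v \<in> Lp_circle 1" using assms(1) by (auto simp: has_weak_deriv_def)
  obtain v' where v': "Lpc 1 v'" "eqc v v'" using Lp_circle_rep[OF uv(2)] by blast
  have L: "Lper v'" using v'(1) Lpc_Lper[of 1 v'] by simp
  show ?thesis using that[OF L v'(2)] has_weak_deriv_iff[OF uv(1) assms(2,3) uv(2) L v'(2)] assms(1) by simp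
qed

text \<open>Justifies the choice in \<open>weak_deriv\<close>: any weak derivative that has been
  constructed may be put in its place under integrals.\<close>

lemma weak_deriv_eqc:
  assumes "wderiv j u v"
  shows "eqc (weak_deriv j u) v" "has_weak_deriv j u (weak_deriv j u)"
proof -
  show 1: "has_weak_deriv j u (weak_deriv j u)"
    unfolding weak_deriv_def using someI[of "has_weak_deriv j u", OF wderiv_has_weak_deriv[OF assms]] .
  have "Lper u" using assms by (simp add: wderiv_def)
  then obtain v' where "eqc (weak_deriv j u) v'" "wderiv j u v'"
    using has_weak_deriv_rep[OF 1 _ eqc_refl] by blast
  thus "eqc (weak_deriv j u) v" using wderiv_unique[OF assms] eqc_sym eqc_trans by blast
qed

lemma weak_deriv_lebesgue: "wderiv j u v \<Longrightarrow> weak_deriv j u \<in> borel_measurable lebesgue"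
  using weak_deriv_eqc(2)[of j u v] by (auto simp: has_weak_deriv_def Lp_circle_def)

lemma wderiv_0: "Lper u \<Longrightarrow> wderiv 0 u u"
  by (simp add: wderiv_def)

section \<open>Weak derivatives as indefinite integrals\<close>

lemma dq_C1_uniform:
  assumes \<phi>: "\<And>x. (\<phi> has_real_derivative \<phi>' x) (at x)" "cper \<phi>'" and \<epsilon>: "\<epsilon> > 0"
  obtains d where "d > 0" "\<And>e x. 0 < e \<Longrightarrow> e \<le> d \<Longrightarrow> \<bar>dq e \<phi> x - \<phi>' x\<bar> \<le> \<epsilon>"
proof -
  obtain d where d: "d > 0" "\<And>e x. 0 < e \<Longrightarrow> e \<le> d \<Longrightarrow> \<bar>avg e \<phi>' x - \<phi>' x\<bar> \<le> \<epsilon>"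
    using avg_uniform[OF \<phi>(2) \<epsilon>] by blast
  have "prim \<phi>' \<phi>" using \<phi> by (intro deriv_prim) auto
  thus ?thesis using that[OF d(1)] d(2) prim_avg by (metis (no_types, lifting))
qed

lemma integral_mult_uniform_limit:
  fixes w :: "nat \<Rightarrow> 'a \<Rightarrow> real"
  assumes u: "integrable M u" and m: "\<And>n. w n \<in> borel_measurable M" "w0 \<in> borel_measurable M"
    and lim: "\<And>\<epsilon>. \<epsilon> > 0 \<Longrightarrow> eventually (\<lambda>n. \<forall>x\<in>space M. \<bar>w n x - w0 x\<bar> \<le> \<epsilon>) sequentially"
    and i: "integrable M (\<lambda>x. u x * w0 x)"
  shows "(\<lambda>n. LINT x|M. u x * w n x) \<longlonglongrightarrow> (LINT x|M. u x * w0 x)"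
proof (rule LIMSEQ_I)
  fix e :: real assume e: "e > 0"
  define K where "K = (LINT x|M. \<bar>u x\<bar>)"
  have K: "K \<ge> 0" by (simp add: K_def)
  have "e / (2 * (K + 1)) > 0" using e K by simp
  from lim[OF this] obtain N where N: "\<And>n x. n \<ge> N \<Longrightarrow> x \<in> space M \<Longrightarrow> \<bar>w n x - w0 x\<bar> \<le> e / (2 * (K + 1))"
    by (auto simp: eventually_sequentially)
  have "norm ((LINT x|M. u x * w n x) - (LINT x|M. u x * w0 x)) < e" if n: "n \<ge> N" for n
  proof -
    have bd: "\<bar>u x * (w n x - w0 x)\<bar> \<le> \<bar>u x\<bar> * (e / (2 * (K + 1)))" if "x \<in> space M" for x
      unfolding abs_mult using N[OF n that] by (intro mult_left_mono) auto
    have i2: "integrable M (\<lambda>x. u x * (w n x - w0 x))"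
    proof (rule Bochner_Integration.integrable_bound)
      show "integrable M (\<lambda>x. \<bar>u x\<bar> * (e / (2 * (K + 1))))" using u by auto
      show "AE x in M. norm (u x * (w n x - w0 x)) \<le> norm (\<bar>u x\<bar> * (e / (2 * (K + 1))))"
      proof (rule AE_I2)
        fix x assume "x \<in> space M"
        from bd[OF this] show "norm (u x * (w n x - w0 x)) \<le> norm (\<bar>u x\<bar> * (e / (2 * (K + 1))))"
          unfolding real_norm_def by (rule order_trans[OF _ abs_ge_self])
      qed
    qed (use u m in measurable)
    have "integrable M (\<lambda>x. u x * (w n x - w0 x) + u x * w0 x)" using i2 i by (rule Bochner_Integration.integrable_add)
    hence i3: "integrable M (\<lambda>x. u x * w n x)" by (simp add: algebra_simps)
    have "(LINT x|M. u x * w n x) - (LINT x|M. u x * w0 x) = (LINT x|M. u x * (w n x - w0 x))"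
      using i i3 by (simp add: right_diff_distrib)
    also have "\<bar>\<dots>\<bar> \<le> (LINT x|M. \<bar>u x * (w n x - w0 x)\<bar>)" by (rule integral_abs_bound)
    also have "\<dots> \<le> (LINT x|M. \<bar>u x\<bar> * (e / (2 * (K + 1))))"
      using i2 u bd by (intro integral_mono) auto
    also have "\<dots> = K * (e / (2 * (K + 1)))" by (simp add: K_def)
    also have "\<dots> < e" using e K by (simp add: field_simps add_nonneg_pos)
    finally show ?thesis by simp
  qed
  thus "\<exists>N. \<forall>n\<ge>N. norm ((LINT x|M. u x * w n x) - (LINT x|M. u x * w0 x)) < e" by blast
qed

lemma avg_small_step: "(\<lambda>n::nat. 1 / real (Suc n)) \<longlonglongrightarrow> 0"
  using LIMSEQ_Suc[OF lim_1_over_n] by simp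

lemma uniform_small_step:
  assumes "d > 0" "\<And>e x. 0 < e \<Longrightarrow> e \<le> d \<Longrightarrow> \<bar>f e x - g x\<bar> \<le> (\<epsilon>::real)"
  shows "eventually (\<lambda>n::nat. \<forall>x\<in>S. \<bar>f (1 / real (Suc n)) x - g x\<bar> \<le> \<epsilon>) sequentially"
proof -
  have "eventually (\<lambda>n. 1 / real (Suc n) < d) sequentially" using avg_small_step assms(1) by (rule order_tendstoD(2))
  thus ?thesis by eventually_elim (use assms(2) in auto)
qed

text \<open>For each width the identity is exact adjointness of averages and quotients, applied to
  \<open>avg e v = dq e u\<close>. Then the width tends to zero on the smooth factor, where the
  convergence is uniform.\<close>

lemma integral_by_parts_periodic:
  assumes u: "cper u" and v: "Lper v" and p: "prim v u"
    and \<phi>: "\<And>x. (\<phi> has_real_derivative \<phi>' x) (at x)" "cper \<phi>'" "periodic \<phi>"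
  shows "(\<integral>x. u x * \<phi>' x) = - (\<integral>x. v x * \<phi> x)"
proof -
  have c\<phi>: "cper \<phi>" using \<phi>(1,3) DERIV_isCont continuous_at_imp_continuous_on by blast
  let ?e = "\<lambda>n::nat. 1 / real (Suc n)"
  have e: "?e n > 0" for n by simp
  have eq: "(\<integral>x. v x * avg (?e n) \<phi> x) = - (\<integral>x. u x * dq (?e n) \<phi> x)" for n
  proof -
    have "(\<integral>x. v x * avg (?e n) \<phi> x) = (\<integral>x. avg (?e n) v x * \<phi> x)"
      using avg_adjoint_cper[OF v c\<phi>] by simp
    also have "\<dots> = (\<integral>x. dq (?e n) u x * \<phi> x)" using prim_avg[OF p e] by simp
    finally show ?thesis using dq_adjoint_cper[OF cper_Lper[OF u] c\<phi>] by simp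
  qed
  have b: "w \<in> borel_measurable circ" if "continuous_on UNIV w" for w
    using borel_measurable_continuous_onI[OF that] by measurable
  have l1: "(\<lambda>n. \<integral>x. v x * avg (?e n) \<phi> x) \<longlonglongrightarrow> (\<integral>x. v x * \<phi> x)"
  proof (rule integral_mult_uniform_limit)
    fix \<epsilon> :: real assume "\<epsilon> > 0"
    then obtain d where "d > 0" "\<And>e x. 0 < e \<Longrightarrow> e \<le> d \<Longrightarrow> \<bar>avg e \<phi> x - \<phi> x\<bar> \<le> \<epsilon>" using avg_uniform[OF c\<phi>] by blast
    thus "\<forall>\<^sub>F n in sequentially. \<forall>x\<in>space circ. \<bar>avg (?e n) \<phi> x - \<phi> x\<bar> \<le> \<epsilon>" by (rule uniform_small_step)
  qed (use v c\<phi> e cper_mult_integrable[OF v c\<phi>, of 0] in \<open>auto simp: Lper_def intro!: b avg_continuous cper_locint\<close>)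
  have l2: "(\<lambda>n. \<integral>x. u x * dq (?e n) \<phi> x) \<longlonglongrightarrow> (\<integral>x. u x * \<phi>' x)"
  proof (rule integral_mult_uniform_limit)
    fix \<epsilon> :: real assume "\<epsilon> > 0"
    then obtain d where "d > 0" "\<And>e x. 0 < e \<Longrightarrow> e \<le> d \<Longrightarrow> \<bar>dq e \<phi> x - \<phi>' x\<bar> \<le> \<epsilon>" using dq_C1_uniform[OF \<phi>(1,2)] by blast
    thus "\<forall>\<^sub>F n in sequentially. \<forall>x\<in>space circ. \<bar>dq (?e n) \<phi> x - \<phi>' x\<bar> \<le> \<epsilon>" by (rule uniform_small_step)
  qed (use cper_Lper[OF u] c\<phi> \<phi>(2) cper_mult_integrable[OF cper_Lper[OF u] \<phi>(2), of 0] in \<open>auto simp: Lper_def intro!: b dq_continuous\<close>)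
  have "(\<integral>x. v x * \<phi> x) = - (\<integral>x. u x * \<phi>' x)"
    by (rule LIMSEQ_unique[OF l1]) (unfold eq, rule tendsto_minus[OF l2])
  thus ?thesis by simp
qed

lemma prim_wderiv:
  assumes "cper u" "Lper v" "prim v u" shows "wderiv 1 u v"
  using integral_by_parts_periodic[OF assms smooth_DERIV] smooth_deriv_periodic smooth_continuous[OF smooth_deriv] assms
  by (auto simp: wderiv_def intro: cper_Lper)

lemma funpow_deriv_Suc: "(deriv ^^ Suc j) \<phi> = (deriv ^^ j) (deriv \<phi>)"
  by (simp add: funpow_swap1)

lemma prim_wderiv_Suc:
  assumes "wderiv j u w" "cper w" "Lper v" "prim v w" shows "wderiv (Suc j) u v"
  unfolding wderiv_def
proof (intro conjI allI impI)
  show "Lper u" using assms(1) by (simp add: wderiv_def)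
  fix \<phi> assume \<phi>: "smooth \<phi> \<and> periodic \<phi>"
  hence "smooth (deriv \<phi>)" "periodic (deriv \<phi>)" using smooth_deriv smooth_deriv_periodic by auto
  hence "(\<integral>x. u x * (deriv ^^ Suc j) \<phi> x) = (- 1) ^ j * (\<integral>x. w x * deriv \<phi> x)"
    unfolding funpow_deriv_Suc using assms(1) by (simp add: wderiv_def)
  also have "(\<integral>x. w x * deriv \<phi> x) = - (\<integral>x. v x * \<phi> x)"
    using \<phi> smooth_deriv_periodic smooth_continuous[OF smooth_deriv]
    by (intro integral_by_parts_periodic[OF assms(2,3,4) smooth_DERIV]) auto
  finally show "(\<integral>x. u x * (deriv ^^ Suc j) \<phi> x) = (- 1) ^ Suc j * (\<integral>x. v x * \<phi> x)" by simp
qed fact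

text \<open>The derivative of \<open>avg e \<phi>\<close> is \<open>dq e \<phi>\<close>, so testing
  the weak derivative with averaged test functions gives the identity in the weak sense; both sides
  are continuous, hence it holds at every point.\<close>

lemma wderiv_dq:
  assumes u: "cper u" and d: "wderiv 1 u v" and e: "e > 0"
  shows "dq e u x = avg e v x"
proof -
  have v: "Lper v" using d by (simp add: wderiv_def)
  have c: "cper (\<lambda>x. dq e u x - avg e v x)"
    using cper_dq[OF u, of e] cper_avg[OF v e] by (auto simp: periodic_def intro: continuous_intros)
  have "dq e u x - avg e v x = 0"
  proof (rule continuous_test_zero[OF c])
    fix \<phi> assume \<phi>: "smooth \<phi>" "periodic \<phi>"
    have c\<phi>: "cper \<phi>" using \<phi> smooth_continuous by auto
    have "(\<integral>x. dq e u x * \<phi> x) = - (\<integral>x. u x * dq e \<phi> x)" by (rule dq_adjoint_cper[OF cper_Lper[OF u] c\<phi>])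
    also have "dq e \<phi> = deriv (avg e \<phi>)"
      using DERIV_imp_deriv[OF avg_deriv[OF smooth_continuous[OF \<phi>(1)] e]] by auto
    also have "(\<integral>x. u x * deriv (avg e \<phi>) x) = - (\<integral>x. v x * avg e \<phi> x)"
      using d smooth_avg[OF \<phi>(1) e] avg_periodic[OF \<phi>(2)] by (simp add: wderiv_def)
    also have "(\<integral>x. v x * avg e \<phi> x) = (\<integral>x. avg e v x * \<phi> x)" using avg_adjoint_cper[OF v c\<phi>] by simp
    finally have "(\<integral>x. dq e u x * \<phi> x) = (\<integral>x. avg e v x * \<phi> x)" by simp
    thus "(\<integral>x. (dq e u x - avg e v x) * \<phi> x) = 0"
      using cper_mult_integrable[OF cper_Lper[OF cper_dq[OF u]] c\<phi>, of e 0]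
        cper_mult_integrable[OF cper_Lper[OF cper_avg[OF v e]] c\<phi>, of 0] by (simp add: left_diff_distrib)
  qed
  thus ?thesis by simp
qed

text \<open>Every increment \<open>u b - u a\<close> is a difference quotient at the midpoint whose
  width is half the length.\<close>

lemma dq_avg_prim:
  assumes v: "Lper v" and dq: "\<And>e x. e > 0 \<Longrightarrow> dq e u x = avg e v x"
  shows "prim v u"
proof -
  obtain V where V: "prim v V" using locint_prim[OF Lper_locint[OF v]] by blast
  have "u b - u a = V b - V a" if "a < b" for a b
  proof -
    let ?e = "(b - a) / 2" and ?x = "(a + b) / 2"
    have "dq ?e u ?x = dq ?e V ?x" using that dq prim_avg[OF V] by simp
    moreover have "?x + ?e = b" "?x - ?e = a" by (simp_all add: field_simps)
    ultimately show ?thesis using that by (simp add: dq_def)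
  qed
  hence "u b - u a = V b - V a" if "a \<le> b" for a b using that by (cases "a = b") auto
  thus ?thesis using V by (simp add: prim_def)
qed

lemma wderiv_prim:
  assumes "cper u" "wderiv 1 u v" shows "prim v u"
  using dq_avg_prim[of v u] wderiv_dq[OF assms] assms(2) by (simp add: wderiv_def)

lemma sobolev_1_rep:
  assumes "u \<in> sobolev 1 p" "p \<ge> 1"
  obtains v where "cper u" "Lpc p v" "prim v u" "wderiv 1 u v" "eqc (weak_deriv 1 u) v"
proof -
  have u: "cper u" using assms(1) by (auto simp: sobolev_def Lp_circle_def)
  obtain v where v: "v \<in> Lp_circle p" "has_weak_deriv 1 u v" using assms(1) by (auto simp: sobolev_def)
  obtain v' where v': "Lper v'" "eqc v v'" "wderiv 1 u v'"
    using has_weak_deriv_rep[OF v(2) cper_Lper[OF u] eqc_refl] by blast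
  obtain w where w: "Lpc p w" "eqc v w" using Lp_circle_rep[OF v(1)] by blast
  have e: "eqc w v'" using w v' eqc_sym eqc_trans by blast
  have Lw: "Lper w" using w(1) assms(2) Lpc_Lper by blast
  have wd: "wderiv 1 u w"
    using has_weak_deriv_iff[OF Lpc_Lp_circle[OF Lper_Lpc[OF cper_Lper[OF u]]] cper_Lper[OF u] eqc_refl, of v w 1] v(2) Lw w(2)
    by (auto simp: has_weak_deriv_def)
  show ?thesis using that[OF u w(1) wderiv_prim[OF u wd] wd weak_deriv_eqc(1)[OF wd]] .
qed

lemma sobolev_I:
  assumes "cper u" "p > 0" "\<And>j. j \<le> k \<Longrightarrow> Lpc p (w j)" "\<And>j. j \<le> k \<Longrightarrow> wderiv j u (w j)"
  shows "u \<in> sobolev k p"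
  unfolding sobolev_def
proof (intro CollectI conjI impI allI)
  show "u \<in> Lp_circle p" by (rule Lpc_Lp_circle[OF cper_Lpc[OF assms(1,2)]])
  show "continuous_on UNIV u" using assms(1) by simp
  fix j assume "j \<le> k"
  thus "\<exists>v\<in>Lp_circle p. has_weak_deriv j u v"
    using assms(3,4)[of j] Lpc_Lp_circle[of p "w j"] wderiv_has_weak_deriv[of j u "w j"] by blast
qed

lemma LINT_powr_eqc:
  assumes "u \<in> borel_measurable lebesgue" "v \<in> borel_measurable borel" "eqc u v"
  shows "(LINT x:{0..2 * pi}|lebesgue. \<bar>u x\<bar> powr p) = Ip circ p v"
  using assms by (intro set_integrable_eqc(2)) (auto simp: eqc_def elim: eventually_mono)

lemma sobolev_norm_eq:
  assumes "\<And>j. j \<le> k \<Longrightarrow> wderiv j u (w j)"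
  shows "sobolev_norm k p u = (\<Sum>j\<le>k. Ip circ p (w j)) powr (1 / p)"
proof -
  have "(LINT x:{0..2 * pi}|lebesgue. \<bar>weak_deriv j u x\<bar> powr p) = Ip circ p (w j)" if "j \<le> k" for j
    using assms[OF that] weak_deriv_eqc(1)[OF assms[OF that]] weak_deriv_lebesgue[OF assms[OF that]]
    by (intro LINT_powr_eqc) (auto simp: wderiv_def Lper_def)
  thus ?thesis by (simp add: sobolev_norm_def)
qed

section \<open>Discrete derivatives and the discrete energy\<close>

text \<open>The derivative of \<open>avg3 e u\<close>: differentiating one of the three averages
  turns it into a quotient.\<close>

definition dsm :: "real \<Rightarrow> (real \<Rightarrow> real) \<Rightarrow> real \<Rightarrow> real" where
  "dsm e u = dq e (avg e (avg e u))"

lemma cper_lin: "cper u \<Longrightarrow> cper v \<Longrightarrow> cper (\<lambda>x. a * u x + b * v x)"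
  by (auto simp: periodic_def intro!: continuous_intros)

lemma cper_add: "cper u \<Longrightarrow> cper v \<Longrightarrow> cper (\<lambda>x. u x + v x)"
  by (auto simp: periodic_def intro!: continuous_intros)

lemma cper_diff: "cper u \<Longrightarrow> cper v \<Longrightarrow> cper (\<lambda>x. u x - v x)"
  by (auto simp: periodic_def intro!: continuous_intros)

lemma cper_mult: "cper u \<Longrightarrow> cper v \<Longrightarrow> cper (\<lambda>x. u x * v x)"
  by (auto simp: periodic_def intro!: continuous_intros)

lemma cper_cmult: "cper u \<Longrightarrow> cper (\<lambda>x. c * u x)"
  by (auto simp: periodic_def intro!: continuous_intros)

lemma cper_const: "cper (\<lambda>x. c)"
  by (simp add: periodic_def)

lemma cper_sum: "(\<And>i. i \<in> S \<Longrightarrow> cper (u i)) \<Longrightarrow> cper (\<lambda>x. \<Sum>i\<in>S. u i x)"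
  by (auto simp: periodic_def intro!: continuous_on_sum)

lemma cper_integrable: "cper u \<Longrightarrow> integrable circ u"
  using cper_Lper by (auto simp: Lper_def)

lemma cper_avg3: "cper u \<Longrightarrow> e > 0 \<Longrightarrow> cper (avg3 e u)"
  by (simp add: avg3_def cper_avg')

lemma cper_dsm: "cper u \<Longrightarrow> e > 0 \<Longrightarrow> cper (dsm e u)"
  by (simp add: dsm_def cper_avg' cper_dq)

lemmas cper_simps = cper_avg' cper_dq cper_avg3 cper_dsm

lemma avg_fun_lin:
  assumes "locint u" "locint v" shows "avg e (\<lambda>x. a * u x + b * v x) = (\<lambda>x. a * avg e u x + b * avg e v x)"
  using avg_lin[OF assms] by auto

lemma avg3_lin:
  assumes "locint u" "locint v" "e > 0" shows "avg3 e (\<lambda>x. a * u x + b * v x) = (\<lambda>x. a * avg3 e u x + b * avg3 e v x)"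
  unfolding avg3_def by (simp add: avg_fun_lin assms locint_avg)

lemma dsm_lin:
  assumes "locint u" "locint v" "e > 0" shows "dsm e (\<lambda>x. a * u x + b * v x) = (\<lambda>x. a * dsm e u x + b * dsm e v x)"
  unfolding dsm_def by (simp add: avg_fun_lin assms locint_avg fun_eq_iff dq_lin)

lemma dq_fun_lin: "dq e (\<lambda>x. a * u x + b * v x) = (\<lambda>x. a * dq e u x + b * dq e v x)"
  by (simp add: fun_eq_iff dq_lin)

lemma avg3_bound:
  assumes "cper u" "e > 0" "\<And>y. \<bar>u y\<bar> \<le> B" shows "\<bar>avg3 e u x\<bar> \<le> B"
  unfolding avg3_def using assms by (intro avg_bound cper_locint) (auto simp: cper_simps)

lemma avg3_commute_avg:
  assumes "cper u" "e > 0" "d > 0" shows "avg d (avg3 e u) = avg3 e (avg d u)"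
  unfolding avg3_def using assms by (simp add: avg_commute[of _ d e] cper_locint cper_simps)

lemma avg3_commute_dq:
  assumes "cper u" "e > 0" "d > 0" shows "dq d (avg3 e u) = avg3 e (dq d u)"
  unfolding avg3_def using assms by (simp add: avg_locint_dq(1)[symmetric] cper_locint cper_simps cper_dq)

lemma dsm_avg3:
  assumes u: "cper u" and e: "e > 0" "d > 0"
  shows "avg3 d (dsm e u) = avg3 e (dsm d u)"
proof -
  have "avg3 d (dsm e u) = dq e (avg e (avg e (avg3 d u)))"
    unfolding dsm_def using u e by (simp add: avg3_commute_avg avg3_commute_dq[symmetric] cper_avg')
  also have "avg e (avg e (avg3 d u)) = avg d (avg e (avg e (avg d (avg d u))))"
    unfolding avg3_def using u e by (simp add: avg_commute[of _ d e] cper_locint cper_simps)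
  also have "dq e (avg d (avg e (avg e (avg d (avg d u))))) = avg e (dq d (avg e (avg e (avg d (avg d u)))))"
    using u e by (intro avg_locint_dq(2)[symmetric] cper_locint) (auto simp: cper_simps)
  also have "\<dots> = avg3 e (dsm d u)"
    unfolding avg3_def dsm_def using u e by (simp add: avg_locint_dq(1)[of _ e d] cper_locint cper_simps cper_dq)
  finally show ?thesis .
qed

text \<open>All differences are moved to the width \<open>e\<close>, and only averages of width
  \<open>d\<close> remain. Bounds derived from this form do not deteriorate as \<open>d\<close>
  tends to zero.\<close>

lemma dsm_flux:
  assumes J: "cper J" and e: "e > 0" "d > 0"
  shows "dsm d (dsm e J) = dq e (dq e (avg e (avg3 d J)))"
proof -
  have "dsm d (dsm e J) = dq e (dq d (avg d (avg d (avg e (avg e J)))))"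
    unfolding dsm_def using J e by (simp add: avg_locint_dq(1)[of _ d e] dq_commute[of d e] cper_locint cper_simps cper_dq)
  also have "avg d (avg d (avg e (avg e J))) = avg e (avg d (avg d (avg e J)))"
    using J e by (simp add: avg_commute[of _ d e] cper_locint cper_simps)
  also have "dq d (avg e (avg d (avg d (avg e J)))) = avg d (dq e (avg d (avg d (avg e J))))"
    using J e by (intro avg_locint_dq(2)[symmetric] cper_locint) (auto simp: cper_simps)
  also have "\<dots> = dq e (avg3 d (avg e J))"
    unfolding avg3_def using J e by (intro avg_locint_dq(1) cper_locint) (auto simp: cper_simps)
  also have "avg3 d (avg e J) = avg e (avg3 d J)" using avg3_commute_avg[OF J e(2) e(1)] by simp
  finally show ?thesis .
qed

text \<open>The energy of \<open>avg3 e h\<close>, whose derivative is \<open>dsm e h\<close>. It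
  makes sense for every continuous periodic \<open>h\<close> and is used with a width different from
  that of the scheme.\<close>

definition En :: "real \<Rightarrow> (real \<Rightarrow> real) \<Rightarrow> real" where
  "En e h = 1 / 2 * (\<integral>x. (dsm e h x)\<^sup>2 - (avg3 e h x)\<^sup>2)"

text \<open>The operator \<partial> + \<partial>^3 applied to \<open>avg3 e h\<close>.\<close>

definition zz :: "real \<Rightarrow> (real \<Rightarrow> real) \<Rightarrow> real \<Rightarrow> real" where
  "zz e h x = dsm e h x + dq e (dq e (dq e h)) x"

lemma cper_zz: "cper h \<Longrightarrow> e > 0 \<Longrightarrow> cper (zz e h)"
  unfolding zz_def[abs_def] by (intro cper_add cper_dsm cper_dq)

text \<open>For \<open>j \<le> 3\<close> the \<open>j\<close>-th derivative of
  \<open>avg3 e u\<close>: each differentiation exchanges one average for a quotient. On bounded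
  functions it costs a factor \<open>e ^ j\<close>.\<close>

definition mderiv :: "real \<Rightarrow> nat \<Rightarrow> (real \<Rightarrow> real) \<Rightarrow> real \<Rightarrow> real" where
  "mderiv e j u = (dq e ^^ j) ((avg e ^^ (3 - j)) u)"

lemma cper_avg_pow: "cper u \<Longrightarrow> e > 0 \<Longrightarrow> cper ((avg e ^^ n) u)"
  by (induction n) (simp_all add: cper_avg')

lemma cper_dq_pow: "cper u \<Longrightarrow> cper ((dq e ^^ n) u)"
  by (induction n) (simp_all add: cper_dq)

lemma cper_mderiv: "cper u \<Longrightarrow> e > 0 \<Longrightarrow> cper (mderiv e j u)"
  unfolding mderiv_def by (intro cper_dq_pow cper_avg_pow)

lemma mderiv_0: "mderiv e 0 u = avg3 e u"
  by (simp add: mderiv_def avg3_def numeral_3_eq_3)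

lemma zz_mderiv: "zz e u x = mderiv e 1 u x + mderiv e 3 u x"
  by (simp add: mderiv_def zz_def dsm_def numeral_3_eq_3 numeral_2_eq_2)

lemma mderiv_1: "mderiv e 1 u = dsm e u"
  by (simp add: mderiv_def dsm_def numeral_2_eq_2)

lemma mderiv_bound:
  assumes c: "cper u" and e: "e > 0" and B: "\<And>x. \<bar>u x\<bar> \<le> B"
  shows "\<bar>mderiv e j u x\<bar> \<le> B / e ^ j"
proof -
  have A: "\<bar>(avg e ^^ n) u y\<bar> \<le> B" for n y
  proof (induction n arbitrary: y)
    case (Suc n)
    thus ?case using avg_bound[OF cper_locint[OF cper_avg_pow[OF c e]] e] by simp
  qed (use B in simp)
  have "\<bar>(dq e ^^ n) f y\<bar> \<le> B / e ^ n" if "\<And>y. \<bar>f y\<bar> \<le> B" for n f y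
  proof (induction n arbitrary: y)
    case (Suc n)
    thus ?case using dq_bound[OF e, of "(dq e ^^ n) f" "B / e ^ n" y] by (simp add: mult.commute)
  qed (use that in simp)
  thus ?thesis using A by (simp add: mderiv_def)
qed

lemma mderiv_diff:
  assumes u: "cper u" and v: "cper v" and e: "e > 0"
  shows "mderiv e j (\<lambda>x. u x - v x) x = mderiv e j u x - mderiv e j v x"
proof -
  have a: "(avg e ^^ n) (\<lambda>x. 1 * u x + (- 1) * v x) = (\<lambda>x. 1 * (avg e ^^ n) u x + (- 1) * (avg e ^^ n) v x)" for n
    by (induction n) (use avg_fun_lin[OF cper_locint cper_locint, OF cper_avg_pow cper_avg_pow, OF u e v e, where e = e and a = 1 and b = "- 1"] in auto)
  have d: "(dq e ^^ n) (\<lambda>x. 1 * f x + (- 1) * g x) = (\<lambda>x. 1 * (dq e ^^ n) f x + (- 1) * (dq e ^^ n) g x)" for n f g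
    by (induction n) (use dq_fun_lin[of e 1 _ "- 1"] in auto)
  show ?thesis using a[of "3 - j"] d[of j "(avg e ^^ (3 - j)) u" "(avg e ^^ (3 - j)) v"] by (simp add: mderiv_def)
qed

lemma mderiv_diff_bound:
  assumes u: "cper u" and v: "cper v" and e: "e > 0" and B: "\<And>x. \<bar>u x - v x\<bar> \<le> B"
  shows "\<bar>mderiv e j u x - mderiv e j v x\<bar> \<le> B / e ^ j"
  using mderiv_bound[OF cper_diff[OF u v] e B] by (simp add: mderiv_diff u v e)

lemma dsm_bound: "cper u \<Longrightarrow> e > 0 \<Longrightarrow> (\<And>x. \<bar>u x\<bar> \<le> B) \<Longrightarrow> \<bar>dsm e u x\<bar> \<le> B / e"
  using mderiv_bound[of u e B 1 x] unfolding mderiv_1 by simp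

lemma zz_bound:
  assumes "cper u" "e > 0" "\<And>x. \<bar>u x\<bar> \<le> B"
  shows "\<bar>zz e u x\<bar> \<le> B / e + B / e ^ 3"
  using mderiv_bound[OF assms, of 1 x] mderiv_bound[OF assms, of 3 x] unfolding zz_mderiv power_one_right by linarith

lemma avg3_diff_bound:
  assumes "cper u" "cper v" "e > 0" "\<And>x. \<bar>u x - v x\<bar> \<le> B"
  shows "\<bar>avg3 e u x - avg3 e v x\<bar> \<le> B"
  using mderiv_diff_bound[OF assms, of 0 x] by (simp add: mderiv_0)

lemma dsm_diff_bound:
  assumes "cper u" "cper v" "e > 0" "\<And>x. \<bar>u x - v x\<bar> \<le> B"
  shows "\<bar>dsm e u x - dsm e v x\<bar> \<le> B / e"
  using mderiv_diff_bound[OF assms, of 1 x] unfolding mderiv_1 by simp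

lemma zz_diff_bound:
  assumes "cper u" "cper v" "e > 0" "\<And>x. \<bar>u x - v x\<bar> \<le> B"
  shows "\<bar>zz e u x - zz e v x\<bar> \<le> B / e + B / e ^ 3"
  using mderiv_diff_bound[OF assms, of 1 x] mderiv_diff_bound[OF assms, of 3 x] unfolding zz_mderiv power_one_right by linarith

lemma dsm_of_prim:
  assumes u: "cper u" and p: "prim v u" and e: "e > 0"
  shows "dsm e u = avg3 e v"
proof -
  have 1: "avg e v = dq e u" using prim_avg[OF p e] by auto
  show ?thesis unfolding dsm_def avg3_def 1
    by (simp only: avg_locint_dq(1)[OF cper_locint[OF u] e e] avg_locint_dq(1)[OF cper_locint[OF cper_avg'[OF u e]] e e])
qed

text \<open>The first variation of the energy in the direction of a divergence: formally the
  integral of h' J'' - h J' equals that of J (h' + h'''). It is exact here because the operators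
  commute and are symmetric or antisymmetric; one smoothing of width \<open>d\<close> stays on each
  factor.\<close>

lemma energy_bilinear:
  assumes h: "cper h" and J: "cper J" and e: "e > 0" "d > 0"
  shows "(\<integral>x. dsm d h x * dsm d (dsm e J) x - avg3 d h x * avg3 d (dsm e J) x)
     = (\<integral>x. avg3 d J x * avg3 d (zz e h) x)"
proof -
  let ?K = "avg3 d J"
  have K: "cper ?K" using J e by (intro cper_avg3)
  note c = h J K e
  have A: "(\<integral>x. dsm d h x * dsm d (dsm e J) x) = (\<integral>x. avg3 d (dq e (dq e (dq e h))) x * ?K x)"
  proof -
    have "(\<integral>x. dsm d h x * dsm d (dsm e J) x) = - (\<integral>x. dq e (dsm d h) x * dq e (avg e ?K) x)"
      unfolding dsm_flux[OF J e] using c by (subst dq_adjoint_cper) (auto simp: cper_simps intro!: cper_Lper)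
    also have "\<dots> = (\<integral>x. dq e (dq e (dsm d h)) x * avg e ?K x)"
      using c by (subst dq_adjoint_cper[of "dq e (dsm d h)"]) (auto simp: cper_simps intro!: cper_Lper)
    also have "\<dots> = (\<integral>x. avg e (dq e (dq e (dsm d h))) x * ?K x)"
      using c by (intro avg_adjoint_cper[symmetric] cper_Lper) (auto simp: cper_simps)
    also have "avg e (dq e (dq e (dsm d h))) = dq e (dq e (avg e (dsm d h)))"
      using c by (simp add: avg_locint_dq(1) cper_locint cper_simps)
    \<comment> \<open>The exchange of widths supplies the third quotient of width \<open>e\<close>;
      the average needed for it is the one carried over from the flux.\<close>
    also have "avg e (dsm d h) = dq e (avg3 d h)"
      unfolding dsm_def avg3_def using c by (intro avg_locint_dq(2) cper_locint) (auto simp: cper_simps)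
    also have "dq e (dq e (dq e (avg3 d h))) = avg3 d (dq e (dq e (dq e h)))"
      using c by (simp add: avg3_commute_dq cper_simps)
    finally show ?thesis .
  qed
  have B: "(\<integral>x. avg3 d h x * avg3 d (dsm e J) x) = - (\<integral>x. avg3 d (dsm e h) x * ?K x)"
  proof -
    have "avg3 d (dsm e J) = dq e (avg e (avg e ?K))"
      unfolding dsm_def using c by (simp add: avg3_commute_dq avg3_commute_avg cper_simps)
    hence "(\<integral>x. avg3 d h x * avg3 d (dsm e J) x) = - (\<integral>x. dq e (avg3 d h) x * avg e (avg e ?K) x)"
      using c by (subst dq_adjoint_cper) (auto simp: cper_simps intro!: cper_Lper)
    also have "(\<integral>x. dq e (avg3 d h) x * avg e (avg e ?K) x) = (\<integral>x. avg e (avg e (dq e (avg3 d h))) x * ?K x)"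
    proof -
      have "(\<integral>x. avg e (avg e (dq e (avg3 d h))) x * ?K x) = (\<integral>x. avg e (dq e (avg3 d h)) x * avg e ?K x)"
        using c by (intro avg_adjoint_cper cper_Lper) (auto simp: cper_simps)
      also have "\<dots> = (\<integral>x. dq e (avg3 d h) x * avg e (avg e ?K) x)"
        using c by (intro avg_adjoint_cper cper_Lper) (auto simp: cper_simps)
      finally show ?thesis by simp
    qed
    also have "avg e (avg e (dq e (avg3 d h))) = avg3 d (dsm e h)"
      unfolding dsm_def using c by (simp add: avg_locint_dq(1) cper_locint avg3_commute_dq[symmetric] avg3_commute_avg[symmetric] cper_simps)
    finally show ?thesis .
  qed
  have "avg3 d (zz e h) = (\<lambda>x. 1 * avg3 d (dsm e h) x + 1 * avg3 d (dq e (dq e (dq e h))) x)"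
    unfolding zz_def[abs_def] using c by (subst avg3_lin[symmetric]) (auto simp: cper_simps intro!: cper_locint)
  hence "(\<integral>x. avg3 d J x * avg3 d (zz e h) x) = (\<integral>x. avg3 d (dsm e h) x * ?K x + avg3 d (dq e (dq e (dq e h))) x * ?K x)"
    by (simp add: algebra_simps)
  also have "\<dots> = (\<integral>x. avg3 d (dsm e h) x * ?K x) + (\<integral>x. avg3 d (dq e (dq e (dq e h))) x * ?K x)"
    using c by (intro Bochner_Integration.integral_add cper_integrable cper_mult) (simp_all add: cper_simps)
  also have "\<dots> = (\<integral>x. dsm d h x * dsm d (dsm e J) x) - (\<integral>x. avg3 d h x * avg3 d (dsm e J) x)"
    unfolding A B by simp
  also have "\<dots> = (\<integral>x. dsm d h x * dsm d (dsm e J) x - avg3 d h x * avg3 d (dsm e J) x)"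
    using c by (intro Bochner_Integration.integral_diff[symmetric] cper_integrable cper_mult) (simp_all add: cper_simps)
  finally show ?thesis by simp
qed

text \<open>\<open>En\<close> is quadratic, so the expansion ends with the second order term. That
  term is the whole error of explicit time stepping.\<close>

lemma energy_step:
  assumes h: "cper h" and J: "cper J" and e: "e > 0" "d > 0"
  shows "En d (\<lambda>x. h x - \<tau> * dsm e J x) = En d h - \<tau> * (\<integral>x. avg3 d J x * avg3 d (zz e h) x) + \<tau>\<^sup>2 * En d (dsm e J)"
proof -
  let ?g = "dsm e J"
  have g: "cper ?g" using J e by (intro cper_dsm)
  have l: "locint h" "locint ?g" using h g by (auto intro: cper_locint)
  have 1: "dsm d (\<lambda>x. h x - \<tau> * ?g x) = (\<lambda>x. dsm d h x - \<tau> * dsm d ?g x)"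
    using dsm_lin[OF l e(2), of 1 "- \<tau>"] by simp
  have 2: "avg3 d (\<lambda>x. h x - \<tau> * ?g x) = (\<lambda>x. avg3 d h x - \<tau> * avg3 d ?g x)"
    using avg3_lin[OF l e(2), of 1 "- \<tau>"] by simp
  let ?A = "\<lambda>x. (dsm d h x)\<^sup>2 - (avg3 d h x)\<^sup>2"
  let ?B = "\<lambda>x. dsm d h x * dsm d ?g x - avg3 d h x * avg3 d ?g x"
  let ?C = "\<lambda>x. (dsm d ?g x)\<^sup>2 - (avg3 d ?g x)\<^sup>2"
  have i: "integrable circ ?A" "integrable circ ?B" "integrable circ ?C"
    unfolding power2_eq_square using h g e by (intro cper_integrable cper_diff cper_mult; simp add: cper_simps)+
  have "(\<integral>x. (dsm d h x - \<tau> * dsm d ?g x)\<^sup>2 - (avg3 d h x - \<tau> * avg3 d ?g x)\<^sup>2) = (\<integral>x. ?A x - 2 * \<tau> * ?B x + \<tau>\<^sup>2 * ?C x)"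
    by (intro Bochner_Integration.integral_cong) (auto simp: power2_eq_square algebra_simps)
  also have "\<dots> = (\<integral>x. ?A x) - 2 * \<tau> * (\<integral>x. ?B x) + \<tau>\<^sup>2 * (\<integral>x. ?C x)"
    using i by simp
  finally show ?thesis unfolding En_def 1 2 energy_bilinear[OF h J e] by (simp add: algebra_simps)
qed

lemma integral_circ_bound:
  assumes "integrable circ f" "\<And>x. f x \<le> B" shows "(\<integral>x. f x) \<le> 2 * pi * B"
proof -
  have "(\<integral>x. f x) \<le> (\<integral>x. B)" using assms by (intro integral_mono) auto
  also have "\<dots> = 2 * pi * B" by (subst integral_Iv_const) auto
  finally show ?thesis .
qed

lemma L2sq_bound:
  assumes u: "cper u" and B: "\<And>x. \<bar>u x\<bar> \<le> B" shows "L2sq u \<le> 2 * (pi * B\<^sup>2)"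
  unfolding mult.assoc[symmetric]
proof (rule integral_circ_bound)
  show "integrable circ (\<lambda>x. (u x)\<^sup>2)" unfolding power2_eq_square by (intro cper_integrable cper_mult u)
  show "(u x)\<^sup>2 \<le> B\<^sup>2" for x using power_mono[OF B[of x], of 2] by simp
qed

lemma En_split:
  assumes "cper u" "k > 0"
  shows "En k u = 1 / 2 * L2sq (dsm k u) - 1 / 2 * L2sq (avg3 k u)"
proof -
  have "integrable circ (\<lambda>x. (dsm k u x)\<^sup>2)" "integrable circ (\<lambda>x. (avg3 k u x)\<^sup>2)"
    unfolding power2_eq_square using assms by (auto intro!: cper_integrable cper_mult simp: cper_simps)
  thus ?thesis by (simp add: En_def)
qed

text \<open>By \<open>dsm_flux\<close> the bound is independent of \<open>d\<close>. Each of the two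
  halves of the energy contributes at most \<pi> times the squared supremum.\<close>

lemma En_flux_bound:
  assumes J: "cper J" and e: "0 < e" "e \<le> 1" "d > 0" and B: "\<And>x. \<bar>J x\<bar> \<le> B"
  shows "\<bar>En d (dsm e J)\<bar> \<le> pi * (B / e / e)\<^sup>2"
proof -
  have c: "cper (dsm e J)" "cper (dsm d (dsm e J))" "cper (avg3 d (dsm e J))" using J e by (simp_all add: cper_simps)
  have b: "\<bar>dsm d (dsm e J) x\<bar> \<le> B / e / e" for x
    unfolding dsm_flux[OF J e(1,3)] using J e B
    by (intro dq_bound avg_bound avg3_bound cper_locint) (auto simp: cper_simps)
  have "B \<ge> 0" using B[of 0] by linarith
  hence "B / e \<le> B / e / e" using e by (simp add: le_divide_eq mult_left_le divide_nonneg_pos)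
  hence b': "\<bar>avg3 d (dsm e J) x\<bar> \<le> B / e / e" for x
    using avg3_bound[OF c(1) e(3) dsm_bound[OF J e(1) B], of x] by linarith
  have "0 \<le> L2sq (dsm d (dsm e J))" "0 \<le> L2sq (avg3 d (dsm e J))" by simp_all
  thus ?thesis unfolding En_split[OF c(1) e(3)]
    using L2sq_bound[OF c(2) b] L2sq_bound[OF c(3) b'] by (intro abs_leI) linarith+
qed

section \<open>Moduli of continuity in space and time\<close>

lemma avg3_near:
  assumes u: "cper u" and e: "e > 0" and near: "\<And>x y. \<bar>y - x\<bar> \<le> e \<Longrightarrow> \<bar>u y - u x\<bar> \<le> \<epsilon>"
  shows "\<bar>avg3 e u x - u x\<bar> \<le> 3 * \<epsilon>"
proof -
  note c1 = cper_avg'[OF u e]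
  note c2 = cper_avg'[OF c1 e]
  note l = cper_locint[OF u] cper_locint[OF c1] cper_locint[OF c2]
  have 1: "\<bar>avg e u y - u y\<bar> \<le> \<epsilon>" for y using near by (intro avg_near[OF l(1) e])
  have 2: "\<bar>avg e (avg e u) y - avg e u y\<bar> \<le> \<epsilon>" for y
    unfolding avg_diff[OF l(2) l(1), of e y, symmetric] by (rule avg_bound[OF locint_diff[OF l(2) l(1)] e 1])
  have 3: "\<bar>avg e (avg e (avg e u)) y - avg e (avg e u) y\<bar> \<le> \<epsilon>" for y
    unfolding avg_diff[OF l(3) l(2), of e y, symmetric] by (rule avg_bound[OF locint_diff[OF l(3) l(2)] e 2])
  show ?thesis using 1[of x] 2[of x] 3[of x] unfolding avg3_def by linarith
qed

lemma avg3_tendsto_seq: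
  assumes u: "cper u" and e: "\<And>n. e n > 0" "e \<longlonglongrightarrow> 0"
  shows "(\<lambda>n. avg3 (e n) u x) \<longlonglongrightarrow> u x"
proof (rule LIMSEQ_I)
  fix \<epsilon> :: real assume "\<epsilon> > 0"
  hence "\<epsilon> / 4 > 0" by simp
  then obtain d where d: "d > 0" "\<And>x y. \<bar>y - x\<bar> \<le> d \<Longrightarrow> \<bar>u y - u x\<bar> \<le> \<epsilon> / 4" using cper_uniform[OF u] by blast
  have "eventually (\<lambda>n. e n < d) sequentially" using e(2) d(1) by (rule order_tendstoD(2))
  then obtain N where N: "\<And>n. n \<ge> N \<Longrightarrow> e n < d" by (auto simp: eventually_sequentially)
  have "norm (avg3 (e n) u x - u x) < \<epsilon>" if "n \<ge> N" for n
  proof -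
    have "\<bar>avg3 (e n) u x - u x\<bar> \<le> 3 * (\<epsilon> / 4)"
      using N[OF that] by (intro avg3_near u e d(2)) auto
    thus ?thesis using \<open>\<epsilon> > 0\<close> by simp
  qed
  thus "\<exists>N. \<forall>n\<ge>N. norm (avg3 (e n) u x - u x) < \<epsilon>" by blast
qed

lemma avg3_tendsto: "cper u \<Longrightarrow> (\<lambda>n. avg3 (1 / real (Suc n)) u x) \<longlonglongrightarrow> u x"
  by (rule avg3_tendsto_seq) (use avg_small_step in simp_all)

text \<open>The embedding of H^1 into Hoelder functions of exponent 1/2, in the form given by
  Young's inequality with free \<delta>; optimising over \<delta> would give the square root of
  \<open>K * r\<close>. Restricting \<open>r\<close> to one period lets the local integral be
  bounded by the integral over the circle.\<close>

lemma space_modulus: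
  assumes u: "cper u" and K: "\<And>k. k > 0 \<Longrightarrow> L2sq (dsm k u) \<le> K"
    and \<delta>: "\<delta> > 0" and r: "\<bar>y - x\<bar> \<le> r" "r \<le> 2 * pi"
  shows "\<bar>u y - u x\<bar> \<le> \<delta> / 2 * K + r / (2 * \<delta>)"
proof -
  have main: "\<bar>u y - u x\<bar> \<le> \<delta> / 2 * K + r / (2 * \<delta>)" if xy: "x \<le> y" "y - x \<le> r" for x y
  proof -
    let ?e = "\<lambda>n. 1 / real (Suc n)"
    have bd: "\<bar>avg3 (?e n) u y - avg3 (?e n) u x\<bar> \<le> \<delta> / 2 * K + r / (2 * \<delta>)" for n
    proof -
      have e: "?e n > 0" by simp
      let ?w = "dsm (?e n) u"
      have w: "cper ?w" using u e by (rule cper_dsm)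
      have p: "prim ?w (avg3 (?e n) u)"
      proof -
        have "continuous_on UNIV (avg (?e n) (avg (?e n) u))" using cper_avg'[OF cper_avg'[OF u e] e] by blast
        thus ?thesis unfolding avg3_def dsm_def by (intro deriv_prim avg_deriv e dq_continuous)
      qed
      have li: "integrable (Iv a b) ?w" "integrable (Iv a b) (\<lambda>x. (?w x)\<^sup>2)" for a b
        using cper_locint[OF w] cper_locint[OF cper_mult[OF w w]] by (auto simp: locint_def power2_eq_square)
      have "\<bar>avg3 (?e n) u y - avg3 (?e n) u x\<bar> = \<bar>LINT s|Iv x y. ?w s\<bar>" using prim_integral[OF p xy(1)] by simp
      also have "\<dots> \<le> (LINT s|Iv x y. \<bar>?w s\<bar>)" by (rule integral_abs_bound)
      also have "\<dots> \<le> (LINT s|Iv x y. \<delta> / 2 * (?w s)\<^sup>2 + 1 / (2 * \<delta>))"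
      proof (intro integral_mono)
        fix s
        have "0 \<le> (\<delta> * \<bar>?w s\<bar> - 1)\<^sup>2" by simp
        hence "2 * \<delta> * \<bar>?w s\<bar> \<le> \<delta> * \<delta> * (?w s)\<^sup>2 + 1" by (simp add: power2_eq_square algebra_simps)
        hence "2 * \<delta> * \<bar>?w s\<bar> / (2 * \<delta>) \<le> (\<delta> * \<delta> * (?w s)\<^sup>2 + 1) / (2 * \<delta>)" using \<delta> by (intro divide_right_mono) auto
        thus "\<bar>?w s\<bar> \<le> \<delta> / 2 * (?w s)\<^sup>2 + 1 / (2 * \<delta>)" using \<delta> by (simp add: add_divide_distrib)
      qed (use li in auto)
      also have "\<dots> = \<delta> / 2 * (LINT s|Iv x y. (?w s)\<^sup>2) + (y - x) / (2 * \<delta>)"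
        using li xy integral_Iv_const[of x y "1 / (2 * \<delta>)"] by (simp del: lebesgue_integral_const)
      also have "\<dots> \<le> \<delta> / 2 * K + r / (2 * \<delta>)"
      proof (intro add_mono mult_left_mono divide_right_mono)
        have "(LINT s|Iv x y. (?w s)\<^sup>2) \<le> (LINT s|Iv x (x + 2 * pi). (?w s)\<^sup>2)"
          using integral_Iv_split[of x "x + 2 * pi" "\<lambda>s. (?w s)\<^sup>2" y] li xy r by (simp add: integral_nonneg_AE)
        also have "\<dots> = L2sq ?w"
          using integral_Iv_periodic(2)[OF cper_Lper[OF cper_mult[OF w w]], of x] by (simp add: power2_eq_square)
        finally show "(LINT s|Iv x y. (?w s)\<^sup>2) \<le> K" using K[OF e] by linarith
      qed (use \<delta> xy in auto)
      finally show ?thesis .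
    qed
    have "(\<lambda>n. \<bar>avg3 (?e n) u y - avg3 (?e n) u x\<bar>) \<longlonglongrightarrow> \<bar>u y - u x\<bar>"
      by (intro tendsto_intros avg3_tendsto u)
    thus ?thesis by (rule LIMSEQ_le_const2) (use bd in auto)
  qed
  show ?thesis
  proof (cases "x \<le> y")
    case True then show ?thesis using main[of x y] r by simp
  next
    case False then show ?thesis using main[of y x] r by (simp add: abs_minus_commute)
  qed
qed

lemma avg_L1_bound:
  assumes f: "Lper f" and r: "0 < r" "r \<le> pi"
  shows "\<bar>avg r f x\<bar> \<le> (\<integral>x. \<bar>f x\<bar>) / (2 * r)"
proof -
  have fa: "Lper (\<lambda>x. \<bar>f x\<bar>)" using f by (auto simp: Lper_def periodic_def)
  have "\<bar>avg r f x\<bar> \<le> avg r (\<lambda>x. \<bar>f x\<bar>) x" using abs_avg_le[OF Lper_locint[OF f] r(1)] .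
  also have "\<dots> = (LINT y|Iv (x - r) (x + r). \<bar>f y\<bar>) / (2 * r)" by (rule avg_Iv)
  also have "\<dots> \<le> (LINT y|Iv (x - r) (x - r + 2 * pi). \<bar>f y\<bar>) / (2 * r)"
  proof (intro divide_right_mono)
    have "integrable (Iv (x - r) (x - r + 2 * pi)) (\<lambda>x. \<bar>f x\<bar>)" by (rule integral_Iv_periodic(1)[OF fa])
    thus "(LINT y|Iv (x - r) (x + r). \<bar>f y\<bar>) \<le> (LINT y|Iv (x - r) (x - r + 2 * pi). \<bar>f y\<bar>)"
      using integral_Iv_split[of "x - r" "x - r + 2 * pi" "\<lambda>x. \<bar>f x\<bar>" "x + r"] r by (simp add: integral_nonneg_AE)
  qed (use r in auto)
  also have "\<dots> = (\<integral>x. \<bar>f x\<bar>) / (2 * r)" using integral_Iv_periodic(2)[OF fa] by simp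
  finally show ?thesis .
qed

text \<open>An increment in time is the divergence of an integrable flux, hence small only in a
  negative norm. Two averages of width \<open>r\<close> turn it into a bounded function at the price
  of \<open>r * r\<close>, and removing them again costs four times the spatial modulus, two
  averages for each of \<open>u\<close> and \<open>w\<close>.\<close>

lemma time_modulus:
  assumes u: "cper u" and w: "cper w" and J: "cper J" and e: "e > 0"
    and eq: "\<And>x. w x - u x = - dsm e J x"
    and K: "\<And>k. k > 0 \<Longrightarrow> L2sq (dsm k u) \<le> K" "\<And>k. k > 0 \<Longrightarrow> L2sq (dsm k w) \<le> K"
    and r: "0 < r" "r \<le> pi" and \<delta>: "\<delta> > 0"
  shows "\<bar>w x - u x\<bar> \<le> 4 * (\<delta> / 2 * K + r / (2 * \<delta>)) + (\<integral>x. \<bar>J x\<bar>) / (2 * r * r)"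
proof -
  define \<omega> where "\<omega> = \<delta> / 2 * K + r / (2 * \<delta>)"
  have near: "\<bar>avg r (avg r v) x - v x\<bar> \<le> 2 * \<omega>" if v: "cper v" "\<And>k. k > 0 \<Longrightarrow> L2sq (dsm k v) \<le> K" for v
  proof -
    have 1: "\<bar>avg r v y - v y\<bar> \<le> \<omega>" for y
      unfolding \<omega>_def using r pi_gt_zero by (intro avg_near cper_locint v space_modulus[OF v \<delta>]) auto
    have "\<bar>avg r (\<lambda>y. avg r v y - v y) x\<bar> \<le> \<omega>"
      using v r 1 by (intro avg_bound cper_locint cper_diff cper_avg') auto
    hence "\<bar>avg r (avg r v) x - avg r v x\<bar> \<le> \<omega>"
      using avg_diff[of "avg r v" v r x] v r by (simp add: cper_locint cper_simps)
    thus ?thesis using 1[of x] by linarith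
  qed
  let ?X = "\<lambda>x. w x - u x"
  have X: "cper ?X" using u w by (rule cper_diff[rotated])
  have "\<bar>avg r (avg r ?X) x - ?X x\<bar> \<le> 4 * \<omega>"
  proof -
    have "avg r (avg r ?X) x = avg r (avg r w) x - avg r (avg r u) x"
    proof -
      have l: "locint u" "locint w" "locint (avg r u)" "locint (avg r w)" using u w r by (auto simp: cper_simps intro!: cper_locint)
      have "avg r ?X = (\<lambda>x. avg r w x - avg r u x)" using avg_diff[OF l(2,1)] by (rule ext)
      thus ?thesis using avg_diff[OF l(4,3), of r x] by simp
    qed
    thus ?thesis using near[OF u K(1)] near[OF w K(2)] by linarith
  qed
  moreover have "\<bar>avg r (avg r ?X) x\<bar> \<le> (\<integral>x. \<bar>J x\<bar>) / (2 * r * r)"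
  proof -
    have "avg r (avg r ?X) = avg r (avg r (\<lambda>x. (- 1) * dsm e J x))" using eq by simp
    also have "\<dots> = (\<lambda>x. - avg r (avg r (dsm e J)) x)" by (simp add: avg_cmult[of _ "- 1", simplified, abs_def])
    also have "avg r (dsm e J) = dq r (avg3 e J)"
      unfolding dsm_def avg3_def using J e r by (intro avg_locint_dq(2) cper_locint) (auto simp: cper_simps)
    also have "avg r (dq r (avg3 e J)) = dq r (avg r (avg3 e J))"
      using J e r by (intro avg_locint_dq(1) cper_locint) (auto simp: cper_simps)
    finally have "\<bar>avg r (avg r ?X) x\<bar> = \<bar>dq r (avg r (avg3 e J)) x\<bar>" by simp
    also have "\<dots> \<le> (\<integral>x. \<bar>J x\<bar>) / (2 * r) / r"
    proof (rule dq_bound[OF r(1)])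
      fix y
      have c: "cper (avg3 e J)" using J e by (rule cper_avg3)
      have "\<bar>avg r (avg3 e J) y\<bar> \<le> (\<integral>x. \<bar>avg3 e J x\<bar>) / (2 * r)" by (rule avg_L1_bound[OF cper_Lper[OF c] r])
      also have "\<dots> \<le> (\<integral>x. \<bar>J x\<bar>) / (2 * r)"
        using Lpc_avg3(2)[OF cper_Lpc[OF J, of 1] _ e] r by (intro divide_right_mono) auto
      finally show "\<bar>avg r (avg3 e J) y\<bar> \<le> (\<integral>x. \<bar>J x\<bar>) / (2 * r)" .
    qed
    finally show ?thesis by simp
  qed
  ultimately show ?thesis unfolding \<omega>_def[symmetric] by linarith
qed

lemma abs_powr_2: "\<bar>x\<bar> powr 2 = x\<^sup>2" for x :: real
  by simp

lemma avg3_integral_tendsto: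
  assumes u: "cper u" and w: "cper w"
  shows "(\<lambda>n. \<integral>x. avg3 (1 / real (Suc n)) u x * avg3 (1 / real (Suc n)) w x) \<longlonglongrightarrow> (\<integral>x. u x * w x)"
proof (rule Lp_conv_mult[where p = 2 and q = 2])
  have L: "Lpc 2 u" "Lpc 2 w" using u w by (auto intro: cper_Lpc)
  show "Lpf circ 2 (avg3 (1 / real (Suc n)) u)" "Lpf circ 2 (avg3 (1 / real (Suc n)) w)" for n
    using L by (auto intro!: Lpc_Lpf Lpc_avg3)
  show "Lpf circ 2 u" "Lpf circ 2 w" using L by (auto intro!: Lpc_Lpf)
  show "Lp_conv circ 2 (\<lambda>n. avg3 (1 / real (Suc n)) u) u" "Lp_conv circ 2 (\<lambda>n. avg3 (1 / real (Suc n)) w) w"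
    by (rule Lp_conv_avg3[OF L(1)] Lp_conv_avg3[OF L(2)], simp, simp, rule avg_small_step)+
qed auto

lemma avg3_sq_le:
  assumes "Lpc 2 u" "e > 0" shows "L2sq (avg3 e u) \<le> L2sq u"
  using Lpc_avg3(2)[OF assms(1) _ assms(2)] by (simp add: abs_powr_2)

section \<open>The explicit Euler scheme\<close>

locale film =
  fixes \<alpha> C0 :: real and h0 v0 :: "real \<Rightarrow> real"
  assumes alpha: "\<alpha> > 0" and h0: "cper h0" and v0: "Lpc 2 v0" and prim0: "prim v0 h0"
    and C0: "C0 > 0" and h0_ge: "\<And>x. C0 \<le> h0 x"
begin

abbreviation E0 :: real where "E0 \<equiv> 1 / 2 * L2sq v0 - 1 / 2 * L2sq h0"

definition cl :: real where "cl = C0 / 2"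

definition M0 :: real where "M0 = (SOME B. \<forall>x. \<bar>h0 x\<bar> \<le> B)"

text \<open>The iterates are shown to stay within \<open>C0 / 2\<close> of \<open>h0\<close>. The
  other half of \<open>C0\<close> leaves room for one further step before its closeness is known
  (\<open>existence_time\<close>).\<close>

definition M :: real where "M = M0 + C0"

text \<open>Truncating the mobility below keeps the scheme meaningful before its iterates are known to be
  positive; for small times they never reach the truncation level \<open>cl\<close>.\<close>

definition mob :: "real \<Rightarrow> real" where "mob s = (max cl s) powr (\<alpha> + 2)"

definition JJ :: "real \<Rightarrow> (real \<Rightarrow> real) \<Rightarrow> real \<Rightarrow> real" where
  "JJ e h x = mob (h x) * \<psi> \<alpha> (zz e h x)"

primrec H :: "real \<Rightarrow> real \<Rightarrow> nat \<Rightarrow> real \<Rightarrow> real" where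
  "H e \<tau> 0 = h0"
| "H e \<tau> (Suc j) = (\<lambda>x. H e \<tau> j x - \<tau> * dsm e (JJ e (H e \<tau> j)) x)"

text \<open>For fixed \<open>e\<close> the discrete flux is bounded by \<open>Bj e\<close>, so that the error of the explicit time
  stepping vanishes if \<open>\<tau>\<close> tends to zero fast enough in terms of \<open>e\<close>.\<close>

definition Bj :: "real \<Rightarrow> real" where
  "Bj e = M powr (\<alpha> + 2) * (M / e + M / e ^ 3) powr \<alpha>"

text \<open>Half of \<open>K\<close> dominates the right-hand side of
  \<open>energy_inequality\<close>: the Dirichlet energy of \<open>h0\<close>, \<pi> times
  \<open>M\<close> squared for half the L_2 term, and 1 for \<open>err\<close>.\<close>

definition K :: real where
  "K = L2sq v0 + 2 * pi * M\<^sup>2 + 2"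

lemma M0: "\<bar>h0 x\<bar> \<le> M0"
proof -
  obtain B where "\<And>x. \<bar>h0 x\<bar> \<le> B" using cper_bounded[OF h0] by blast
  hence "\<forall>x. \<bar>h0 x\<bar> \<le> B" by blast
  hence "\<forall>x. \<bar>h0 x\<bar> \<le> M0" unfolding M0_def by (rule someI)
  thus ?thesis by blast
qed

lemma cl_pos: "cl > 0" and cl_le_M: "cl \<le> M" and M_pos: "M > 0"
  using C0 h0_ge[of 0] M0[of 0] by (auto simp: cl_def M_def)

lemma K_pos: "K > 0"
proof -
  have "0 \<le> L2sq v0" by simp
  thus ?thesis by (simp add: K_def add_nonneg_pos)
qed

lemma mob_cont: "continuous_on UNIV mob"
  unfolding mob_def using cl_pos by (intro continuous_intros) (auto simp: max_def)

lemma mob_pos: "mob s > 0" and mob_ge: "mob s \<ge> cl powr (\<alpha> + 2)"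
  using cl_pos alpha by (auto simp: mob_def max_def intro!: powr_mono2)

lemma mob_le: "s \<le> M \<Longrightarrow> mob s \<le> M powr (\<alpha> + 2)"
  unfolding mob_def using cl_pos cl_le_M alpha by (intro powr_mono2) auto

lemma cper_JJ: "cper h \<Longrightarrow> e > 0 \<Longrightarrow> cper (JJ e h)"
proof
  assume h: "cper h" and e: "e > 0"
  show "continuous_on UNIV (JJ e h)"
    unfolding JJ_def[abs_def] using h cper_zz[OF h e] alpha
    by (intro continuous_intros continuous_on_compose2[OF mob_cont]) auto
  show "periodic (JJ e h)" using h cper_zz[OF h e] by (simp add: periodic_def JJ_def)
qed

lemma cper_H: "e > 0 \<Longrightarrow> cper (H e \<tau> j)"
proof (induction j)
  case (Suc j)
  have "cper (\<lambda>x. H e \<tau> j x - \<tau> * dsm e (JJ e (H e \<tau> j)) x)"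
    using Suc by (intro cper_diff cper_cmult cper_dsm cper_JJ) auto
  thus ?case by simp
qed (simp add: h0)

lemma JJ_bound:
  assumes "cper h" "e > 0" "\<And>x. \<bar>h x\<bar> \<le> M"
  shows "\<bar>JJ e h x\<bar> \<le> Bj e"
proof -
  have "\<bar>JJ e h x\<bar> = mob (h x) * \<bar>zz e h x\<bar> powr \<alpha>"
    using mob_pos[of "h x"] by (simp add: JJ_def abs_mult abs_psi)
  also have "\<dots> \<le> Bj e"
    unfolding Bj_def using zz_bound[OF assms, of x] assms(3)[of x] mob_pos[of "h x"] alpha
    by (intro mult_mono mob_le powr_mono2) auto
  finally show ?thesis .
qed

lemma JJ_zz: "JJ e h x * zz e h x = mob (h x) * \<bar>zz e h x\<bar> powr (\<alpha> + 1)"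
  using psi_mult_self[of \<alpha> "zz e h x"] by (simp add: JJ_def)

lemma JJ_zz_nonneg: "JJ e h x * zz e h x \<ge> 0"
  unfolding JJ_zz using mob_pos[of "h x"] by simp

text \<open>For large \<open>z\<close> the flux is smaller than the dissipation density by a factor
  of order \<open>1 / \<bar>z\<bar>\<close>. An arbitrarily small multiple of the dissipation plus a
  constant thus bounds it, which makes the flux small in L_1 over short times.\<close>

lemma JJ_le:
  assumes "h x \<le> M" and \<delta>: "\<delta> > 0"
  shows "\<bar>JJ e h x\<bar> \<le> \<delta> * (JJ e h x * zz e h x) + M powr (\<alpha> + 2) * (1 / \<delta>) powr \<alpha>"
proof -
  let ?z = "\<bar>zz e h x\<bar>"
  have "?z powr \<alpha> \<le> \<delta> * ?z powr (\<alpha> + 1) + (1 / \<delta>) powr \<alpha>"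
  proof (cases "?z \<le> 1 / \<delta>")
    case True
    hence "?z powr \<alpha> \<le> (1 / \<delta>) powr \<alpha>" using alpha by (intro powr_mono2) auto
    moreover have "0 \<le> \<delta> * ?z powr (\<alpha> + 1)" using \<delta> by simp
    ultimately show ?thesis by linarith
  next
    case False
    hence z: "?z > 0" "1 \<le> \<delta> * ?z" using \<delta> by (auto simp: not_le field_simps intro: less_trans[of 0 "1/\<delta>"])
    have "?z powr \<alpha> = ?z powr \<alpha> * 1" by simp
    also have "\<dots> \<le> ?z powr \<alpha> * (\<delta> * ?z)" using z by (intro mult_left_mono) auto
    also have "\<dots> = \<delta> * ?z powr (\<alpha> + 1)" using z by (simp add: powr_add)
    finally show ?thesis by (simp add: add_increasing2)
  qed
  hence "mob (h x) * ?z powr \<alpha> \<le> mob (h x) * (\<delta> * ?z powr (\<alpha> + 1) + (1 / \<delta>) powr \<alpha>)"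
    using mob_pos[of "h x"] by (intro mult_left_mono) auto
  also have "\<dots> \<le> \<delta> * (mob (h x) * ?z powr (\<alpha> + 1)) + M powr (\<alpha> + 2) * (1 / \<delta>) powr \<alpha>"
    using mob_le[OF assms(1)] by (simp add: distrib_left mult.left_commute mult_right_mono)
  finally show ?thesis using mob_pos[of "h x"] unfolding JJ_zz by (simp add: JJ_def abs_mult abs_psi)
qed

lemma En_h0_le:
  assumes d: "d > 0"
  shows "En d h0 \<le> 1 / 2 * L2sq v0 - 1 / 2 * L2sq (avg3 d h0)"
proof -
  have i: "integrable circ (\<lambda>x. (dsm d h0 x)\<^sup>2)" "integrable circ (\<lambda>x. (avg3 d h0 x)\<^sup>2)"
    unfolding power2_eq_square using h0 d by (auto intro!: cper_integrable cper_mult simp: cper_simps)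
  have "L2sq (dsm d h0) \<le> L2sq v0"
    unfolding dsm_of_prim[OF h0 prim0 d] by (rule avg3_sq_le[OF v0 d])
  thus ?thesis unfolding En_def using i by simp
qed

lemma energy_sum:
  assumes e: "e > 0" "d > 0"
  shows "En d (H e \<tau> j) + \<tau> * (\<Sum>i<j. \<integral>x. avg3 d (JJ e (H e \<tau> i)) x * avg3 d (zz e (H e \<tau> i)) x)
    = En d h0 + \<tau>\<^sup>2 * (\<Sum>i<j. En d (dsm e (JJ e (H e \<tau> i))))"
proof (induction j)
  case (Suc j)
  have "En d (H e \<tau> (Suc j)) = En d (H e \<tau> j) - \<tau> * (\<integral>x. avg3 d (JJ e (H e \<tau> j)) x * avg3 d (zz e (H e \<tau> j)) x)
     + \<tau>\<^sup>2 * En d (dsm e (JJ e (H e \<tau> j)))"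
    using energy_step[OF cper_H[OF e(1)] cper_JJ[OF cper_H[OF e(1)] e(1)] e] by simp
  with Suc show ?case by (simp add: algebra_simps)
qed simp

text \<open>The second order terms of all steps together: at most \<open>1 / \<tau>\<close> steps,
  each contributing \<open>\<tau>\<^sup>2\<close> times the bound of
  \<open>En_flux_bound\<close>.\<close>

definition err :: "real \<Rightarrow> real \<Rightarrow> real" where
  "err e \<tau> = \<tau> * (pi * (Bj e / e / e)\<^sup>2)"

lemma energy_error:
  assumes e: "0 < e" "e \<le> 1" "d > 0" and \<tau>: "\<tau> > 0" and bd: "\<And>i x. i < j \<Longrightarrow> \<bar>H e \<tau> i x\<bar> \<le> M" and j: "real j * \<tau> \<le> 1"
  shows "\<bar>\<tau>\<^sup>2 * (\<Sum>i<j. En d (dsm e (JJ e (H e \<tau> i))))\<bar> \<le> err e \<tau>"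
proof -
  have "\<bar>\<Sum>i<j. En d (dsm e (JJ e (H e \<tau> i)))\<bar> \<le> (\<Sum>i<j. pi * (Bj e / e / e)\<^sup>2)"
    using e bd by (intro order_trans[OF sum_abs] sum_mono En_flux_bound cper_JJ cper_H JJ_bound) auto
  hence "\<bar>\<tau>\<^sup>2 * (\<Sum>i<j. En d (dsm e (JJ e (H e \<tau> i))))\<bar> \<le> \<tau>\<^sup>2 * (real j * (pi * (Bj e / e / e)\<^sup>2))"
    unfolding abs_mult by (intro mult_mono) auto
  also have "\<dots> = (real j * \<tau>) * err e \<tau>" by (simp add: err_def power2_eq_square)
  also have "\<dots> \<le> 1 * err e \<tau>" using j \<tau> by (intro mult_right_mono) (auto simp: err_def)
  finally show ?thesis by simp
qed

text \<open>\<open>energy_sum\<close> at width \<open>d\<close> with \<open>d\<close> tending to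
  zero. The Dirichlet integral stays behind a fixed \<open>dsm k\<close>, which loses only an
  inequality and survives uniform limits later on.\<close>

lemma energy_inequality:
  assumes e: "0 < e" "e \<le> 1" and \<tau>: "\<tau> > 0" and bd: "\<And>i x. i < j \<Longrightarrow> \<bar>H e \<tau> i x\<bar> \<le> M" and j: "real j * \<tau> \<le> 1" and k: "k > 0"
  shows "1 / 2 * L2sq (dsm k (H e \<tau> j)) + \<tau> * (\<Sum>i<j. \<integral>x. JJ e (H e \<tau> i) x * zz e (H e \<tau> i) x)
    \<le> E0 + 1 / 2 * L2sq (H e \<tau> j) + err e \<tau>"
proof -
  let ?d = "\<lambda>n. 1 / real (Suc n)"
  let ?u = "H e \<tau> j"
  let ?J = "\<lambda>i. JJ e (H e \<tau> i)" and ?z = "\<lambda>i. zz e (H e \<tau> i)"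
  have u: "cper ?u" using e(1) by (rule cper_H)
  have c: "cper (?J i)" "cper (?z i)" for i using e by (simp_all add: cper_JJ cper_zz cper_H)
  have "1 / 2 * L2sq (avg3 (?d n) (dsm k ?u)) + \<tau> * (\<Sum>i<j. \<integral>x. avg3 (?d n) (?J i) x * avg3 (?d n) (?z i) x)
    \<le> 1 / 2 * L2sq v0 - 1 / 2 * L2sq (avg3 (?d n) h0) + 1 / 2 * L2sq (avg3 (?d n) ?u) + err e \<tau>" for n
  proof -
    have d: "?d n > 0" by simp
    \<comment> \<open>The widths are exchanged: the average of width \<open>k\<close> contracts the
      norm of \<open>dsm (?d n) ?u\<close>, while the average of width \<open>?d n\<close> that is
      left disappears in the limit.\<close>
    have "L2sq (avg3 (?d n) (dsm k ?u)) = L2sq (avg3 k (dsm (?d n) ?u))"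
      using dsm_avg3[OF u k d] by simp
    also have "\<dots> \<le> L2sq (dsm (?d n) ?u)"
      by (rule avg3_sq_le[OF cper_Lpc[OF cper_dsm[OF u d]] k]) simp
    finally have 1: "L2sq (avg3 (?d n) (dsm k ?u)) \<le> L2sq (dsm (?d n) ?u)" .
    show ?thesis using energy_sum[OF e(1) d, of \<tau> j] abs_le_D1[OF energy_error[OF e d \<tau> bd j]] En_h0_le[OF d] 1
      unfolding En_split[OF u d] by linarith
  qed
  moreover have "(\<lambda>n. 1 / 2 * L2sq (avg3 (?d n) (dsm k ?u)) + \<tau> * (\<Sum>i<j. \<integral>x. avg3 (?d n) (?J i) x * avg3 (?d n) (?z i) x))
     \<longlonglongrightarrow> 1 / 2 * L2sq (dsm k ?u) + \<tau> * (\<Sum>i<j. \<integral>x. ?J i x * ?z i x)"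
    unfolding power2_eq_square by (intro tendsto_intros avg3_integral_tendsto cper_dsm u k c)
  moreover have "(\<lambda>n. 1 / 2 * L2sq v0 - 1 / 2 * L2sq (avg3 (?d n) h0) + 1 / 2 * L2sq (avg3 (?d n) ?u) + err e \<tau>)
     \<longlonglongrightarrow> E0 + 1 / 2 * L2sq ?u + err e \<tau>"
    unfolding power2_eq_square by (intro tendsto_intros avg3_integral_tendsto h0 u)
  ultimately show ?thesis by (intro LIMSEQ_le) auto
qed

text \<open>The condition on \<open>\<tau> * (Bj e / e)\<close> keeps a single step below
  \<open>C0 / 2\<close>; the one on \<open>err\<close> keeps the energy bound \<open>K\<close>
  independent of the discretisation.\<close>

definition good :: "real \<Rightarrow> real \<Rightarrow> bool" where
  "good e \<tau> \<longleftrightarrow> 0 < e \<and> e \<le> 1 \<and> 0 < \<tau> \<and> \<tau> * (Bj e / e) \<le> C0 / 2 \<and> err e \<tau> \<le> 1"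

lemma a_priori:
  assumes g: "good e \<tau>" and bd: "\<And>i x. i \<le> j \<Longrightarrow> \<bar>H e \<tau> i x\<bar> \<le> M" and j: "real j * \<tau> \<le> 1"
  shows "k > 0 \<Longrightarrow> L2sq (dsm k (H e \<tau> j)) \<le> K"
    and "\<tau> * (\<Sum>i<j. \<integral>x. JJ e (H e \<tau> i) x * zz e (H e \<tau> i) x) \<le> K"
proof -
  have e: "0 < e" "e \<le> 1" "\<tau> > 0" "err e \<tau> \<le> 1" using g by (auto simp: good_def)
  let ?S = "\<tau> * (\<Sum>i<j. \<integral>x. JJ e (H e \<tau> i) x * zz e (H e \<tau> i) x)"
  have S0: "?S \<ge> 0" using e JJ_zz_nonneg by (intro mult_nonneg_nonneg sum_nonneg integral_nonneg_AE) auto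
  have h2: "L2sq (H e \<tau> j) \<le> 2 * pi * M\<^sup>2" using L2sq_bound[OF cper_H[OF e(1)] bd[OF order_refl]] by simp
  have h0': "0 \<le> L2sq h0" "0 \<le> L2sq v0" by simp_all
  have main: "1 / 2 * L2sq (dsm k (H e \<tau> j)) + ?S \<le> K / 2" if "k > 0" for k
  proof -
    have "1 / 2 * L2sq (dsm k (H e \<tau> j)) + ?S \<le> E0 + 1 / 2 * L2sq (H e \<tau> j) + err e \<tau>"
      using bd by (intro energy_inequality e j that) auto
    thus ?thesis using h2 h0' e(4) unfolding K_def add_divide_distrib by linarith
  qed
  show "k > 0 \<Longrightarrow> L2sq (dsm k (H e \<tau> j)) \<le> K" using main[of k] S0 by linarith
  have "0 \<le> L2sq (dsm 1 (H e \<tau> j))" by simp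
  thus "?S \<le> K" using main[of 1] K_pos by linarith
qed

lemma H_diff:
  assumes e: "e > 0" and ij: "i \<le> j"
  shows "H e \<tau> j x - H e \<tau> i x = - dsm e (\<lambda>x. \<Sum>l=i..<j. \<tau> * JJ e (H e \<tau> l) x) x"
  using ij
proof (induction j rule: dec_induct)
  case base
  show ?case by (simp add: dsm_def dq_def avg_def)
next
  case (step j)
  have c: "cper (JJ e (H e \<tau> l))" for l using e by (intro cper_JJ cper_H)
  have cs: "cper (\<lambda>x. \<Sum>l=i..<j. \<tau> * JJ e (H e \<tau> l) x)" by (intro cper_sum cper_cmult c)
  have "dsm e (\<lambda>x. \<Sum>l=i..<Suc j. \<tau> * JJ e (H e \<tau> l) x) = dsm e (\<lambda>x. 1 * (\<Sum>l=i..<j. \<tau> * JJ e (H e \<tau> l) x) + \<tau> * JJ e (H e \<tau> j) x)"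
    using step by simp
  also have "\<dots> = (\<lambda>x. 1 * dsm e (\<lambda>x. \<Sum>l=i..<j. \<tau> * JJ e (H e \<tau> l) x) x + \<tau> * dsm e (JJ e (H e \<tau> j)) x)"
    using c cs e by (intro dsm_lin cper_locint) auto
  finally show ?case using step.IH by simp
qed

text \<open>\<open>time_modulus\<close> for the flux accumulated between steps \<open>i\<close> and
  \<open>j\<close>, whose L_1 norm is controlled by \<open>JJ_le\<close> and the total dissipation.
  The resulting \<open>d\<close> depends on \<epsilon> only, not on the discretisation.\<close>

lemma modulus:
  assumes \<epsilon>: "\<epsilon> > 0"
  obtains d where "d > 0" "\<And>e \<tau> i j x. good e \<tau> \<Longrightarrow> i \<le> j \<Longrightarrow> (\<And>l x. l \<le> j \<Longrightarrow> \<bar>H e \<tau> l x\<bar> \<le> M) \<Longrightarrow> real j * \<tau> \<le> 1 \<Longrightarrow>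
     real (j - i) * \<tau> \<le> d \<Longrightarrow> \<bar>H e \<tau> j x - H e \<tau> i x\<bar> \<le> \<epsilon>"
proof -
  \<comment> \<open>The four constants are balanced so that the Dirichlet part, the part with
    \<open>r\<close>, the dissipation part and the part with the elapsed time each contribute at
    most a quarter of \<epsilon>.\<close>
  define \<delta> where "\<delta> = \<epsilon> / (8 * K)"
  have \<delta>: "\<delta> > 0" using \<epsilon> K_pos by (simp add: \<delta>_def)
  define r where "r = min 1 (\<epsilon> * \<delta> / 8)"
  have r: "0 < r" "r \<le> pi" "r \<le> \<epsilon> * \<delta> / 8" using \<epsilon> \<delta> pi_gt3 by (auto simp: r_def)
  define \<delta>' where "\<delta>' = \<epsilon> * r * r / (2 * K)"
  have \<delta>': "\<delta>' > 0" using \<epsilon> r K_pos by (simp add: \<delta>'_def)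
  define L where "L = M powr (\<alpha> + 2) * (1 / \<delta>') powr \<alpha>"
  have L: "L > 0" using M_pos \<delta>' by (simp add: L_def)
  define d where "d = \<epsilon> * r * r / (4 * pi * L)"
  have d: "d > 0" using \<epsilon> r L by (simp add: d_def)
  show ?thesis
  proof (rule that[OF d])
    fix e \<tau> i j x
    assume g: "good e \<tau>" and ij: "i \<le> j" and bd: "\<And>l x. l \<le> j \<Longrightarrow> \<bar>H e \<tau> l x\<bar> \<le> M" and j: "real j * \<tau> \<le> 1"
      and small: "real (j - i) * \<tau> \<le> d"
    have e: "e > 0" "\<tau> > 0" using g by (auto simp: good_def)
    let ?J = "\<lambda>l. JJ e (H e \<tau> l)" and ?z = "\<lambda>l. zz e (H e \<tau> l)"
    let ?S = "\<lambda>x. \<Sum>l=i..<j. \<tau> * ?J l x"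
    have c: "cper (?J l)" "cper (?z l)" for l using e by (simp_all add: cper_JJ cper_zz cper_H)
    have iJ: "integrable circ (\<lambda>x. \<bar>?J l x\<bar>)" "integrable circ (\<lambda>x. ?J l x * ?z l x)" for l
      using cper_integrable[OF c(1)] by (auto intro!: cper_integrable cper_mult c)
    have i1: "real i * \<tau> \<le> 1"
    proof -
      have "real i * \<tau> \<le> real j * \<tau>" using ij e by (intro mult_right_mono) auto
      thus ?thesis using j by linarith
    qed
    have main: "\<bar>H e \<tau> j x - H e \<tau> i x\<bar> \<le> 4 * (\<delta> / 2 * K + r / (2 * \<delta>)) + (\<integral>x. \<bar>?S x\<bar>) / (2 * r * r)"
    proof (rule time_modulus[OF cper_H[OF e(1)] cper_H[OF e(1)] _ e(1) H_diff[OF e(1) ij] _ _ r(1,2) \<delta>])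
      show "cper ?S" by (intro cper_sum cper_cmult c)
      show "L2sq (dsm k (H e \<tau> i)) \<le> K" "L2sq (dsm k (H e \<tau> j)) \<le> K" if "k > 0" for k
        using a_priori(1)[OF g _ i1 that] a_priori(1)[OF g _ j that] bd ij by auto
    qed
    have "(\<integral>x. \<bar>?S x\<bar>) \<le> \<delta>' * K + 2 * pi * L * d"
    proof -
      have "(\<integral>x. \<bar>?S x\<bar>) \<le> (\<integral>x. (\<Sum>l=i..<j. \<tau> * \<bar>?J l x\<bar>))"
      proof (intro integral_mono)
        show "integrable circ (\<lambda>x. \<bar>?S x\<bar>)" using cper_integrable[OF c(1)] by auto
        fix x
        have "\<bar>?S x\<bar> \<le> (\<Sum>l=i..<j. \<bar>\<tau> * ?J l x\<bar>)" by (rule sum_abs)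
        thus "\<bar>?S x\<bar> \<le> (\<Sum>l=i..<j. \<tau> * \<bar>?J l x\<bar>)" using e by (simp add: abs_mult)
      qed (use iJ in auto)
      also have "\<dots> = \<tau> * (\<Sum>l=i..<j. \<integral>x. \<bar>?J l x\<bar>)" using iJ by (simp add: sum_distrib_left)
      also have "\<dots> \<le> \<tau> * (\<Sum>l=i..<j. \<delta>' * (\<integral>x. ?J l x * ?z l x) + 2 * pi * L)"
      proof (intro mult_left_mono sum_mono)
        fix l assume l: "l \<in> {i..<j}"
        have "(\<integral>x. \<bar>?J l x\<bar>) \<le> (\<integral>x. \<delta>' * (?J l x * ?z l x) + L)"
        proof (intro integral_mono)
          show "\<bar>?J l x\<bar> \<le> \<delta>' * (?J l x * ?z l x) + L" for x
            unfolding L_def using bd[of l x] l by (intro JJ_le \<delta>') auto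
        qed (use iJ in auto)
        also have "\<dots> = \<delta>' * (\<integral>x. ?J l x * ?z l x) + 2 * pi * L"
          using iJ integral_Iv_const[of 0 "2 * pi" L] by (simp del: lebesgue_integral_const)
        finally show "(\<integral>x. \<bar>?J l x\<bar>) \<le> \<delta>' * (\<integral>x. ?J l x * ?z l x) + 2 * pi * L" .
      qed (use e in simp)
      also have "\<dots> = \<delta>' * (\<tau> * (\<Sum>l=i..<j. \<integral>x. ?J l x * ?z l x)) + 2 * pi * L * (real (j - i) * \<tau>)"
        by (simp add: sum.distrib sum_distrib_left algebra_simps)
      also have "\<dots> \<le> \<delta>' * K + 2 * pi * L * d"
      proof (intro add_mono mult_left_mono small)
        have "(\<Sum>l=i..<j. \<integral>x. ?J l x * ?z l x) \<le> (\<Sum>l<j. \<integral>x. ?J l x * ?z l x)"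
          using JJ_zz_nonneg by (intro sum_mono2 integral_nonneg_AE) auto
        hence "\<tau> * (\<Sum>l=i..<j. \<integral>x. ?J l x * ?z l x) \<le> \<tau> * (\<Sum>l<j. \<integral>x. ?J l x * ?z l x)"
          using e by (intro mult_left_mono) auto
        also have "\<dots> \<le> K" using bd by (intro a_priori(2)[OF g _ j]) auto
        finally show "\<tau> * (\<Sum>l=i..<j. \<integral>x. ?J l x * ?z l x) \<le> K" .
      qed (use \<delta>' L in auto)
      finally show ?thesis .
    qed
    from divide_right_mono[OF this, of "2 * r * r"] have "(\<integral>x. \<bar>?S x\<bar>) / (2 * r * r) \<le> (\<delta>' * K + 2 * pi * L * d) / (2 * r * r)"
      using r by simp
    also have "(\<delta>' * K + 2 * pi * L * d) / (2 * r * r) = \<epsilon> / 4 + \<epsilon> / 4"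
      using r K_pos L by (simp add: \<delta>'_def d_def field_simps)
    also have "\<dots> = \<epsilon> / 2" by simp
    finally have 1: "(\<integral>x. \<bar>?S x\<bar>) / (2 * r * r) \<le> \<epsilon> / 2" .
    have 2: "4 * (\<delta> / 2 * K) = \<epsilon> / 4" using K_pos by (simp add: \<delta>_def)
    have 3: "4 * (r / (2 * \<delta>)) \<le> \<epsilon> / 4" using r(3) \<delta> by (simp add: field_simps)
    have "4 * (\<delta> / 2 * K + r / (2 * \<delta>)) = 4 * (\<delta> / 2 * K) + 4 * (r / (2 * \<delta>))" by (simp add: distrib_left)
    thus "\<bar>H e \<tau> j x - H e \<tau> i x\<bar> \<le> \<epsilon>" using main 1 2 3 by linarith
  qed
qed

text \<open>A continuation argument by induction on the step: the bound \<open>M\<close> up to step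
  \<open>j\<close> makes \<open>modulus\<close> applicable, and for short times
  \<open>modulus\<close> returns the stronger bound \<open>C0 / 2\<close> for the distance to
  \<open>h0\<close>.\<close>

lemma existence_time:
  obtains T where "0 < T" "T \<le> 1"
    "\<And>e \<tau> j x. good e \<tau> \<Longrightarrow> real j * \<tau> \<le> T \<Longrightarrow> \<bar>H e \<tau> j x - h0 x\<bar> \<le> C0 / 2"
proof -
  obtain d where d: "d > 0" "\<And>e \<tau> i j x. good e \<tau> \<Longrightarrow> i \<le> j \<Longrightarrow> (\<And>l x. l \<le> j \<Longrightarrow> \<bar>H e \<tau> l x\<bar> \<le> M) \<Longrightarrow> real j * \<tau> \<le> 1 \<Longrightarrow>
     real (j - i) * \<tau> \<le> d \<Longrightarrow> \<bar>H e \<tau> j x - H e \<tau> i x\<bar> \<le> C0 / 2"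
    using modulus[of "C0 / 2"] C0 by (metis half_gt_zero)
  define T where "T = min 1 d"
  have "\<forall>x. \<bar>H e \<tau> j x - h0 x\<bar> \<le> C0 / 2" if g: "good e \<tau>" and j: "real j * \<tau> \<le> T" for e \<tau> j
    using j
  proof (induction j rule: less_induct)
    case (less j)
    have e: "e > 0" "\<tau> > 0" using g by (auto simp: good_def)
    have IH: "\<bar>H e \<tau> l x - h0 x\<bar> \<le> C0 / 2" if "l < j" for l x
    proof -
      have "real l * \<tau> \<le> real j * \<tau>" using that e by (intro mult_right_mono) auto
      thus ?thesis using less.IH[OF that] less.prems by auto
    qed
    have bl: "\<bar>H e \<tau> l x\<bar> \<le> M0 + C0 / 2" if "l < j" for l x using IH[OF that, of x] M0[of x] by linarith
    \<comment> \<open>For the current step itself only the crude estimate is available: the previous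
      iterate plus one step of size at most \<open>C0 / 2\<close>.\<close>
    have bj: "\<bar>H e \<tau> j x\<bar> \<le> M" for x
    proof (cases j)
      case 0 then show ?thesis using M0[of x] C0 by (simp add: M_def)
    next
      case (Suc l)
      have "\<bar>dsm e (JJ e (H e \<tau> l)) x\<bar> \<le> Bj e / e"
        unfolding dsm_def
      proof (rule dq_bound[OF e(1)])
        fix y
        have c: "cper (JJ e (H e \<tau> l))" using e by (intro cper_JJ cper_H)
        have "\<bar>JJ e (H e \<tau> l) y\<bar> \<le> Bj e" for y
          
        proof (rule JJ_bound[OF cper_H[OF e(1)] e(1)])
          show "\<bar>H e \<tau> l x\<bar> \<le> M" for x using bl[of l x] Suc C0 unfolding M_def by linarith
        qed
        thus "\<bar>avg e (avg e (JJ e (H e \<tau> l))) y\<bar> \<le> Bj e"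
          using c e by (intro avg_bound cper_locint) (auto simp: cper_simps)
      qed
      hence "\<tau> * \<bar>dsm e (JJ e (H e \<tau> l)) x\<bar> \<le> \<tau> * (Bj e / e)" using e by (intro mult_left_mono) auto
      also have "\<dots> \<le> C0 / 2" using g by (simp add: good_def)
      finally have "\<bar>\<tau> * dsm e (JJ e (H e \<tau> l)) x\<bar> \<le> C0 / 2" using e by (simp add: abs_mult)
      hence "\<bar>H e \<tau> j x - H e \<tau> l x\<bar> \<le> C0 / 2" using Suc by simp
      thus ?thesis using bl[of l x] Suc unfolding M_def by auto
    qed
    have "\<bar>H e \<tau> l x\<bar> \<le> M" if "l \<le> j" for l x
      using bj[of x] bl[of l x] that C0 by (cases "l = j") (auto simp: M_def)
    thus ?case using d(2)[of e \<tau> 0 j] g less.prems by (auto simp: T_def)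
  qed
  thus ?thesis using that[of T] d(1) by (auto simp: T_def)
qed

end

section \<open>Piecewise constant interpolation in time and compactness\<close>

lemma step_integral:
  fixes f :: "nat \<Rightarrow> real"
  assumes \<tau>: "\<tau> > 0" and t: "t \<ge> 0"
  shows "integrable (Iv 0 t) (\<lambda>s. f (nat \<lfloor>s / \<tau>\<rfloor>))"
    and "(LINT s|Iv 0 t. f (nat \<lfloor>s / \<tau>\<rfloor>)) = \<tau> * (\<Sum>i<nat \<lfloor>t / \<tau>\<rfloor>. f i) + (t - real (nat \<lfloor>t / \<tau>\<rfloor>) * \<tau>) * f (nat \<lfloor>t / \<tau>\<rfloor>)"
proof -
  let ?F = "\<lambda>s. f (nat \<lfloor>s / \<tau>\<rfloor>)"
  have meas: "?F \<in> borel_measurable borel" by measurable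
  have cell: "integrable (Iv (real i * \<tau>) b) ?F \<and> (LINT s|Iv (real i * \<tau>) b. ?F s) = (b - real i * \<tau>) * f i"
    if b: "real i * \<tau> \<le> b" "b \<le> real (Suc i) * \<tau>" for i b
  proof -
    have "AE s in lborel. s \<noteq> real (Suc i) * \<tau>" by (rule AE_lborel_singleton)
    hence ae: "AE s in lborel. indicator {real i * \<tau>..b} s * ?F s = indicator {real i * \<tau>..b} s * f i"
    proof eventually_elim
      case (elim s)
      show ?case
      proof (cases "s \<in> {real i * \<tau>..b}")
        case True
        hence "real i * \<tau> \<le> s" "s < real (Suc i) * \<tau>" using b elim by auto
        hence "real i \<le> s / \<tau>" "s / \<tau> < real i + 1"
          using pos_le_divide_eq[OF \<tau>, of "real i" s] pos_divide_less_eq[OF \<tau>, of s "real i + 1"] by (auto simp: algebra_simps)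
        hence "\<lfloor>s / \<tau>\<rfloor> = int i" by linarith
        thus ?thesis by simp
      qed simp
    qed
    have "integrable lborel (\<lambda>s. indicator {real i * \<tau>..b} s * f i)"
      using integrable_Iv_const[of "real i * \<tau>" b "f i"] unfolding integrable_Iv .
    hence 1: "integrable (Iv (real i * \<tau>) b) ?F"
      unfolding integrable_Iv using meas ae by (subst integrable_cong_AE[OF _ _ ae]) auto
    have "(LINT s|Iv (real i * \<tau>) b. ?F s) = (LINT s|Iv (real i * \<tau>) b. f i)"
      unfolding integral_Iv by (rule integral_cong_AE[OF _ _ ae]) (use meas in auto)
    also have "\<dots> = (b - real i * \<tau>) * f i" using b by (subst integral_Iv_const) auto
    finally show ?thesis using 1 by simp
  qed
  have full: "integrable (Iv 0 (real j * \<tau>)) ?F \<and> (LINT s|Iv 0 (real j * \<tau>). ?F s) = \<tau> * (\<Sum>i<j. f i)" for j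
  proof (induction j)
    case 0
    have "integrable (Iv 0 0) ?F" using cell[of 0 0] \<tau> by simp
    thus ?case using integral_Iv_singleton[of 0 ?F] by simp
  next
    case (Suc j)
    have c: "integrable (Iv (real j * \<tau>) (real (Suc j) * \<tau>)) ?F" "(LINT s|Iv (real j * \<tau>) (real (Suc j) * \<tau>). ?F s) = (real (Suc j) * \<tau> - real j * \<tau>) * f j"
      using cell[of j "real (Suc j) * \<tau>"] \<tau> by auto
    have le: "0 \<le> real j * \<tau>" "real j * \<tau> \<le> real (Suc j) * \<tau>" using \<tau> by auto
    have i: "integrable (Iv 0 (real (Suc j) * \<tau>)) ?F" using integrable_Iv_union[OF _ c(1) le] Suc by blast
    show ?case using i integral_Iv_split[OF i le] Suc c(2) by (simp add: algebra_simps)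
  qed
  let ?j = "nat \<lfloor>t / \<tau>\<rfloor>"
  have "real ?j \<le> t / \<tau>" "t / \<tau> \<le> real (Suc ?j)" using t \<tau> by (auto simp: le_floor_iff) linarith+
  hence j: "0 \<le> real ?j * \<tau>" "real ?j * \<tau> \<le> t" "t \<le> real (Suc ?j) * \<tau>"
    using pos_le_divide_eq[OF \<tau>, of "real ?j" t] pos_divide_le_eq[OF \<tau>, of t "real (Suc ?j)"] \<tau> by auto
  note c = cell[OF j(2,3)]
  show i: "integrable (Iv 0 t) ?F" using integrable_Iv_union[OF _ _ j(1,2)] c full by blast
  show "(LINT s|Iv 0 t. ?F s) = \<tau> * (\<Sum>i<?j. f i) + (t - real ?j * \<tau>) * f ?j"
    using integral_Iv_split[OF i j(1,2)] c full[of ?j] by simp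
qed

lemma floor_step:
  assumes "\<tau> > 0" "t \<ge> 0"
  shows "real (nat \<lfloor>t / \<tau>\<rfloor>) * \<tau> \<le> t" "t - real (nat \<lfloor>t / \<tau>\<rfloor>) * \<tau> \<le> \<tau>"
proof -
  have "real (nat \<lfloor>t / \<tau>\<rfloor>) \<le> t / \<tau>" "t / \<tau> \<le> real (nat \<lfloor>t / \<tau>\<rfloor>) + 1" using assms by (auto simp: le_floor_iff)
  thus "real (nat \<lfloor>t / \<tau>\<rfloor>) * \<tau> \<le> t" "t - real (nat \<lfloor>t / \<tau>\<rfloor>) * \<tau> \<le> \<tau>"
    using pos_le_divide_eq[OF assms(1), of "real (nat \<lfloor>t / \<tau>\<rfloor>)" t] pos_divide_le_eq[OF assms(1), of t "real (nat \<lfloor>t / \<tau>\<rfloor>) + 1"]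
    by (auto simp: algebra_simps)
qed

text \<open>Interpolants that are constant in time jump, so equicontinuity can be expected only for
  large \<open>n\<close> at each scale. The classical proof survives: a diagonal subsequence
  converges on a countable union of finite nets, and a finite net controls the rest from some index
  on.\<close>

lemma asymptotic_Ascoli:
  fixes f :: "nat \<Rightarrow> 'a::metric_space \<Rightarrow> real"
  assumes S: "compact S" and B: "\<And>n x. x \<in> S \<Longrightarrow> \<bar>f n x\<bar> \<le> B"
    and eq: "\<And>\<epsilon>. \<epsilon> > 0 \<Longrightarrow> \<exists>d>0. \<exists>N. \<forall>n\<ge>N. \<forall>x\<in>S. \<forall>y\<in>S. dist x y < d \<longrightarrow> \<bar>f n x - f n y\<bar> \<le> \<epsilon>"
  shows "\<exists>r :: nat \<Rightarrow> nat. strict_mono r \<and> uniformly_convergent_on S (\<lambda>n. f (r n))"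
proof -
  have "\<forall>m::nat. \<exists>k. finite k \<and> k \<subseteq> S \<and> S \<subseteq> (\<Union>x\<in>k. ball x (1 / real (Suc m)))"
    using seq_compact_imp_totally_bounded[of S] S by (auto simp: compact_eq_seq_compact_metric)
  then obtain G where G: "\<And>m. finite (G m)" "\<And>m. G m \<subseteq> S" "\<And>m. S \<subseteq> (\<Union>x\<in>G m. ball x (1 / real (Suc m)))" by metis
  have "countable (\<Union>m. G m)" using G(1) by (auto intro: countable_finite)
  then obtain r where r: "strict_mono r" "\<And>x. x \<in> (\<Union>m. G m) \<Longrightarrow> \<exists>l. (\<lambda>n. f (r n) x) \<longlonglongrightarrow> l"
    using function_convergent_subsequence[of "\<Union>m. G m" f B] B G(2) by (metis UN_iff real_norm_def subsetD)
  have "uniformly_Cauchy_on S (\<lambda>n. f (r n))"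
    unfolding uniformly_Cauchy_on_def
  proof (intro allI impI)
    fix \<epsilon> :: real assume \<epsilon>: "\<epsilon> > 0"
    hence "\<epsilon> / 5 > 0" by simp
    from eq[OF this] obtain d N where d: "d > 0" "\<And>n x y. n \<ge> N \<Longrightarrow> x \<in> S \<Longrightarrow> y \<in> S \<Longrightarrow> dist x y < d \<Longrightarrow> \<bar>f n x - f n y\<bar> \<le> \<epsilon> / 5" by blast
    obtain m :: nat where m: "1 / real (Suc m) < d" using nat_approx_posE[OF d(1)] by blast
    have "\<exists>l. \<forall>g\<in>G m. (\<lambda>n. f (r n) g) \<longlonglongrightarrow> l g" using r(2) by (intro bchoice) blast
    then obtain l where l: "\<And>g. g \<in> G m \<Longrightarrow> (\<lambda>n. f (r n) g) \<longlonglongrightarrow> l g" by blast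
    have "eventually (\<lambda>n. \<forall>g\<in>G m. dist (f (r n) g) (l g) < \<epsilon> / 5) sequentially"
      using G(1) l \<open>\<epsilon> / 5 > 0\<close> by (intro eventually_ball_finite ballI tendstoD) auto
    then obtain N' where N': "\<And>n g. n \<ge> N' \<Longrightarrow> g \<in> G m \<Longrightarrow> dist (f (r n) g) (l g) < \<epsilon> / 5" unfolding eventually_sequentially by blast
    have "dist (f (r i) x) (f (r j) x) < \<epsilon>" if x: "x \<in> S" and ij: "i \<ge> max N N'" "j \<ge> max N N'" for x i j
    proof -
      obtain g where g: "g \<in> G m" "dist x g < 1 / real (Suc m)" using G(3)[of m] x by (auto simp: dist_commute)
      have b: "\<bar>f (r k) x - f (r k) g\<bar> \<le> \<epsilon> / 5" if "k \<ge> max N N'" for k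
        using that seq_suble[OF r(1), of k] g m G(2) x by (intro d(2)) auto
      show ?thesis using b[OF ij(1)] b[OF ij(2)] N'[of i g] N'[of j g] ij g(1) \<epsilon> unfolding dist_real_def by (simp add: abs_if split: if_splits)
    qed
    thus "\<exists>M. \<forall>x\<in>S. \<forall>m\<ge>M. \<forall>n\<ge>M. dist (f (r m) x) (f (r n) x) < \<epsilon>" by blast
  qed
  thus ?thesis using r(1) Cauchy_uniformly_convergent by blast
qed

text \<open>The pairing of a weak with a strong limit. Replacing \<open>g k\<close> by
  \<open>g0\<close> costs a null sequence because the \<open>u k\<close> are bounded; with
  \<open>g0\<close> fixed the weighted sum is the pairing of \<open>comb (w n) u\<close>, which
  converges strongly.\<close>

lemma Lp_conv_comb_test:
  assumes u: "\<And>k. Lpf M q (u k)" "\<And>k. Ip M q (u k) \<le> C" and u0: "Lpf M q u0" "Lp_conv M q (\<lambda>n. comb (w n) u) u0"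
    and w: "\<And>n. w n \<in> convw n"
    and g: "\<And>k. Lpf M p (g k)" "Lpf M p g0" "Lp_conv M p g g0"
    and p: "p > 1" and q: "q > 1" "1/p + 1/q = 1"
  shows "(\<lambda>n. wsum (w n) (\<lambda>k. LINT x|M. u k x * g k x)) \<longlonglongrightarrow> (LINT x|M. u0 x * g0 x)"
proof -
  have q': "1/q + 1/p = 1" using q by simp
  have p0: "p > 0" "q > 0" using p q by auto
  have i: "integrable M (\<lambda>x. u k x * g0 x)" "integrable M (\<lambda>x. u k x * g l x)" for k l
    using u g p q q' by (auto intro!: Lpf_mult_integrable[of M q _ p])
  have dg: "Lpf M p (\<lambda>x. g k x - g0 x)" for k using g p0 by (intro Lpf_diff)
  have C: "C \<ge> 0" using u(2)[of 0] Ip_nonneg[of M "u 0" q] by linarith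
  have "(\<lambda>k. LINT x|M. u k x * (g k x - g0 x)) \<longlonglongrightarrow> 0"
  proof (rule Lim_null_comparison)
    have "\<bar>LINT x|M. u k x * (g k x - g0 x)\<bar> \<le> C powr (1/q) * Ip M p (\<lambda>x. g k x - g0 x) powr (1/p)" for k
    proof -
      have "\<bar>LINT x|M. u k x * (g k x - g0 x)\<bar> \<le> Ip M q (u k) powr (1/q) * Ip M p (\<lambda>x. g k x - g0 x) powr (1/p)"
        by (rule Hoelder_inequality[OF u(1) dg q(1) p q'])
      also have "\<dots> \<le> C powr (1/q) * Ip M p (\<lambda>x. g k x - g0 x) powr (1/p)"
        using u(2) p0 by (intro mult_right_mono powr_mono2 Ip_nonneg) auto
      finally show ?thesis .
    qed
    thus "\<forall>\<^sub>F k in sequentially. norm (LINT x|M. u k x * (g k x - g0 x)) \<le> C powr (1/q) * Ip M p (\<lambda>x. g k x - g0 x) powr (1/p)" by simp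
    have "(\<lambda>k. Ip M p (\<lambda>x. g k x - g0 x) powr (1/p)) \<longlonglongrightarrow> 0 powr (1/p)"
      using p by (intro tendsto_powr'[OF g(3)] tendsto_const) (simp add: Ip_nonneg)
    thus "(\<lambda>k. C powr (1/q) * Ip M p (\<lambda>x. g k x - g0 x) powr (1/p)) \<longlonglongrightarrow> 0"
      by (intro tendsto_mult_right_zero) simp
  qed
  from convw_tendsto[OF w this]
  have 1: "(\<lambda>n. wsum (w n) (\<lambda>k. (LINT x|M. u k x * (g k x - g0 x)))) \<longlonglongrightarrow> 0" .
  have "(\<lambda>n. LINT x|M. comb (w n) u x * g0 x) \<longlonglongrightarrow> (LINT x|M. u0 x * g0 x)"
    using p0 by (intro Lp_conv_mult[OF Lpf_comb u0 g(2) g(2) _ q(1) p q'] u) auto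
  moreover have "(LINT x|M. comb (w n) u x * g0 x) = wsum (w n) (\<lambda>k. LINT x|M. u k x * g0 x)" for n
    unfolding comb_def sum_distrib_right using i by (simp add: mult.assoc)
  ultimately have 2: "(\<lambda>n. wsum (w n) (\<lambda>k. LINT x|M. u k x * g0 x)) \<longlonglongrightarrow> (LINT x|M. u0 x * g0 x)" by simp
  from tendsto_add[OF 1 2] show ?thesis
    using i by (simp add: right_diff_distrib distrib_left[symmetric] sum.distrib[symmetric])
qed

section \<open>Recovering derivatives of limits from their averages\<close>

lemma dsm_prim: "cper u \<Longrightarrow> e > 0 \<Longrightarrow> prim (dsm e u) (avg3 e u)"
proof -
  assume u: "cper u" and e: "e > 0"
  have "continuous_on UNIV (avg e (avg e u))" using cper_avg'[OF cper_avg'[OF u e] e] by blast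
  thus ?thesis unfolding avg3_def dsm_def by (intro deriv_prim avg_deriv e dq_continuous)
qed

lemma Lp_conv_L1:
  assumes M: "finite_measure M" and L: "\<And>n. Lpf M p (u n)" "Lpf M p v" and c: "Lp_conv M p u v" and p: "p > 1"
  shows "(\<lambda>n. LINT x|M. \<bar>u n x - v x\<bar>) \<longlonglongrightarrow> 0"
proof (rule Lim_null_comparison)
  let ?m = "measure M (space M) powr ((p - 1) / p)"
  show "\<forall>\<^sub>F n in sequentially. norm (LINT x|M. \<bar>u n x - v x\<bar>) \<le> Ip M p (\<lambda>x. u n x - v x) powr (1/p) * ?m"
    using Lp_L1_bound[OF M Lpf_diff[OF _ L] p] p by simp
  have "(\<lambda>n. Ip M p (\<lambda>x. u n x - v x) powr (1/p)) \<longlonglongrightarrow> 0 powr (1/p)"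
    using p by (intro tendsto_powr'[OF c] tendsto_const) (simp add: Ip_nonneg)
  thus "(\<lambda>n. Ip M p (\<lambda>x. u n x - v x) powr (1/p) * ?m) \<longlonglongrightarrow> 0" by (intro tendsto_mult_left_zero) simp
qed

text \<open>The identity says that \<open>v\<close> and the derivative of \<open>u\<close> have the
  same triple averages. Increments of \<open>avg3 k u\<close> are integrals of
  \<open>avg3 k v\<close>, and both sides converge as \<open>k\<close> tends to zero.\<close>

lemma avg3_dsm_prim:
  assumes u: "cper u" and v: "Lper v" and eq: "\<And>k x. 0 < k \<Longrightarrow> k \<le> 1 \<Longrightarrow> avg3 k v x = dsm k u x"
  shows "prim v u"
proof -
  obtain V where V: "prim v V" using locint_prim[OF Lper_locint[OF v]] by blast
  let ?e = "\<lambda>n. 1 / real (Suc n)"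
  have vn: "Lper (avg3 (?e n) v)" for n using Lpc_avg3(1)[OF Lper_Lpc[OF v], of "?e n"] Lpc_Lper[of 1] by simp
  have conv: "(\<lambda>n. \<integral>x. \<bar>avg3 (?e n) v x - v x\<bar>) \<longlonglongrightarrow> 0"
    using Lp_conv_avg3[OF Lper_Lpc[OF v], of ?e] avg_small_step by simp
  have eqd: "u b - u a = V b - V a" if ab: "a \<le> b" "b \<le> a + 2 * pi" for a b
  proof -
    have "(\<lambda>n. avg3 (?e n) u b - avg3 (?e n) u a) \<longlonglongrightarrow> u b - u a" by (intro tendsto_intros avg3_tendsto u)
    moreover have "(\<lambda>n. avg3 (?e n) u b - avg3 (?e n) u a) \<longlonglongrightarrow> V b - V a"
    proof (rule LIM_zero_cancel, rule Lim_null_comparison[OF _ conv], rule always_eventually, rule allI)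
      fix n
      have e: "?e n > 0" "?e n \<le> 1" by auto
      have "avg3 (?e n) u b - avg3 (?e n) u a = (LINT x|Iv a b. dsm (?e n) u x)" using prim_integral[OF dsm_prim[OF u e(1)] ab(1)] by simp
      also have "\<dots> = (LINT x|Iv a b. avg3 (?e n) v x)" using eq[OF e] by simp
      finally have "avg3 (?e n) u b - avg3 (?e n) u a - (V b - V a) = (LINT x|Iv a b. avg3 (?e n) v x) - (LINT x|Iv a b. v x)"
        using prim_integral[OF V ab(1)] by simp
      also have "\<dots> = (LINT x|Iv a b. avg3 (?e n) v x - v x)"
        using Lper_locint[OF vn] Lper_locint[OF v] by (simp add: locint_def)
      finally have "\<bar>avg3 (?e n) u b - avg3 (?e n) u a - (V b - V a)\<bar> \<le> (LINT x|Iv a b. \<bar>avg3 (?e n) v x - v x\<bar>)"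
        using integral_abs_bound[of "Iv a b" "\<lambda>x. avg3 (?e n) v x - v x"] by simp
      also have "\<dots> \<le> (LINT x|Iv a (a + 2 * pi). \<bar>avg3 (?e n) v x - v x\<bar>)"
      proof -
        have "integrable (Iv a (a + 2 * pi)) (\<lambda>x. \<bar>avg3 (?e n) v x - v x\<bar>)"
          using Lper_locint[OF vn] Lper_locint[OF v] by (simp add: locint_def)
        from integral_Iv_split[OF this ab] show ?thesis by (simp add: integral_nonneg_AE)
      qed
      also have "\<dots> = (\<integral>x. \<bar>avg3 (?e n) v x - v x\<bar>)"
        using vn[of n] v by (intro integral_Iv_periodic(2)) (auto simp: Lper_def periodic_def)
      finally show "norm (avg3 (?e n) u b - avg3 (?e n) u a - (V b - V a)) \<le> (\<integral>x. \<bar>avg3 (?e n) v x - v x\<bar>)" by simp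
    qed
    ultimately show ?thesis by (rule LIMSEQ_unique)
  qed
  \<comment> \<open>Equality of increments is known only over at most one period, so it is extended
    by local constancy.\<close>
  have "((\<lambda>x. u x - V x) has_real_derivative 0) (at x)" for x
  proof (rule has_field_derivative_transform_within_open[of "\<lambda>y. u x - V x" 0 x "ball x 1"])
    fix y assume "y \<in> ball x 1"
    hence d: "\<bar>y - x\<bar> < 1" by (simp add: dist_real_def abs_minus_commute)
    show "u x - V x = u y - V y"
      using eqd[of x y] eqd[of y x] d pi_gt3 by (cases "x \<le> y") auto
  qed auto
  hence "u a - V a = u b - V b" for a b using DERIV_const_ratio_const DERIV_isconst_all by blast
  hence "u b - u a = V b - V a" for a b by (metis add_diff_cancel_left' diff_add_cancel diff_diff_eq2 diff_add_eq)
  thus ?thesis using V by (simp add: prim_def)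
qed

lemma avg3_L1_bound:
  assumes "Lper f" "0 < k" "k \<le> pi"
  shows "\<bar>avg3 k f x\<bar> \<le> (\<integral>x. \<bar>f x\<bar>) / (2 * k)"
  unfolding avg3_def using assms by (intro avg_bound avg_L1_bound locint_avg Lper_locint) auto

lemma avg3_comb:
  assumes f: "\<And>l. cper (f l)" and k: "k > 0" and fin: "finite {l. w l \<noteq> 0}"
  shows "avg3 k (comb w f) x = (\<Sum>l | w l \<noteq> 0. w l * avg3 k (f l) x)"
proof -
  have "avg3 k (\<lambda>x. \<Sum>l\<in>S. w l * f l x) x = (\<Sum>l\<in>S. w l * avg3 k (f l) x)" if "finite S" for S
    using that
  proof (induction S rule: finite_induct)
    case empty
    have "avg3 k (\<lambda>x. 0) x = 0" by (simp add: avg3_def avg_def)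
    thus ?case by simp
  next
    case (insert l S)
    have l: "locint (f l)" "locint (\<lambda>x. \<Sum>l\<in>S. w l * f l x)"
      by (intro cper_locint f cper_sum cper_cmult)+
    have "avg3 k (\<lambda>x. \<Sum>l\<in>insert l S. w l * f l x) x = avg3 k (\<lambda>x. w l * f l x + 1 * (\<Sum>l\<in>S. w l * f l x)) x"
      using insert by simp
    also have "\<dots> = w l * avg3 k (f l) x + 1 * avg3 k (\<lambda>x. \<Sum>l\<in>S. w l * f l x) x"
      unfolding avg3_lin[OF l k] by simp
    finally show ?case using insert by simp
  qed
  from this[OF fin] show ?thesis by (simp add: comb_def[abs_def])
qed

text \<open>\<open>avg3 k\<close> maps L_1 into bounded functions, so after smoothing an L_1 limit
  of combinations can be evaluated at a point, and there the weights drop out by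
  \<open>convw_tendsto\<close>.\<close>

lemma comb_avg3_limit:
  assumes w: "\<And>n. w n \<in> convw n" and f: "\<And>l. cper (f l)" and v: "Lper v"
    and conv: "(\<lambda>n. \<integral>x. \<bar>comb (w n) f x - v x\<bar>) \<longlonglongrightarrow> 0"
    and k: "0 < k" "k \<le> pi" and lim: "(\<lambda>l. avg3 k (f l) x) \<longlonglongrightarrow> c"
  shows "avg3 k v x = c"
proof -
  have cc: "cper (comb (w n) f)" for n unfolding comb_def[abs_def] by (intro cper_sum cper_cmult f)
  have "(\<lambda>n. avg3 k (comb (w n) f) x) \<longlonglongrightarrow> avg3 k v x"
  proof (rule LIM_zero_cancel, rule Lim_null_comparison)
    show "\<forall>\<^sub>F n in sequentially. norm (avg3 k (comb (w n) f) x - avg3 k v x) \<le> (\<integral>x. \<bar>comb (w n) f x - v x\<bar>) / (2 * k)"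
    proof (rule always_eventually, rule allI)
      fix n
      let ?c = "comb (w n) f"
      have l: "locint ?c" "locint v" using cc v by (auto intro: cper_locint Lper_locint)
      have "avg3 k ?c x - avg3 k v x = avg3 k (\<lambda>x. ?c x - v x) x"
        using avg3_lin[OF l k(1), of 1 "- 1"] by simp
      also have "\<bar>\<dots>\<bar> \<le> (\<integral>x. \<bar>?c x - v x\<bar>) / (2 * k)"
        using cper_Lper[OF cc[of n]] v k by (intro avg3_L1_bound) (auto simp: Lper_def periodic_def)
      finally show "norm (avg3 k ?c x - avg3 k v x) \<le> (\<integral>x. \<bar>?c x - v x\<bar>) / (2 * k)" by simp
    qed
    show "(\<lambda>n. (\<integral>x. \<bar>comb (w n) f x - v x\<bar>) / (2 * k)) \<longlonglongrightarrow> 0"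
      using tendsto_divide[OF conv tendsto_const[of "2 * k"]] k by simp
  qed
  moreover have "avg3 k (comb (w n) f) x = (\<Sum>l | w n l \<noteq> 0. w n l * avg3 k (f l) x)" for n
    using w[of n] by (intro avg3_comb f k) (simp add: convw_def)
  ultimately show ?thesis using convw_tendsto[OF w lim] LIMSEQ_unique by simp
qed

text \<open>Weak compactness in L_2 through convex combinations, here with both sequences equal. The
  limit is recognised as the derivative because \<open>avg3 k\<close> of \<open>dsm (?e l) u\<close>
  is \<open>avg3 (?e l)\<close> of the fixed function \<open>dsm k u\<close>.\<close>

lemma H1_of_bounded:
  assumes u: "cper u" and K: "\<And>k. k > 0 \<Longrightarrow> L2sq (dsm k u) \<le> K"
  obtains v where "Lpc 2 v" "prim v u"
proof -
  let ?e = "\<lambda>n. 1 / real (Suc n)"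
  let ?f = "\<lambda>n. dsm (?e n) u"
  have cf: "cper (?f n)" for n using u by (intro cper_dsm) auto
  have Lf: "Lpf circ 2 (?f n)" "Ip circ 2 (?f n) \<le> K" for n
    using Lpc_Lpf[OF cper_Lpc[OF cf]] K by (simp_all add: abs_powr_2)
  obtain w r where w: "\<And>n. w n \<in> convw n" and L: "Lpf circ 2 (\<lambda>x. lim (\<lambda>n. comb (w (r n)) ?f x))"
    "Lp_conv circ 2 (\<lambda>n. comb (w n) ?f) (\<lambda>x. lim (\<lambda>n. comb (w (r n)) ?f x))"
  proof (rule convex_combinations_converge[of circ 2 2 ?f K ?f])
    show "(1::real) < 2" "(1::real) < 2" by auto
  qed (use Lf that finite_measure_Iv in auto)
  define v where "v = (\<lambda>x. lim (\<lambda>n. comb (w (r n)) ?f x))"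
  have cc: "cper (comb (w n) ?f)" for n unfolding comb_def[abs_def] by (intro cper_sum cper_cmult cf)
  have [measurable]: "comb (w n) ?f \<in> borel_measurable borel" for n using cc by (intro borel_measurable_continuous_onI) simp
  have vm: "v \<in> borel_measurable borel" unfolding v_def by measurable
  have "comb (w n) ?f (x + 2 * pi) = comb (w n) ?f x" for n x using cc by (simp add: periodic_def)
  hence vp: "periodic v" by (simp add: v_def periodic_def)
  have v: "Lpc 2 v" using vm vp L(1) by (intro LpcI) (auto simp: v_def)
  have Lv: "Lper v" using v by (rule Lpc_Lper[rotated]) simp
  have "prim v u"
  proof (rule avg3_dsm_prim[OF u Lv])
    fix k x :: real assume k: "0 < k" "k \<le> 1"
    have kp: "k \<le> pi" using k pi_gt3 by simp
    have l1: "(\<lambda>n. \<integral>x. \<bar>comb (w n) ?f x - v x\<bar>) \<longlonglongrightarrow> 0"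
      unfolding v_def using Lf by (intro Lp_conv_L1[OF finite_measure_Iv _ L] Lpf_comb) auto
    have "avg3 k (?f l) = avg3 (?e l) (dsm k u)" for l using k by (intro dsm_avg3 u) auto
    hence "(\<lambda>l. avg3 k (?f l) x) \<longlonglongrightarrow> dsm k u x" using avg3_tendsto[OF cper_dsm[OF u k(1)]] by simp
    thus "avg3 k v x = dsm k u x" by (rule comb_avg3_limit[OF w cf Lv l1 k(1) kp])
  qed
  with v that show ?thesis by blast
qed

lemma integral_dq: "Lper f \<Longrightarrow> (\<integral>x. dq e f x) = 0"
  using dq_adjoint_cper[of f "\<lambda>x. 1" e] by (simp add: dq_def periodic_def)

lemma prim_periodic:
  assumes z: "Lper z" and z0: "(\<integral>x. z x) = 0"
  obtains Z where "cper Z" "prim z Z" "(\<integral>x. Z x) = c"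
proof -
  obtain Y where Y: "prim z Y" using locint_prim[OF Lper_locint[OF z]] by blast
  have "Y (x + 2 * pi) = Y x" for x
    using prim_integral[OF Y, of x "x + 2 * pi"] integral_Iv_periodic(2)[OF z, of x] z0 by simp
  hence cY: "cper Y" using prim_continuous[OF Y] by (simp add: periodic_def)
  define d where "d = (c - (\<integral>x. Y x)) / (2 * pi)"
  show ?thesis
  proof (rule that[of "\<lambda>x. Y x + d"])
    show "cper (\<lambda>x. Y x + d)" by (intro cper_add cY cper_const)
    show "prim z (\<lambda>x. Y x + d)" using Y by (simp add: prim_def)
    have "(\<integral>x. Y x + d) = (\<integral>x. Y x) + 2 * pi * d"
      using cper_integrable[OF cY] integral_Iv_const[of 0 "2 * pi" d] by (simp del: lebesgue_integral_const)
    thus "(\<integral>x. Y x + d) = c" by (simp add: d_def)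
  qed
qed

lemma prim_oscillation:
  assumes Z: "cper Z" and z: "Lper z" and p: "prim z Z"
  shows "\<bar>Z x - (\<integral>y. Z y) / (2 * pi)\<bar> \<le> (\<integral>y. \<bar>z y\<bar>)"
proof -
  let ?A = "\<integral>y. \<bar>z y\<bar>"
  have za: "Lper (\<lambda>x. \<bar>z x\<bar>)" using z by (auto simp: Lper_def periodic_def)
  have inc: "\<bar>Z b - Z a\<bar> \<le> ?A" if "a \<le> b" "b \<le> a + 2 * pi" for a b
  proof -
    have "\<bar>Z b - Z a\<bar> = \<bar>LINT y|Iv a b. z y\<bar>" using prim_integral[OF p that(1)] by simp
    also have "\<dots> \<le> (LINT y|Iv a b. \<bar>z y\<bar>)" by (rule integral_abs_bound)
    also have "\<dots> \<le> (LINT y|Iv a (a + 2 * pi). \<bar>z y\<bar>)"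
      using integral_Iv_split[OF integral_Iv_periodic(1)[OF za, of a] that] by (simp add: integral_nonneg_AE)
    also have "\<dots> = ?A" by (rule integral_Iv_periodic(2)[OF za])
    finally show ?thesis .
  qed
  have osc: "\<bar>Z y - Z x\<bar> \<le> ?A" if "y \<in> {x..x + 2 * pi}" for y using inc[of x y] that by auto
  have i: "integrable (Iv x (x + 2 * pi)) Z" "(LINT y|Iv x (x + 2 * pi). Z y) = (\<integral>y. Z y)"
    using integral_Iv_periodic[OF cper_Lper[OF Z]] by auto
  have "2 * pi * Z x - (\<integral>y. Z y) = - (LINT y|Iv x (x + 2 * pi). Z y - Z x)"
    using i integral_Iv_const[of x "x + 2 * pi" "Z x"] by (simp del: lebesgue_integral_const)
  also have "\<bar>\<dots>\<bar> \<le> (LINT y|Iv x (x + 2 * pi). \<bar>Z y - Z x\<bar>)"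
    using integral_abs_bound[of "Iv x (x + 2 * pi)" "\<lambda>y. Z y - Z x"] by simp
  also have "\<dots> \<le> (LINT y|Iv x (x + 2 * pi). ?A)" using i osc by (intro integral_mono) auto
  also have "\<dots> = 2 * pi * ?A" by (subst integral_Iv_const) auto
  finally have "\<bar>2 * pi * Z x - (\<integral>y. Z y)\<bar> / (2 * pi) \<le> 2 * pi * ?A / (2 * pi)"
    by (intro divide_right_mono) auto
  moreover have "\<bar>2 * pi * Z x - (\<integral>y. Z y)\<bar> / (2 * pi) = \<bar>Z x - (\<integral>y. Z y) / (2 * pi)\<bar>"
  proof -
    have "Z x - (\<integral>y. Z y) / (2 * pi) = (2 * pi * Z x - (\<integral>y. Z y)) / (2 * pi)" by (simp add: diff_divide_distrib)
    thus ?thesis by (simp only: abs_divide) simp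
  qed
  ultimately show ?thesis by simp
qed

lemma prim_avg3: "prim u U \<Longrightarrow> e > 0 \<Longrightarrow> prim (avg3 e u) (avg3 e U)"
  unfolding avg3_def by (intro prim_avg_avg)

text \<open>If the second difference vanishes, then \<open>g\<close> grows linearly along an
  arithmetic progression of step \<open>2 * e\<close>; a bounded function allows only slope
  zero.\<close>

lemma dq_zero:
  assumes g: "cper g" and e: "e > 0" and d: "dq e (dq e g) = (\<lambda>x. 0)"
  shows "dq e g x = 0"
proof -
  have c: "dq e g (y + 2 * e) = dq e g y" for y
    using fun_cong[OF d, of "y + e"] e unfolding dq_def[of e "dq e g"] by (simp add: algebra_simps)
  have "dq e g (x + 2 * e * real n) = dq e g x \<and> g (x - e + 2 * e * real n) = g (x - e) + real n * (2 * e * dq e g x)" for n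
  proof (induction n)
    case (Suc n)
    let ?y = "x + 2 * e * real n"
    have "x + 2 * e * real (Suc n) = ?y + 2 * e" "x - e + 2 * e * real (Suc n) = ?y + e" "x - e + 2 * e * real n = ?y - e"
      by (simp_all add: algebra_simps)
    moreover have "g (?y + e) = g (?y - e) + 2 * e * dq e g ?y" using e by (simp add: dq_def)
    ultimately show ?case using Suc c[of ?y] by (simp only: of_nat_Suc distrib_right) simp
  qed simp
  moreover obtain B where B: "\<And>x. \<bar>g x\<bar> \<le> B" using cper_bounded[OF g] by blast
  ultimately have "\<bar>real n * (2 * e * dq e g x)\<bar> \<le> 2 * B" for n
    using B[of "x - e"] B[of "x - e + 2 * e * real n"] by (smt (verit))
  hence "real n * (2 * e * \<bar>dq e g x\<bar>) \<le> 2 * B" for n using e by (simp add: abs_mult)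
  hence "\<not> 2 * e * \<bar>dq e g x\<bar> > 0" using reals_Archimedean3[of "2 * e * \<bar>dq e g x\<bar>"] by (meson not_le)
  thus ?thesis using e by (simp add: zero_less_mult_iff)
qed

text \<open>Two applications of \<open>dq_zero\<close> leave \<open>w (x + e) = w (x - e)\<close>
  for all small widths, which makes \<open>w\<close> locally constant.\<close>

lemma dq3_zero_const:
  assumes w: "cper w" and d: "\<And>e. 0 < e \<Longrightarrow> e \<le> 1 \<Longrightarrow> dq e (dq e (dq e w)) = (\<lambda>x. 0)"
  shows "w x = w y"
proof -
  have s: "w (x + e) = w (x - e)" if e: "0 < e" "e \<le> 1" for e x
  proof -
    have "dq e (dq e w) = (\<lambda>x. 0)" using dq_zero[OF cper_dq[OF w] e(1) d[OF e]] by auto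
    from dq_zero[OF w e(1) this] show ?thesis using e by (simp add: dq_def)
  qed
  have "w y = w x" if "\<bar>y - x\<bar> < 1" for x y
    using s[of "(y - x) / 2" "(x + y) / 2"] s[of "(x - y) / 2" "(x + y) / 2"] that
    by (cases x y rule: linorder_cases) (auto simp: add_divide_distrib diff_divide_distrib)
  hence "(w has_real_derivative 0) (at x)" for x
    by (intro has_field_derivative_transform_within[OF DERIV_const[of "w x"], of 1]) (auto simp: dist_real_def)
  thus ?thesis using DERIV_isconst_all by blast
qed

text \<open>The candidates for the derivatives come from integrating the equation: \<open>k\<close>
  with derivative \<open>z\<close> plays the role of u + u'', \<open>v2 = k - u\<close> that of u'',
  and two periodic primitives lead to \<open>v1\<close> and \<open>U\<close>. The averages of
  \<open>z\<close> show that \<open>u\<close> and \<open>U\<close> have equal third differences, so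
  \<open>u = U\<close>.\<close>

lemma W3_of_avg3:
  assumes u: "cper u" and z: "Lper z" and eq: "\<And>k x. 0 < k \<Longrightarrow> k \<le> 1 \<Longrightarrow> avg3 k z x = zz k u x"
    and B: "\<And>x. \<bar>u x\<bar> \<le> B"
  obtains v1 v2 where "cper v1" "cper v2" "prim v1 u" "prim v2 v1" "prim (\<lambda>x. z x - v1 x) v2"
    "\<And>x. \<bar>v2 x\<bar> \<le> 2 * B + (\<integral>x. \<bar>z x\<bar>)" "\<And>x. \<bar>v1 x\<bar> \<le> 2 * pi * (2 * B + (\<integral>x. \<bar>z x\<bar>))"
proof -
  have "(\<integral>x. z x) = (\<integral>x. avg3 1 z x)"
    unfolding avg3_def using z by (simp add: integral_avg cper_avg cper_Lper)
  also have "\<dots> = (\<integral>x. dsm 1 u x + dq 1 (dq 1 (dq 1 u)) x)" using eq by (simp add: zz_def)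
  also have "\<dots> = (\<integral>x. dsm 1 u x) + (\<integral>x. dq 1 (dq 1 (dq 1 u)) x)"
    using u by (intro Bochner_Integration.integral_add cper_integrable) (auto simp: cper_simps)
  also have "\<dots> = 0" unfolding dsm_def using u by (simp add: integral_dq cper_Lper cper_simps)
  \<comment> \<open>The constant of integration is fixed by the mean of \<open>u\<close>: then
    \<open>v2\<close> has mean zero and possesses a periodic primitive.\<close>
  finally obtain k where k: "cper k" "prim z k" "(\<integral>x. k x) = (\<integral>x. u x)" using prim_periodic[OF z] by blast
  define v2 where "v2 = (\<lambda>x. 1 * k x + (- 1) * u x)"
  have cv2: "cper v2" unfolding v2_def using k u by (intro cper_lin)
  have v20: "(\<integral>x. v2 x) = 0"
    unfolding v2_def using k cper_integrable[OF k(1)] cper_integrable[OF u] by simp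
  obtain v1 where v1: "cper v1" "prim v2 v1" "(\<integral>x. v1 x) = 0" using prim_periodic[OF cper_Lper[OF cv2] v20] by blast
  obtain U where U: "cper U" "prim v1 U" "(\<integral>x. U x) = (\<integral>x. u x)" using prim_periodic[OF cper_Lper[OF v1(1)] v1(3)] by blast
  define w where "w = (\<lambda>x. 1 * u x + (- 1) * U x)"
  have cw: "cper w" unfolding w_def using u U by (intro cper_lin)
  have "dq e (dq e (dq e w)) = (\<lambda>x. 0)" if e: "0 < e" "e \<le> 1" for e
  proof -
    note s = cper_locint cper_simps u k(1) v1(1) cv2 U(1) e(1)
    have a: "avg e z = dq e k" "avg e v2 = dq e v1" "avg e v1 = dq e U"
      using prim_avg[OF k(2) e(1)] prim_avg[OF v1(2) e(1)] prim_avg[OF U(2) e(1)] by auto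
    have "avg e (avg e v2) = dq e (dq e U)" unfolding a using a(3) by (simp add: avg_locint_dq(1) s)
    moreover have "avg e (avg e v2) = (\<lambda>x. 1 * avg e (avg e k) x + (- 1) * avg e (avg e u) x)"
      unfolding v2_def avg_fun_lin[OF cper_locint[OF k(1)] cper_locint[OF u]] by (rule avg_fun_lin) (simp_all add: s)
    ultimately have "dq e (dq e (dq e U)) = (\<lambda>x. 1 * dq e (avg e (avg e k)) x + (- 1) * dsm e u x)"
      unfolding dsm_def dq_fun_lin[symmetric] by simp
    moreover have "avg3 e z = dq e (avg e (avg e k))" by (simp add: avg3_def a avg_locint_dq(1) s)
    ultimately have "dq e (dq e (dq e U)) x = dq e (dq e (dq e u)) x" for x using eq[OF e, of x] by (simp add: zz_def)
    thus ?thesis unfolding w_def by (simp only: dq_fun_lin) simp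
  qed
  hence wc: "w x = w 0" for x by (rule dq3_zero_const[OF cw])
  have "(\<integral>x. w x) = 0" unfolding w_def using U cper_integrable[OF U(1)] cper_integrable[OF u] by simp
  moreover have "(\<integral>x. w x) = (\<integral>x. w 0)" by (intro Bochner_Integration.integral_cong refl wc)
  ultimately have "w 0 = 0" using integral_Iv_const[of 0 "2 * pi" "w 0"] by (simp del: lebesgue_integral_const)
  hence uU: "u = U" using wc by (simp add: w_def fun_eq_iff)
  have bk: "\<bar>k x\<bar> \<le> B + (\<integral>x. \<bar>z x\<bar>)" for x
  proof -
    have "\<bar>\<integral>x. u x\<bar> \<le> (\<integral>x. \<bar>u x\<bar>)" by (rule integral_abs_bound)
    also have "\<dots> \<le> 2 * pi * B" using B cper_integrable[OF u] by (intro integral_circ_bound) auto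
    finally have "\<bar>(\<integral>x. k x) / (2 * pi)\<bar> \<le> B" by (simp only: k(3)) (simp add: field_simps)
    thus ?thesis using prim_oscillation[OF k(1) z k(2), of x] by linarith
  qed
  have b2: "\<bar>v2 x\<bar> \<le> 2 * B + (\<integral>x. \<bar>z x\<bar>)" for x
    unfolding v2_def using bk[of x] B[of x] by linarith
  have "\<bar>v1 x - (\<integral>x. v1 x) / (2 * pi)\<bar> \<le> (\<integral>y. \<bar>v2 y\<bar>)" for x by (rule prim_oscillation[OF v1(1) cper_Lper[OF cv2] v1(2)])
  moreover have "(\<integral>y. \<bar>v2 y\<bar>) \<le> 2 * pi * (2 * B + (\<integral>x. \<bar>z x\<bar>))" using b2 cper_integrable[OF cv2] by (intro integral_circ_bound) auto
  ultimately have b1: "\<bar>v1 x\<bar> \<le> 2 * pi * (2 * B + (\<integral>x. \<bar>z x\<bar>))" for x by (simp add: v1(3)) (blast intro: order_trans)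
  have p3: "prim (\<lambda>x. z x - v1 x) v2"
    using prim_lin[OF k(2) U(2), of 1 "- 1"] uU by (simp add: v2_def)
  show ?thesis using that[OF v1(1) cv2 _ v1(2) p3 b2 b1] U(2) uU by simp
qed

text \<open>\<open>Jensen_avg\<close> with width \<pi> at the point \<pi>, where the box average is
  the mean over the circle.\<close>

lemma powr_mean_le:
  assumes "Lpc p z" "p \<ge> 1"
  shows "((\<integral>x. \<bar>z x\<bar>)) powr p \<le> (2 * pi) powr p * ((\<integral>x. \<bar>z x\<bar> powr p) / (2 * pi))"
proof -
  have za: "Lpc p (\<lambda>x. \<bar>z x\<bar>)" using assms(1) by (auto simp: Lpc_def periodic_def)
  have m: "avg pi f pi = (\<integral>x. f x) / (2 * pi)" for f by (simp add: avg_Iv)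
  have "((\<integral>x. \<bar>z x\<bar>) / (2 * pi)) powr p \<le> (\<integral>x. \<bar>z x\<bar> powr p) / (2 * pi)"
    using Jensen_avg[OF Lper_locint[OF Lpc_Lper[OF assms(2) za]] Lper_locint[OF Lper_powr[OF za]] assms(2) pi_gt_zero, of pi] by (simp add: m integral_nonneg_AE)
  hence "(2 * pi) powr p * ((\<integral>x. \<bar>z x\<bar>) / (2 * pi)) powr p \<le> (2 * pi) powr p * ((\<integral>x. \<bar>z x\<bar> powr p) / (2 * pi))"
    by (intro mult_left_mono) auto
  thus ?thesis by (simp add: powr_divide integral_nonneg_AE)
qed

text \<open>Both sides are \<partial> + \<partial>^3 of the function smoothed with both kernels. The
  exchange moves the vanishing width of the scheme into an average while the differences keep a
  fixed width.\<close>

lemma avg3_zz: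
  assumes u: "cper u" and e: "e > 0" "d > 0"
  shows "avg3 d (zz e u) = avg3 e (zz d u)"
proof -
  have sw: "avg3 d (dq e (dq e (dq e u))) = avg3 e (dq d (dq d (dq d u)))"
  proof -
    have s: "avg d (dq e f) = avg e (dq d f)" if "cper f" for f
      using avg_locint_dq(1)[of f e d] avg_locint_dq(2)[of f d e] that e by (simp add: cper_locint)
    have m: "avg e (avg d f) = avg d (avg e f)" "dq d (avg e f) = avg e (dq d f)" "dq d (dq e f) = dq e (dq d f)" if "cper f" for f
      using that e by (simp_all add: avg_commute[of f e d] avg_locint_dq(1) dq_commute[of d e] cper_locint)
    have "avg3 d (dq e (dq e (dq e u))) = avg d (avg d (avg e (dq e (dq e (dq d u)))))"
      unfolding avg3_def using u e by (simp add: s m(3) cper_simps)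
    also have "\<dots> = avg e (avg d (avg d (dq e (dq e (dq d u)))))"
      using u e by (simp add: avg_commute[of _ d e] cper_locint cper_simps)
    also have "\<dots> = avg e (avg d (avg e (dq e (dq d (dq d u)))))"
      using u e by (simp add: s m(3) cper_simps)
    also have "\<dots> = avg e (avg e (avg d (dq e (dq d (dq d u)))))"
      using u e by (simp add: avg_commute[of _ d e] cper_locint cper_simps)
    also have "\<dots> = avg3 e (dq d (dq d (dq d u)))"
      unfolding avg3_def using u e by (simp add: s cper_simps)
    finally show ?thesis .
  qed
  have l: "locint (dsm e u)" "locint (dsm d u)" "locint (dq e (dq e (dq e u)))" "locint (dq d (dq d (dq d u)))"
    using u e by (auto intro!: cper_locint simp: cper_simps)
  have "zz k u = (\<lambda>x. 1 * dsm k u x + 1 * dq k (dq k (dq k u)) x)" for k by (simp add: zz_def fun_eq_iff)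
  thus ?thesis
    using avg3_lin[OF l(1,3) e(2), of 1 1] avg3_lin[OF l(2,4) e(1), of 1 1] dsm_avg3[OF u e] sw by simp
qed

section \<open>The space-time cylinder\<close>

lemma step_measurable:
  fixes F :: "nat \<Rightarrow> real \<Rightarrow> real" and \<tau> :: real
  assumes "\<And>j. F j \<in> borel_measurable borel"
  shows "(\<lambda>y. F (nat \<lfloor>fst y / \<tau>\<rfloor>) (snd y)) \<in> borel_measurable borel2"
proof (rule measurable_compose_countable[of "\<lambda>j y. F j (snd y)"])
  show "(\<lambda>y. F j (snd y)) \<in> borel_measurable borel2" for j
    using assms by measurable
  have [measurable]: "(\<lambda>y :: real \<times> real. fst y / \<tau>) \<in> borel_measurable borel2"
    by (intro borel_measurable_divide measurable_fst borel_measurable_const)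
  show "(\<lambda>y. nat \<lfloor>fst y / \<tau>\<rfloor>) \<in> measurable borel2 (count_space UNIV)"
    by measurable
qed

definition Qm :: "real \<Rightarrow> (real \<times> real) measure" where
  "Qm T = Iv 0 T \<Otimes>\<^sub>M circ"

lemma space_Qm [simp]: "space (Qm T) = {0..T} \<times> {0..2 * pi}"
  by (simp add: Qm_def space_pair_measure)

lemma measurable_Qm [measurable (raw)]:
  "f \<in> borel_measurable borel2 \<Longrightarrow> f \<in> borel_measurable (Qm T)"
  unfolding Qm_def by (rule measurable_Iv_pair)

lemma finite_measure_Qm: "finite_measure (Qm T)"
  unfolding Qm_def by (intro finite_measure_pair_measure finite_measure_Iv)

lemma Qm_bounded_integrable:
  fixes f :: "real \<times> real \<Rightarrow> real"
  assumes "f \<in> borel_measurable (Qm T)" "\<And>y. y \<in> space (Qm T) \<Longrightarrow> \<bar>f y\<bar> \<le> B"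
  shows "integrable (Qm T) f"
  using assms by (intro finite_measure.integrable_const_bound[OF finite_measure_Qm, of _ B]) auto

lemma Qm_Fubini:
  fixes f :: "real \<times> real \<Rightarrow> real"
  assumes "integrable (Qm T) f"
  shows "(LINT y|Qm T. f y) = (LINT t|Iv 0 T. LINT x|circ. f (t, x))" "integrable (Iv 0 T) (\<lambda>t. \<integral>x. f (t, x))"
    "AE t in Iv 0 T. integrable circ (\<lambda>x. f (t, x))"
proof -
  interpret pair_sigma_finite "Iv 0 T" circ by (rule circ_pair_sigma_finite)
  show "(LINT y|Qm T. f y) = (LINT t|Iv 0 T. LINT x|circ. f (t, x))" "integrable (Iv 0 T) (\<lambda>t. \<integral>x. f (t, x))"
    "AE t in Iv 0 T. integrable circ (\<lambda>x. f (t, x))"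
    using assms integral_fst'[of f] integrable_fst'[of f] AE_integrable_fst'[of f] by (simp_all add: Qm_def)
qed

lemma integral_Iv_restrict:
  fixes f :: "real \<Rightarrow> real"
  assumes "0 \<le> t" "t \<le> T"
  shows "(LINT s|Iv 0 T. indicator {0..t} s * f s) = (LINT s|Iv 0 t. f s)"
  unfolding integral_Iv using assms by (intro Bochner_Integration.integral_cong) (auto simp: indicator_def)

lemma Qm_step:
  fixes F :: "nat \<Rightarrow> real \<Rightarrow> real"
  assumes \<tau>: "\<tau> > 0" and t: "0 \<le> t" "t \<le> T" and F: "\<And>j. cper (F j)"
  shows "integrable (Qm T) (\<lambda>y. indicator {0..t} (fst y) * F (nat \<lfloor>fst y / \<tau>\<rfloor>) (snd y))"
    and "(LINT y|Qm T. indicator {0..t} (fst y) * F (nat \<lfloor>fst y / \<tau>\<rfloor>) (snd y))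
      = \<tau> * (\<Sum>i<nat \<lfloor>t / \<tau>\<rfloor>. \<integral>x. F i x) + (t - real (nat \<lfloor>t / \<tau>\<rfloor>) * \<tau>) * (\<integral>x. F (nat \<lfloor>t / \<tau>\<rfloor>) x)"
proof -
  have meas: "F j \<in> borel_measurable borel" for j using F by (intro borel_measurable_continuous_onI) simp
  note [measurable] = step_measurable[OF meas, of "\<lambda>j. j" \<tau>]
  have "\<forall>j. \<exists>B. \<forall>x. \<bar>F j x\<bar> \<le> B" using cper_bounded[OF F] by metis
  then obtain B where B: "\<And>j x. \<bar>F j x\<bar> \<le> B j" by metis
  let ?N = "nat \<lfloor>T / \<tau>\<rfloor>"
  show i: "integrable (Qm T) (\<lambda>y. indicator {0..t} (fst y) * F (nat \<lfloor>fst y / \<tau>\<rfloor>) (snd y))"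
  proof (rule Qm_bounded_integrable[where B = "Max (B ` {..?N})"])
    fix y assume y: "y \<in> space (Qm T)"
    have "nat \<lfloor>fst y / \<tau>\<rfloor> \<le> ?N" using y \<tau> by (intro nat_mono floor_mono divide_right_mono) auto
    hence "B (nat \<lfloor>fst y / \<tau>\<rfloor>) \<le> Max (B ` {..?N})" by (intro Max_ge) auto
    moreover have "0 \<le> \<bar>F (nat \<lfloor>fst y / \<tau>\<rfloor>) (snd y)\<bar>" by simp
    ultimately show "\<bar>indicator {0..t} (fst y) * F (nat \<lfloor>fst y / \<tau>\<rfloor>) (snd y)\<bar> \<le> Max (B ` {..?N})"
      using B[of "nat \<lfloor>fst y / \<tau>\<rfloor>" "snd y"] by (auto simp: indicator_def)
  qed (use step_measurable[OF meas] in measurable)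
  have "(LINT y|Qm T. indicator {0..t} (fst y) * F (nat \<lfloor>fst y / \<tau>\<rfloor>) (snd y)) = (LINT s|Iv 0 T. indicator {0..t} s * (\<integral>x. F (nat \<lfloor>s / \<tau>\<rfloor>) x))"
    using Qm_Fubini(1)[OF i] by simp
  also have "\<dots> = (LINT s|Iv 0 t. (\<integral>x. F (nat \<lfloor>s / \<tau>\<rfloor>) x))" by (rule integral_Iv_restrict[OF t])
  also have "\<dots> = \<tau> * (\<Sum>i<nat \<lfloor>t / \<tau>\<rfloor>. \<integral>x. F i x) + (t - real (nat \<lfloor>t / \<tau>\<rfloor>) * \<tau>) * (\<integral>x. F (nat \<lfloor>t / \<tau>\<rfloor>) x)"
    by (rule step_integral(2)[OF \<tau> t(1), of "\<lambda>j. \<integral>x. F j x"])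
  finally show "(LINT y|Qm T. indicator {0..t} (fst y) * F (nat \<lfloor>fst y / \<tau>\<rfloor>) (snd y))
      = \<tau> * (\<Sum>i<nat \<lfloor>t / \<tau>\<rfloor>. \<integral>x. F i x) + (t - real (nat \<lfloor>t / \<tau>\<rfloor>) * \<tau>) * (\<integral>x. F (nat \<lfloor>t / \<tau>\<rfloor>) x)" .
qed

section \<open>The limit of the scheme\<close>

text \<open>\<open>hclamp\<close> freezes \<open>h\<close> outside the time interval, so bounds and
  continuity hold for all real times. \<open>rem0\<close> makes the incomplete last time step
  negligible; its power of \<open>e n\<close> is the one lost by third differences.\<close>

locale film_limit = film +
  fixes T :: real and e \<tau> :: "nat \<Rightarrow> real" and h :: "real \<Rightarrow> real \<Rightarrow> real"
  assumes T: "0 < T" "T \<le> 1"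
    and good: "\<And>n. good (e n) (\<tau> n)"
    and e0: "e \<longlonglongrightarrow> 0" "\<And>n. e n \<le> 1"
    and err0: "(\<lambda>n. err (e n) (\<tau> n)) \<longlonglongrightarrow> 0"
    and rem0: "(\<lambda>n. \<tau> n * (Bj (e n) / e n ^ 3)) \<longlonglongrightarrow> 0"
    and near: "\<And>n j x. real j * \<tau> n \<le> T \<Longrightarrow> \<bar>H (e n) (\<tau> n) j x - h0 x\<bar> \<le> C0 / 2"
    and conv: "\<And>\<epsilon>. \<epsilon> > 0 \<Longrightarrow> \<exists>N. \<forall>n\<ge>N. \<forall>t\<in>{0..T}. \<forall>x. \<bar>H (e n) (\<tau> n) (nat \<lfloor>t / \<tau> n\<rfloor>) x - h t x\<bar> \<le> \<epsilon>"
    and hcont: "\<And>\<epsilon>. \<epsilon> > 0 \<Longrightarrow> \<exists>d>0. \<forall>s t x y. \<bar>t - s\<bar> \<le> d \<longrightarrow> \<bar>y - x\<bar> \<le> d \<longrightarrow> \<bar>h t y - h s x\<bar> \<le> \<epsilon>"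
    and hclamp: "\<And>t. h t = h (max 0 (min T t))"
begin

abbreviation "p \<equiv> \<alpha> + 1"
abbreviation "q \<equiv> (\<alpha> + 1) / \<alpha>"
abbreviation "Q \<equiv> Qm T"
abbreviation "Hs n \<equiv> H (e n) (\<tau> n)"

lemma p1: "p > 1" and q1: "q > 1" and pq: "1/p + 1/q = 1" and qp: "1/q + 1/p = 1" and pq0: "p > 0" "q > 0"
  using alpha by (auto simp: field_simps)

lemma pos: "e n > 0" "\<tau> n > 0"
  using good[of n] by (auto simp: good_def)

definition jn :: "nat \<Rightarrow> real \<Rightarrow> nat" where "jn n t = nat \<lfloor>t / \<tau> n\<rfloor>"

definition Hn :: "nat \<Rightarrow> real \<Rightarrow> real \<Rightarrow> real" where "Hn n t = Hs n (jn n t)"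

definition Zn :: "nat \<Rightarrow> real \<times> real \<Rightarrow> real" where "Zn n y = zz (e n) (Hn n (fst y)) (snd y)"

definition Jn :: "nat \<Rightarrow> real \<times> real \<Rightarrow> real" where "Jn n y = JJ (e n) (Hn n (fst y)) (snd y)"

lemma cper_Hn: "cper (Hn n t)"
  unfolding Hn_def by (rule cper_H[OF pos(1)])

lemma jn_le: "t \<in> {0..T} \<Longrightarrow> real (jn n t) * \<tau> n \<le> t"
  unfolding jn_def using floor_step(1)[OF pos(2)[of n], of t] by simp

lemma H_range:
  assumes "real j * \<tau> n \<le> T"
  shows "cl \<le> Hs n j x" "Hs n j x \<le> M" "\<bar>Hs n j x\<bar> \<le> M"
proof -
  have 1: "- (C0 / 2) \<le> Hs n j x - h0 x" "Hs n j x - h0 x \<le> C0 / 2"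
    using near[OF assms, of x] by (auto simp only: abs_le_iff)
  have 2: "h0 x \<le> M0" using M0[of x] by simp
  show "cl \<le> Hs n j x" using 1 h0_ge[of x] unfolding cl_def by linarith
  hence "0 \<le> Hs n j x" using cl_pos by linarith
  moreover show "Hs n j x \<le> M" using 1 2 C0 unfolding M_def by linarith
  ultimately show "\<bar>Hs n j x\<bar> \<le> M" by simp
qed

lemma Hn_range:
  assumes "t \<in> {0..T}"
  shows "cl \<le> Hn n t x" "Hn n t x \<le> M" "\<bar>Hn n t x\<bar> \<le> M"
proof -
  have "real (jn n t) * \<tau> n \<le> T" using jn_le[OF assms, of n] assms by simp
  thus "cl \<le> Hn n t x" "Hn n t x \<le> M" "\<bar>Hn n t x\<bar> \<le> M" unfolding Hn_def by (rule H_range)+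
qed

lemma Hn_uniform: "\<epsilon> > 0 \<Longrightarrow> eventually (\<lambda>n. \<forall>t\<in>{0..T}. \<forall>x. \<bar>Hn n t x - h t x\<bar> \<le> \<epsilon>) sequentially"
  using conv[of \<epsilon>] by (auto simp: Hn_def jn_def eventually_sequentially)

lemma Hn_tendsto: "t \<in> {0..T} \<Longrightarrow> (\<lambda>n. Hn n t x) \<longlonglongrightarrow> h t x"
proof (rule LIMSEQ_I)
  fix r :: real assume t: "t \<in> {0..T}" and r: "r > 0"
  have "eventually (\<lambda>n. \<forall>t\<in>{0..T}. \<forall>x. \<bar>Hn n t x - h t x\<bar> \<le> r / 2) sequentially" using r by (intro Hn_uniform) simp
  then obtain N where N: "\<And>n. n \<ge> N \<Longrightarrow> \<bar>Hn n t x - h t x\<bar> \<le> r / 2" using t unfolding eventually_sequentially by blast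
  have "norm (Hn n t x - h t x) < r" if "n \<ge> N" for n using N[OF that] r by simp
  thus "\<exists>N. \<forall>n\<ge>N. norm (Hn n t x - h t x) < r" by blast
qed

lemma clampT: "max 0 (min T t) \<in> {0..T}"
  using T by auto

lemma h_range: "cl \<le> h t x" "h t x \<le> M" "\<bar>h t x\<bar> \<le> M"
proof -
  let ?t = "max 0 (min T t)"
  have l: "(\<lambda>n. Hn n ?t x) \<longlonglongrightarrow> h t x" using Hn_tendsto[OF clampT] hclamp[of t] by simp
  show "cl \<le> h t x" "h t x \<le> M"
    using LIMSEQ_le_const[OF l, of cl] LIMSEQ_le_const2[OF l, of M] Hn_range[OF clampT[of t]] by auto
  thus "\<bar>h t x\<bar> \<le> M" using cl_pos by simp
qed

lemma cper_h: "cper (h t)"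
proof
  show "periodic (h t)"
    unfolding periodic_def
  proof
    fix x
    let ?t = "max 0 (min T t)"
    have "(\<lambda>n. Hn n ?t (x + 2 * pi)) \<longlonglongrightarrow> h t (x + 2 * pi)" "(\<lambda>n. Hn n ?t x) \<longlonglongrightarrow> h t x"
      using Hn_tendsto[OF clampT[of t]] hclamp[of t] by simp_all
    moreover have "Hn n ?t (x + 2 * pi) = Hn n ?t x" for n using cper_Hn periodicD by blast
    ultimately show "h t (x + 2 * pi) = h t x" using LIMSEQ_unique by simp
  qed
  show "continuous_on UNIV (h t)"
    unfolding continuous_on_iff
  proof (intro ballI allI impI)
    fix x \<epsilon> :: real assume "\<epsilon> > 0"
    hence "\<epsilon> / 2 > 0" by simp
    from hcont[OF this] obtain d where d: "d > 0" "\<And>x y. \<bar>y - x\<bar> \<le> d \<Longrightarrow> \<bar>h t y - h t x\<bar> \<le> \<epsilon> / 2" by force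
    have "dist (h t y) (h t x) < \<epsilon>" if "dist y x < d" for y
      using d(2)[of y x] that \<open>\<epsilon> > 0\<close> by (simp add: dist_real_def)
    thus "\<exists>d>0. \<forall>x'\<in>UNIV. dist x' x < d \<longrightarrow> dist (h t x') (h t x) < \<epsilon>" using d(1) by blast
  qed
qed

lemma h_joint_continuous: "continuous_on UNIV (\<lambda>y. h (fst y) (snd y))"
  unfolding continuous_on_iff
proof (intro ballI allI impI)
  fix x :: "real \<times> real" and \<epsilon> :: real assume "\<epsilon> > 0"
  hence "\<epsilon> / 2 > 0" by simp
  from hcont[OF this] obtain d where d: "d > 0" "\<And>s t x y. \<bar>t - s\<bar> \<le> d \<Longrightarrow> \<bar>y - x\<bar> \<le> d \<Longrightarrow> \<bar>h t y - h s x\<bar> \<le> \<epsilon> / 2" by blast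
  have "dist (h (fst y) (snd y)) (h (fst x) (snd x)) < \<epsilon>" if "dist y x < d" for y
  proof -
    have "\<bar>fst y - fst x\<bar> \<le> d" "\<bar>snd y - snd x\<bar> \<le> d"
      using that dist_fst_le[of y x] dist_snd_le[of y x] by (auto simp: dist_real_def)
    from d(2)[OF this] show ?thesis using \<open>\<epsilon> > 0\<close> by (simp add: dist_real_def)
  qed
  thus "\<exists>d>0. \<forall>x'\<in>UNIV. dist x' x < d \<longrightarrow> dist (h (fst x') (snd x')) (h (fst x) (snd x)) < \<epsilon>" using d(1) by blast
qed

lemma h_measurable [measurable]: "(\<lambda>y. h (fst y) (snd y)) \<in> borel_measurable borel2"
  using borel_measurable_continuous_onI[OF h_joint_continuous] by (simp add: borel_prod)

lemma h_0: "h 0 = h0"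
proof
  fix x
  have "Hn n 0 x = h0 x" for n by (simp add: Hn_def jn_def)
  thus "h 0 x = h0 x" using Hn_tendsto[of 0 x] T by (simp add: LIMSEQ_const_iff)
qed

lemma zz_meas: "zz (e n) (Hs n j) \<in> borel_measurable borel"
  and JJ_meas: "JJ (e n) (Hs n j) \<in> borel_measurable borel"
  and H_meas: "Hs n j \<in> borel_measurable borel"
  using cper_zz[OF cper_H[OF pos(1)] pos(1)] cper_JJ[OF cper_H[OF pos(1)] pos(1)] cper_H[OF pos(1)]
  by (auto intro: borel_measurable_continuous_onI)

lemma Zn_measurable [measurable]: "Zn n \<in> borel_measurable borel2"
  and Jn_measurable [measurable]: "Jn n \<in> borel_measurable borel2"
  and Hn_measurable [measurable]: "(\<lambda>y. Hn n (fst y) (snd y)) \<in> borel_measurable borel2"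
  using step_measurable[of "\<lambda>j. zz (e n) (Hs n j)", OF zz_meas, of "\<tau> n"]
    step_measurable[of "\<lambda>j. JJ (e n) (Hs n j)", OF JJ_meas, of "\<tau> n"]
    step_measurable[of "\<lambda>j. Hs n j", OF H_meas, of "\<tau> n"]
  by (simp_all add: Zn_def[abs_def] Jn_def[abs_def] Hn_def jn_def)

lemma Zn_bound: "y \<in> space Q \<Longrightarrow> \<bar>Zn n y\<bar> \<le> M / e n + M / e n ^ 3"
  unfolding Zn_def by (rule zz_bound[OF cper_Hn pos(1)]) (use Hn_range in auto)

lemma Jn_bound: "y \<in> space Q \<Longrightarrow> \<bar>Jn n y\<bar> \<le> Bj (e n)"
  unfolding Jn_def by (rule JJ_bound[OF cper_Hn pos(1)]) (use Hn_range in auto)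

lemma Lpf_Zn: "s > 0 \<Longrightarrow> Lpf Q s (Zn n)" and Lpf_Jn: "s > 0 \<Longrightarrow> Lpf Q s (Jn n)"
  by (rule Lpf_bounded[OF finite_measure_Qm _ Zn_bound], measurable)
    (rule Lpf_bounded[OF finite_measure_Qm _ Jn_bound], measurable)

text \<open>The size, up to constants, of one time step's contribution to the pairing of the flux
  with a function of order \<open>1 / e n ^ 3\<close>.\<close>

definition \<rho> :: "nat \<Rightarrow> real" where "\<rho> n = \<tau> n * (Bj (e n) / e n ^ 3)"

lemma \<rho>_lim: "\<rho> \<longlonglongrightarrow> 0"
  using rem0 by (simp add: \<rho>_def[abs_def])

lemma Bj_nonneg: "Bj x \<ge> 0"
  by (simp add: Bj_def)

text \<open>The sum over whole steps and the integral up to time \<open>t\<close> differ only by the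
  incomplete cell that contains \<open>t\<close>.\<close>

lemma step_sum:
  assumes t: "t \<in> {0..T}" and G: "\<And>j. cper (G j)" and b: "\<And>x. \<bar>G (jn n t) x\<bar> \<le> B / e n ^ 3"
  shows "\<bar>(LINT y|Q. Jn n y * (indicator {0..t} (fst y) * G (nat \<lfloor>fst y / \<tau> n\<rfloor>) (snd y))) -
     \<tau> n * (\<Sum>i<jn n t. \<integral>x. JJ (e n) (Hs n i) x * G i x)\<bar> \<le> 2 * pi * B * \<rho> n"
proof -
  let ?F = "\<lambda>j x. JJ (e n) (Hs n j) x * G j x"
  have c: "cper (?F j)" for j by (intro cper_mult cper_JJ cper_H pos G)
  have B: "B / e n ^ 3 \<ge> 0" using b[of 0] by linarith
  have st: "0 \<le> t - real (jn n t) * \<tau> n" "t - real (jn n t) * \<tau> n \<le> \<tau> n"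
  proof -
    have "0 \<le> t" using t by simp
    from floor_step[OF pos(2)[of n] this] show "0 \<le> t - real (jn n t) * \<tau> n" "t - real (jn n t) * \<tau> n \<le> \<tau> n"
      unfolding jn_def by linarith+
  qed
  have Jb: "\<bar>JJ (e n) (Hn n t) x\<bar> \<le> Bj (e n)" for x by (rule JJ_bound[OF cper_Hn pos(1)]) (use Hn_range[OF t] in auto)
  have "\<bar>LINT x|circ. ?F (jn n t) x\<bar> \<le> (\<integral>x. \<bar>?F (jn n t) x\<bar>)" by (rule integral_abs_bound)
  also have "\<dots> \<le> 2 * pi * (Bj (e n) * (B / e n ^ 3))"
  proof (rule integral_circ_bound)
    show "\<bar>?F (jn n t) x\<bar> \<le> Bj (e n) * (B / e n ^ 3)" for x
      unfolding abs_mult Hn_def[symmetric] using Jb b Bj_nonneg by (intro mult_mono) auto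
  qed (use cper_integrable[OF c] in auto)
  finally have "\<bar>(t - real (jn n t) * \<tau> n) * (\<integral>x. ?F (jn n t) x)\<bar> \<le> \<tau> n * (2 * pi * (Bj (e n) * (B / e n ^ 3)))"
    unfolding abs_mult using st pos(2)[of n] by (intro mult_mono) auto
  hence r: "\<bar>(t - real (jn n t) * \<tau> n) * (\<integral>x. ?F (jn n t) x)\<bar> \<le> 2 * pi * B * \<rho> n" by (simp add: \<rho>_def mult_ac)
  have "(LINT y|Q. Jn n y * (indicator {0..t} (fst y) * G (nat \<lfloor>fst y / \<tau> n\<rfloor>) (snd y)))
     = (LINT y|Q. indicator {0..t} (fst y) * ?F (nat \<lfloor>fst y / \<tau> n\<rfloor>) (snd y))"
    by (intro Bochner_Integration.integral_cong) (auto simp: Jn_def Hn_def jn_def)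
  also have "\<dots> = \<tau> n * (\<Sum>i<jn n t. \<integral>x. ?F i x) + (t - real (jn n t) * \<tau> n) * (\<integral>x. ?F (jn n t) x)"
    using Qm_step(2)[of "\<tau> n" t T ?F, OF pos(2) _ _ c] t by (simp add: jn_def)
  finally show ?thesis using r by simp
qed

lemma JZ_bound:
  assumes t: "t \<in> {0..T}"
  shows "\<bar>(LINT y|Q. indicator {0..t} (fst y) * (Jn n y * Zn n y)) -
     \<tau> n * (\<Sum>i<jn n t. \<integral>x. JJ (e n) (Hs n i) x * zz (e n) (Hs n i) x)\<bar> \<le> 4 * pi * M * \<rho> n"
proof -
  have "\<bar>zz (e n) (Hs n (jn n t)) x\<bar> \<le> 2 * M / e n ^ 3" for x
  proof -
    have "e n ^ 3 \<le> e n ^ 1" using pos(1)[of n] e0(2)[of n] by (intro power_decreasing) auto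
    hence "M / e n \<le> M / e n ^ 3" using pos(1)[of n] M_pos by (intro divide_left_mono) auto
    moreover have "\<bar>zz (e n) (Hn n t) x\<bar> \<le> M / e n + M / e n ^ 3" by (rule zz_bound[OF cper_Hn pos(1)]) (use Hn_range[OF t] in auto)
    ultimately show ?thesis unfolding Hn_def by simp
  qed
  from step_sum[where G = "\<lambda>j. zz (e n) (Hs n j)", OF t cper_zz[OF cper_H[OF pos(1)] pos(1)] this] show ?thesis
    by (simp add: Zn_def Hn_def jn_def mult.left_commute)
qed

lemma restrict_full: "(LINT y|Q. indicator {0..T} (fst y) * f y) = (LINT y|Q. f y)" for f :: "real \<times> real \<Rightarrow> real"
  by (intro Bochner_Integration.integral_cong) auto

lemma JZ_int_bound: "(LINT y|Q. Jn n y * Zn n y) \<le> K + 4 * pi * M * \<rho> n"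
proof -
  have T': "T \<in> {0..T}" using T by simp
  have j: "real (jn n T) * \<tau> n \<le> T" using jn_le[OF T'] .
  have "\<tau> n * (\<Sum>i<jn n T. \<integral>x. JJ (e n) (Hs n i) x * zz (e n) (Hs n i) x) \<le> K"
  proof (rule a_priori(2)[OF good])
    fix i x assume "i \<le> jn n T"
    hence "real i * \<tau> n \<le> real (jn n T) * \<tau> n" using pos(2)[of n] by (intro mult_right_mono) auto
    thus "\<bar>Hs n i x\<bar> \<le> M" using j by (intro H_range) auto
  qed (use j T in auto)
  thus ?thesis using JZ_bound[OF T', of n] unfolding restrict_full by linarith
qed

lemma dsm_Hn_bound:
  assumes t: "t \<in> {0..T}" and k: "k > 0"
  shows "L2sq (dsm k (Hn n t)) \<le> K"
  unfolding Hn_def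
proof (rule a_priori(1)[OF good _ _ k])
  have j: "real (jn n t) * \<tau> n \<le> T" using jn_le[OF t, of n] t by simp
  thus "real (jn n t) * \<tau> n \<le> 1" using T by simp
  fix i x assume "i \<le> jn n t"
  hence "real i * \<tau> n \<le> real (jn n t) * \<tau> n" using pos(2)[of n] by (intro mult_right_mono) auto
  thus "\<bar>Hs n i x\<bar> \<le> M" using j by (intro H_range) auto
qed

text \<open>The mobility lies between positive constants along the iterates. The dissipation density
  is \<open>mob\<close> times the \<open>p\<close>-th power of \<open>Zn\<close>, and the
  \<open>q\<close>-th power of \<open>Jn\<close> is the dissipation density times
  \<open>mob powr (q - 1)\<close>, so both norms are controlled by the dissipation.\<close>

lemma Ip_Zn_Jn:
  obtains C where "\<And>n. Ip Q p (Zn n) \<le> C" "\<And>n. Ip Q q (Jn n) \<le> C"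
proof -
  have "Bseq \<rho>" using \<rho>_lim by (intro convergent_imp_Bseq convergentI)
  then obtain R where R: "\<And>n. \<bar>\<rho> n\<bar> \<le> R" unfolding Bseq_def by auto
  define S where "S = K + 4 * pi * M * R"
  have S: "(LINT y|Q. Jn n y * Zn n y) \<le> S" for n
  proof -
    have "4 * pi * M * \<rho> n \<le> 4 * pi * M * R" using R[of n] M_pos by (intro mult_left_mono) auto
    thus ?thesis using JZ_int_bound[of n] unfolding S_def by linarith
  qed
  have JZ: "Jn n y * Zn n y = mob (Hn n (fst y) (snd y)) * \<bar>Zn n y\<bar> powr p" for n y
    using JJ_zz by (simp add: Jn_def Zn_def)
  have i: "integrable Q (\<lambda>y. Jn n y * Zn n y)" for n
    by (rule Lpf_mult_integrable[OF Lpf_Jn Lpf_Zn q1 p1 qp]) (use pq0 in auto)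
  define c where "c = cl powr (\<alpha> + 2)"
  have c: "c > 0" using cl_pos by (simp add: c_def)
  have "Ip Q p (Zn n) \<le> S / c" for n
  proof -
    have "Ip Q p (Zn n) \<le> (LINT y|Q. (1 / c) * (Jn n y * Zn n y))"
    proof (intro integral_mono)
      fix y
      have "c * \<bar>Zn n y\<bar> powr p \<le> mob (Hn n (fst y) (snd y)) * \<bar>Zn n y\<bar> powr p"
        unfolding c_def by (intro mult_right_mono mob_ge) auto
      thus "\<bar>Zn n y\<bar> powr p \<le> (1 / c) * (Jn n y * Zn n y)" using c unfolding JZ by (simp add: field_simps)
    qed (use Lpf_Zn[of p n] i pq0 in \<open>auto simp: Lpf_def\<close>)
    also have "\<dots> = (LINT y|Q. Jn n y * Zn n y) / c" by simp
    also have "\<dots> \<le> S / c" using S c by (intro divide_right_mono) auto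
    finally show ?thesis .
  qed
  moreover
  define m where "m = (M powr (\<alpha> + 2)) powr (q - 1)"
  have "Ip Q q (Jn n) \<le> m * S" for n
  proof -
    have "Ip Q q (Jn n) \<le> (LINT y|Q. m * (Jn n y * Zn n y))"
    proof (intro integral_mono)
      fix y assume y: "y \<in> space Q"
      let ?m = "mob (Hn n (fst y) (snd y))"
      have "\<bar>Jn n y\<bar> = ?m * \<bar>Zn n y\<bar> powr \<alpha>"
        using mob_pos[of "Hn n (fst y) (snd y)"] by (simp add: Jn_def JJ_def Zn_def abs_mult abs_psi)
      hence "\<bar>Jn n y\<bar> powr q = ?m powr q * \<bar>Zn n y\<bar> powr p"
        using alpha mob_pos[of "Hn n (fst y) (snd y)"] by (simp add: powr_mult powr_powr)
      also have "?m powr q = ?m powr (q - 1) * ?m" using mob_pos[of "Hn n (fst y) (snd y)"] powr_add[of ?m "q - 1" 1] by simp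
      also have "?m powr (q - 1) * ?m * \<bar>Zn n y\<bar> powr p = ?m powr (q - 1) * (Jn n y * Zn n y)" unfolding JZ by simp
      also have "\<dots> \<le> m * (Jn n y * Zn n y)"
      proof (intro mult_right_mono)
        have "Hn n (fst y) (snd y) \<le> M" using y Hn_range by auto
        thus "?m powr (q - 1) \<le> m" unfolding m_def using q1 mob_pos[of "Hn n (fst y) (snd y)"] by (intro powr_mono2 mob_le) auto
        show "0 \<le> Jn n y * Zn n y" unfolding JZ using mob_pos[of "Hn n (fst y) (snd y)"] by simp
      qed
      finally show "\<bar>Jn n y\<bar> powr q \<le> m * (Jn n y * Zn n y)" .
    qed (use Lpf_Jn[of q n] i pq0 in \<open>auto simp: Lpf_def\<close>)
    also have "\<dots> = m * (LINT y|Q. Jn n y * Zn n y)" by simp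
    also have "\<dots> \<le> m * S" using S by (intro mult_left_mono) (auto simp: m_def)
    finally show ?thesis .
  qed
  ultimately show ?thesis using that[of "max (S / c) (m * S)"] by (meson max.coboundedI1 max.coboundedI2)
qed

text \<open>The weights are shared by both sequences. The limits are explicit pointwise limits,
  hence Borel on the whole plane and periodic in space for every time.\<close>

lemma weak_limits:
  obtains w z J where "\<And>n. w n \<in> convw n"
    "z \<in> borel_measurable borel2" "J \<in> borel_measurable borel2"
    "\<And>t. periodic (\<lambda>x. z (t, x))" "\<And>t. periodic (\<lambda>x. J (t, x))"
    "Lpf Q p z" "Lp_conv Q p (\<lambda>n. comb (w n) Zn) z" "Lpf Q q J" "Lp_conv Q q (\<lambda>n. comb (w n) Jn) J"
proof -
  obtain C where C: "\<And>n. Ip Q p (Zn n) \<le> C" "\<And>n. Ip Q q (Jn n) \<le> C" using Ip_Zn_Jn by blast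
  obtain w r s where w: "\<And>n. w n \<in> convw n" and r:
    "Lpf Q p (\<lambda>x. lim (\<lambda>n. comb (w (r n)) Zn x))" "Lp_conv Q p (\<lambda>n. comb (w n) Zn) (\<lambda>x. lim (\<lambda>n. comb (w (r n)) Zn x))"
    "Lpf Q q (\<lambda>x. lim (\<lambda>n. comb (w (s n)) Jn x))" "Lp_conv Q q (\<lambda>n. comb (w n) Jn) (\<lambda>x. lim (\<lambda>n. comb (w (s n)) Jn x))"
  proof (rule convex_combinations_converge[of Q p q Zn C Jn])
    show "Lpf Q p (Zn n)" "Lpf Q q (Jn n)" for n using pq0 by (auto intro: Lpf_Zn Lpf_Jn)
  qed (use p1 q1 C that finite_measure_Qm in auto)
  have m: "comb (w n) Zn \<in> borel_measurable borel2" "comb (w n) Jn \<in> borel_measurable borel2" for n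
    unfolding comb_def[abs_def] by measurable
  have per: "Zn n (t, x + 2 * pi) = Zn n (t, x)" "Jn n (t, x + 2 * pi) = Jn n (t, x)" for n t x
    using cper_zz[OF cper_Hn[of n t] pos(1)[of n]] cper_JJ[OF cper_Hn[of n t] pos(1)[of n]]
    by (auto simp: Zn_def Jn_def periodic_def)
  hence per': "comb (w n) Zn (t, x + 2 * pi) = comb (w n) Zn (t, x)" "comb (w n) Jn (t, x + 2 * pi) = comb (w n) Jn (t, x)" for n t x
    by (simp_all add: comb_def)
  show ?thesis
  proof (rule that[OF w _ _ _ _ r])
    show "(\<lambda>x. lim (\<lambda>n. comb (w (r n)) Zn x)) \<in> borel_measurable borel2"
      "(\<lambda>x. lim (\<lambda>n. comb (w (s n)) Jn x)) \<in> borel_measurable borel2"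
      using m by measurable
    show "periodic (\<lambda>x. lim (\<lambda>n. comb (w (r n)) Zn (t, x)))" "periodic (\<lambda>x. lim (\<lambda>n. comb (w (s n)) Jn (t, x)))" for t
      by (simp_all add: periodic_def per')
  qed
qed

end

section \<open>Mollified operators in space-time and limits at fixed width\<close>

lemma dq_measurable:
  assumes [measurable]: "f \<in> borel_measurable borel2"
  shows "(\<lambda>y. dq k (\<lambda>x. f (fst y, x)) (snd y)) \<in> borel_measurable borel2"
proof -
  have [measurable]: "(\<lambda>y. (fst y, snd y + c)) \<in> measurable borel2 borel2" for c :: real
    by measurable
  have "(\<lambda>y. f (fst y, snd y + c)) \<in> borel_measurable borel2" for c :: real by measurable
  from this[of k] this[of "- k"] show ?thesis by (simp add: dq_def)
qed

lemma avg_measurable: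
  assumes [measurable]: "f \<in> borel_measurable borel2"
  shows "(\<lambda>y. avg k (\<lambda>x. f (fst y, x)) (snd y)) \<in> borel_measurable borel2"
proof -
  have id: "(\<lambda>y. y) \<in> measurable (Iv (- k) k) borel" by (rule measurable_Iv) simp
  have "(\<lambda>y. (fst (fst y), snd (fst y) + snd y)) \<in> measurable (borel2 \<Otimes>\<^sub>M Iv (- k) k) (borel \<Otimes>\<^sub>M (borel :: real measure))"
    by (intro measurable_Pair borel_measurable_add measurable_compose[OF measurable_fst measurable_fst]
      measurable_compose[OF measurable_fst measurable_snd] measurable_compose[OF measurable_snd id])
  from measurable_compose[OF this assms]
  have "(\<lambda>y. f (fst (fst y), snd (fst y) + snd y)) \<in> borel_measurable (borel2 \<Otimes>\<^sub>M Iv (- k) k)" by simp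
  hence "(\<lambda>(y, z). f (fst y, snd y + z)) \<in> borel_measurable (borel2 \<Otimes>\<^sub>M Iv (- k) k)"
    by (simp add: case_prod_beta')
  hence "(\<lambda>y. LINT z|Iv (- k) k. f (fst y, snd y + z)) \<in> borel_measurable borel2"
    by (rule sigma_finite_measure.borel_measurable_lebesgue_integral[OF finite_measure.axioms(1)[OF finite_measure_Iv]])
  thus ?thesis unfolding avg_def by measurable
qed

lemma avg3_measurable:
  assumes "f \<in> borel_measurable borel2"
  shows "(\<lambda>y. avg3 k (\<lambda>x. f (fst y, x)) (snd y)) \<in> borel_measurable borel2"
  using avg_measurable[OF avg_measurable[OF avg_measurable[OF assms, of k], of k], of k] by (simp add: avg3_def)

lemma zz_measurable:
  assumes "f \<in> borel_measurable borel2"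
  shows "(\<lambda>y. zz k (\<lambda>x. f (fst y, x)) (snd y)) \<in> borel_measurable borel2"
  using dq_measurable[OF avg_measurable[OF avg_measurable[OF assms, of k], of k], of k]
    dq_measurable[OF dq_measurable[OF dq_measurable[OF assms, of k], of k], of k] by (simp add: zz_def dsm_def)

lemma avg_shift: "avg k (\<lambda>x. u (x + c)) x = avg k u (x + c)"
  by (simp add: avg_def add_ac)

lemma zz_shift: "zz k (\<lambda>x. u (x + c)) x = zz k u (x + c)"
proof -
  have "avg k (\<lambda>x. u (x + c)) = (\<lambda>x. avg k u (x + c))" "dq k (\<lambda>x. u (x + c)) = (\<lambda>x. dq k u (x + c))" for u
    by (auto simp: avg_shift dq_def algebra_simps)
  thus ?thesis by (simp add: zz_def dsm_def)
qed

lemma cper_shift: "cper u \<Longrightarrow> cper (\<lambda>x. u (x + c))"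
  using Lper_shift[OF cper_Lper, of u c] by (auto simp: Lper_def intro: continuous_on_compose2[of UNIV u] intro!: continuous_intros)

lemma flux_test:
  assumes S: "cper S" and u: "cper u" and v: "Lper v" and p: "prim v u" and k: "k > 0"
  shows "(\<integral>x. dsm k S x * u x) = - (\<integral>x. S x * avg3 k v x)"
proof -
  have 1: "dq k u = avg k v" using prim_avg[OF p k] by auto
  have c: "cper (avg k v)" by (rule cper_avg[OF v k])
  have "(\<integral>x. dsm k S x * u x) = - (\<integral>x. avg k (avg k S) x * avg k v x)"
    unfolding dsm_def 1[symmetric] using S u k by (intro dq_adjoint_cper cper_Lper) (auto simp: cper_simps)
  also have "(\<integral>x. avg k (avg k S) x * avg k v x) = (\<integral>x. avg k S x * avg k (avg k v) x)"
    by (rule avg_adjoint_cper[OF cper_Lper[OF cper_avg'[OF S k]] c])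
  also have "\<dots> = (\<integral>x. S x * avg3 k v x)"
    unfolding avg3_def by (rule avg_adjoint_cper[OF cper_Lper[OF S] cper_avg'[OF c k]])
  finally show ?thesis .
qed

lemma avg3_adjoint:
  assumes "cper u" "cper v" "k > 0"
  shows "(\<integral>x. avg3 k u x * v x) = (\<integral>x. u x * avg3 k v x)"
proof -
  have "(\<integral>x. avg3 k u x * v x) = (\<integral>x. avg k (avg k u) x * avg k v x)"
    unfolding avg3_def using assms by (intro avg_adjoint_cper cper_Lper) (auto simp: cper_simps)
  also have "\<dots> = (\<integral>x. avg k u x * avg k (avg k v) x)" using assms by (intro avg_adjoint_cper cper_Lper) (auto simp: cper_simps)
  also have "\<dots> = (\<integral>x. u x * avg3 k v x)"
    unfolding avg3_def using assms by (intro avg_adjoint_cper cper_Lper) (auto simp: cper_simps)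
  finally show ?thesis .
qed

lemma L2sq_avg3_tendsto:
  assumes v: "Lpc 2 v" shows "(\<lambda>n. L2sq (avg3 (1 / real (Suc n)) v)) \<longlonglongrightarrow> L2sq v"
proof -
  have "Lp_conv circ 2 (\<lambda>n. avg3 (1 / real (Suc n)) v) v" by (rule Lp_conv_avg3[OF v _ _ avg_small_step]) auto
  hence "(\<lambda>n. Ip circ 2 (avg3 (1 / real (Suc n)) v)) \<longlonglongrightarrow> Ip circ 2 v"
    using v by (intro Lp_conv_Ip Lpc_Lpf Lpc_avg3) auto
  thus ?thesis by (simp add: abs_powr_2)
qed

lemma dsm_sq_limit:
  assumes u: "cper u" and v: "Lpc 2 v" "prim v u"
  shows "(\<lambda>n. L2sq (dsm (1 / real (Suc n)) u)) \<longlonglongrightarrow> L2sq v"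
  using L2sq_avg3_tendsto[OF v(1)] by (simp add: dsm_of_prim[OF u v(2)])

lemma En_limit:
  assumes u: "cper u" and v: "Lpc 2 v" "prim v u"
  shows "(\<lambda>n. En (1 / real (Suc n)) u) \<longlonglongrightarrow> 1 / 2 * L2sq v - 1 / 2 * L2sq u"
proof -
  have "En (1 / real (Suc n)) u = 1 / 2 * L2sq (dsm (1 / real (Suc n)) u) - 1 / 2 * L2sq (avg3 (1 / real (Suc n)) u)" for n
    by (rule En_split[OF u]) simp
  thus ?thesis using u by (simp only:) (intro tendsto_intros dsm_sq_limit[OF u v] L2sq_avg3_tendsto cper_Lpc; simp)
qed

context film_limit
begin

lemma zz_uniform:
  assumes k: "k > 0" and \<epsilon>: "\<epsilon> > 0"
  shows "\<exists>r>0. \<forall>u v. cper u \<longrightarrow> cper v \<longrightarrow> (\<forall>x. \<bar>u x - v x\<bar> \<le> r) \<longrightarrow> (\<forall>x. \<bar>zz k u x - zz k v x\<bar> \<le> \<epsilon>)"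
proof -
  define c where "c = 1 / k + 1 / k ^ 3"
  have c: "c > 0" using k by (simp add: c_def add_pos_pos)
  show ?thesis
  proof (intro exI[of _ "\<epsilon> / c"] conjI allI impI)
    show "\<epsilon> / c > 0" using \<epsilon> c by simp
    fix u v x assume uv: "cper u" "cper v" "\<forall>x. \<bar>u x - v x\<bar> \<le> \<epsilon> / c"
    have "\<bar>zz k u x - zz k v x\<bar> \<le> \<epsilon> / c / k + \<epsilon> / c / k ^ 3" by (rule zz_diff_bound[OF uv(1,2) k]) (use uv(3) in blast)
    also have "X / k + X / k ^ 3 = X * c" for X by (simp add: c_def distrib_left)
    finally show "\<bar>zz k u x - zz k v x\<bar> \<le> \<epsilon>" using c by simp
  qed
qed

lemma zzH_uniform:
  assumes k: "k > 0" and \<epsilon>: "\<epsilon> > 0"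
  shows "eventually (\<lambda>n. \<forall>t\<in>{0..T}. \<forall>x. \<bar>zz k (Hn n t) x - zz k (h t) x\<bar> \<le> \<epsilon>) sequentially"
proof -
  obtain r where r: "r > 0" "\<And>u v x. cper u \<Longrightarrow> cper v \<Longrightarrow> (\<And>x. \<bar>u x - v x\<bar> \<le> r) \<Longrightarrow> \<bar>zz k u x - zz k v x\<bar> \<le> \<epsilon>"
    using zz_uniform[OF k \<epsilon>] by blast
  from Hn_uniform[OF r(1)] show ?thesis by eventually_elim (intro ballI allI r(2) cper_Hn cper_h; blast)
qed

lemma zzh_modulus:
  assumes k: "k > 0" and \<epsilon>: "\<epsilon> > 0"
  obtains d where "d > 0" "\<And>s t x y. \<bar>t - s\<bar> \<le> d \<Longrightarrow> \<bar>y - x\<bar> \<le> d \<Longrightarrow> \<bar>zz k (h t) y - zz k (h s) x\<bar> \<le> \<epsilon>"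
proof -
  obtain r where r: "r > 0" "\<And>u v x. cper u \<Longrightarrow> cper v \<Longrightarrow> (\<And>x. \<bar>u x - v x\<bar> \<le> r) \<Longrightarrow> \<bar>zz k u x - zz k v x\<bar> \<le> \<epsilon>"
    using zz_uniform[OF k \<epsilon>] by blast
  from hcont[OF r(1)] obtain d where d: "d > 0" "\<And>s t x y. \<bar>t - s\<bar> \<le> d \<Longrightarrow> \<bar>y - x\<bar> \<le> d \<Longrightarrow> \<bar>h t y - h s x\<bar> \<le> r" by blast
  show ?thesis
  proof (rule that[OF d(1)])
    fix s t x y :: real assume st: "\<bar>t - s\<bar> \<le> d" and xy: "\<bar>y - x\<bar> \<le> d"
    have "\<bar>h t (u + (y - x)) - h s u\<bar> \<le> r" for u using xy by (intro d(2) st) auto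
    from r(2)[OF cper_shift[OF cper_h] cper_h this, of x]
    show "\<bar>zz k (h t) y - zz k (h s) x\<bar> \<le> \<epsilon>" by (simp add: zz_shift)
  qed
qed

text \<open>At fixed width \<open>k\<close> the operator \<open>zz k\<close> is bounded in the
  supremum norm, so uniform convergence of the iterates carries over; the additional average of
  width \<open>e n\<close> is harmless because \<open>zz k (h t)\<close> is equicontinuous in time
  and space.\<close>

lemma avg3_zzH_uniform:
  assumes k: "k > 0" and \<epsilon>: "\<epsilon> > 0"
  shows "eventually (\<lambda>n. \<forall>t\<in>{0..T}. \<forall>x. \<bar>avg3 (e n) (zz k (Hn n t)) x - zz k (h t) x\<bar> \<le> \<epsilon>) sequentially"
proof -
  have "\<epsilon> / 6 > 0" using \<epsilon> by simp
  from zzh_modulus[OF k this] obtain d where d: "d > 0" "\<And>s t x y. \<bar>t - s\<bar> \<le> d \<Longrightarrow> \<bar>y - x\<bar> \<le> d \<Longrightarrow> \<bar>zz k (h t) y - zz k (h s) x\<bar> \<le> \<epsilon> / 6" by metis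
  have "\<epsilon> / 2 > 0" using \<epsilon> by simp
  have "eventually (\<lambda>n. e n < d) sequentially" using e0(1) d(1) by (rule order_tendstoD(2))
  with zzH_uniform[OF k \<open>\<epsilon> / 2 > 0\<close>] show ?thesis
  proof eventually_elim
    case (elim n)
    show ?case
    proof (intro ballI allI)
      fix t x assume t: "t \<in> {0..T}"
      have c: "cper (zz k (Hn n t))" "cper (zz k (h t))" using k by (simp_all add: cper_zz cper_Hn cper_h)
      have "\<bar>avg3 (e n) (zz k (Hn n t)) x - avg3 (e n) (zz k (h t)) x\<bar> \<le> \<epsilon> / 2"
        using elim(1) t by (intro avg3_diff_bound c pos) auto
      moreover have "\<bar>avg3 (e n) (zz k (h t)) x - zz k (h t) x\<bar> \<le> 3 * (\<epsilon> / 6)"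
        using elim(2) d(1) by (intro avg3_near c pos d(2)) auto
      ultimately show "\<bar>avg3 (e n) (zz k (Hn n t)) x - zz k (h t) x\<bar> \<le> \<epsilon>" by linarith
    qed
  qed
qed

lemma sq_integral_limit:
  assumes t: "t \<in> {0..T}" and f: "\<And>n. cper (f n)" "cper g" and lim: "\<And>x. (\<lambda>n. f n x) \<longlonglongrightarrow> g x" and B: "\<And>n x. \<bar>f n x\<bar> \<le> B"
  shows "(\<lambda>n. L2sq (f n)) \<longlonglongrightarrow> L2sq g"
proof (rule integral_dominated_convergence[where w = "\<lambda>x. B\<^sup>2"])
  have "continuous_on UNIV u \<Longrightarrow> u \<in> borel_measurable circ" for u :: "real \<Rightarrow> real"
    using borel_measurable_continuous_onI[of u] by measurable
  hence [measurable]: "f n \<in> borel_measurable circ" "g \<in> borel_measurable circ" for n using f by auto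
  show "(\<lambda>x. (g x)\<^sup>2) \<in> borel_measurable circ" "(\<lambda>x. (f n x)\<^sup>2) \<in> borel_measurable circ" for n by measurable
  show "AE x in circ. (\<lambda>n. (f n x)\<^sup>2) \<longlonglongrightarrow> (g x)\<^sup>2" using lim by (auto intro!: tendsto_intros)
  show "AE x in circ. norm ((f n x)\<^sup>2) \<le> B\<^sup>2" for n
    using power_mono[OF B[of n] abs_ge_zero, of _ 2] by auto
qed simp

lemma op_limit:
  assumes t: "t \<in> {0..T}" and c: "c \<ge> 0" and op: "\<And>n B. (\<And>x. \<bar>Hn n t x - h t x\<bar> \<le> B) \<Longrightarrow> \<bar>L n - l\<bar> \<le> B * c"
  shows "L \<longlonglongrightarrow> (l::real)"
proof (rule LIMSEQ_I)
  fix r :: real assume r: "r > 0"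
  hence "r / (c + 1) > 0" using c by simp
  from Hn_uniform[OF this] obtain N where N: "\<And>n x. n \<ge> N \<Longrightarrow> \<bar>Hn n t x - h t x\<bar> \<le> r / (c + 1)"
    using t unfolding eventually_sequentially by blast
  have "norm (L n - l) < r" if "n \<ge> N" for n
  proof -
    have "\<bar>L n - l\<bar> \<le> r / (c + 1) * c" using N[OF that] by (rule op)
    also have "\<dots> < r" using r c by (simp add: field_simps)
    finally show ?thesis by simp
  qed
  thus "\<exists>N. \<forall>n\<ge>N. norm (L n - l) < r" by blast
qed

lemma dsm_Hn_tendsto: "t \<in> {0..T} \<Longrightarrow> k > 0 \<Longrightarrow> (\<lambda>n. dsm k (Hn n t) x) \<longlonglongrightarrow> dsm k (h t) x"
  using dsm_diff_bound[OF cper_Hn cper_h] by (intro op_limit[of t "1 / k"]) auto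

lemma avg3_Hn_tendsto: "t \<in> {0..T} \<Longrightarrow> k > 0 \<Longrightarrow> (\<lambda>n. avg3 k (Hn n t) x) \<longlonglongrightarrow> avg3 k (h t) x"
  using avg3_diff_bound[OF cper_Hn cper_h] by (intro op_limit[of t 1]) auto

lemma int_sq_Hn:
  assumes t: "t \<in> {0..T}"
  shows "(\<lambda>n. L2sq (Hn n t)) \<longlonglongrightarrow> L2sq (h t)"
    and "k > 0 \<Longrightarrow> (\<lambda>n. L2sq (dsm k (Hn n t))) \<longlonglongrightarrow> L2sq (dsm k (h t))"
    and "k > 0 \<Longrightarrow> (\<lambda>n. L2sq (avg3 k (Hn n t))) \<longlonglongrightarrow> L2sq (avg3 k (h t))"
proof -
  show "(\<lambda>n. L2sq (Hn n t)) \<longlonglongrightarrow> L2sq (h t)"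
    by (rule sq_integral_limit[OF t cper_Hn cper_h Hn_tendsto[OF t] Hn_range(3)[OF t]])
  assume k: "k > 0"
  show "(\<lambda>n. L2sq (dsm k (Hn n t))) \<longlonglongrightarrow> L2sq (dsm k (h t))"
    by (rule sq_integral_limit[OF t cper_dsm[OF cper_Hn k] cper_dsm[OF cper_h k] dsm_Hn_tendsto[OF t k] dsm_bound[OF cper_Hn k Hn_range(3)[OF t]]])
  show "(\<lambda>n. L2sq (avg3 k (Hn n t))) \<longlonglongrightarrow> L2sq (avg3 k (h t))"
    by (rule sq_integral_limit[OF t cper_avg3[OF cper_Hn k] cper_avg3[OF cper_h k] avg3_Hn_tendsto[OF t k] avg3_bound[OF cper_Hn k Hn_range(3)[OF t]]])
qed

lemma En_Hn_tendsto: "t \<in> {0..T} \<Longrightarrow> k > 0 \<Longrightarrow> (\<lambda>n. En k (Hn n t)) \<longlonglongrightarrow> En k (h t)"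
  by (simp only: En_split[OF cper_Hn] En_split[OF cper_h]) (intro tendsto_intros int_sq_Hn)

lemma h_H1:
  assumes t: "t \<in> {0..T}"
  obtains v where "Lpc 2 v" "prim v (h t)"
proof -
  have "L2sq (dsm k (h t)) \<le> K" if "k > 0" for k
    using LIMSEQ_le_const2[OF int_sq_Hn(2)[OF t that], of K] dsm_Hn_bound[OF t that] by blast
  from H1_of_bounded[OF cper_h this] that show ?thesis by blast
qed

end

lemma convw_antimono: "w \<in> convw n \<Longrightarrow> m \<le> n \<Longrightarrow> w \<in> convw m"
  by (auto simp: convw_def)

lemma Qm_snd: "Lpc p f \<Longrightarrow> integrable (Qm T) (\<lambda>y. \<bar>f (snd y)\<bar> powr p)"
proof -
  assume f: "Lpc p f"
  interpret pair_sigma_finite "Iv 0 T" circ by (rule circ_pair_sigma_finite)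
  have [measurable]: "f \<in> borel_measurable borel" using f by (rule Lpc_measurable)
  have "integrable (Iv 0 T \<Otimes>\<^sub>M circ) (\<lambda>(s, x). \<bar>f x\<bar> powr p)"
    using f by (intro Fubini_integrable) (auto simp: Lpc_def integrable_Iv_const)
  thus ?thesis by (simp add: Qm_def case_prod_beta')
qed

section \<open>The equation and the energy balance of the limit\<close>

locale film_weak = film_limit +
  fixes w :: "nat \<Rightarrow> nat \<Rightarrow> real" and z J :: "real \<times> real \<Rightarrow> real"
  assumes w: "\<And>n. w n \<in> convw n"
    and zm [measurable]: "z \<in> borel_measurable borel2"
    and Jm [measurable]: "J \<in> borel_measurable borel2"
    and zper: "\<And>t. periodic (\<lambda>x. z (t, x))" and Jper: "\<And>t. periodic (\<lambda>x. J (t, x))"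
    and zL: "Lpf Q p z" and zconv: "Lp_conv Q p (\<lambda>n. comb (w n) Zn) z"
    and JL: "Lpf Q q J" and Jconv: "Lp_conv Q q (\<lambda>n. comb (w n) Jn) J"
begin

lemma section_meas: "f \<in> borel_measurable borel2 \<Longrightarrow> (\<lambda>x. f (t, x)) \<in> borel_measurable borel"
  for f :: "real \<times> real \<Rightarrow> real"
  by (rule measurable_compose[OF measurable_Pair1'[of t borel borel]]) simp_all

lemma sections: "AE t in Iv 0 T. Lpc p (\<lambda>x. z (t, x)) \<and> Lpc q (\<lambda>x. J (t, x))"
  using Qm_Fubini(3)[OF Lpf_integrable[OF zL]] Qm_Fubini(3)[OF Lpf_integrable[OF JL]]
proof eventually_elim
  case (elim t)
  thus ?case using section_meas[OF zm] section_meas[OF Jm] zper Jper by (simp add: Lpc_def)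
qed

text \<open>Strong convergence on the cylinder gives, for a subsequence, convergence on almost every
  time slice. There \<open>avg3 k\<close> of the discrete \<open>z\<close> is, by
  \<open>avg3_zz\<close>, an average of width \<open>e l\<close> of \<open>zz k (Hn l t)\<close>,
  whose limit is known. This is the mollified form of z = \<partial>h + \<partial>^3 h.\<close>

lemma zz_limit: "AE t in Iv 0 T. \<forall>k x. 0 < k \<and> k \<le> pi \<longrightarrow> avg3 k (\<lambda>x. z (t, x)) x = zz k (h t) x"
proof -
  let ?D = "\<lambda>n y. \<bar>comb (w n) Zn y - z y\<bar> powr p"
  have cL: "Lpf Q p (comb (w n) Zn)" for n using pq0 by (intro Lpf_comb Lpf_Zn)
  have iD: "integrable Q (?D n)" for n
    using Lpf_diff[OF _ cL zL] pq0 by (auto simp: Lpf_def)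
  have iF: "integrable (Iv 0 T) (\<lambda>t. \<integral>x. ?D n (t, x))" for n by (rule Qm_Fubini(2)[OF iD])
  have "(\<lambda>n. LINT t|Iv 0 T. norm (\<integral>x. ?D n (t, x))) \<longlonglongrightarrow> 0"
    using zconv Qm_Fubini(1)[OF iD] by simp
  from tendsto_L1_AE_subseq[OF iF this] obtain r where r: "strict_mono r"
    "AE t in Iv 0 T. (\<lambda>n. \<integral>x. ?D (r n) (t, x)) \<longlonglongrightarrow> 0" by blast
  have "AE t in Iv 0 T. t \<in> {0..T}" by (rule AE_I2) simp
  with r(2) sections show ?thesis
  proof eventually_elim
    case (elim t)
    let ?f = "\<lambda>l x. Zn l (t, x)" and ?v = "\<lambda>x. z (t, x)"
    have f: "?f l = zz (e l) (Hn l t)" for l by (auto simp: Zn_def)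
    have cf: "cper (?f l)" for l unfolding f by (intro cper_zz cper_Hn pos)
    have Lf: "Lpf circ p (?f l)" for l using cper_Lpc[OF cf pq0(1)] by (rule Lpc_Lpf)
    have Lv: "Lpc p ?v" using elim by simp
    have wr: "w (r n) \<in> convw n" for n using w[of "r n"] seq_suble[OF r(1), of n] by (rule convw_antimono)
    have eqc: "comb (w (r n)) Zn (t, x) = comb (w (r n)) ?f x" for n x by (simp add: comb_def)
    have l1: "(\<lambda>n. \<integral>x. \<bar>comb (w (r n)) ?f x - ?v x\<bar>) \<longlonglongrightarrow> 0"
      using elim(1) pq0 by (intro Lp_conv_L1[OF finite_measure_Iv _ Lpc_Lpf[OF Lv] _ p1] Lpf_comb Lf) (simp_all add: eqc)
    show ?case
    proof (intro allI impI)
      fix k x :: real assume k: "0 < k \<and> k \<le> pi"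
      have "avg3 k (?f l) = avg3 (e l) (zz k (Hn l t))" for l
        unfolding f using k by (intro avg3_zz cper_Hn pos) auto
      moreover have "(\<lambda>l. avg3 (e l) (zz k (Hn l t)) x) \<longlonglongrightarrow> zz k (h t) x"
      proof (rule LIMSEQ_I)
        fix \<epsilon> :: real assume "\<epsilon> > 0"
        hence "\<epsilon> / 2 > 0" by simp
        then obtain N where N: "\<And>n. n \<ge> N \<Longrightarrow> \<bar>avg3 (e n) (zz k (Hn n t)) x - zz k (h t) x\<bar> \<le> \<epsilon> / 2"
          using avg3_zzH_uniform[of k "\<epsilon> / 2"] k elim(3) unfolding eventually_sequentially by blast
        have "norm (avg3 (e n) (zz k (Hn n t)) x - zz k (h t) x) < \<epsilon>" if "n \<ge> N" for n
          using N[OF that] \<open>\<epsilon> > 0\<close> by simp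
        thus "\<exists>N. \<forall>n\<ge>N. norm (avg3 (e n) (zz k (Hn n t)) x - zz k (h t) x) < \<epsilon>" by blast
      qed
      ultimately have "(\<lambda>l. avg3 k (?f l) x) \<longlonglongrightarrow> zz k (h t) x" by simp
      thus "avg3 k ?v x = zz k (h t) x"
        using k p1 Lpc_Lper[OF _ Lv] by (intro comb_avg3_limit[OF wr cf _ l1]) auto
    qed
  qed
qed

lemma comb_test_J:
  assumes g: "\<And>k. Lpf Q p (g k)" "Lpf Q p g0" "Lp_conv Q p g g0"
  shows "(\<lambda>n. wsum (w n) (\<lambda>k. LINT y|Q. Jn k y * g k y)) \<longlonglongrightarrow> (LINT y|Q. J y * g0 y)"
proof -
  obtain C where C: "\<And>n. Ip Q p (Zn n) \<le> C" "\<And>n. Ip Q q (Jn n) \<le> C" using Ip_Zn_Jn by blast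
  show ?thesis using pq0 by (intro Lp_conv_comb_test[OF _ C(2) JL Jconv w g p1 q1 pq] Lpf_Jn)
qed

lemma comb_test_Z:
  assumes g: "\<And>k. Lpf Q q (g k)" "Lpf Q q g0" "Lp_conv Q q g g0"
  shows "(\<lambda>n. wsum (w n) (\<lambda>k. LINT y|Q. Zn k y * g k y)) \<longlonglongrightarrow> (LINT y|Q. z y * g0 y)"
proof -
  obtain C where C: "\<And>n. Ip Q p (Zn n) \<le> C" "\<And>n. Ip Q q (Jn n) \<le> C" using Ip_Zn_Jn by blast
  show ?thesis using pq0 by (intro Lp_conv_comb_test[OF _ C(1) zL zconv w g q1 p1 qp] Lpf_Zn)
qed

lemma remainder_null: "(\<And>n. \<bar>a n - b n\<bar> \<le> C * \<rho> n) \<Longrightarrow> (\<lambda>n. a n - b n) \<longlonglongrightarrow> 0"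
proof -
  assume a: "\<And>n. \<bar>a n - b n\<bar> \<le> C * \<rho> n"
  show ?thesis
    by (rule Lim_null_comparison[where g = "\<lambda>n. C * \<rho> n"]) (use a tendsto_mult_right_zero[OF \<rho>_lim] in auto)
qed

text \<open>The scheme tested with \<open>u\<close>. The mollification of the flux divergence is
  moved onto the derivative \<open>v\<close>, whose averages converge strongly in L_p, so
  \<open>comb_test_J\<close> applies.\<close>

lemma weak_equation:
  assumes t: "t \<in> {0..T}" and u: "cper u" and v: "Lpc p v" and prm: "prim v u"
  shows "(\<integral>x. h t x * u x) = (\<integral>x. h0 x * u x) + (LINT y|Q. indicator {0..t} (fst y) * (J y * v (snd y)))"
proof -
  have Lv: "Lper v" using v p1 by (intro Lpc_Lper) auto
  have [measurable]: "v \<in> borel_measurable borel" using v by (rule Lpc_measurable)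
  let ?g = "\<lambda>(n::nat) (y::real \<times> real). indicator {0..t} (fst y) * avg3 (e n) v (snd y)"
  let ?gl = "\<lambda>y::real \<times> real. indicator {0..t} (fst y) * v (snd y)"
  have gc: "cper (avg3 (e n) v)" for n unfolding avg3_def by (intro cper_avg cper_avg' cper_Lper Lv pos)
  have L: "Lpf Q p (\<lambda>y. indicator {0..t} (fst y) * f (snd y))"
    and I: "Ip Q p (\<lambda>y. indicator {0..t} (fst y) * f (snd y)) \<le> T * Ip circ p f" if f: "Lpc p f" for f
  proof -
    have [measurable]: "f \<in> borel_measurable borel" using f by (rule Lpc_measurable)
    note i2 = Qm_snd[OF f, of T]
    show L: "Lpf Q p (\<lambda>y. indicator {0..t} (fst y) * f (snd y))"
      using pq0 by (intro Lpf_dominated[OF i2]) (auto simp: indicator_def)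
    have "Ip Q p (\<lambda>y. indicator {0..t} (fst y) * f (snd y)) \<le> (LINT y|Q. \<bar>f (snd y)\<bar> powr p)"
      using L i2 pq0 by (intro integral_mono) (auto simp: Lpf_def indicator_def)
    also have "\<dots> = T * Ip circ p f"
      using Qm_Fubini(1)[OF i2] T integral_Iv_const[of 0 T "Ip circ p f"] by (simp del: lebesgue_integral_const)
    finally show "Ip Q p (\<lambda>y. indicator {0..t} (fst y) * f (snd y)) \<le> T * Ip circ p f" .
  qed
  have conv: "Lp_conv Q p ?g ?gl"
  proof (rule tendsto_sandwich[OF _ _ tendsto_const])
    show "\<forall>\<^sub>F n in sequentially. 0 \<le> Ip Q p (\<lambda>y. ?g n y - ?gl y)" by (simp add: Ip_nonneg)
    show "\<forall>\<^sub>F n in sequentially. Ip Q p (\<lambda>y. ?g n y - ?gl y) \<le> T * Ip circ p (\<lambda>x. avg3 (e n) v x - v x)"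
      using I[OF Lpc_diff[OF pq0(1) cper_Lpc[OF gc pq0(1)] v]] by (simp add: right_diff_distrib)
    show "(\<lambda>n. T * Ip circ p (\<lambda>x. avg3 (e n) v x - v x)) \<longlonglongrightarrow> 0"
      using p1 by (intro tendsto_mult_right_zero Lp_conv_avg3 v pos e0) auto
  qed
  let ?S = "\<lambda>n. \<tau> n * (\<Sum>i<jn n t. \<integral>x. JJ (e n) (Hs n i) x * avg3 (e n) v x)"
  have S: "(\<integral>x. Hn n t x * u x) = (\<integral>x. h0 x * u x) + ?S n" for n
  proof -
    let ?JS = "\<lambda>x. \<Sum>l=0..<jn n t. \<tau> n * JJ (e n) (Hs n l) x"
    have cJ: "cper (JJ (e n) (Hs n l))" for l by (intro cper_JJ cper_H pos)
    have cS: "cper ?JS" by (intro cper_sum cper_cmult cJ)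
    have "Hn n t x = h0 x - dsm (e n) ?JS x" for x
      using H_diff[OF pos(1)[of n], of 0 "jn n t" "\<tau> n" x] by (simp add: Hn_def)
    hence "(\<integral>x. Hn n t x * u x) = (\<integral>x. h0 x * u x - dsm (e n) ?JS x * u x)"
      by (simp add: left_diff_distrib)
    also have "\<dots> = (\<integral>x. h0 x * u x) - (\<integral>x. dsm (e n) ?JS x * u x)"
      using h0 u cS pos by (intro Bochner_Integration.integral_diff cper_integrable cper_mult cper_dsm) auto
    also have "(\<integral>x. dsm (e n) ?JS x * u x) = - (\<integral>x. ?JS x * avg3 (e n) v x)"
      by (rule flux_test[OF cS u Lv prm pos(1)])
    also have "(\<integral>x. ?JS x * avg3 (e n) v x) = (\<integral>x. (\<Sum>l=0..<jn n t. \<tau> n * (JJ (e n) (Hs n l) x * avg3 (e n) v x)))"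
      by (simp add: sum_distrib_right mult.assoc)
    also have "\<dots> = ?S n"
      using cper_integrable[OF cper_mult[OF cJ gc]] by (simp add: sum_distrib_left atLeast0LessThan)
    finally show ?thesis by simp
  qed
  \<comment> \<open>\<open>v\<close> is merely integrable, so its averages are bounded only up to a
    negative power of \<open>e n\<close>; the power allowed in \<rho> is enough.\<close>
  have diff: "(\<lambda>n. (LINT y|Q. Jn n y * ?g n y) - ?S n) \<longlonglongrightarrow> 0"
  proof (rule remainder_null[where C = "2 * pi * (\<integral>x. \<bar>v x\<bar>)"], rule step_sum[OF t gc])
    fix n x
    have e1: "0 < e n" "e n \<le> 1" "e n \<le> pi" using pos(1)[of n] e0(2)[of n] pi_gt3 by auto
    hence "e n ^ 3 \<le> e n ^ 1" by (intro power_decreasing) auto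
    hence "(\<integral>x. \<bar>v x\<bar>) / (2 * e n) \<le> (\<integral>x. \<bar>v x\<bar>) / e n ^ 3" using e1 by (intro divide_left_mono) auto
    thus "\<bar>avg3 (e n) v x\<bar> \<le> (\<integral>x. \<bar>v x\<bar>) / e n ^ 3" using avg3_L1_bound[OF Lv e1(1,3), of x] by linarith
  qed
  have "(\<lambda>n. \<integral>x. Hn n t x * u x) \<longlonglongrightarrow> (\<integral>x. h t x * u x)"
  proof -
    note m = borel_measurable_integrable[OF cper_integrable]
    have "(\<lambda>n. \<integral>x. u x * Hn n t x) \<longlonglongrightarrow> (\<integral>x. u x * h t x)"
    proof (rule integral_mult_uniform_limit[OF cper_integrable[OF u] m[OF cper_Hn] m[OF cper_h]])
      show "\<forall>\<^sub>F n in sequentially. \<forall>x\<in>space circ. \<bar>Hn n t x - h t x\<bar> \<le> \<epsilon>" if "\<epsilon> > 0" for \<epsilon>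
        using Hn_uniform[OF that] by eventually_elim (use t in auto)
    qed (intro cper_integrable cper_mult u cper_h)
    thus ?thesis by (simp add: mult.commute)
  qed
  hence "(\<lambda>n. ?S n) \<longlonglongrightarrow> (\<integral>x. h t x * u x) - (\<integral>x. h0 x * u x)"
    unfolding S using tendsto_diff[OF _ tendsto_const[of "\<integral>x. h0 x * u x"]] by fastforce
  from tendsto_add[OF diff this] have "(\<lambda>n. LINT y|Q. Jn n y * ?g n y) \<longlonglongrightarrow> (\<integral>x. h t x * u x) - (\<integral>x. h0 x * u x)" by simp
  from convw_tendsto[OF w this]
  have "(\<lambda>n. wsum (w n) (\<lambda>k. LINT y|Q. Jn k y * ?g k y)) \<longlonglongrightarrow> (\<integral>x. h t x * u x) - (\<integral>x. h0 x * u x)" .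
  moreover have "(\<lambda>n. wsum (w n) (\<lambda>k. LINT y|Q. Jn k y * ?g k y)) \<longlonglongrightarrow> (LINT y|Q. J y * ?gl y)"
    by (rule comb_test_J[OF L[OF cper_Lpc[OF gc pq0(1)]] L[OF v] conv])
  ultimately have "(LINT y|Q. J y * ?gl y) = (\<integral>x. h t x * u x) - (\<integral>x. h0 x * u x)"
    using LIMSEQ_unique by blast
  thus ?thesis by (simp add: mult.left_commute)
qed

lemma Gz_measurable [measurable]: "(\<lambda>y. avg3 k (zz k (h (fst y))) (snd y)) \<in> borel_measurable borel2"
proof -
  have "(\<lambda>y. zz k (\<lambda>x. (\<lambda>y. h (fst y) (snd y)) (fst y, x)) (snd y)) \<in> borel_measurable borel2"
    by (rule zz_measurable[OF h_measurable])
  hence m: "(\<lambda>y. zz k (h (fst y)) (snd y)) \<in> borel_measurable borel2" by simp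
  have "(\<lambda>y. avg3 k (\<lambda>x. (\<lambda>y. zz k (h (fst y)) (snd y)) (fst y, x)) (snd y)) \<in> borel_measurable borel2"
    by (rule avg3_measurable[OF m])
  thus ?thesis by simp
qed

text \<open>The exact balance \<open>energy_sum\<close> at a fixed second width \<open>k\<close>. By
  symmetry of the averages and \<open>avg3_zz\<close> the flux is paired with averages of
  \<open>zz k\<close> of the iterates, which converge uniformly, so no product of two weak limits
  occurs.\<close>

lemma energy_smoothed:
  assumes t: "t \<in> {0..T}" and k: "k > 0"
  shows "En k (h t) = En k h0 - (LINT y|Q. indicator {0..t} (fst y) * (J y * avg3 k (zz k (h (fst y))) (snd y)))"
proof -
  define B where "B = M / k + M / k ^ 3"
  let ?G = "\<lambda>n j. avg3 k (avg3 (e n) (zz k (Hs n j)))"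
  let ?g = "\<lambda>(n::nat) (y::real \<times> real). indicator {0..t} (fst y) * ?G n (nat \<lfloor>fst y / \<tau> n\<rfloor>) (snd y)"
  let ?gl = "\<lambda>y::real \<times> real. indicator {0..t} (fst y) * avg3 k (zz k (h (fst y))) (snd y)"
  have cG: "cper (?G n j)" for n j using k pos by (intro cper_avg3 cper_zz cper_H) auto
  have GB: "\<bar>?G n j x\<bar> \<le> B" if "real j * \<tau> n \<le> T" for n j x
    unfolding B_def using k pos H_range(3)[OF that] by (intro avg3_bound cper_avg3 cper_zz cper_H zz_bound) auto
  have jT: "real (nat \<lfloor>s / \<tau> n\<rfloor>) * \<tau> n \<le> T" if "s \<in> {0..T}" for s n
    using jn_le[OF that, of n] that unfolding jn_def by simp
  have Gm: "?G n j \<in> borel_measurable borel" for n j using cG by (intro borel_measurable_continuous_onI) simp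
  have gm: "?g n \<in> borel_measurable Q" for n
    using step_measurable[of "?G n", OF Gm, of "\<tau> n"] by measurable
  have g0m: "?gl \<in> borel_measurable Q" by measurable
  have gB: "\<bar>?g n y\<bar> \<le> B" if "y \<in> space Q" for n y
    using GB[OF jT, of "fst y" n "snd y"] that by (auto simp: indicator_def intro: order_trans[OF abs_ge_zero])
  have g0B: "\<bar>?gl y\<bar> \<le> B" for y
  proof -
    have "\<bar>avg3 k (zz k (h (fst y))) (snd y)\<bar> \<le> B"
      unfolding B_def using k h_range(3) by (intro avg3_bound cper_zz cper_h zz_bound) auto
    thus ?thesis by (auto simp: indicator_def intro: order_trans[OF abs_ge_zero])
  qed
  have Lg: "Lpf Q p (?g n)" "Lpf Q p ?gl" for n
    using pq0 gB g0B by (auto intro!: Lpf_bounded[OF finite_measure_Qm, where B = B] gm g0m)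
  have conv: "Lp_conv Q p ?g ?gl"
  proof (rule Lp_conv_uniform[OF finite_measure_Qm pq0(1) _ gm g0m])
    fix \<epsilon> :: real assume "\<epsilon> > 0"
    from avg3_zzH_uniform[OF k this] show "\<forall>\<^sub>F n in sequentially. \<forall>y\<in>space Q. \<bar>?g n y - ?gl y\<bar> \<le> \<epsilon>"
    proof eventually_elim
      case (elim n)
      show ?case
      proof
        fix y assume "y \<in> space Q"
        hence s: "fst y \<in> {0..T}" by auto
        have "\<bar>?G n (nat \<lfloor>fst y / \<tau> n\<rfloor>) (snd y) - avg3 k (zz k (h (fst y))) (snd y)\<bar> \<le> \<epsilon>"
        proof (rule avg3_diff_bound)
          show "\<bar>avg3 (e n) (zz k (Hs n (nat \<lfloor>fst y / \<tau> n\<rfloor>))) x - zz k (h (fst y)) x\<bar> \<le> \<epsilon>" for x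
            using elim s by (simp add: Hn_def jn_def)
        qed (use k pos in \<open>auto simp: cper_avg3 cper_zz cper_H cper_h\<close>)
        thus "\<bar>?g n y - ?gl y\<bar> \<le> \<epsilon>" using \<open>\<epsilon> > 0\<close> by (simp add: indicator_def)
      qed
    qed
  qed
  let ?S = "\<lambda>n. \<tau> n * (\<Sum>i<jn n t. \<integral>x. JJ (e n) (Hs n i) x * ?G n i x)"
  let ?R = "\<lambda>n. (\<tau> n)\<^sup>2 * (\<Sum>i<jn n t. En k (dsm (e n) (JJ (e n) (Hs n i))))"
  have E: "?S n = En k h0 - En k (Hn n t) + ?R n" for n
  proof -
    have "(\<integral>x. avg3 k (JJ (e n) (Hs n i)) x * avg3 k (zz (e n) (Hs n i)) x)
       = (\<integral>x. JJ (e n) (Hs n i) x * ?G n i x)" for i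
      unfolding avg3_zz[OF cper_H[OF pos(1)] pos(1) k]
      using k pos by (intro avg3_adjoint cper_JJ cper_H cper_avg3 cper_zz) auto
    thus ?thesis using energy_sum[OF pos(1)[of n] k, of "\<tau> n" "jn n t"] by (simp add: Hn_def)
  qed
  have "\<bar>?R n\<bar> \<le> err (e n) (\<tau> n)" for n
  proof (rule energy_error[OF pos(1) e0(2) k pos(2)])
    have j: "real (jn n t) * \<tau> n \<le> T" using jn_le[OF t, of n] t by simp
    thus "real (jn n t) * \<tau> n \<le> 1" using T by simp
    fix i x assume "i < jn n t"
    hence "real i * \<tau> n \<le> real (jn n t) * \<tau> n" using pos(2)[of n] by (intro mult_right_mono) auto
    thus "\<bar>Hs n i x\<bar> \<le> M" using j by (intro H_range(3)) linarith
  qed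
  hence R0: "?R \<longlonglongrightarrow> 0" by (intro Lim_null_comparison[OF _ err0]) simp
  have "(\<lambda>n. (LINT y|Q. Jn n y * ?g n y) - ?S n) \<longlonglongrightarrow> 0"
  proof (rule remainder_null[where C = "2 * pi * B"], rule step_sum[OF t cG])
    fix n x
    have b: "\<bar>?G n (jn n t) x\<bar> \<le> B" using GB[OF jT[OF t], of n x] by (simp add: jn_def)
    have "e n ^ 3 \<le> 1" using pos(1)[of n] e0(2)[of n] by (intro power_le_one) auto
    hence "B * e n ^ 3 \<le> B * 1" using b by (intro mult_left_mono) auto
    thus "\<bar>?G n (jn n t) x\<bar> \<le> B / e n ^ 3" using b pos(1)[of n] by (simp add: pos_le_divide_eq order_trans[OF mult_right_mono])
  qed
  moreover have "?S \<longlonglongrightarrow> En k h0 - En k (h t) + 0"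
    unfolding E by (intro tendsto_intros R0 En_Hn_tendsto t k)
  ultimately have "(\<lambda>n. ((LINT y|Q. Jn n y * ?g n y) - ?S n) + ?S n) \<longlonglongrightarrow> 0 + (En k h0 - En k (h t) + 0)" by (rule tendsto_add)
  hence "(\<lambda>n. LINT y|Q. Jn n y * ?g n y) \<longlonglongrightarrow> En k h0 - En k (h t)" by simp
  from convw_tendsto[OF w this]
  have "(\<lambda>n. \<Sum>l | w n l \<noteq> 0. w n l * (LINT y|Q. Jn l y * ?g l y)) \<longlonglongrightarrow> En k h0 - En k (h t)" .
  moreover have "(\<lambda>n. \<Sum>l | w n l \<noteq> 0. w n l * (LINT y|Q. Jn l y * ?g l y)) \<longlonglongrightarrow> (LINT y|Q. J y * ?gl y)"
    by (rule comb_test_J[OF Lg conv])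
  ultimately have "(LINT y|Q. J y * ?gl y) = En k h0 - En k (h t)" using LIMSEQ_unique by blast
  thus ?thesis by (simp add: mult.left_commute)
qed

text \<open>For almost every time \<open>zz_limit\<close> turns the test function into
  \<open>avg3\<close> of \<open>avg3\<close> of \<open>z\<close>, which converges to
  \<open>z\<close> in L_p; the contraction property of averages dominates it in time.\<close>

lemma JG_limit:
  assumes t: "t \<in> {0..T}"
  shows "(\<lambda>n. LINT y|Q. indicator {0..t} (fst y) * (J y * avg3 (1 / real (Suc n)) (zz (1 / real (Suc n)) (h (fst y))) (snd y)))
    \<longlonglongrightarrow> (LINT y|Q. indicator {0..t} (fst y) * (J y * z y))"
proof -
  let ?e = "\<lambda>n. 1 / real (Suc n)"
  let ?g = "\<lambda>n y. avg3 (?e n) (zz (?e n) (h (fst y))) (snd y)"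
  have ek: "0 < ?e n" "?e n \<le> pi" for n
  proof -
    have "?e n \<le> 1" by simp
    thus "?e n \<le> pi" using pi_gt3 by linarith
  qed simp
  have Lg: "Lpf Q p (?g n)" for n
  proof (rule Lpf_bounded[OF finite_measure_Qm _ _ pq0(1)])
    show "\<bar>?g n y\<bar> \<le> M / ?e n + M / ?e n ^ 3" for y
      by (rule avg3_bound[OF cper_zz[OF cper_h ek(1)] ek(1) zz_bound[OF cper_h ek(1) h_range(3)]])
  qed measurable
  have Li: "Lpf Q q (\<lambda>y. indicator {0..t} (fst y) * J y)"
    using pq0 by (intro Lpf_dominated[OF Lpf_integrable[OF JL]]) (auto simp: indicator_def)
  let ?d = "\<lambda>n y. ?g n y - z y"
  have Ld: "Lpf Q p (?d n)" for n by (rule Lpf_diff[OF pq0(1) Lg zL])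
  note F = Qm_Fubini(1,2)[OF Lpf_integrable[OF Ld]]
  have "(\<lambda>n. LINT s|Iv 0 T. Ip circ p (\<lambda>x. ?d n (s, x))) \<longlonglongrightarrow> (LINT s|Iv 0 T. 0)"
  proof (rule integral_dominated_convergence[where w = "\<lambda>s. 2 powr p * (2 * Ip circ p (\<lambda>x. z (s, x)))"])
    show "integrable (Iv 0 T) (\<lambda>s. 2 powr p * (2 * Ip circ p (\<lambda>x. z (s, x))))"
      by (intro integrable_mult_right Qm_Fubini(2) Lpf_integrable zL)
    have good: "AE s in Iv 0 T. Lpc p (\<lambda>x. z (s, x)) \<and> (\<forall>n. avg3 (?e n) (zz (?e n) (h s)) = avg3 (?e n) (avg3 (?e n) (\<lambda>x. z (s, x))))"
      using sections zz_limit
    proof eventually_elim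
      case (elim s)
      hence "avg3 (?e n) (\<lambda>x. z (s, x)) = zz (?e n) (h s)" for n using ek by (intro ext) blast
      thus ?case using elim by simp
    qed
    show "AE s in Iv 0 T. (\<lambda>n. Ip circ p (\<lambda>x. ?d n (s, x))) \<longlonglongrightarrow> 0"
      using good
    proof eventually_elim
      case (elim s)
      let ?z = "\<lambda>x. z (s, x)"
      have z1: "Lpc p (avg3 (?e n) ?z)" for n using elim p1 ek(1) by (intro Lpc_avg3) auto
      have c1: "Lp_conv circ p (\<lambda>n. avg3 (?e n) ?z) ?z" using elim p1 avg_small_step by (intro Lp_conv_avg3) auto
      have "Lp_conv circ p (\<lambda>n. avg3 (?e n) (avg3 (?e n) ?z)) ?z"
        unfolding avg3_def[of _ "avg3 _ _"]
        using elim p1 z1 ek(1) by (intro Lp_conv_avg_of[OF _ _ _ _ _ avg_small_step] c1 Lpc_avg) auto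
      thus ?case using elim by simp
    qed
    show "AE s in Iv 0 T. norm (Ip circ p (\<lambda>x. ?d n (s, x))) \<le> 2 powr p * (2 * Ip circ p (\<lambda>x. z (s, x)))" for n
      using good
    proof eventually_elim
      case (elim s)
      let ?z = "\<lambda>x. z (s, x)" and ?a = "avg3 (?e n) (avg3 (?e n) (\<lambda>x. z (s, x)))"
      have z1: "Lpc p (avg3 (?e n) ?z)" "Ip circ p (avg3 (?e n) ?z) \<le> Ip circ p ?z" using elim p1 ek(1) by (auto intro!: Lpc_avg3)
      have z2: "Lpc p ?a" "Ip circ p ?a \<le> Ip circ p (avg3 (?e n) ?z)" using z1 p1 ek(1) by (auto intro!: Lpc_avg3)
      have "Ip circ p (\<lambda>x. ?a x - ?z x) \<le> 2 powr p * (Ip circ p ?a + Ip circ p ?z)"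
        using Ip_add_le[OF pq0(1) Lpc_Lpf[OF z2(1)] Lpf_minus[OF Lpc_Lpf]] elim by simp
      also have "\<dots> \<le> 2 powr p * (2 * Ip circ p ?z)" using z1(2) z2(2) by (intro mult_left_mono) auto
      finally show ?case using elim by (simp add: Ip_nonneg)
    qed
  qed (use F(2) in auto)
  hence "Lp_conv Q p ?g z" unfolding F(1) by simp
  from Lp_conv_mult[OF Li Li _ Lg zL this q1 p1 qp] show ?thesis using pq0 by (simp add: mult.assoc)
qed

lemma energy_equality:
  assumes t: "t \<in> {0..T}" and v: "Lpc 2 v" "prim v (h t)"
  shows "1 / 2 * L2sq v - 1 / 2 * L2sq (h t) + (LINT y|Q. indicator {0..t} (fst y) * (J y * z y))
    = E0"
proof -
  let ?e = "\<lambda>n. 1 / real (Suc n)"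
  have "(\<lambda>n. En (?e n) (h t)) \<longlonglongrightarrow> E0 - (LINT y|Q. indicator {0..t} (fst y) * (J y * z y))"
    unfolding energy_smoothed[OF t divide_pos_pos[OF zero_less_one], OF of_nat_0_less_iff[THEN iffD2, OF zero_less_Suc]]
    by (intro tendsto_diff En_limit h0 v0 prim0 JG_limit t)
  from LIMSEQ_unique[OF this En_limit[OF cper_h v]] show ?thesis by simp
qed

end

section \<open>Identification of the flux by monotonicity\<close>

context film_limit
begin

lemma mob_meas [measurable]: "mob \<in> borel_measurable borel"
  by (rule borel_measurable_continuous_onI[OF mob_cont])

lemma mob_h: "mob (h t x) = h t x powr (\<alpha> + 2)"
  using h_range(1)[of t x] by (simp add: mob_def max_def)

lemma Jn_Zn_le:
  assumes k: "k > 0"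
  shows "(LINT y|Q. Jn n y * Zn n y) \<le> E0
    + 1 / 2 * L2sq (Hn n T) + err (e n) (\<tau> n) - 1 / 2 * L2sq (dsm k (Hn n T)) + 4 * pi * M * \<rho> n"
proof -
  have T': "T \<in> {0..T}" using T by simp
  have j: "real (jn n T) * \<tau> n \<le> T" using jn_le[OF T'] .
  have "1 / 2 * L2sq (dsm k (Hn n T)) + \<tau> n * (\<Sum>i<jn n T. \<integral>x. JJ (e n) (Hs n i) x * zz (e n) (Hs n i) x)
    \<le> E0 + 1 / 2 * L2sq (Hn n T) + err (e n) (\<tau> n)"
    unfolding Hn_def
  proof (rule energy_inequality[OF pos(1) e0(2) pos(2) _ _ k])
    fix i x assume "i < jn n T"
    hence "real i * \<tau> n \<le> real (jn n T) * \<tau> n" using pos(2)[of n] by (intro mult_right_mono) auto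
    thus "\<bar>Hs n i x\<bar> \<le> M" using j by (intro H_range) auto
  qed (use j T in auto)
  thus ?thesis using JZ_bound[OF T', of n] unfolding restrict_full by linarith
qed

lemma Lpf_psi: "Lpf N p g \<Longrightarrow> Lpf N q (\<lambda>y. \<psi> \<alpha> (g y))"
  using alpha by (auto simp: Lpf_def abs_psi powr_powr)

end

context film_weak
begin

text \<open>Monotonicity of \<psi> is used for the iterates with one and the same mobility in both
  fluxes. Then \<open>mob (Hn ..) * \<psi> \<alpha> (g ..)\<close> converges strongly and the mixed
  terms pass to the limit with the weights. The remaining product \<open>Jn * Zn\<close> is bounded
  above by the discrete energy inequality at time \<open>T\<close>, and
  \<open>energy_equality\<close> identifies the limit of that bound.\<close>

lemma Minty_inequality:
  assumes g: "Lpf Q p g"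
  shows "0 \<le> (LINT y|Q. (J y - mob (h (fst y) (snd y)) * \<psi> \<alpha> (g y)) * (z y - g y))"
proof -
  have [measurable]: "g \<in> borel_measurable Q" using g by (rule Lpf_measurable)
  let ?B = "M powr (\<alpha> + 2)"
  let ?c = "\<lambda>n y. mob (Hn n (fst y) (snd y))" and ?d = "\<lambda>y. mob (h (fst y) (snd y))"
  let ?G = "\<lambda>n y. ?c n y * \<psi> \<alpha> (g y)" and ?F = "\<lambda>y. ?d y * \<psi> \<alpha> (g y)"
  have mHn [measurable]: "(\<lambda>y. Hn n (fst y) (snd y)) \<in> borel_measurable Q" for n by (rule measurable_Qm[OF Hn_measurable])
  have mh [measurable]: "(\<lambda>y. h (fst y) (snd y)) \<in> borel_measurable Q" by (rule measurable_Qm[OF h_measurable])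
  have cm: "?c n \<in> borel_measurable Q" "?d \<in> borel_measurable Q" for n
    using measurable_compose[OF mHn mob_meas] measurable_compose[OF mh mob_meas] by auto
  have cb: "0 \<le> ?c n y" "?c n y \<le> ?B" if "y \<in> space Q" for n y
    using mob_pos[of "Hn n (fst y) (snd y)"] Hn_range(2)[of "fst y" n "snd y"] that by (auto intro!: mob_le)
  have db: "0 \<le> ?d y" "?d y \<le> ?B" for y
    using mob_pos[of "h (fst y) (snd y)"] h_range(2)[of "fst y" "snd y"] by (auto intro!: mob_le)
  have cb': "\<bar>?c n y\<bar> \<le> ?B" "\<bar>?d y\<bar> \<le> ?B" if "y \<in> space Q" for n y using cb[OF that, of n] db[of y] by simp_all
  have LG: "Lpf Q q (?G n)" for n by (rule Lpf_mult_bounded(1)[OF Lpf_psi[OF g] cm(1) cb'(1) pq0(2)])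
  have LF: "Lpf Q q ?F" by (rule Lpf_mult_bounded(1)[OF Lpf_psi[OF g] cm(2) cb'(2) pq0(2)])
  have conv: "Lp_conv Q q ?G ?F"
  proof (rule Lp_conv_mult_bounded[OF pq0(2) Lpf_psi[OF g] Lpf_psi[OF g] _ cm cb'])
    have "isCont mob s" for s using mob_cont by (simp add: continuous_on_eq_continuous_at)
    thus "(\<lambda>n. ?c n y) \<longlonglongrightarrow> ?d y" if "y \<in> space Q" for y
      using Hn_tendsto[of "fst y" "snd y"] that by (intro isCont_tendsto_compose[of _ mob]) auto
  qed (use pq0 in simp)
  have i: "integrable Q (\<lambda>y. Jn n y * Zn n y)" "integrable Q (\<lambda>y. Jn n y * g y)" "integrable Q (\<lambda>y. Zn n y * ?G n y)" "integrable Q (\<lambda>y. g y * ?G n y)" for n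
    using Lpf_mult_integrable[OF Lpf_Jn Lpf_Zn q1 p1 qp] Lpf_mult_integrable[OF Lpf_Jn g q1 p1 qp]
      Lpf_mult_integrable[OF Lpf_Zn LG p1 q1 pq] Lpf_mult_integrable[OF g LG p1 q1 pq] pq0 by auto
  have mono: "(LINT y|Q. Jn n y * g y) + (LINT y|Q. Zn n y * ?G n y) - (LINT y|Q. g y * ?G n y) \<le> (LINT y|Q. Jn n y * Zn n y)" for n
  proof -
    have "0 \<le> (LINT y|Q. Jn n y * Zn n y - Jn n y * g y - Zn n y * ?G n y + g y * ?G n y)"
    proof (intro Bochner_Integration.integral_nonneg)
      fix y
      have "0 \<le> ?c n y * ((\<psi> \<alpha> (Zn n y) - \<psi> \<alpha> (g y)) * (Zn n y - g y))"
        by (rule mult_nonneg_nonneg[OF less_imp_le[OF mob_pos] psi_monotone[OF alpha]])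
      moreover have "Jn n y = ?c n y * \<psi> \<alpha> (Zn n y)" by (simp add: Jn_def Zn_def JJ_def)
      ultimately show "0 \<le> Jn n y * Zn n y - Jn n y * g y - Zn n y * ?G n y + g y * ?G n y"
        by (simp add: algebra_simps)
    qed
    thus ?thesis using i[of n] by simp
  qed
  let ?L = "\<lambda>n. (LINT y|Q. Jn n y * g y) + (LINT y|Q. Zn n y * ?G n y) - (LINT y|Q. g y * ?G n y)"
  let ?l = "(LINT y|Q. J y * g y) + (LINT y|Q. z y * ?F y) - (LINT y|Q. g y * ?F y)"
  have L: "(\<lambda>n. wsum (w n) ?L) \<longlonglongrightarrow> ?l"
  proof -
    have "(\<lambda>n. LINT y|Q. g y * ?G n y) \<longlonglongrightarrow> (LINT y|Q. g y * ?F y)"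
      using pq0 by (intro Lp_conv_mult[OF g g _ LG LF conv p1 q1 pq]) auto
    from convw_tendsto[OF w this] comb_test_J[of "\<lambda>n. g", OF g g] comb_test_Z[OF LG LF conv] pq0
    have "(\<lambda>n. (wsum (w n) (\<lambda>k. LINT y|Q. Jn k y * g y)) + (wsum (w n) (\<lambda>k. LINT y|Q. Zn k y * ?G k y))
      - wsum (w n) (\<lambda>k. LINT y|Q. g y * ?G k y)) \<longlonglongrightarrow> ?l"
      by (intro tendsto_intros) auto
    thus ?thesis by (simp only: distrib_left right_diff_distrib sum.distrib sum_subtractf)
  qed
  have T': "T \<in> {0..T}" using T by simp
  \<comment> \<open>The final Dirichlet integral stays behind \<open>dsm k\<close>, which is
    continuous under uniform convergence; only after the limit of the iterates is \<open>k\<close>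
    sent to zero, where it becomes the full integral.\<close>
  have upper: "?l
    \<le> E0 + 1 / 2 * L2sq (h T) - 1 / 2 * L2sq (dsm k (h T))" if k: "k > 0" for k
  proof -
    let ?U = "\<lambda>n. E0 + 1 / 2 * L2sq (Hn n T) + err (e n) (\<tau> n) - 1 / 2 * L2sq (dsm k (Hn n T)) + 4 * pi * M * \<rho> n"
    have "?U \<longlonglongrightarrow> E0 + 1 / 2 * L2sq (h T) + 0 - 1 / 2 * L2sq (dsm k (h T)) + 4 * pi * M * 0"
      by (intro tendsto_intros int_sq_Hn T' k err0 \<rho>_lim)
    from convw_tendsto[OF w this] have U: "(\<lambda>n. wsum (w n) ?U) \<longlonglongrightarrow> E0 + 1 / 2 * L2sq (h T) - 1 / 2 * L2sq (dsm k (h T))"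
      by simp
    have "wsum (w n) ?L \<le> wsum (w n) ?U" for n
    proof (intro sum_mono mult_left_mono)
      show "?L i \<le> ?U i" for i using mono[of i] Jn_Zn_le[OF k, of i] by linarith
      show "0 \<le> w n i" for i using w[of n] by (auto simp: convw_def)
    qed
    thus ?thesis using LIMSEQ_le[OF L U] by blast
  qed
  obtain v where v: "Lpc 2 v" "prim v (h T)" using h_H1[OF T'] .
  from dsm_sq_limit[OF cper_h v]
  have "(\<lambda>n. E0 + 1 / 2 * L2sq (h T) - 1 / 2 * L2sq (dsm (1 / real (Suc n)) (h T))) \<longlonglongrightarrow> E0 + 1 / 2 * L2sq (h T) - 1 / 2 * L2sq v"
    by (intro tendsto_intros)
  hence "?l \<le> E0 + 1 / 2 * L2sq (h T) - 1 / 2 * L2sq v"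
    by (rule LIMSEQ_le_const) (use upper in auto)
  hence "?l \<le> (LINT y|Q. J y * z y)"
    using energy_equality[OF T' v] unfolding restrict_full by linarith
  moreover have "integrable Q (\<lambda>y. J y * z y)" "integrable Q (\<lambda>y. J y * g y)" "integrable Q (\<lambda>y. z y * ?F y)" "integrable Q (\<lambda>y. g y * ?F y)"
    by (rule Lpf_mult_integrable[OF JL zL q1 p1 qp] Lpf_mult_integrable[OF JL g q1 p1 qp]
      Lpf_mult_integrable[OF zL LF p1 q1 pq] Lpf_mult_integrable[OF g LF p1 q1 pq])+
  moreover have "(\<lambda>y. (J y - ?F y) * (z y - g y)) = (\<lambda>y. J y * z y - J y * g y - z y * ?F y + g y * ?F y)"
    by (simp add: algebra_simps fun_eq_iff)
  ultimately show ?thesis by simp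
qed

text \<open>Minty's argument with the perturbation \<open>z - s * ?\<phi>\<close>, where the
  direction \<open>?\<phi>\<close> is minus the sign of the difference to be shown zero. Dividing by
  \<open>s\<close> and letting it tend to zero leaves minus the L_1 norm of that difference, which
  must be nonnegative.\<close>

lemma flux_identified: "AE y in Q. J y = h (fst y) (snd y) powr (\<alpha> + 2) * \<psi> \<alpha> (z y)"
proof -
  interpret finite_measure Q by (rule finite_measure_Qm)
  let ?d = "\<lambda>y. mob (h (fst y) (snd y))" and ?B = "M powr (\<alpha> + 2)"
  define D where "D = (\<lambda>s y. J y - ?d y * \<psi> \<alpha> (z y - s * - sgn (J y - ?d y * \<psi> \<alpha> (z y))))"
  let ?\<phi> = "\<lambda>y. - sgn (J y - ?d y * \<psi> \<alpha> (z y))"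
  have zQ: "z \<in> borel_measurable Q" "J \<in> borel_measurable Q" by (rule measurable_Qm[OF zm], rule measurable_Qm[OF Jm])
  have dQ: "?d \<in> borel_measurable Q" using measurable_compose[OF measurable_Qm[OF h_measurable] mob_meas] by simp
  have db: "\<bar>?d y\<bar> \<le> ?B" for y
    using mob_pos[of "h (fst y) (snd y)"] h_range(2)[of "fst y" "snd y"] by (auto intro!: mob_le)
  have "?\<phi> \<in> borel_measurable borel2" by measurable
  hence L\<phi>: "Lpf Q p ?\<phi>"
    by (intro Lpf_bounded[OF finite_measure_Qm measurable_Qm _ pq0(1), where B = 1]) (auto simp: sgn_if)
  have pos: "0 \<le> (LINT y|Q. D s y * ?\<phi> y)" if s: "s > 0" for s
  proof -
    have "Lpf Q p (\<lambda>y. z y - s * ?\<phi> y)" by (intro Lpf_diff Lpf_cmult zL L\<phi> pq0)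
    from Minty_inequality[OF this] have "0 \<le> (LINT y|Q. s * (D s y * ?\<phi> y))" by (simp add: D_def mult_ac)
    thus ?thesis using s by (simp add: mult_le_0_iff)
  qed
  have Dl: "(\<lambda>n. D (1 / real (Suc n)) y) \<longlonglongrightarrow> D 0 y" for y
  proof -
    have "continuous_on UNIV (\<lambda>s. D s y)" unfolding D_def using alpha by (intro continuous_intros)
    hence "isCont (\<lambda>s. D s y) 0" by (simp add: continuous_on_eq_continuous_at)
    thus ?thesis by (rule isCont_tendsto_compose) (use LIMSEQ_inverse_real_of_nat in \<open>simp add: inverse_eq_divide\<close>)
  qed
  have Lz: "Lpf Q p (\<lambda>y. \<bar>z y\<bar> + 1)"
  proof (rule Lpf_add[OF pq0(1)])
    show "Lpf Q p (\<lambda>y. \<bar>z y\<bar>)" using zL by (simp add: Lpf_def)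
    show "Lpf Q p (\<lambda>y. 1)" by (simp add: Lpf_def)
  qed
  have "(\<lambda>n. LINT y|Q. D (1 / real (Suc n)) y * ?\<phi> y) \<longlonglongrightarrow> (LINT y|Q. D 0 y * ?\<phi> y)"
  proof (rule integral_dominated_convergence[where w = "\<lambda>y. \<bar>J y\<bar> + ?B * \<bar>\<bar>z y\<bar> + 1\<bar> powr p"])
    show "integrable Q (\<lambda>y. \<bar>J y\<bar> + ?B * \<bar>\<bar>z y\<bar> + 1\<bar> powr p)"
      using Lpf_imp_integrable[OF finite_measure_Qm JL] q1 Lpf_integrable[OF Lz] by (intro Bochner_Integration.integrable_add integrable_mult_right integrable_abs) auto
    show "AE y in Q. (\<lambda>n. D (1 / real (Suc n)) y * ?\<phi> y) \<longlonglongrightarrow> D 0 y * ?\<phi> y"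
      by (intro AE_I2 tendsto_mult Dl tendsto_const)
    show "AE y in Q. norm (D (1 / real (Suc n)) y * ?\<phi> y) \<le> \<bar>J y\<bar> + ?B * \<bar>\<bar>z y\<bar> + 1\<bar> powr p" for n
    proof (intro AE_I2)
      fix y
      let ?s = "1 / real (Suc n)"
      have 1: "\<bar>?\<phi> y\<bar> \<le> 1" by (simp add: sgn_if)
      have "\<bar>?s * ?\<phi> y\<bar> \<le> 1 * 1" unfolding abs_mult using 1 by (intro mult_mono) auto
      hence "\<bar>z y - ?s * ?\<phi> y\<bar> \<le> \<bar>z y\<bar> + 1" by linarith
      hence "\<bar>z y - ?s * ?\<phi> y\<bar> powr \<alpha> \<le> (\<bar>z y\<bar> + 1) powr \<alpha>" using alpha by (intro powr_mono2) simp_all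
      also have "\<dots> \<le> \<bar>\<bar>z y\<bar> + 1\<bar> powr p" using powr_mono[of \<alpha> p "\<bar>z y\<bar> + 1"] by simp
      finally have "\<bar>?d y\<bar> * \<bar>\<psi> \<alpha> (z y - ?s * ?\<phi> y)\<bar> \<le> ?B * \<bar>\<bar>z y\<bar> + 1\<bar> powr p"
        unfolding abs_psi using db[of y] by (intro mult_mono) auto
      hence "\<bar>D ?s y\<bar> \<le> \<bar>J y\<bar> + ?B * \<bar>\<bar>z y\<bar> + 1\<bar> powr p"
        unfolding D_def using abs_triangle_ineq4[of "J y" "?d y * \<psi> \<alpha> (z y - ?s * ?\<phi> y)"] unfolding abs_mult by linarith
      moreover have "\<bar>D ?s y * ?\<phi> y\<bar> \<le> \<bar>D ?s y\<bar> * 1" unfolding abs_mult using 1 by (intro mult_left_mono) auto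
      ultimately show "norm (D ?s y * ?\<phi> y) \<le> \<bar>J y\<bar> + ?B * \<bar>\<bar>z y\<bar> + 1\<bar> powr p" by simp
    qed
  qed (unfold D_def, (rule measurable_Qm, measurable)+)
  hence "0 \<le> (LINT y|Q. D 0 y * ?\<phi> y)" by (rule LIMSEQ_le_const) (use pos in auto)
  moreover have D0: "D 0 y * ?\<phi> y = - \<bar>J y - ?d y * \<psi> \<alpha> (z y)\<bar>" for y by (simp add: D_def abs_sgn)
  ultimately have "(LINT y|Q. \<bar>J y - ?d y * \<psi> \<alpha> (z y)\<bar>) \<le> 0" by simp
  hence eq0: "(LINT y|Q. \<bar>J y - ?d y * \<psi> \<alpha> (z y)\<bar>) = 0" by (simp add: antisym)
  have "Lpf Q q (\<lambda>y. ?d y * \<psi> \<alpha> (z y))" by (rule Lpf_mult_bounded(1)[OF Lpf_psi[OF zL] dQ db pq0(2)])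
  hence "Lpf Q q (\<lambda>y. J y - ?d y * \<psi> \<alpha> (z y))" by (intro Lpf_diff JL pq0)
  hence "integrable Q (\<lambda>y. \<bar>J y - ?d y * \<psi> \<alpha> (z y)\<bar>)" using q1 by (intro integrable_abs Lpf_imp_integrable finite_measure_Qm) auto
  with eq0 have "AE y in Q. \<bar>J y - ?d y * \<psi> \<alpha> (z y)\<bar> = 0" by (subst (asm) integral_nonneg_eq_0_iff_AE) auto
  thus ?thesis by eventually_elim (simp add: mob_h)
qed

end

section \<open>Existence of the limit objects\<close>

context film
begin

lemma near_range: "\<bar>H e \<tau> j x - h0 x\<bar> \<le> C0 / 2 \<Longrightarrow> \<bar>H e \<tau> j x\<bar> \<le> M"
  using M0[of x] C0 h0_ge[of x] unfolding M_def by linarith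

lemma small_time_step:
  assumes e: "0 < e" "e \<le> 1" and \<delta>: "\<delta> > 0"
  obtains \<tau> where "good e \<tau>" "\<tau> \<le> \<delta>" "err e \<tau> \<le> \<delta>" "\<tau> * (Bj e / e ^ 3) \<le> \<delta>"
proof -
  define X where "X = Bj e / e"
  define Y where "Y = pi * (Bj e / e / e)\<^sup>2"
  define Z where "Z = Bj e / e ^ 3"
  have XYZ: "0 \<le> X" "0 \<le> Y" "0 \<le> Z"
    using e M_pos by (auto simp: X_def Y_def Z_def Bj_def)
  define m where "m = min (min 1 \<delta>) (C0 / 2)"
  \<comment> \<open>Dividing by the sum makes \<tau> and its products with \<open>X\<close>,
    \<open>Y\<close> and \<open>Z\<close> all at most \<open>m\<close>, so one choice meets every
    requirement.\<close>
  define \<tau> where "\<tau> = m / (1 + X + Y + Z)"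
  have m: "0 < m" "m \<le> 1" "m \<le> \<delta>" "m \<le> C0 / 2" using \<delta> C0 by (auto simp: m_def)
  have \<tau>: "\<tau> > 0" using m XYZ by (simp add: \<tau>_def)
  have "\<tau> * (1 + X + Y + Z) = m" using XYZ by (simp add: \<tau>_def)
  hence s: "\<tau> + \<tau> * X + \<tau> * Y + \<tau> * Z = m" by (simp add: algebra_simps)
  moreover have "0 \<le> \<tau> * X" "0 \<le> \<tau> * Y" "0 \<le> \<tau> * Z" using \<tau> XYZ by simp_all
  ultimately have *: "\<tau> \<le> m" "\<tau> * X \<le> m" "\<tau> * Y \<le> m" "\<tau> * Z \<le> m" using \<tau> by linarith+
  show ?thesis
  proof (rule that[of \<tau>])
    show "\<tau> \<le> \<delta>" "err e \<tau> \<le> \<delta>" "\<tau> * (Bj e / e ^ 3) \<le> \<delta>"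
      unfolding err_def Y_def[symmetric] Z_def[symmetric] using * m by linarith+
    have "\<tau> * (Bj e / e) \<le> C0 / 2" unfolding X_def[symmetric] using * m by linarith
    thus "good e \<tau>" unfolding good_def err_def Y_def[symmetric] using * m \<tau> e by simp
  qed
qed

text \<open>Combines \<open>modulus\<close> in time with \<open>space_modulus\<close> at the later
  time, each contributing half of \<epsilon>. It holds only for large \<open>n\<close> because of
  the jumps in time.\<close>

lemma asymptotic_equicontinuity:
  fixes e \<tau> :: "nat \<Rightarrow> real"
  assumes T: "T \<le> 1" and good: "\<And>n. good (e n) (\<tau> n)" and \<tau>0: "\<tau> \<longlonglongrightarrow> 0"
    and near: "\<And>n j x. real j * \<tau> n \<le> T \<Longrightarrow> \<bar>H (e n) (\<tau> n) j x - h0 x\<bar> \<le> C0 / 2" and \<epsilon>: "\<epsilon> > 0"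
  shows "\<exists>d>0. \<exists>N. \<forall>n\<ge>N. \<forall>s\<in>{0..T}. \<forall>t\<in>{0..T}. \<forall>x y. \<bar>t - s\<bar> \<le> d \<longrightarrow> \<bar>y - x\<bar> \<le> d \<longrightarrow>
    \<bar>H (e n) (\<tau> n) (nat \<lfloor>t / \<tau> n\<rfloor>) y - H (e n) (\<tau> n) (nat \<lfloor>s / \<tau> n\<rfloor>) x\<bar> \<le> \<epsilon>"
proof -
  obtain d where d: "d > 0" "\<And>e \<tau> i j x. good e \<tau> \<Longrightarrow> i \<le> j \<Longrightarrow> (\<And>l x. l \<le> j \<Longrightarrow> \<bar>H e \<tau> l x\<bar> \<le> M) \<Longrightarrow> real j * \<tau> \<le> 1 \<Longrightarrow>
     real (j - i) * \<tau> \<le> d \<Longrightarrow> \<bar>H e \<tau> j x - H e \<tau> i x\<bar> \<le> \<epsilon> / 2"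
    using modulus[of "\<epsilon> / 2"] \<epsilon> by (metis half_gt_zero)
  define \<delta> where "\<delta> = \<epsilon> / (2 * K)"
  have \<delta>: "\<delta> > 0" using \<epsilon> K_pos by (simp add: \<delta>_def)
  define r where "r = min (2 * pi) (\<epsilon> * \<delta> / 2)"
  have r: "0 < r" "r \<le> 2 * pi" "r \<le> \<epsilon> * \<delta> / 2" using \<epsilon> \<delta> by (auto simp: r_def)
  have sm: "\<delta> / 2 * K + r / (2 * \<delta>) \<le> \<epsilon> / 2"
  proof -
    have "\<delta> / 2 * K = \<epsilon> / 4" using K_pos by (simp add: \<delta>_def)
    moreover have "r / (2 * \<delta>) \<le> (\<epsilon> * \<delta> / 2) / (2 * \<delta>)" using r \<delta> by (intro divide_right_mono) auto
    moreover have "(\<epsilon> * \<delta> / 2) / (2 * \<delta>) = \<epsilon> / 4" using \<delta> by simp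
    ultimately show ?thesis by linarith
  qed
  \<comment> \<open>Rounding times down to the grid can enlarge their distance by one step, so half
    of \<open>d\<close> is reserved for it.\<close>
  have "eventually (\<lambda>n. \<tau> n < d / 2) sequentially" using \<tau>0 d(1) by (intro order_tendstoD) auto
  then obtain N where N: "\<And>n. n \<ge> N \<Longrightarrow> \<tau> n < d / 2" unfolding eventually_sequentially by blast
  have one: "\<bar>H (e n) (\<tau> n) (nat \<lfloor>t / \<tau> n\<rfloor>) y - H (e n) (\<tau> n) (nat \<lfloor>s / \<tau> n\<rfloor>) x\<bar> \<le> \<epsilon>"
    if n: "n \<ge> N" and st: "s \<le> t" "0 \<le> s" "t \<le> T" and d': "t - s \<le> min (d / 2) r" "\<bar>y - x\<bar> \<le> min (d / 2) r" for n s t x y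
  proof -
    let ?i = "nat \<lfloor>s / \<tau> n\<rfloor>" and ?j = "nat \<lfloor>t / \<tau> n\<rfloor>"
    have e: "e n > 0" "\<tau> n > 0" using good[of n] by (auto simp: good_def)
    have ij: "?i \<le> ?j" using st e by (intro nat_mono floor_mono divide_right_mono) auto
    have fl: "real ?j * \<tau> n \<le> t" "s - real ?i * \<tau> n \<le> \<tau> n" using floor_step[OF e(2)] st by auto
    have dist: "real (?j - ?i) * \<tau> n \<le> d"
      unfolding of_nat_diff[OF ij] left_diff_distrib using fl d' N[OF n] by linarith
    have bd: "\<bar>H (e n) (\<tau> n) l x\<bar> \<le> M" if "l \<le> ?j" for l x
    proof (intro near_range near)
      have "real l * \<tau> n \<le> real ?j * \<tau> n" using that e by (intro mult_right_mono) auto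
      thus "real l * \<tau> n \<le> T" using fl st by linarith
    qed
    have j1: "real ?j * \<tau> n \<le> 1" using fl st T by linarith
    have "\<bar>H (e n) (\<tau> n) ?j x - H (e n) (\<tau> n) ?i x\<bar> \<le> \<epsilon> / 2" by (rule d(2)[OF good ij bd j1 dist])
    moreover have "\<bar>H (e n) (\<tau> n) ?j y - H (e n) (\<tau> n) ?j x\<bar> \<le> \<delta> / 2 * K + r / (2 * \<delta>)"
      by (rule space_modulus[OF cper_H[OF e(1)] a_priori(1)[OF good bd j1] \<delta> _ r(2)]) (use d' in auto)
    ultimately show ?thesis using sm by linarith
  qed
  show ?thesis
  proof (intro exI[of _ "min (d / 2) r"] conjI exI[of _ N] allI impI ballI)
    fix n s t x y assume *: "N \<le> n" "s \<in> {0..T}" "t \<in> {0..T}" "\<bar>t - s\<bar> \<le> min (d / 2) r" "\<bar>y - x\<bar> \<le> min (d / 2) r"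
    show "\<bar>H (e n) (\<tau> n) (nat \<lfloor>t / \<tau> n\<rfloor>) y - H (e n) (\<tau> n) (nat \<lfloor>s / \<tau> n\<rfloor>) x\<bar> \<le> \<epsilon>"
    proof (cases "s \<le> t")
      case True then show ?thesis using * by (intro one) auto
    next
      case False
      hence "\<bar>H (e n) (\<tau> n) (nat \<lfloor>s / \<tau> n\<rfloor>) x - H (e n) (\<tau> n) (nat \<lfloor>t / \<tau> n\<rfloor>) y\<bar> \<le> \<epsilon>" using * by (intro one) (auto simp: abs_minus_commute)
      thus ?thesis by linarith
    qed
  qed (use d r in auto)
qed

lemma film_limit_exists:
  obtains T e \<tau> h where "film_limit \<alpha> C0 h0 v0 T e \<tau> h"
proof -
  obtain T where T: "0 < T" "T \<le> 1" and nearT: "\<And>e \<tau> j x. good e \<tau> \<Longrightarrow> real j * \<tau> \<le> T \<Longrightarrow> \<bar>H e \<tau> j x - h0 x\<bar> \<le> C0 / 2"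
    using existence_time by blast
  define e where "e = (\<lambda>n::nat. 1 / real (Suc n))"
  have e: "e n > 0" "e n \<le> 1" for n by (auto simp: e_def)
  have e0: "e \<longlonglongrightarrow> 0" unfolding e_def by (rule avg_small_step)
  have "\<forall>n. \<exists>\<tau>. good (e n) \<tau> \<and> \<tau> \<le> e n \<and> err (e n) \<tau> \<le> e n \<and> \<tau> * (Bj (e n) / e n ^ 3) \<le> e n"
    using small_time_step[OF e e(1)] by metis
  then obtain \<tau> where \<tau>: "\<And>n. good (e n) (\<tau> n)" "\<And>n. \<tau> n \<le> e n" "\<And>n. err (e n) (\<tau> n) \<le> e n"
    "\<And>n. \<tau> n * (Bj (e n) / e n ^ 3) \<le> e n" by metis
  have \<tau>pos: "\<tau> n > 0" for n using \<tau>(1)[of n] by (simp add: good_def)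
  have null: "f \<longlonglongrightarrow> 0" if "\<And>n. 0 \<le> f n" "\<And>n. f n \<le> e n" for f
    by (rule tendsto_sandwich[OF _ _ tendsto_const e0]) (use that in auto)
  have \<tau>0: "\<tau> \<longlonglongrightarrow> 0" using \<tau>pos \<tau>(2) by (intro null) (auto intro: less_imp_le)
  have near: "\<bar>H (e n) (\<tau> n) j x - h0 x\<bar> \<le> C0 / 2" if "real j * \<tau> n \<le> T" for n j x
    using nearT[OF \<tau>(1) that] .
  define f where "f = (\<lambda>n t. H (e n) (\<tau> n) (nat \<lfloor>t / \<tau> n\<rfloor>))"
  have eq: "\<exists>d>0. \<exists>N. \<forall>n\<ge>N. \<forall>s\<in>{0..T}. \<forall>t\<in>{0..T}. \<forall>x y. \<bar>t - s\<bar> \<le> d \<longrightarrow> \<bar>y - x\<bar> \<le> d \<longrightarrow> \<bar>f n t y - f n s x\<bar> \<le> \<epsilon>" if "\<epsilon> > 0" for \<epsilon>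
    unfolding f_def by (rule asymptotic_equicontinuity[OF T(2) \<tau>(1) \<tau>0 near that])
  have fM: "\<bar>f n t x\<bar> \<le> M" if "t \<in> {0..T}" for n t x
    unfolding f_def using floor_step(1)[OF \<tau>pos[of n], of t] that by (intro near_range near) auto
  have "\<exists>r :: nat \<Rightarrow> nat. strict_mono r \<and> uniformly_convergent_on ({0..T} \<times> {0..2 * pi}) (\<lambda>n y. f (r n) (fst y) (snd y))"
  proof (rule asymptotic_Ascoli[where B = M])
    fix \<epsilon> :: real assume "\<epsilon> > 0"
    from eq[OF this] obtain d N where d: "d > 0" "\<And>n s t x y. n \<ge> N \<Longrightarrow> s \<in> {0..T} \<Longrightarrow> t \<in> {0..T} \<Longrightarrow> \<bar>t - s\<bar> \<le> d \<Longrightarrow> \<bar>y - x\<bar> \<le> d \<Longrightarrow> \<bar>f n t y - f n s x\<bar> \<le> \<epsilon>" by metis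
    have "\<bar>f n (fst x) (snd x) - f n (fst y) (snd y)\<bar> \<le> \<epsilon>"
      if "n \<ge> N" "x \<in> {0..T} \<times> {0..2 * pi}" "y \<in> {0..T} \<times> {0..2 * pi}" "dist x y < d" for n x y
      using that dist_fst_le[of x y] dist_snd_le[of x y] by (intro d(2)) (auto simp: dist_real_def)
    thus "\<exists>d>0. \<exists>N. \<forall>n\<ge>N. \<forall>x\<in>{0..T} \<times> {0..2 * pi}. \<forall>y\<in>{0..T} \<times> {0..2 * pi}. dist x y < d \<longrightarrow> \<bar>f n (fst x) (snd x) - f n (fst y) (snd y)\<bar> \<le> \<epsilon>"
      using d(1) by blast
  qed (use fM in \<open>auto intro: compact_Times\<close>)
  then obtain r g where r: "strict_mono (r :: nat \<Rightarrow> nat)"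
    and ul: "uniform_limit ({0..T} \<times> {0..2 * pi}) (\<lambda>n y. f (r n) (fst y) (snd y)) g sequentially"
    unfolding uniformly_convergent_on_def by blast
  \<comment> \<open>\<open>m\<close> reduces a point to one period and \<open>c\<close> a time to
    \<open>[0, T]\<close>. Composing the uniform limit on the compact rectangle with both gives a
    limit defined everywhere, periodic in space and frozen outside the time interval.\<close>
  define m where "m = (\<lambda>x. x + 2 * pi * of_int (- \<lfloor>x / (2 * pi)\<rfloor>))"
  have m: "m x \<in> {0..2 * pi}" for x unfolding m_def by (rule period_shift)
  define c where "c = (\<lambda>t. max 0 (min T t))"
  have c: "c t \<in> {0..T}" "t \<in> {0..T} \<Longrightarrow> c t = t" "c (c t) = c t" "\<bar>c t - c s\<bar> \<le> \<bar>t - s\<bar>" for t s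
    using T by (auto simp: c_def)
  define h where "h = (\<lambda>t x. g (c t, m x))"
  have fm: "f n t (m x) = f n t x" for n t x
  proof -
    have "periodic (f n t)" unfolding f_def using cper_H[OF e(1)] by blast
    thus ?thesis using periodic_of_int[of "f n t" x "- \<lfloor>x / (2 * pi)\<rfloor>"] by (simp add: periodicD m_def)
  qed
  have conv: "\<exists>N. \<forall>n\<ge>N. \<forall>t\<in>{0..T}. \<forall>x. \<bar>f (r n) t x - h t x\<bar> \<le> \<epsilon>" if \<epsilon>: "\<epsilon> > 0" for \<epsilon>
  proof -
    obtain N where N: "\<And>n t x. n \<ge> N \<Longrightarrow> t \<in> {0..T} \<Longrightarrow> x \<in> {0..2 * pi} \<Longrightarrow> \<bar>f (r n) t x - g (t, x)\<bar> \<le> \<epsilon>"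
      using uniform_limitD[OF ul \<epsilon>] unfolding eventually_sequentially dist_real_def by (metis fst_conv less_imp_le mem_Sigma_iff snd_conv)
    have "\<bar>f (r n) t x - h t x\<bar> \<le> \<epsilon>" if "n \<ge> N" "t \<in> {0..T}" for n t x
      using N[OF that m[of x]] c(2)[OF that(2)] by (simp add: h_def fm)
    thus ?thesis by blast
  qed
  have hcont: "\<exists>d>0. \<forall>s t x y. \<bar>t - s\<bar> \<le> d \<longrightarrow> \<bar>y - x\<bar> \<le> d \<longrightarrow> \<bar>h t y - h s x\<bar> \<le> \<epsilon>" if \<epsilon>: "\<epsilon> > 0" for \<epsilon>
  proof -
    have \<epsilon>3: "\<epsilon> / 3 > 0" using \<epsilon> by simp
    obtain d N where d: "d > 0" and N: "\<And>n s t x y. n \<ge> N \<Longrightarrow> s \<in> {0..T} \<Longrightarrow> t \<in> {0..T} \<Longrightarrow> \<bar>t - s\<bar> \<le> d \<Longrightarrow> \<bar>y - x\<bar> \<le> d \<Longrightarrow> \<bar>f n t y - f n s x\<bar> \<le> \<epsilon> / 3"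
      using eq[OF \<epsilon>3] by metis
    obtain N' where N': "\<And>n t x. n \<ge> N' \<Longrightarrow> t \<in> {0..T} \<Longrightarrow> \<bar>f (r n) t x - h t x\<bar> \<le> \<epsilon> / 3"
      using conv[OF \<epsilon>3] by blast
    have "\<bar>h t y - h s x\<bar> \<le> \<epsilon>" if st: "\<bar>t - s\<bar> \<le> d" "\<bar>y - x\<bar> \<le> d" for s t x y
    proof -
      define n where "n = max N N'"
      have n: "N' \<le> n" "N \<le> r n" using seq_suble[OF r, of n] by (auto simp: n_def)
      have hc: "h (c t) y = h t y" "h (c s) x = h s x" by (simp_all add: h_def c(3))
      have "\<bar>f (r n) (c t) y - f (r n) (c s) x\<bar> \<le> \<epsilon> / 3" using c(4)[of t s] st by (intro N n c) linarith+
      thus ?thesis using N'[OF n(1) c(1), of t y] N'[OF n(1) c(1), of s x] unfolding hc by linarith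
    qed
    thus ?thesis using d by blast
  qed
  have er0: "(\<lambda>n. e (r n)) \<longlonglongrightarrow> 0" using LIMSEQ_subseq_LIMSEQ[OF e0 r] by (simp add: o_def)
  have "film_limit \<alpha> C0 h0 v0 T (\<lambda>n. e (r n)) (\<lambda>n. \<tau> (r n)) h"
  proof
    have nullr: "(\<lambda>n. a (r n)) \<longlonglongrightarrow> 0" if "\<And>n. 0 \<le> a n" "\<And>n. a n \<le> e n" for a
      using LIMSEQ_subseq_LIMSEQ[OF null[OF that] r] by (simp add: o_def)
    have B0: "0 \<le> Bj x" for x by (simp add: Bj_def)
    show "(\<lambda>n. err (e (r n)) (\<tau> (r n))) \<longlonglongrightarrow> 0"
      using \<tau>(3) \<tau>pos by (intro nullr[of "\<lambda>n. err (e n) (\<tau> n)"]) (auto simp: err_def less_imp_le)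
    show "(\<lambda>n. \<tau> (r n) * (Bj (e (r n)) / e (r n) ^ 3)) \<longlonglongrightarrow> 0"
    proof (rule nullr[of "\<lambda>n. \<tau> n * (Bj (e n) / e n ^ 3)"])
      show "0 \<le> \<tau> n * (Bj (e n) / e n ^ 3)" for n
        using B0 M_pos e(1)[of n] \<tau>pos[of n] by (intro mult_nonneg_nonneg add_nonneg_nonneg) auto
    qed (rule \<tau>)
    show "\<And>\<epsilon>. \<epsilon> > 0 \<Longrightarrow> \<exists>N. \<forall>n\<ge>N. \<forall>t\<in>{0..T}. \<forall>x. \<bar>H (e (r n)) (\<tau> (r n)) (nat \<lfloor>t / \<tau> (r n)\<rfloor>) x - h t x\<bar> \<le> \<epsilon>"
      using conv by (simp add: f_def)
    show "h t = h (max 0 (min T t))" for t using c(3)[of t] by (simp add: h_def c_def)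
  qed (use T \<tau>(1) er0 e near hcont in auto)
  thus ?thesis by (rule that)
qed

lemma film_weak_exists:
  obtains T e \<tau> h w z J where "film_weak \<alpha> C0 h0 v0 T e \<tau> h w z J"
proof -
  obtain T e \<tau> h where "film_limit \<alpha> C0 h0 v0 T e \<tau> h" by (rule film_limit_exists)
  then interpret film_limit \<alpha> C0 h0 v0 T e \<tau> h .
  obtain w z J where "\<And>n. w n \<in> convw n"
    "z \<in> borel_measurable borel2" "J \<in> borel_measurable borel2"
    "\<And>t. periodic (\<lambda>x. z (t, x))" "\<And>t. periodic (\<lambda>x. J (t, x))"
    "Lpf Q p z" "Lp_conv Q p (\<lambda>n. comb (w n) Zn) z" "Lpf Q q J" "Lp_conv Q q (\<lambda>n. comb (w n) Jn) J"
    by (rule weak_limits, rule that)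
  hence "film_weak \<alpha> C0 h0 v0 T e \<tau> h w z J" by unfold_locales
  thus ?thesis by (rule that)
qed

end

section \<open>Bochner and Sobolev norms\<close>

lemma simple_function_grid:
  fixes \<tau> :: real
  assumes \<tau>: "\<tau> > 0"
  shows "simple_function (lebesgue_on {0<..<T}) (\<lambda>t. F (nat \<lfloor>t / \<tau>\<rfloor>))"
proof (rule simple_function_compose1[where g = F])
  have "(\<lambda>t. nat \<lfloor>t / \<tau>\<rfloor>) ` {0<..<T} \<subseteq> {..nat \<lfloor>T / \<tau>\<rfloor>}"
    using \<tau> by (auto intro!: nat_mono floor_mono divide_right_mono)
  hence fin: "finite ((\<lambda>t. nat \<lfloor>t / \<tau>\<rfloor>) ` {0<..<T})" by (rule finite_subset) simp
  have [measurable]: "(\<lambda>t :: real. t / \<tau>) \<in> borel_measurable borel" by simp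
  have "(\<lambda>t :: real. nat \<lfloor>t / \<tau>\<rfloor>) \<in> measurable borel (count_space UNIV)" by measurable
  hence "(\<lambda>t. nat \<lfloor>t / \<tau>\<rfloor>) \<in> measurable (lebesgue_on {0<..<T}) (count_space UNIV)"
    by (intro measurable_restrict_space1 measurable_completion) simp
  with fin show "simple_function (lebesgue_on {0<..<T}) (\<lambda>t. nat \<lfloor>t / \<tau>\<rfloor>)"
    by (simp add: simple_function_eq_measurable)
qed

lemma cper_mult_integrable0: "Lper u \<Longrightarrow> cper v \<Longrightarrow> integrable circ (\<lambda>x. u x * v x)"
  using cper_mult_integrable[of u v 0] by simp

lemma wderiv_lin:
  assumes "wderiv j u v" "wderiv j u' v'"
  shows "wderiv j (\<lambda>x. a * u x + b * u' x) (\<lambda>x. a * v x + b * v' x)"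
proof -
  have L: "Lper (\<lambda>x. a * f x + b * g x)" if "Lper f" "Lper g" for f g
    using that by (auto simp: Lper_def periodic_def)
  have "(\<integral>x. (a * u x + b * u' x) * (deriv ^^ j) \<phi> x) = (- 1) ^ j * (\<integral>x. (a * v x + b * v' x) * \<phi> x)"
    if \<phi>: "smooth \<phi>" "periodic \<phi>" for \<phi>
  proof -
    have per: "periodic ((deriv ^^ i) \<phi>)" for i
      by (induction i) (use \<phi> smooth_deriv_periodic smooth_funpow in auto)
    have "cper ((deriv ^^ j) \<phi>)" "cper \<phi>" using \<phi> per smooth_continuous smooth_funpow by auto
    hence i: "integrable circ (\<lambda>x. f x * (deriv ^^ j) \<phi> x)" "integrable circ (\<lambda>x. f x * \<phi> x)" if "Lper f" for f
      using cper_mult_integrable0[OF that] by auto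
    have int: "(\<integral>x. (a * f x + b * g x) * \<eta> x) = a * (\<integral>x. f x * \<eta> x) + b * (\<integral>x. g x * \<eta> x)"
      if "integrable circ (\<lambda>x. f x * \<eta> x)" "integrable circ (\<lambda>x. g x * \<eta> x)" for f g \<eta> :: "real \<Rightarrow> real"
      using that by (simp add: distrib_right mult.assoc)
    show ?thesis using assms i \<phi> unfolding wderiv_def by (subst (1 2) int) (auto simp: distrib_left mult.left_commute)
  qed
  thus ?thesis using assms L by (simp add: wderiv_def)
qed

lemma sobolev_norm_powr: "p > 0 \<Longrightarrow> (\<And>j. j \<le> k \<Longrightarrow> wderiv j u (v j)) \<Longrightarrow> sobolev_norm k p u powr p = (\<Sum>j\<le>k. Ip circ p (v j))"
  by (subst sobolev_norm_eq[where w = v]) (auto simp: powr_powr sum_nonneg Ip_nonneg)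

lemma sobolev_norm_conv:
  assumes p: "p > 0" and u: "\<And>n j. j \<le> k \<Longrightarrow> wderiv j (u n) (f n j)" "\<And>j. j \<le> k \<Longrightarrow> wderiv j u0 (g j)"
    and conv: "\<And>j. j \<le> k \<Longrightarrow> Lp_conv circ p (\<lambda>n. f n j) (g j)"
  shows "(\<lambda>n. sobolev_norm k p (\<lambda>x. u n x - u0 x)) \<longlonglongrightarrow> 0"
proof -
  have "wderiv j (\<lambda>x. u n x - u0 x) (\<lambda>x. f n j x - g j x)" if "j \<le> k" for n j
    using wderiv_lin[OF u(1)[OF that, of n] u(2)[OF that], of 1 "- 1"] by simp
  hence eq: "sobolev_norm k p (\<lambda>x. u n x - u0 x) = (\<Sum>j\<le>k. Ip circ p (\<lambda>x. f n j x - g j x)) powr (1 / p)" for n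
    by (intro sobolev_norm_eq)
  have "(\<lambda>n. (\<Sum>j\<le>k. Ip circ p (\<lambda>x. f n j x - g j x)) powr (1 / p)) \<longlonglongrightarrow> (\<Sum>j\<le>k. 0) powr (1 / p)"
    using p by (intro tendsto_powr2 tendsto_sum tendsto_const conv) (auto intro!: always_eventually sum_nonneg Ip_nonneg)
  thus ?thesis using p by (simp add: eq)
qed

text \<open>The functional represented by the distribution -\<partial>f. It is written with
  \<open>weak_deriv\<close> and the completed measure so that it coincides literally with the
  expression in the weak formulation.\<close>

definition flux_fun :: "(real \<Rightarrow> real) \<Rightarrow> (real \<Rightarrow> real) \<Rightarrow> real" where
  "flux_fun f w = (LINT \<theta>:{0..2 * pi}|lebesgue. f \<theta> * weak_deriv 1 w \<theta>)"

lemma flux_fun_eq: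
  assumes "eqc f g" "g \<in> borel_measurable borel" "v \<in> borel_measurable borel" "eqc (weak_deriv 1 u) v"
  shows "flux_fun f u = (\<integral>x. g x * v x)"
  unfolding flux_fun_def
proof (rule lebesgue_on_Iv(2))
  show "(\<lambda>x. g x * v x) \<in> borel_measurable circ" using assms(2,3) by (intro measurable_Iv) measurable
  show "AE x in circ. f x * weak_deriv 1 u x = g x * v x"
    using assms(1,4) unfolding eqc_circ by eventually_elim simp
qed simp

lemma sobolev_norm_1:
  assumes "cper u" "wderiv 1 u v"
  shows "sobolev_norm 1 p u = (Ip circ p u + Ip circ p v) powr (1 / p)"
proof -
  have "wderiv j u (if j = 0 then u else v)" if "j \<le> 1" for j
    using that assms wderiv_0[OF cper_Lper[OF assms(1)]] by (cases j) auto
  from sobolev_norm_eq[OF this] show ?thesis by simp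
qed

lemma zero_in_sobolev_ball: "p \<ge> 1 \<Longrightarrow> (\<lambda>x. 0) \<in> {u \<in> sobolev 1 p. sobolev_norm 1 p u \<le> 1}"
proof -
  assume p: "p \<ge> 1"
  have c: "cper (\<lambda>x. 0 :: real)" by (simp add: periodic_def)
  have d: "wderiv j (\<lambda>x. 0) (\<lambda>x. 0)" for j using cper_Lper[OF c] by (simp add: wderiv_def)
  have "(\<lambda>x. 0) \<in> sobolev 1 p" using p by (intro sobolev_I[where w = "\<lambda>j x. 0"] c d Lpc_zero) auto
  thus ?thesis using p by (simp add: sobolev_norm_1[OF c d] del: One_nat_def)
qed

lemma flux_fun_bound:
  assumes f: "Lpc q f" "eqc f' f" and g: "Lpc q g" "eqc g' g" and u: "u \<in> sobolev 1 p" and pq: "p > 1" "q > 1" "1/p + 1/q = 1"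
  shows "\<bar>flux_fun f' u - flux_fun g' u\<bar> \<le> Ip circ q (\<lambda>x. f x - g x) powr (1/q) * sobolev_norm 1 p u"
proof -
  have p1: "p \<ge> 1" using pq by simp
  obtain v where v: "cper u" "Lpc p v" "prim v u" "wderiv 1 u v" "eqc (weak_deriv 1 u) v"
    using sobolev_1_rep[OF u p1] by blast
  have qp: "1/q + 1/p = 1" using pq by simp
  have i: "integrable circ (\<lambda>x. f x * v x)" "integrable circ (\<lambda>x. g x * v x)"
    using f g v pq by (auto intro!: Lpf_mult_integrable[OF _ _ pq(2,1) qp] Lpc_Lpf)
  have "flux_fun f' u - flux_fun g' u = (\<integral>x. (f x - g x) * v x)"
    using flux_fun_eq[OF f(2) Lpc_measurable[OF f(1)] Lpc_measurable[OF v(2)] v(5)]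
      flux_fun_eq[OF g(2) Lpc_measurable[OF g(1)] Lpc_measurable[OF v(2)] v(5)] i
    by (simp add: left_diff_distrib)
  moreover have "\<bar>LINT x|circ. (f x - g x) * v x\<bar> \<le> Ip circ q (\<lambda>x. f x - g x) powr (1/q) * Ip circ p v powr (1/p)"
    using f g v pq by (intro Hoelder_inequality Lpf_diff Lpc_Lpf qp) auto
  moreover have "Ip circ p v powr (1/p) \<le> sobolev_norm 1 p u"
    unfolding sobolev_norm_1[OF v(1,4)] using pq by (intro powr_mono2) (auto simp: Ip_nonneg)
  ultimately show ?thesis by (smt (verit) mult_left_mono powr_ge_zero)
qed

lemma flux_fun_dual:
  assumes f: "Lpc q f" "eqc f' f" and pq: "p > 1" "q > 1" "1/p + 1/q = 1"
  shows "flux_fun f' \<in> dual_space (sobolev 1 p) (sobolev_norm 1 p)"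
  unfolding dual_space_def
proof (intro CollectI conjI ballI allI exI)
  have p1: "p \<ge> 1" using pq by simp
  have qp: "1/q + 1/p = 1" using pq by simp
  fix u assume u: "u \<in> sobolev 1 p"
  have z: "Lpc q (\<lambda>x. 0)" "eqc (\<lambda>x. 0) (\<lambda>x. 0)" using pq by (auto intro: Lpc_zero eqc_refl)
  have "flux_fun (\<lambda>x. 0) u = 0" by (simp add: flux_fun_def)
  thus "\<bar>flux_fun f' u\<bar> \<le> Ip circ q f powr (1/q) * sobolev_norm 1 p u"
    using flux_fun_bound[OF f z u pq] by simp
  fix u' and a b :: real assume u': "u' \<in> sobolev 1 p"
  obtain v where v: "cper u" "Lpc p v" "prim v u" "wderiv 1 u v" "eqc (weak_deriv 1 u) v"
    using sobolev_1_rep[OF u p1] by blast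
  obtain v' where v': "cper u'" "Lpc p v'" "prim v' u'" "wderiv 1 u' v'" "eqc (weak_deriv 1 u') v'"
    using sobolev_1_rep[OF u' p1] by blast
  have "flux_fun f' (\<lambda>x. a * u x + b * u' x) = (\<integral>x. f x * (a * v x + b * v' x))"
    using Lpc_measurable[OF v(2)] Lpc_measurable[OF v'(2)]
    by (intro flux_fun_eq[OF f(2) Lpc_measurable[OF f(1)]] weak_deriv_eqc(1)[OF wderiv_lin[OF v(4) v'(4)]] borel_measurable_add borel_measurable_times borel_measurable_const) auto
  also have "\<dots> = a * (\<integral>x. f x * v x) + b * (\<integral>x. f x * v' x)"
    using Lpf_mult_integrable[OF Lpc_Lpf[OF f(1)] Lpc_Lpf[OF v(2)] pq(2,1) qp] Lpf_mult_integrable[OF Lpc_Lpf[OF f(1)] Lpc_Lpf[OF v'(2)] pq(2,1) qp]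
    by (simp add: distrib_left mult.left_commute)
  finally show "flux_fun f' (\<lambda>x. a * u x + b * u' x) = a * flux_fun f' u + b * flux_fun f' u'"
    using flux_fun_eq[OF f(2) Lpc_measurable[OF f(1)] Lpc_measurable[OF v(2)] v(5)]
      flux_fun_eq[OF f(2) Lpc_measurable[OF f(1)] Lpc_measurable[OF v'(2)] v'(5)] by simp
qed

lemma flux_fun_ball:
  assumes f: "Lpc q f" "eqc f' f" and g: "Lpc q g" "eqc g' g" and u: "u \<in> {u \<in> sobolev 1 p. sobolev_norm 1 p u \<le> 1}" and pq: "p > 1" "q > 1" "1/p + 1/q = 1"
  shows "\<bar>flux_fun f' u - flux_fun g' u\<bar> \<le> Ip circ q (\<lambda>x. f x - g x) powr (1/q)"
proof -
  have "Ip circ q (\<lambda>x. f x - g x) powr (1/q) * sobolev_norm 1 p u \<le> Ip circ q (\<lambda>x. f x - g x) powr (1/q) * 1"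
    using u by (intro mult_left_mono) auto
  thus ?thesis using flux_fun_bound[OF f g _ pq, of u] u by simp
qed

text \<open>All five bounds come from Hoelder's inequality on the unit ball; the zero function shows
  that the ball is nonempty, so the suprema behave as expected. The last bound plays the role of the
  reverse triangle inequality for the dual norm.\<close>

lemma dual_norm_flux:
  assumes f: "Lpc q f" "eqc f' f" and g: "Lpc q g" "eqc g' g" and pq: "p > 1" "q > 1" "1/p + 1/q = 1"
  shows "0 \<le> dual_norm (sobolev 1 p) (sobolev_norm 1 p) (\<lambda>u. flux_fun f' u - flux_fun g' u)"
    and "dual_norm (sobolev 1 p) (sobolev_norm 1 p) (\<lambda>u. flux_fun f' u - flux_fun g' u) \<le> Ip circ q (\<lambda>x. f x - g x) powr (1/q)"
    and "0 \<le> dual_norm (sobolev 1 p) (sobolev_norm 1 p) (flux_fun f')"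
    and "dual_norm (sobolev 1 p) (sobolev_norm 1 p) (flux_fun f') \<le> Ip circ q f powr (1/q)"
    and "\<bar>dual_norm (sobolev 1 p) (sobolev_norm 1 p) (flux_fun f') - dual_norm (sobolev 1 p) (sobolev_norm 1 p) (flux_fun g')\<bar>
      \<le> Ip circ q (\<lambda>x. f x - g x) powr (1/q)"
proof -
  let ?B = "{u \<in> sobolev 1 p. sobolev_norm 1 p u \<le> 1}"
  have ne: "(\<lambda>x. 0) \<in> ?B" using pq by (intro zero_in_sobolev_ball) auto
  have z: "Lpc q (\<lambda>x. 0)" "eqc (\<lambda>x. 0) (\<lambda>x. 0)" using pq by (auto intro: Lpc_zero eqc_refl)
  have fz: "flux_fun (\<lambda>x. 0) u = 0" for u by (simp add: flux_fun_def)
  have b: "\<bar>flux_fun f' u\<bar> \<le> Ip circ q f powr (1/q)" if "u \<in> ?B" "Lpc q f" "eqc f' f" for u f f'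
    using flux_fun_ball[OF that(2,3) z that(1) pq] fz by simp
  have bdd: "bdd_above ((\<lambda>u. \<bar>flux_fun f' u\<bar>) ` ?B)" if "Lpc q f" "eqc f' f" for f f'
    using b[OF _ that] by (intro bdd_aboveI2) auto
  note d = flux_fun_ball[OF f g _ pq]
  have bdd2: "bdd_above ((\<lambda>u. \<bar>flux_fun f' u - flux_fun g' u\<bar>) ` ?B)"
    using d by (intro bdd_aboveI2) auto
  show "0 \<le> dual_norm (sobolev 1 p) (sobolev_norm 1 p) (\<lambda>u. flux_fun f' u - flux_fun g' u)"
    "0 \<le> dual_norm (sobolev 1 p) (sobolev_norm 1 p) (flux_fun f')"
    unfolding dual_norm_def using cSUP_upper[OF ne bdd[OF f]] cSUP_upper[OF ne bdd2] by (meson abs_ge_zero order_trans)+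
  show "dual_norm (sobolev 1 p) (sobolev_norm 1 p) (\<lambda>u. flux_fun f' u - flux_fun g' u) \<le> Ip circ q (\<lambda>x. f x - g x) powr (1/q)"
    "dual_norm (sobolev 1 p) (sobolev_norm 1 p) (flux_fun f') \<le> Ip circ q f powr (1/q)"
    unfolding dual_norm_def using ne d b[OF _ f] by (auto intro!: cSUP_least)
  have le: "dual_norm (sobolev 1 p) (sobolev_norm 1 p) (flux_fun f1) \<le> dual_norm (sobolev 1 p) (sobolev_norm 1 p) (flux_fun f2) + X"
    if bd: "bdd_above ((\<lambda>u. \<bar>flux_fun f2 u\<bar>) ` ?B)" and X: "\<And>u. u \<in> ?B \<Longrightarrow> \<bar>flux_fun f1 u - flux_fun f2 u\<bar> \<le> X" for f1 f2 X
    unfolding dual_norm_def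
  proof (rule cSUP_least)
    fix u assume u: "u \<in> ?B"
    show "\<bar>flux_fun f1 u\<bar> \<le> (SUP u\<in>?B. \<bar>flux_fun f2 u\<bar>) + X"
      using cSUP_upper[OF u bd] X[OF u] by linarith
  qed (use ne in blast)
  have "\<bar>flux_fun g' u - flux_fun f' u\<bar> \<le> Ip circ q (\<lambda>x. f x - g x) powr (1/q)" if "u \<in> ?B" for u
    using d[OF that] by (simp add: abs_minus_commute)
  from le[OF bdd[OF g] d] le[OF bdd[OF f] this]
  show "\<bar>dual_norm (sobolev 1 p) (sobolev_norm 1 p) (flux_fun f') - dual_norm (sobolev 1 p) (sobolev_norm 1 p) (flux_fun g')\<bar>
      \<le> Ip circ q (\<lambda>x. f x - g x) powr (1/q)" by linarith
qed

text \<open>The approximating simple functions are constant on the cells of a time grid. Since they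
  also converge in norm, measurability of \<open>N (f t)\<close> follows from the grid functions,
  and only an integrable bound remains to be supplied.\<close>

lemma Lp_bochner_I:
  fixes f :: "real \<Rightarrow> 'b \<Rightarrow> real" and F :: "nat \<Rightarrow> nat \<Rightarrow> 'b \<Rightarrow> real"
  assumes \<tau>: "\<And>n. \<tau> n > 0" and F: "\<And>n k. F n k \<in> X" and b: "integrable (Iv 0 T) b"
    and f: "AE t in Iv 0 T. f t \<in> X \<and> (\<lambda>n. N (\<lambda>x. F n (nat \<lfloor>t / \<tau> n\<rfloor>) x - f t x)) \<longlonglongrightarrow> 0 \<and>
      (\<lambda>n. N (F n (nat \<lfloor>t / \<tau> n\<rfloor>))) \<longlonglongrightarrow> N (f t) \<and> N (f t) powr q \<le> b t"
  shows "f \<in> Lp_bochner {0<..<T} q X N"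
proof -
  define g where "g = (\<lambda>t. lim (\<lambda>n. N (F n (nat \<lfloor>t / \<tau> n\<rfloor>))) powr q)"
  have [measurable]: "(\<lambda>t. N (F n (nat \<lfloor>t / \<tau> n\<rfloor>))) \<in> borel_measurable borel" for n
  proof -
    have [measurable]: "(\<lambda>t :: real. t / \<tau> n) \<in> borel_measurable borel" by simp
    have "(\<lambda>t :: real. nat \<lfloor>t / \<tau> n\<rfloor>) \<in> measurable borel (count_space UNIV)" by measurable
    from measurable_compose[OF this, of "\<lambda>k. N (F n k)" borel] show ?thesis by simp
  qed
  have g: "g \<in> borel_measurable (Iv 0 T)" by (rule measurable_Iv) (unfold g_def, measurable)
  have eq: "AE t in Iv 0 T. N (f t) powr q = g t"
    using f
  proof eventually_elim
    case (elim t)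
    hence "lim (\<lambda>n. N (F n (nat \<lfloor>t / \<tau> n\<rfloor>))) = N (f t)" by (intro limI) blast
    thus ?case by (simp add: g_def)
  qed
  have "integrable (Iv 0 T) g"
  proof (rule Bochner_Integration.integrable_bound[OF b g])
    show "AE t in Iv 0 T. norm (g t) \<le> norm (b t)"
      using f eq
    proof eventually_elim
      case (elim t)
      have "g t = N (f t) powr q" using elim by simp
      hence "0 \<le> g t" "g t \<le> b t" using elim powr_ge_zero[of "N (f t)" q] by auto
      thus ?case by simp
    qed
  qed
  hence "integrable (lebesgue_on {0<..<T}) (\<lambda>t. N (f t) powr q)"
    using lebesgue_on_Iv(1)[OF g eq, of "{0<..<T}"] by simp
  moreover have "AE t in lebesgue_on {0<..<T}. f t \<in> X \<and> (\<lambda>n. N (\<lambda>x. F n (nat \<lfloor>t / \<tau> n\<rfloor>) x - f t x)) \<longlonglongrightarrow> 0"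
  proof (rule AE_Iv_lebesgue_on[where a = 0 and b = T])
    show "AE t in Iv 0 T. f t \<in> X \<and> (\<lambda>n. N (\<lambda>x. F n (nat \<lfloor>t / \<tau> n\<rfloor>) x - f t x)) \<longlonglongrightarrow> 0"
      using f by (rule eventually_mono) simp
  qed simp
  moreover have "\<forall>n. simple_function (lebesgue_on {0<..<T}) (\<lambda>t. F n (nat \<lfloor>t / \<tau> n\<rfloor>)) \<and> (\<lambda>t. F n (nat \<lfloor>t / \<tau> n\<rfloor>)) ` {0<..<T} \<subseteq> X"
    using F simple_function_grid[OF \<tau>] by blast
  ultimately show ?thesis
    unfolding Lp_bochner_def eventually_conj_iff
    by (intro CollectI conjI exI[of _ "\<lambda>n t. F n (nat \<lfloor>t / \<tau> n\<rfloor>)"]) blast+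
qed

section \<open>Approximation of the solution and its derivatives\<close>

lemma prim_mderiv:
  assumes u: "cper u" and e: "e > 0" and j: "j < 3"
  shows "prim (mderiv e (Suc j) u) (mderiv e j u)"
proof -
  let ?w = "(avg e ^^ (2 - j)) u"
  have w: "cper ?w" by (rule cper_avg_pow[OF u e])
  have "prim ((dq e ^^ i) (dq e ?w)) ((dq e ^^ i) (avg e ?w))" for i
    by (induction i) (use w e in \<open>auto intro: prim_dq deriv_prim avg_deriv dq_continuous\<close>)
  moreover have "3 - j = Suc (2 - j)" "3 - Suc j = 2 - j" using j by simp_all
  ultimately show ?thesis unfolding mderiv_def by (simp add: funpow_swap1)
qed

lemma wderiv_mderiv:
  assumes u: "cper u" and e: "e > 0" shows "j \<le> 3 \<Longrightarrow> wderiv j (avg3 e u) (mderiv e j u)"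
proof (induction j)
  case 0
  show ?case unfolding mderiv_0 by (rule wderiv_0[OF cper_Lper[OF cper_avg3[OF u e]]])
next
  case (Suc j)
  thus ?case
    using u e by (intro prim_wderiv_Suc[OF _ cper_mderiv cper_Lper[OF cper_mderiv] prim_mderiv]) auto
qed

text \<open>A function with its derivatives up to order three, each the indefinite integral of the
  next; only the last one is allowed to be discontinuous.\<close>

definition deriv_chain :: "real \<Rightarrow> (nat \<Rightarrow> real \<Rightarrow> real) \<Rightarrow> bool" where
  "deriv_chain p v \<longleftrightarrow> (\<forall>j<3. cper (v j) \<and> prim (v (Suc j)) (v j)) \<and> Lpc p (v 3)"

lemma deriv_chain_Lpc: "deriv_chain p v \<Longrightarrow> p > 0 \<Longrightarrow> j \<le> 3 \<Longrightarrow> Lpc p (v j)"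
  by (cases "j = 3") (auto simp: deriv_chain_def cper_Lpc)

lemma deriv_chain_wderiv:
  assumes v: "deriv_chain p v" and p: "p \<ge> 1" shows "j \<le> 3 \<Longrightarrow> wderiv j (v 0) (v j)"
proof (induction j)
  case 0
  show ?case using v by (intro wderiv_0 cper_Lper) (auto simp: deriv_chain_def)
next
  case (Suc j)
  moreover have "Lper (v (Suc j))" using deriv_chain_Lpc[OF v _ Suc.prems] p by (intro Lpc_Lper[of p]) auto
  ultimately show ?case using v by (intro prim_wderiv_Suc[of j "v 0" "v j"]) (auto simp: deriv_chain_def)
qed

lemma deriv_chain_avg3: "deriv_chain p v \<Longrightarrow> p \<ge> 1 \<Longrightarrow> e > 0 \<Longrightarrow> deriv_chain p (\<lambda>j. avg3 e (v j))"
  by (simp add: deriv_chain_def prim_avg3 Lpc_avg3 cper_avg3)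

text \<open>Perturbing the function by \<open>e n ^ 4\<close> costs at most \<open>e n\<close> after
  three divisions by \<open>e n\<close>. For the unperturbed function the mollified derivative is
  \<open>avg3\<close> of the derivative, so it converges in L_p.\<close>

lemma deriv_chain_conv:
  assumes v: "deriv_chain p v" and p: "p \<ge> 1" and e: "\<And>n. 0 < e n" "\<And>n. e n \<le> 1" "e \<longlonglongrightarrow> 0"
    and u: "\<And>n. cper (u n)" "\<And>n x. \<bar>u n x - v 0 x\<bar> \<le> e n ^ 4" and j: "j \<le> 3"
  shows "Lp_conv circ p (\<lambda>n. mderiv (e n) j (u n)) (v j)"
proof -
  have p0: "p > 0" using p by simp
  have v0: "cper (v 0)" using v by (simp add: deriv_chain_def)
  have Lv: "Lpc p (v j)" by (rule deriv_chain_Lpc[OF v p0 j])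
  let ?D = "\<lambda>n. mderiv (e n) j"
  have L: "Lpc p (?D n f)" if "cper f" for f n by (rule cper_Lpc[OF cper_mderiv[OF that e(1)] p0])
  have "eqc (?D n (v 0)) (avg3 (e n) (v j))" for n
    using wderiv_unique[OF wderiv_mderiv[OF v0 e(1) j] deriv_chain_wderiv[OF deriv_chain_avg3[OF v p e(1)] p j]] .
  hence "Ip circ p (\<lambda>x. ?D n (v 0) x - v j x) = Ip circ p (\<lambda>x. avg3 (e n) (v j) x - v j x)" for n
    using Lpc_measurable[OF Lv] Lpc_measurable[OF L[OF v0]] Lpc_measurable[OF Lpc_avg3(1)[OF Lv p e(1)[of n]]] unfolding eqc_circ
    by (intro Ip_cong_AE measurable_Iv) auto
  hence c: "Lp_conv circ p (\<lambda>n. ?D n (v 0)) (v j)" using Lp_conv_avg3[OF Lv p e(1,3)] by simp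
  have "(\<lambda>n. Ip circ p (\<lambda>x. ?D n (u n) x - ?D n (v 0) x)) \<longlonglongrightarrow> 0"
  proof (rule tendsto_sandwich[OF _ _ tendsto_const])
    have d: "\<bar>?D n (u n) x - ?D n (v 0) x\<bar> powr p \<le> e n powr p" for n x
    proof -
      have "\<bar>?D n (u n) x - ?D n (v 0) x\<bar> \<le> e n ^ 4 / e n ^ j" by (rule mderiv_diff_bound[OF u(1) v0 e(1) u(2)])
      also have "\<dots> = e n ^ (4 - j)" using e(1)[of n] j by (simp add: power_diff)
      also have "\<dots> \<le> e n ^ 1" using e(1,2)[of n] j by (intro power_decreasing) auto
      finally show ?thesis using p by (intro powr_mono2) auto
    qed
    have "Ip circ p (\<lambda>x. ?D n (u n) x - ?D n (v 0) x) \<le> 2 * pi * e n powr p" for n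
      using Lpf_integrable[OF Lpc_Lpf[OF Lpc_diff[OF p0 L[OF u(1)] L[OF v0]]]] d by (rule integral_circ_bound)
    thus "\<forall>\<^sub>F n in sequentially. Ip circ p (\<lambda>x. ?D n (u n) x - ?D n (v 0) x) \<le> 2 * pi * e n powr p" by simp
    have "(\<lambda>n. 2 * pi * e n powr p) \<longlonglongrightarrow> 2 * pi * 0 powr p"
      using p0 e(1) by (intro tendsto_intros tendsto_powr2 e) (auto intro: always_eventually less_imp_le)
    thus "(\<lambda>n. 2 * pi * e n powr p) \<longlonglongrightarrow> 0" using p0 by simp
  qed (auto simp: Ip_nonneg)
  thus ?thesis using c by (intro Lp_conv_perturb[OF p0 Lpc_Lpf[OF L[OF u(1)]] Lpc_Lpf[OF L[OF v0]] Lpc_Lpf[OF Lv]])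
qed

context film_weak
begin

text \<open>The times at which the slice of \<open>z\<close> determines three space derivatives of
  \<open>h t\<close> and the slice of \<open>J\<close> is the flux of the equation; almost every
  time is of this kind.\<close>

definition regular :: "real \<Rightarrow> bool" where
  "regular t \<longleftrightarrow> t \<in> {0..T} \<and> Lpc p (\<lambda>x. z (t, x)) \<and> Lpc q (\<lambda>x. J (t, x)) \<and>
    (\<forall>k x. 0 < k \<and> k \<le> pi \<longrightarrow> avg3 k (\<lambda>x. z (t, x)) x = zz k (h t) x) \<and>
    (AE x in circ. J (t, x) = h t x powr (\<alpha> + 2) * \<psi> \<alpha> (z (t, x)))"

lemma AE_regular: "AE t in Iv 0 T. regular t"
proof -
  interpret pair_sigma_finite "Iv 0 T" circ by (rule circ_pair_sigma_finite)
  have "AE t in Iv 0 T. AE x in circ. J (t, x) = h t x powr (\<alpha> + 2) * \<psi> \<alpha> (z (t, x))"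
    using AE_pair[of "\<lambda>y. J y = h (fst y) (snd y) powr (\<alpha> + 2) * \<psi> \<alpha> (z y)"] flux_identified unfolding Qm_def by simp
  moreover have "AE t in Iv 0 T. t \<in> {0..T}" by (rule AE_I2) simp
  ultimately show ?thesis using sections zz_limit by eventually_elim (simp add: regular_def)
qed

lemma regular_chain:
  assumes t: "regular t"
  obtains v where "deriv_chain p v" "v 0 = h t" "v 3 = (\<lambda>x. z (t, x) - v 1 x)"
    "\<And>x. \<bar>v 2 x\<bar> \<le> 2 * M + (\<integral>x. \<bar>z (t, x)\<bar>)" "\<And>x. \<bar>v 1 x\<bar> \<le> 2 * pi * (2 * M + (\<integral>x. \<bar>z (t, x)\<bar>))"
proof -
  let ?z = "\<lambda>x. z (t, x)"
  have z: "Lpc p ?z" "Lper ?z" using t p1 by (auto simp: regular_def intro: Lpc_Lper[of p])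
  have eq: "avg3 k ?z x = zz k (h t) x" if "0 < k" "k \<le> 1" for k x
    using that t pi_gt3 by (auto simp: regular_def)
  obtain v1 v2 where v: "cper v1" "cper v2" "prim v1 (h t)" "prim v2 v1" "prim (\<lambda>x. ?z x - v1 x) v2"
    "\<And>x. \<bar>v2 x\<bar> \<le> 2 * M + (\<integral>x. \<bar>?z x\<bar>)" "\<And>x. \<bar>v1 x\<bar> \<le> 2 * pi * (2 * M + (\<integral>x. \<bar>?z x\<bar>))"
    using W3_of_avg3[OF cper_h z(2) eq h_range(3)] by blast
  define w where "w = (\<lambda>j. [h t, v1, v2, \<lambda>x. ?z x - v1 x] ! j)"
  have w: "w 0 = h t" "w 1 = v1" "w (Suc 0) = v1" "w 2 = v2" "w (Suc (Suc 0)) = v2" "w 3 = (\<lambda>x. ?z x - v1 x)" "w (Suc (Suc (Suc 0))) = (\<lambda>x. ?z x - v1 x)"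
    by (simp_all add: w_def numeral_3_eq_3 numeral_2_eq_2)
  have "deriv_chain p w"
    unfolding deriv_chain_def
  proof (intro conjI allI impI)
    show "Lpc p (w 3)" unfolding w by (intro Lpc_diff z(1) cper_Lpc v pq0)
    fix j :: nat assume "j < 3"
    hence "j = 0 \<or> j = 1 \<or> j = 2" by linarith
    thus "continuous_on UNIV (w j)" "periodic (w j)" "prim (w (Suc j)) (w j)" using v cper_h[of t] by (auto simp: w)
  qed
  thus ?thesis using v by (intro that[of w]) (simp_all add: w)
qed

abbreviation grid :: "real \<Rightarrow> real \<Rightarrow> real" where
  "grid s t \<equiv> real (nat \<lfloor>t / s\<rfloor>) * s"

text \<open>Uniform continuity in time provides grids fine enough for the fourth power required in
  \<open>deriv_chain_conv\<close>.\<close>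

lemma grid_exists:
  obtains \<sigma> where "\<And>n. \<sigma> n > 0" "\<And>n t x. t \<ge> 0 \<Longrightarrow> \<bar>h (grid (\<sigma> n) t) x - h t x\<bar> \<le> (1 / real (Suc n)) ^ 4"
proof -
  have "\<exists>d>0. \<forall>s t x. \<bar>t - s\<bar> \<le> d \<longrightarrow> \<bar>h t x - h s x\<bar> \<le> (1 / real (Suc n)) ^ 4" for n
  proof -
    have "(1 / real (Suc n)) ^ 4 > 0" by simp
    from hcont[OF this] show ?thesis by force
  qed
  then obtain \<sigma> where \<sigma>: "\<And>n. \<sigma> n > 0" "\<And>n s t x. \<bar>t - s\<bar> \<le> \<sigma> n \<Longrightarrow> \<bar>h t x - h s x\<bar> \<le> (1 / real (Suc n)) ^ 4" by metis
  have "\<bar>h (grid (\<sigma> n) t) x - h t x\<bar> \<le> (1 / real (Suc n)) ^ 4" if t: "t \<ge> 0" for t n x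
    using floor_step[OF \<sigma>(1)[of n] t] by (intro \<sigma>(2)) auto
  thus ?thesis using \<sigma>(1) that by blast
qed

lemma small_step_le: "0 < 1 / real (Suc n)" "1 / real (Suc n) \<le> 1"
  by simp_all

text \<open>The simple approximants are the mollified samples
  \<open>avg3 (?e n) (h (real k * \<sigma> n))\<close>, which belong to every Sobolev space needed.
  At regular times they converge together with three derivatives.\<close>

lemma h_bochner: "h \<in> Lp_bochner {0<..<T} p (sobolev 3 p) (sobolev_norm 3 p)"
proof -
  obtain \<sigma> where \<sigma>: "\<And>n. \<sigma> n > 0" "\<And>n t x. t \<ge> 0 \<Longrightarrow> \<bar>h (grid (\<sigma> n) t) x - h t x\<bar> \<le> (1 / real (Suc n)) ^ 4"
    using grid_exists by blast
  let ?e = "\<lambda>n. 1 / real (Suc n)"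
  let ?I = "\<lambda>t. Ip circ p (\<lambda>x. z (t, x))"
  \<comment> \<open>\<open>?W\<close> bounds the \<open>p\<close>-th power of the supremum of the
    second derivative, through Jensen's inequality. The four summands of \<open>?b\<close> then
    bound the derivatives of order 0, 1, 2, 3; the last uses that the third derivative is
    \<open>z\<close> minus the first.\<close>
  let ?W = "\<lambda>t. 2 powr p * ((2 * M) powr p + (2 * pi) powr p * (?I t / (2 * pi)))"
  let ?b = "\<lambda>t. 2 * pi * M powr p + 2 * pi * ((2 * pi) powr p * ?W t) + 2 * pi * ?W t + 2 powr p * (?I t + 2 * pi * ((2 * pi) powr p * ?W t))"
  show ?thesis
  proof (rule Lp_bochner_I[where \<tau> = \<sigma> and F = "\<lambda>n k. avg3 (?e n) (h (real k * \<sigma> n))" and b = ?b])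
    show "avg3 (?e n) (h (real k * \<sigma> n)) \<in> sobolev 3 p" for n k
      using pq0 by (intro sobolev_I[where w = "\<lambda>j. mderiv (?e n) j (h (real k * \<sigma> n))"] cper_avg3 cper_Lpc[OF cper_mderiv] wderiv_mderiv cper_h small_step_le(1)) auto
    show "integrable (Iv 0 T) ?b"
      using Qm_Fubini(2)[OF Lpf_integrable[OF zL]]
      by (intro Bochner_Integration.integrable_add integrable_mult_right integrable_divide integrable_Iv_const)
    show "AE t in Iv 0 T. h t \<in> sobolev 3 p \<and>
       (\<lambda>n. sobolev_norm 3 p (\<lambda>x. avg3 (?e n) (h (grid (\<sigma> n) t)) x - h t x)) \<longlonglongrightarrow> 0 \<and>
       (\<lambda>n. sobolev_norm 3 p (avg3 (?e n) (h (grid (\<sigma> n) t)))) \<longlonglongrightarrow> sobolev_norm 3 p (h t) \<and>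
       sobolev_norm 3 p (h t) powr p \<le> ?b t"
      using AE_regular
    proof eventually_elim
      case (elim t)
      obtain v where v: "deriv_chain p v" "v 0 = h t" "v 3 = (\<lambda>x. z (t, x) - v 1 x)"
        "\<And>x. \<bar>v 2 x\<bar> \<le> 2 * M + (\<integral>x. \<bar>z (t, x)\<bar>)" "\<And>x. \<bar>v 1 x\<bar> \<le> 2 * pi * (2 * M + (\<integral>x. \<bar>z (t, x)\<bar>))"
        using regular_chain[OF elim] by blast
      have p1': "p \<ge> 1" using p1 by simp
      have t: "t \<ge> 0" and z: "Lpc p (\<lambda>x. z (t, x))" using elim by (auto simp: regular_def)
      have wd: "wderiv j (h t) (v j)" if "j \<le> 3" for j using deriv_chain_wderiv[OF v(1) p1' that] v(2) by simp
      have L: "Lpc p (v j)" if "j \<le> 3" for j using deriv_chain_Lpc[OF v(1) pq0(1) that] .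
      let ?u = "\<lambda>n. h (grid (\<sigma> n) t)"
      have wu: "wderiv j (avg3 (?e n) (?u n)) (mderiv (?e n) j (?u n))" if "j \<le> 3" for j n
        by (rule wderiv_mderiv[OF cper_h small_step_le(1) that])
      have conv: "Lp_conv circ p (\<lambda>n. mderiv (?e n) j (?u n)) (v j)" if "j \<le> 3" for j
        using \<sigma>(2)[OF t] by (intro deriv_chain_conv[OF v(1) p1' small_step_le avg_small_step cper_h _ that]) (simp add: v(2))
      have N: "sobolev_norm 3 p (avg3 (?e n) (?u n)) = (\<Sum>j\<le>3. Ip circ p (mderiv (?e n) j (?u n))) powr (1 / p)"
        "sobolev_norm 3 p (h t) = (\<Sum>j\<le>3. Ip circ p (v j)) powr (1 / p)" for n
        by (rule sobolev_norm_eq[OF wu], assumption, rule sobolev_norm_eq[OF wd])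
      have "(\<lambda>n. sobolev_norm 3 p (avg3 (?e n) (?u n))) \<longlonglongrightarrow> sobolev_norm 3 p (h t)"
        unfolding N
      proof (rule tendsto_powr2)
        show "(\<lambda>n. \<Sum>j\<le>3. Ip circ p (mderiv (?e n) j (?u n))) \<longlonglongrightarrow> (\<Sum>j\<le>3. Ip circ p (v j))"
          using pq0 L Lpc_Lpf[OF cper_Lpc[OF cper_mderiv[OF cper_h small_step_le(1)] pq0(1)]]
          by (intro tendsto_sum Lp_conv_Ip conv) (auto intro: Lpc_Lpf)
      qed (use pq0 in \<open>auto intro!: always_eventually sum_nonneg Ip_nonneg\<close>)
      moreover have "sobolev_norm 3 p (h t) powr p \<le> ?b t"
      proof -
        define Z where "Z = (\<integral>x. \<bar>z (t, x)\<bar>)"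
        have Z: "Z \<ge> 0" by (simp add: Z_def)
        have sup: "Ip circ p f \<le> 2 * pi * B powr p" if "Lpc p f" "\<And>x. \<bar>f x\<bar> \<le> B" for f B
          using that pq0 by (intro integral_circ_bound powr_mono2) (auto simp: Lpc_def)
        have W: "(2 * M + Z) powr p \<le> ?W t"
        proof -
          have "(2 * M + Z) powr p \<le> 2 powr p * ((2 * M) powr p + Z powr p)"
            using abs_powr_add_le[OF pq0(1), of "2 * M" Z] M_pos Z by simp
          also have "\<dots> \<le> ?W t" using powr_mean_le[OF z p1'] by (intro mult_left_mono add_left_mono) (auto simp: Z_def)
          finally show ?thesis .
        qed
        have 0: "Ip circ p (v 0) \<le> 2 * pi * M powr p" unfolding v(2) by (intro sup cper_Lpc cper_h pq0 h_range)
        have "Ip circ p (v 2) \<le> 2 * pi * (2 * M + Z) powr p" using v(4) L by (intro sup) (auto simp: Z_def)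
        also have "\<dots> \<le> 2 * pi * ?W t" using W by (intro mult_left_mono) auto
        finally have 2: "Ip circ p (v 2) \<le> 2 * pi * ?W t" .
        have "Ip circ p (v 1) \<le> 2 * pi * (2 * pi * (2 * M + Z)) powr p" using v(5) L by (intro sup) (auto simp: Z_def)
        also have "\<dots> = 2 * pi * ((2 * pi) powr p * (2 * M + Z) powr p)" using M_pos Z by (simp add: powr_mult)
        also have "\<dots> \<le> 2 * pi * ((2 * pi) powr p * ?W t)" using W by (intro mult_left_mono) auto
        finally have 1: "Ip circ p (v 1) \<le> 2 * pi * ((2 * pi) powr p * ?W t)" .
        have "Ip circ p (v 3) \<le> 2 powr p * (?I t + Ip circ p (v 1))"
          using Ip_add_le[OF pq0(1) Lpc_Lpf[OF z] Lpf_minus[OF Lpc_Lpf[OF L[of 1]]]] by (simp add: v(3))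
        also have "\<dots> \<le> 2 powr p * (?I t + 2 * pi * ((2 * pi) powr p * ?W t))" using 1 by (intro mult_left_mono add_left_mono) auto
        finally have 3: "Ip circ p (v 3) \<le> 2 powr p * (?I t + 2 * pi * ((2 * pi) powr p * ?W t))" .
        have "sobolev_norm 3 p (h t) powr p = Ip circ p (v 0) + Ip circ p (v 1) + Ip circ p (v 2) + Ip circ p (v 3)"
          using sobolev_norm_powr[OF pq0(1), of 3 "h t" v] wd by (simp add: numeral_3_eq_3 numeral_2_eq_2)
        thus ?thesis using 0 1 2 3 by linarith
      qed
      moreover have "h t \<in> sobolev 3 p" using wd L by (intro sobolev_I[OF cper_h pq0(1)])
      moreover have "(\<lambda>n. sobolev_norm 3 p (\<lambda>x. avg3 (?e n) (?u n) x - h t x)) \<longlonglongrightarrow> 0"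
        by (rule sobolev_norm_conv[OF pq0(1) wu wd conv])
      ultimately show ?case by blast
    qed
  qed (rule \<sigma>)
qed

end

text \<open>\<open>B\<close> is merely integrable, so the formula is obtained from Fubini on the
  triangle of pairs \<open>s \<le> t\<close>; the boundary terms vanish with \<eta>.\<close>

lemma integral_by_parts_Iv:
  assumes T: "0 \<le> T" and B: "integrable (Iv 0 T) B" and \<eta>: "smooth \<eta>" "\<eta> 0 = 0" "\<eta> T = 0"
  shows "(LINT t|Iv 0 T. deriv \<eta> t * (c + (LINT s|Iv 0 T. indicator {0..t} s * B s))) = - (LINT t|Iv 0 T. \<eta> t * B t)"
proof -
  interpret pair_sigma_finite "Iv 0 T" "Iv 0 T" by (rule circ_pair_sigma_finite)
  have c': "continuous_on UNIV (deriv \<eta>)" by (intro smooth_continuous smooth_deriv \<eta>)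
  have prm: "prim (deriv \<eta>) \<eta>" using smooth_DERIV[OF \<eta>(1)] c' by (rule deriv_prim)
  have "compact (deriv \<eta> ` {0..T})" using c' by (intro compact_continuous_image continuous_on_subset[OF c']) auto
  hence "\<exists>C. \<forall>t\<in>{0..T}. \<bar>deriv \<eta> t\<bar> \<le> C" by (auto dest!: compact_imp_bounded simp: bounded_iff)
  then obtain C where C: "\<And>t. t \<in> {0..T} \<Longrightarrow> \<bar>deriv \<eta> t\<bar> \<le> C" by blast
  have [measurable]: "deriv \<eta> \<in> borel_measurable borel" by (rule borel_measurable_continuous_onI[OF c'])
  have [measurable]: "B \<in> borel_measurable (Iv 0 T)" using B by (rule borel_measurable_integrable)
  let ?P = "Iv 0 T \<Otimes>\<^sub>M Iv 0 T" and ?f = "\<lambda>t s. deriv \<eta> t * (indicator {0..t} s * B s)"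
  have dom: "integrable ?P (\<lambda>(t, s). C * \<bar>B s\<bar>)"
    using B by (intro Fubini_integrable) (auto simp: integrable_Iv_const abs_mult)
  have "integrable ?P (case_prod ?f)"
  proof (rule Bochner_Integration.integrable_bound[OF dom])
    have "(\<lambda>y. (if 0 \<le> snd y \<and> snd y \<le> fst y then deriv \<eta> (fst y) else 0) * B (snd y)) \<in> borel_measurable ?P"
      by (rule borel_measurable_times[OF measurable_Iv_pair]; measurable)
    also have "(\<lambda>y. (if 0 \<le> snd y \<and> snd y \<le> fst y then deriv \<eta> (fst y) else 0) * B (snd y)) = case_prod ?f"
      by (auto simp: fun_eq_iff indicator_def)
    finally show "case_prod ?f \<in> borel_measurable ?P" .
    show "AE y in ?P. norm (case_prod ?f y) \<le> norm (case y of (t, s) \<Rightarrow> C * \<bar>B s\<bar>)"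
    proof (intro AE_I2)
      fix y assume "y \<in> space ?P"
      hence "\<bar>deriv \<eta> (fst y)\<bar> \<le> C" using C by (auto simp: space_pair_measure)
      thus "norm (case_prod ?f y) \<le> norm (case y of (t, s) \<Rightarrow> C * \<bar>B s\<bar>)"
        by (auto simp: case_prod_beta abs_mult indicator_def intro!: mult_right_mono)
    qed
  qed
  from Fubini_integral[OF this] integrable_fst[OF this]
  have F: "(LINT s|Iv 0 T. (LINT t|Iv 0 T. ?f t s)) = (LINT t|Iv 0 T. (LINT s|Iv 0 T. ?f t s))"
    and i: "integrable (Iv 0 T) (\<lambda>t. LINT s|Iv 0 T. ?f t s)" by auto
  have i0: "integrable (Iv 0 T) (\<lambda>t. deriv \<eta> t * c)" using continuous_locint[OF c'] by (simp add: locint_def)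
  have "(LINT t|Iv 0 T. deriv \<eta> t * (c + (LINT s|Iv 0 T. indicator {0..t} s * B s)))
      = (LINT t|Iv 0 T. deriv \<eta> t * c) + (LINT t|Iv 0 T. (LINT s|Iv 0 T. ?f t s))"
    using i i0 by (simp add: distrib_left)
  also have "(LINT t|Iv 0 T. deriv \<eta> t * c) = 0" using prim_integral[OF prm T] \<eta> by simp
  also have "(LINT t|Iv 0 T. (LINT s|Iv 0 T. ?f t s)) = (LINT s|Iv 0 T. - (\<eta> s * B s))"
    unfolding F[symmetric]
  proof (intro Bochner_Integration.integral_cong refl)
    fix s assume s: "s \<in> space (Iv 0 T)"
    have "(LINT t|Iv 0 T. ?f t s) = (LINT t|Iv 0 T. B s * (indicator {s..T} t * deriv \<eta> t))"
      using s by (intro Bochner_Integration.integral_cong) (auto simp: indicator_def)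
    also have "\<dots> = B s * (LINT t|Iv 0 T. indicator {s..T} t * deriv \<eta> t)" by (rule integral_mult_right_zero)
    also have "(LINT t|Iv 0 T. indicator {s..T} t * deriv \<eta> t) = (LINT t|Iv s T. deriv \<eta> t)"
      unfolding integral_Iv using s by (intro Bochner_Integration.integral_cong) (auto simp: indicator_def)
    also have "\<dots> = - \<eta> s" using prim_integral[OF prm, of s T] s \<eta> by simp
    finally show "(LINT t|Iv 0 T. ?f t s) = - (\<eta> s * B s)" by simp
  qed
  finally show ?thesis by simp
qed

lemma energy_eq:
  assumes u: "cper u" and v: "Lpc 2 v" "prim v u"
  shows "energy u = 1 / 2 * L2sq v - 1 / 2 * L2sq u"
proof -
  have w: "wderiv 1 u v" using u v by (intro prim_wderiv) (auto intro: Lpc_Lper[of 2])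
  have L: "Lpc 2 u" using u by (intro cper_Lpc) auto
  have i: "integrable circ (\<lambda>x. (v x)\<^sup>2)" "integrable circ (\<lambda>x. (u x)\<^sup>2)"
    using Lpf_integrable[OF Lpc_Lpf[OF v(1)]] Lpf_integrable[OF Lpc_Lpf[OF L]] by simp_all
  have "(LINT \<theta>:{0..2 * pi}|lebesgue. (weak_deriv 1 u \<theta>)\<^sup>2 - (u \<theta>)\<^sup>2) = (\<integral>x. (v x)\<^sup>2 - (u x)\<^sup>2)"
  proof (rule lebesgue_on_Iv(2))
    show "(\<lambda>x. (v x)\<^sup>2 - (u x)\<^sup>2) \<in> borel_measurable circ" using i by (intro borel_measurable_diff borel_measurable_integrable)
    show "AE x in circ. (weak_deriv 1 u x)\<^sup>2 - (u x)\<^sup>2 = (v x)\<^sup>2 - (u x)\<^sup>2"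
      using weak_deriv_eqc(1)[OF w] unfolding eqc_circ by eventually_elim simp
  qed simp
  thus ?thesis using i by (simp add: energy_def)
qed

context film_weak
begin

lemma regular_deriv:
  assumes t: "regular t"
  shows "eqc (\<lambda>x. weak_deriv 1 (h t) x + weak_deriv 3 (h t) x) (\<lambda>x. z (t, x))"
    and "eqc (\<lambda>x. h t x powr (\<alpha> + 2) * \<psi> \<alpha> (weak_deriv 1 (h t) x + weak_deriv 3 (h t) x)) (\<lambda>x. J (t, x))"
proof -
  obtain v where v: "deriv_chain p v" "v 0 = h t" "v 3 = (\<lambda>x. z (t, x) - v 1 x)" by (rule regular_chain[OF t], rule that)
  have "eqc (weak_deriv j (h t)) (v j)" if "j \<le> 3" for j
    using weak_deriv_eqc(1)[OF deriv_chain_wderiv[OF v(1) _ that]] p1 by (simp add: v(2))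
  from this[of 1] this[of 3] show 1: "eqc (\<lambda>x. weak_deriv 1 (h t) x + weak_deriv 3 (h t) x) (\<lambda>x. z (t, x))"
    unfolding eqc_circ v(3) by simp (erule (1) eventually_elim2, simp)
  have "AE x in circ. J (t, x) = h t x powr (\<alpha> + 2) * \<psi> \<alpha> (z (t, x))" using t by (simp add: regular_def)
  with 1 show "eqc (\<lambda>x. h t x powr (\<alpha> + 2) * \<psi> \<alpha> (weak_deriv 1 (h t) x + weak_deriv 3 (h t) x)) (\<lambda>x. J (t, x))"
    unfolding eqc_circ by eventually_elim simp
qed

text \<open>Built from \<open>weak_deriv\<close> exactly as in the weak formulation, so identity
  (ii) holds by unfolding. What has to be proved is that this functional is the time derivative and
  lies in the Bochner space.\<close>

definition ht :: "real \<Rightarrow> (real \<Rightarrow> real) \<Rightarrow> real" where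
  "ht t = flux_fun (\<lambda>x. h t x powr (\<alpha> + 2) * \<psi> \<alpha> (weak_deriv 1 (h t) x + weak_deriv 3 (h t) x))"

text \<open>Mollified derivatives of nearby samples converge by \<open>deriv_chain_conv\<close>,
  \<psi> is continuous by \<open>psi_conv\<close>, and the mobility factors converge boundedly. This
  supplies the simple approximants of the flux functional.\<close>

lemma flux_conv:
  assumes t: "regular t" and e: "\<And>n. 0 < e' n" "\<And>n. e' n \<le> 1" "e' \<longlonglongrightarrow> 0"
    and s: "\<And>n x. \<bar>h (s n) x - h t x\<bar> \<le> e' n ^ 4"
  shows "Lp_conv circ q (\<lambda>n. JJ (e' n) (h (s n))) (\<lambda>x. J (t, x))"
proof -
  obtain v where v: "deriv_chain p v" "v 0 = h t" "v 3 = (\<lambda>x. z (t, x) - v 1 x)" by (rule regular_chain[OF t], rule that)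
  have p1': "p \<ge> 1" using p1 by simp
  have Lz: "Lpc p (\<lambda>x. z (t, x))" using t by (simp add: regular_def)
  have Lv: "Lpf circ p (v j)" if "j \<le> 3" for j using deriv_chain_Lpc[OF v(1) pq0(1) that] by (rule Lpc_Lpf)
  have Lc: "Lpf circ r f" if "cper f" "r > 0" for f r using cper_Lpc[OF that] by (rule Lpc_Lpf)
  have D: "Lp_conv circ p (\<lambda>n. mderiv (e' n) j (h (s n))) (v j)" if "j \<le> 3" for j
    using s by (intro deriv_chain_conv[OF v(1) p1' e cper_h _ that]) (simp add: v(2))
  have "Lp_conv circ p (\<lambda>n x. mderiv (e' n) 1 (h (s n)) x + mderiv (e' n) 3 (h (s n)) x) (\<lambda>x. v 1 x + v 3 x)"
    by (intro Lp_conv_add D Lv Lc cper_mderiv cper_h e pq0) auto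
  hence "Lp_conv circ p (\<lambda>n. zz (e' n) (h (s n))) (\<lambda>x. z (t, x))" by (simp add: zz_mderiv v(3))
  from psi_conv[OF alpha Lc[OF cper_zz[OF cper_h e(1)] pq0(1)] Lpc_Lpf[OF Lz] this]
  have "Lp_conv circ q (\<lambda>n x. \<psi> \<alpha> (zz (e' n) (h (s n)) x)) (\<lambda>x. \<psi> \<alpha> (z (t, x)))" .
  moreover have mh: "(\<lambda>x. mob (h r x)) \<in> borel_measurable circ" for r
    by (intro measurable_Iv measurable_compose[OF _ mob_meas] borel_measurable_continuous_onI) (use cper_h in auto)
  moreover have "(\<lambda>n. mob (h (s n) x)) \<longlonglongrightarrow> mob (h t x)" for x
  proof (rule isCont_tendsto_compose[of _ mob])
    show "isCont mob (h t x)" using mob_cont by (simp add: continuous_on_eq_continuous_at)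
    have l: "(\<lambda>n. e' n ^ 4) \<longlonglongrightarrow> 0" using tendsto_power[OF e(3), of 4] by simp
    show "(\<lambda>n. h (s n) x) \<longlonglongrightarrow> h t x" by (rule LIM_zero_cancel[OF Lim_null_comparison[OF _ l]]) (use s in simp)
  qed
  moreover have "\<bar>mob (h r x)\<bar> \<le> M powr (\<alpha> + 2)" for r x
    using mob_pos[of "h r x"] mob_le[OF h_range(2)[of r x]] by simp
  ultimately have "Lp_conv circ q (\<lambda>n x. mob (h (s n) x) * \<psi> \<alpha> (zz (e' n) (h (s n)) x)) (\<lambda>x. mob (h t x) * \<psi> \<alpha> (z (t, x)))"
    by (intro Lp_conv_mult_bounded[OF pq0(2) Lpf_psi[OF Lc[OF cper_zz[OF cper_h e(1)] pq0(1)]] Lpf_psi[OF Lpc_Lpf[OF Lz]]]) auto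
  moreover have "Ip circ q (\<lambda>x. JJ (e' n) (h (s n)) x - J (t, x))
      = Ip circ q (\<lambda>x. mob (h (s n) x) * \<psi> \<alpha> (zz (e' n) (h (s n)) x) - mob (h t x) * \<psi> \<alpha> (z (t, x)))" for n
  proof (rule Ip_cong_AE)
    have 1: "(\<lambda>x. J (t, x)) \<in> borel_measurable circ" "(\<lambda>x. z (t, x)) \<in> borel_measurable circ"
      using t by (auto simp: regular_def intro!: measurable_Iv Lpc_measurable)
    have 2: "JJ (e' n) (h (s n)) \<in> borel_measurable circ" "zz (e' n) (h (s n)) \<in> borel_measurable circ"
      using cper_JJ[OF cper_h e(1)] cper_zz[OF cper_h e(1)] by (auto intro!: measurable_Iv borel_measurable_continuous_onI)
    show "(\<lambda>x. JJ (e' n) (h (s n)) x - J (t, x)) \<in> borel_measurable circ"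
      "(\<lambda>x. mob (h (s n) x) * \<psi> \<alpha> (zz (e' n) (h (s n)) x) - mob (h t x) * \<psi> \<alpha> (z (t, x))) \<in> borel_measurable circ"
      by (intro borel_measurable_diff borel_measurable_times 1 2 mh measurable_compose[OF _ borel_measurable_psi])+
    have "AE x in circ. J (t, x) = mob (h t x) * \<psi> \<alpha> (z (t, x))" using t by (simp add: regular_def mob_h)
    thus "AE x in circ. JJ (e' n) (h (s n)) x - J (t, x) = mob (h (s n) x) * \<psi> \<alpha> (zz (e' n) (h (s n)) x) - mob (h t x) * \<psi> \<alpha> (z (t, x))"
      by eventually_elim (simp add: JJ_def)
  qed
  ultimately show ?thesis by simp
qed

lemma ht_bochner:
  "ht \<in> Lp_bochner {0<..<T} q (dual_space (sobolev 1 p) (sobolev_norm 1 p)) (dual_norm (sobolev 1 p) (sobolev_norm 1 p))"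
proof -
  obtain \<sigma> where \<sigma>: "\<And>n. \<sigma> n > 0" "\<And>n t x. t \<ge> 0 \<Longrightarrow> \<bar>h (grid (\<sigma> n) t) x - h t x\<bar> \<le> (1 / real (Suc n)) ^ 4"
    using grid_exists by blast
  let ?e = "\<lambda>n. 1 / real (Suc n)" and ?d = "dual_norm (sobolev 1 p) (sobolev_norm 1 p)"
  have LF: "Lpc q (JJ (?e n) (h r))" for n r by (rule cper_Lpc[OF cper_JJ[OF cper_h small_step_le(1)] pq0(2)])
  show ?thesis
  proof (rule Lp_bochner_I[where \<tau> = \<sigma> and F = "\<lambda>n k. flux_fun (JJ (?e n) (h (real k * \<sigma> n)))" and b = "\<lambda>t. Ip circ q (\<lambda>x. J (t, x))"])
    show "flux_fun (JJ (?e n) (h (real k * \<sigma> n))) \<in> dual_space (sobolev 1 p) (sobolev_norm 1 p)" for n k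
      by (rule flux_fun_dual[OF LF eqc_refl p1 q1 pq])
    show "integrable (Iv 0 T) (\<lambda>t. Ip circ q (\<lambda>x. J (t, x)))" by (rule Qm_Fubini(2)[OF Lpf_integrable[OF JL]])
    show "AE t in Iv 0 T. ht t \<in> dual_space (sobolev 1 p) (sobolev_norm 1 p) \<and>
        (\<lambda>n. ?d (\<lambda>u. flux_fun (JJ (?e n) (h (grid (\<sigma> n) t))) u - ht t u)) \<longlonglongrightarrow> 0 \<and>
        (\<lambda>n. ?d (flux_fun (JJ (?e n) (h (grid (\<sigma> n) t))))) \<longlonglongrightarrow> ?d (ht t) \<and>
        ?d (ht t) powr q \<le> Ip circ q (\<lambda>x. J (t, x))"
      using AE_regular
    proof eventually_elim
      case (elim t)
      let ?J = "\<lambda>x. J (t, x)" and ?u = "\<lambda>n. JJ (?e n) (h (grid (\<sigma> n) t))"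
      have t: "t \<ge> 0" and JL: "Lpc q ?J" using elim by (auto simp: regular_def)
      note f = JL regular_deriv(2)[OF elim]
      have c: "(\<lambda>n. Ip circ q (\<lambda>x. ?u n x - ?J x) powr (1 / q)) \<longlonglongrightarrow> 0 powr (1 / q)"
        using flux_conv[OF elim small_step_le avg_small_step \<sigma>(2)[OF t]] alpha by (intro tendsto_powr2) (auto simp: Ip_nonneg)
      hence c: "(\<lambda>n. Ip circ q (\<lambda>x. ?u n x - ?J x) powr (1 / q)) \<longlonglongrightarrow> 0" using q1 by simp
      note b = dual_norm_flux[OF LF eqc_refl f p1 q1 pq, folded ht_def]
      note b' = dual_norm_flux(3,4)[OF f f p1 q1 pq, folded ht_def]
      have "(\<lambda>n. ?d (\<lambda>w. flux_fun (?u n) w - ht t w)) \<longlonglongrightarrow> 0"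
        by (rule tendsto_sandwich[OF _ _ tendsto_const c]) (use b in auto)
      moreover have "(\<lambda>n. ?d (flux_fun (?u n)) - ?d (ht t)) \<longlonglongrightarrow> 0"
        by (rule Lim_null_comparison[OF _ c]) (use b in auto)
      hence "(\<lambda>n. ?d (flux_fun (?u n))) \<longlonglongrightarrow> ?d (ht t)" by (rule LIM_zero_cancel)
      moreover have "?d (ht t) powr q \<le> (Ip circ q ?J powr (1 / q)) powr q" using b' pq0 by (intro powr_mono2) auto
      hence "?d (ht t) powr q \<le> Ip circ q ?J" using pq0 alpha Ip_nonneg[of circ ?J q] by (simp add: powr_powr)
      moreover have "ht t \<in> dual_space (sobolev 1 p) (sobolev_norm 1 p)"
        unfolding ht_def by (rule flux_fun_dual[OF f p1 q1 pq])
      ultimately show ?case by blast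
    qed
  qed (rule \<sigma>)
qed

end

section \<open>Energy identity, continuity in time and conclusion\<close>

context film_weak
begin

definition JG :: "real \<Rightarrow> real" where "JG s = (\<integral>x. J (s, x) * z (s, x))"

lemma JG_integrable: "integrable (Iv 0 T) JG"
  and JG_integral: "(LINT y|Q. indicator {0..t} (fst y) * (J y * z y)) = (LINT s|Iv 0 T. indicator {0..t} s * JG s)"
proof -
  have i: "integrable Q (\<lambda>y. J y * z y)" by (rule Lpf_mult_integrable[OF JL zL q1 p1 qp])
  show "integrable (Iv 0 T) JG" using Qm_Fubini(2)[OF i] by (simp add: JG_def[abs_def])
  have "integrable Q (\<lambda>y. indicator {0..t} (fst y) * (J y * z y))"
    by (rule Bochner_Integration.integrable_bound[OF i measurable_Qm]) (measurable, auto simp: indicator_def)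
  from Qm_Fubini(1)[OF this]
  show "(LINT y|Q. indicator {0..t} (fst y) * (J y * z y)) = (LINT s|Iv 0 T. indicator {0..t} s * JG s)"
    by (simp add: JG_def)
qed

lemma energy_identity:
  assumes t: "t \<in> {0..T}"
  shows "energy (h t) + (LINT s|Iv 0 T. indicator {0..t} s * JG s) = energy h0"
proof -
  obtain v where v: "Lpc 2 v" "prim v (h t)" by (rule h_H1[OF t], rule that)
  show ?thesis
    using energy_equality[OF t v] energy_eq[OF cper_h v] energy_eq[OF h0 v0 prim0] unfolding JG_integral by linarith
qed

lemma dissipation_tendsto:
  assumes X: "X \<longlonglongrightarrow> t"
  shows "(\<lambda>n. LINT s|Iv 0 T. indicator {0..X n} s * JG s) \<longlonglongrightarrow> (LINT s|Iv 0 T. indicator {0..t} s * JG s)"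
proof (rule integral_dominated_convergence[where w = "\<lambda>s. \<bar>JG s\<bar>"])
  have m: "JG \<in> borel_measurable (Iv 0 T)" using JG_integrable by (rule borel_measurable_integrable)
  have mi: "(indicator {0..r} :: real \<Rightarrow> real) \<in> borel_measurable (Iv 0 T)" for r by (rule measurable_Iv) simp
  show "(\<lambda>s. indicator {0..t} s * JG s) \<in> borel_measurable (Iv 0 T)" "(\<lambda>s. indicator {0..X n} s * JG s) \<in> borel_measurable (Iv 0 T)" for n
    by (intro borel_measurable_times m mi)+
  show "AE s in Iv 0 T. norm (indicator {0..X n} s * JG s) \<le> \<bar>JG s\<bar>" for n
    by (intro AE_I2) (simp add: indicator_def)
  have "AE s in Iv 0 T. s \<noteq> t" using AE_lborel_singleton[of t] unfolding AE_Iv_iff by eventually_elim simp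
  thus "AE s in Iv 0 T. (\<lambda>n. indicator {0..X n} s * JG s) \<longlonglongrightarrow> indicator {0..t} s * JG s"
  proof eventually_elim
    case (elim s)
    have "eventually (\<lambda>n. indicator {0..X n} s = (indicator {0..t} s :: real)) sequentially"
    proof (cases "s < t")
      case True
      show ?thesis using order_tendstoD(1)[OF X True] by eventually_elim (use True in \<open>simp add: indicator_def\<close>)
    next
      case False
      hence "t < s" using elim by simp
      from order_tendstoD(2)[OF X this] show ?thesis by eventually_elim (use \<open>t < s\<close> in \<open>simp add: indicator_def\<close>)
    qed
    thus ?case by (intro tendsto_mult tendsto_const tendsto_eventually)
  qed
qed (use JG_integrable in simp)

text \<open>The energy identity gives convergence of the norms of the derivatives. By the
  parallelogram identity the distance is then controlled once the norm of the sum is bounded below,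
  and this is done by \<open>dsm\<close> of the sum at a fixed width, which passes to the limit
  under uniform convergence; finally the width tends to zero.\<close>

lemma h_derivative_conv:
  assumes X: "\<And>n. X n \<in> {0..T}" "X \<longlonglongrightarrow> t" and t: "t \<in> {0..T}"
    and V: "\<And>s. s \<in> {0..T} \<Longrightarrow> Lpc 2 (V s)" "\<And>s. s \<in> {0..T} \<Longrightarrow> prim (V s) (h s)"
  shows "Lp_conv circ 2 (\<lambda>n. h (X n)) (h t)" "Lp_conv circ 2 (\<lambda>n. V (X n)) (V t)"
proof -
  have near: "eventually (\<lambda>n. \<forall>x. \<bar>h (X n) x - h t x\<bar> \<le> \<epsilon>) sequentially" if \<epsilon>: "\<epsilon> > 0" for \<epsilon>
  proof -
    obtain d where d: "d > 0" "\<And>s t x. \<bar>t - s\<bar> \<le> d \<Longrightarrow> \<bar>h t x - h s x\<bar> \<le> \<epsilon>" using hcont[OF \<epsilon>] by force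
    have "eventually (\<lambda>n. dist (X n) t < d) sequentially" using X(2) d(1) by (rule tendstoD)
    thus ?thesis by eventually_elim (use d in \<open>auto simp: dist_real_def\<close>)
  qed
  have lim: "(\<lambda>n. h (X n) x) \<longlonglongrightarrow> h t x" for x
  proof (rule tendstoI)
    fix \<epsilon> :: real assume "\<epsilon> > 0"
    hence "\<epsilon> / 2 > 0" by simp
    from near[OF this] show "eventually (\<lambda>n. dist (h (X n) x) (h t x) < \<epsilon>) sequentially"
      by eventually_elim (use \<open>\<epsilon> > 0\<close> in \<open>auto simp: dist_real_def intro: le_less_trans[of _ "\<epsilon> / 2"]\<close>)
  qed
  have hm: "h s \<in> borel_measurable circ" for s by (intro measurable_Iv borel_measurable_continuous_onI) (use cper_h in auto)
  show "Lp_conv circ 2 (\<lambda>n. h (X n)) (h t)"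
  proof (rule Lp_conv_uniform[OF finite_measure_Iv _ _ hm hm])
    show "eventually (\<lambda>n. \<forall>x\<in>space circ. \<bar>h (X n) x - h t x\<bar> \<le> \<epsilon>) sequentially" if "\<epsilon> > 0" for \<epsilon>
      using near[OF that] by eventually_elim simp
  qed simp
  let ?S = "\<lambda>u. \<integral>x. (u x)\<^sup>2"
  have sq: "integrable circ (\<lambda>x. (u x)\<^sup>2)" if "Lpc 2 u" for u using Lpf_integrable[OF Lpc_Lpf[OF that]] by simp
  have hsq: "(\<lambda>n. ?S (h (X n))) \<longlonglongrightarrow> ?S (h t)" by (rule sq_integral_limit[OF t cper_h cper_h lim h_range(3)])
  \<comment> \<open>The Dirichlet integral is expressed by quantities that are already known to be
    continuous in time.\<close>
  have Veq: "?S (V s) = 2 * energy h0 - 2 * (LINT r|Iv 0 T. indicator {0..s} r * JG r) + ?S (h s)" if "s \<in> {0..T}" for s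
    using energy_identity[OF that] energy_eq[OF cper_h V[OF that]] by linarith
  have VX: "(\<lambda>n. ?S (V (X n))) \<longlonglongrightarrow> ?S (V t)"
    unfolding Veq[OF X(1)] Veq[OF t] by (intro tendsto_intros hsq dissipation_tendsto X)
  let ?d = "\<lambda>m. 1 / real (Suc m)" and ?w = "\<lambda>s x. 1 * h s x + 1 * h t x"
  have cw: "cper (?w s)" for s by (intro cper_lin cper_h)
  define U where "U = (\<lambda>m n. 2 * ?S (V (X n)) + 2 * ?S (V t) - ?S (dsm (?d m) (?w (X n))))"
  have 1: "?S (\<lambda>x. V (X n) x - V t x) \<le> U m n" for m n
  proof -
    note L = V(1)[OF X(1)[of n]] V(1)[OF t]
    have La: "Lpc 2 (\<lambda>x. 1 * V (X n) x + 1 * V t x)" by (intro Lpc_add Lpc_cmult L) simp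
    have "?S (\<lambda>x. V (X n) x - V t x) = (\<integral>x. 2 * (V (X n) x)\<^sup>2 + 2 * (V t x)\<^sup>2 - (1 * V (X n) x + 1 * V t x)\<^sup>2)"
      by (simp add: power2_eq_square algebra_simps)
    also have "\<dots> = 2 * ?S (V (X n)) + 2 * ?S (V t) - ?S (\<lambda>x. 1 * V (X n) x + 1 * V t x)"
      using sq[OF La] sq[OF L(1)] sq[OF L(2)] by simp
    finally have eq: "?S (\<lambda>x. V (X n) x - V t x) = \<dots>" .
    have "dsm (?d m) (?w (X n)) = avg3 (?d m) (\<lambda>x. 1 * V (X n) x + 1 * V t x)"
      by (rule dsm_of_prim[OF cw prim_lin[OF V(2)[OF X(1)] V(2)[OF t]]]) simp
    hence "?S (dsm (?d m) (?w (X n))) \<le> ?S (\<lambda>x. 1 * V (X n) x + 1 * V t x)"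
      using avg3_sq_le[OF La, of "?d m"] by simp
    thus ?thesis using eq unfolding U_def by linarith
  qed
  have 2: "(\<lambda>n. U m n) \<longlonglongrightarrow> 2 * ?S (V t) + 2 * ?S (V t) - ?S (dsm (?d m) (?w t))" for m
    unfolding U_def
  proof (intro tendsto_diff tendsto_add tendsto_mult tendsto_const VX)
    have d: "?d m > 0" by simp
    show "(\<lambda>n. ?S (dsm (?d m) (?w (X n)))) \<longlonglongrightarrow> ?S (dsm (?d m) (?w t))"
    proof (rule sq_integral_limit[OF t cper_dsm[OF cw d] cper_dsm[OF cw d]])
      show "\<bar>dsm (?d m) (?w (X n)) x\<bar> \<le> 2 * M / ?d m" for n x
      proof (rule dsm_bound[OF cw d])
        show "\<bar>?w (X n) y\<bar> \<le> 2 * M" for y using h_range(3)[of "X n" y] h_range(3)[of t y] by linarith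
      qed
      show "(\<lambda>n. dsm (?d m) (?w (X n)) x) \<longlonglongrightarrow> dsm (?d m) (?w t) x" for x
      proof (rule tendstoI)
        fix \<epsilon> :: real assume \<epsilon>: "\<epsilon> > 0"
        hence "\<epsilon> / 2 * ?d m > 0" by simp
        from near[OF this] show "eventually (\<lambda>n. dist (dsm (?d m) (?w (X n)) x) (dsm (?d m) (?w t) x) < \<epsilon>) sequentially"
        proof eventually_elim
          case (elim n)
          have "\<bar>dsm (?d m) (?w (X n)) x - dsm (?d m) (?w t) x\<bar> \<le> \<epsilon> / 2 * ?d m / ?d m"
            by (rule dsm_diff_bound[OF cw cw d]) (use elim in simp)
          also have "\<dots> = \<epsilon> / 2" using d by (intro nonzero_mult_div_cancel_right) linarith
          also have "\<dots> < \<epsilon>" using \<epsilon> by simp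
          finally show ?case by (simp add: dist_real_def)
        qed
      qed
    qed
  qed
  have 3: "(\<lambda>m. 2 * ?S (V t) + 2 * ?S (V t) - ?S (dsm (?d m) (?w t))) \<longlonglongrightarrow> 0"
  proof -
    have p: "prim (\<lambda>x. 1 * V t x + 1 * V t x) (?w t)" by (intro prim_lin V t)
    have "Lpc 2 (\<lambda>x. 1 * V t x + 1 * V t x)" using V(1)[OF t] by (intro Lpc_add Lpc_cmult) auto
    note tendsto_diff[OF tendsto_const[of "2 * ?S (V t) + 2 * ?S (V t)"] dsm_sq_limit[OF cw this p]]
    moreover have "?S (\<lambda>x. 1 * V t x + 1 * V t x) = 4 * ?S (V t)" by (simp add: power_mult_distrib)
    ultimately show ?thesis by simp
  qed
  have "(\<lambda>n. ?S (\<lambda>x. V (X n) x - V t x)) \<longlonglongrightarrow> 0"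
    by (rule tendsto_zero_diagonal[OF _ 1 2 3]) simp
  thus "Lp_conv circ 2 (\<lambda>n. V (X n)) (V t)" by simp
qed

lemma h_continuous_into: "h \<in> continuous_into {0..T} (sobolev 1 2) (sobolev_norm 1 2)"
proof -
  have "\<forall>s\<in>{0..T}. \<exists>v. Lpc 2 v \<and> prim v (h s)" using h_H1 by metis
  then obtain V where V: "\<And>s. s \<in> {0..T} \<Longrightarrow> Lpc 2 (V s)" "\<And>s. s \<in> {0..T} \<Longrightarrow> prim (V s) (h s)" by metis
  let ?v = "\<lambda>s j. if j = 0 then h s else V s"
  have wd: "wderiv j (h s) (?v s j)" if "s \<in> {0..T}" "j \<le> 1" for s j
    using that prim_wderiv[OF cper_h _ V(2)[OF that(1)]] V(1)[OF that(1)] wderiv_0[OF cper_Lper[OF cper_h]] Lpc_Lper[of 2 "V s"]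
    by (cases j) auto
  have L: "Lpc 2 (?v s j)" if "s \<in> {0..T}" for s j using V(1)[OF that] cper_Lpc[OF cper_h, of 2] by auto
  show ?thesis
    unfolding continuous_into_def
  proof (intro CollectI ballI conjI)
    fix t assume t: "t \<in> {0..T}"
    show "h t \<in> sobolev 1 2" by (intro sobolev_I[OF cper_h, where w = "?v t"] wd[OF t] L[OF t]) simp
    show "((\<lambda>s. sobolev_norm 1 2 (\<lambda>x. h s x - h t x)) \<longlongrightarrow> 0) (at t within {0..T})"
      unfolding tendsto_at_iff_sequentially o_def
    proof (intro allI impI)
      fix X assume "\<forall>i. X i \<in> {0..T} - {t}" and Xt: "X \<longlonglongrightarrow> t"
      hence X: "X i \<in> {0..T}" for i by blast
      show "(\<lambda>n. sobolev_norm 1 2 (\<lambda>x. h (X n) x - h t x)) \<longlonglongrightarrow> 0"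
      proof (rule sobolev_norm_conv[where f = "\<lambda>n. ?v (X n)" and g = "?v t"])
        show "Lp_conv circ 2 (\<lambda>n. ?v (X n) j) (?v t j)" if "j \<le> 1" for j
          using h_derivative_conv[OF X Xt t V] by (cases "j = 0") simp_all
      qed (use wd X t in auto)
    qed
  qed
qed

lemma ht_eq:
  assumes "regular t" "w' \<in> sobolev 1 p" "Lpc p v" "eqc (weak_deriv 1 w') v"
  shows "ht t w' = (\<integral>x. J (t, x) * v x)"
  unfolding ht_def using assms(1)
  by (intro flux_fun_eq[OF regular_deriv(2)] Lpc_measurable[OF assms(3)] assms(4) Lpc_measurable[of q]) (auto simp: regular_def)

lemma ht_time_deriv: "has_weak_time_deriv T (sobolev 1 p) h ht"
  unfolding has_weak_time_deriv_def
proof (intro allI impI ballI, elim conjE)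
  fix \<eta> u assume \<eta>: "smooth \<eta>" and supp: "closure {t. \<eta> t \<noteq> 0} \<subseteq> {0<..<T}" and u: "u \<in> sobolev 1 p"
  have z: "\<eta> 0 = 0" "\<eta> T = 0" using supp closure_subset[of "{t. \<eta> t \<noteq> 0}"] by auto
  obtain v where v: "cper u" "Lpc p v" "prim v u" "wderiv 1 u v" "eqc (weak_deriv 1 u) v"
    by (rule sobolev_1_rep[OF u]) (use p1 in simp, rule that)
  define B where "B = (\<lambda>s. \<integral>x. J (s, x) * v x)"
  define A where "A = (\<lambda>t. \<integral>x. h t x * u x)"
  have [measurable]: "v \<in> borel_measurable borel" "u \<in> borel_measurable borel"
    using Lpc_measurable[OF v(2)] v(1) by (auto intro: borel_measurable_continuous_onI)
  have Lv: "Lpf Q p (\<lambda>y. v (snd y))" by (intro LpfI Qm_snd v measurable_Qm) measurable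
  have i: "integrable Q (\<lambda>y. J y * v (snd y))" by (rule Lpf_mult_integrable[OF JL Lv q1 p1 qp])
  have iB: "integrable (Iv 0 T) B" using Qm_Fubini(2)[OF i] by (simp add: B_def[abs_def])
  have A: "A t = A 0 + (LINT s|Iv 0 T. indicator {0..t} s * B s)" if t: "t \<in> {0..T}" for t
  proof -
    have "integrable Q (\<lambda>y. indicator {0..t} (fst y) * (J y * v (snd y)))"
      by (rule Bochner_Integration.integrable_bound[OF i measurable_Qm]) (measurable, auto simp: indicator_def)
    from Qm_Fubini(1)[OF this] weak_equation[OF t v(1,2,3)] show ?thesis by (simp add: A_def B_def h_0)
  qed
  obtain R where R: "\<And>x. \<bar>u x\<bar> \<le> R" using cper_bounded[OF v(1)] by blast
  have "integrable Q (\<lambda>y. h (fst y) (snd y) * u (snd y))"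
  proof (rule Qm_bounded_integrable[OF measurable_Qm])
    show "\<bar>h (fst y) (snd y) * u (snd y)\<bar> \<le> M * R" for y unfolding abs_mult using R M_pos h_range(3) by (intro mult_mono) auto
  qed measurable
  from Qm_Fubini(2)[OF this] have iA: "integrable (Iv 0 T) A" by (simp add: A_def[abs_def])
  have m: "deriv \<eta> \<in> borel_measurable (Iv 0 T)" "\<eta> \<in> borel_measurable (Iv 0 T)"
    by (intro measurable_Iv borel_measurable_continuous_onI smooth_continuous smooth_deriv \<eta>)+
  have "(LINT \<theta>:{0..2 * pi}|lebesgue. h t \<theta> * u \<theta>) = A t" for t
    unfolding A_def by (rule set_integrable_eqc(2)[OF borel_measurable_continuous_onI eqc_refl]) (use cper_mult[OF cper_h v(1)] in blast)
  hence "(LINT t:{0<..<T}|lebesgue. deriv \<eta> t * (LINT \<theta>:{0..2 * pi}|lebesgue. h t \<theta> * u \<theta>)) = (LINT t|Iv 0 T. deriv \<eta> t * A t)"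
    using borel_measurable_times[OF m(1) borel_measurable_integrable[OF iA]] by (intro lebesgue_on_Iv(2)) simp_all
  also have "\<dots> = (LINT t|Iv 0 T. deriv \<eta> t * (A 0 + (LINT s|Iv 0 T. indicator {0..t} s * B s)))"
    by (rule Bochner_Integration.integral_cong[OF refl], subst A) simp_all
  also have "\<dots> = - (LINT t|Iv 0 T. \<eta> t * B t)" using T by (intro integral_by_parts_Iv iB \<eta> z) simp
  also have "(LINT t|Iv 0 T. \<eta> t * B t) = (LINT t:{0<..<T}|lebesgue. \<eta> t * ht t u)"
  proof (rule lebesgue_on_Iv(2)[symmetric])
    show "AE t in Iv 0 T. \<eta> t * ht t u = \<eta> t * B t"
      using AE_regular by eventually_elim (simp add: ht_eq[OF _ u v(2,5)] B_def)
  qed (use borel_measurable_times[OF m(2) borel_measurable_integrable[OF iB]] in simp_all)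
  finally show "(LINT t:{0<..<T}|lebesgue. deriv \<eta> t * (LINT \<theta>:{0..2 * pi}|lebesgue. h t \<theta> * u \<theta>)) = - (LINT t:{0<..<T}|lebesgue. \<eta> t * ht t u)" .
qed

text \<open>\<open>weak_equation\<close> tested with the constant 1, whose derivative vanishes; by
  positivity the L_1 norm is the integral.\<close>

lemma mass_conserved:
  assumes t: "t \<in> {0..T}"
  shows "Lp_circle_norm 1 (h t) = Lp_circle_norm 1 h0"
proof -
  have pr: "prim (\<lambda>x. 0) (\<lambda>x. 1)" by (simp add: prim_def)
  have "(\<integral>x. h t x * 1) = (\<integral>x. h0 x * 1) + (LINT y|Q. indicator {0..t} (fst y) * (J y * 0))"
    by (rule weak_equation[OF t cper_const Lpc_zero[OF pq0(1)] pr])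
  moreover have "(LINT x:{0..2 * pi}|lebesgue. \<bar>h s x\<bar> powr 1) = (\<integral>x. h s x)" for s
  proof (rule lebesgue_on_Iv(2))
    show "h s \<in> borel_measurable circ" by (intro measurable_Iv borel_measurable_continuous_onI) (use cper_h in auto)
    show "AE x in circ. \<bar>h s x\<bar> powr 1 = h s x"
    proof (intro AE_I2)
      show "\<bar>h s x\<bar> powr 1 = h s x" for x using h_range(1)[of s x] cl_pos by simp
    qed
  qed simp
  ultimately show ?thesis by (simp add: Lp_circle_norm_def h_0[symmetric])
qed

lemma dissipation_eq:
  assumes t: "t \<in> {0..T}"
  shows "(LINT s:{0..t}|lebesgue. LINT \<theta>:{0..2 * pi}|lebesgue.
          \<bar>h s \<theta>\<bar> powr (\<alpha> + 2) * \<bar>weak_deriv 1 (h s) \<theta> + weak_deriv 3 (h s) \<theta>\<bar> powr (\<alpha> + 1)) = (LINT s|Iv 0 T. indicator {0..t} s * JG s)"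
proof -
  have "(LINT s:{0..t}|lebesgue. LINT \<theta>:{0..2 * pi}|lebesgue.
          \<bar>h s \<theta>\<bar> powr (\<alpha> + 2) * \<bar>weak_deriv 1 (h s) \<theta> + weak_deriv 3 (h s) \<theta>\<bar> powr (\<alpha> + 1)) = (LINT s|Iv 0 t. JG s)"
  proof (rule lebesgue_on_Iv(2))
    show "JG \<in> borel_measurable (Iv 0 t)"
      using integrable_Iv_subset[OF JG_integrable, of 0 t] t by (auto intro: borel_measurable_integrable)
    have "AE s in Iv 0 t. regular s"
      using AE_regular t unfolding AE_Iv_iff by (auto elim: eventually_mono)
    thus "AE s in Iv 0 t. (LINT \<theta>:{0..2 * pi}|lebesgue.
          \<bar>h s \<theta>\<bar> powr (\<alpha> + 2) * \<bar>weak_deriv 1 (h s) \<theta> + weak_deriv 3 (h s) \<theta>\<bar> powr (\<alpha> + 1)) = JG s"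
    proof eventually_elim
      case (elim s)
      show ?case
        unfolding JG_def
      proof (rule lebesgue_on_Iv(2))
        show "(\<lambda>x. J (s, x) * z (s, x)) \<in> borel_measurable circ"
          by (intro measurable_Iv borel_measurable_times section_meas zm Jm)
        have "AE x in circ. J (s, x) = h s x powr (\<alpha> + 2) * \<psi> \<alpha> (z (s, x))" using elim by (simp add: regular_def)
        with regular_deriv(1)[OF elim] show "AE x in circ. \<bar>h s x\<bar> powr (\<alpha> + 2) * \<bar>weak_deriv 1 (h s) x + weak_deriv 3 (h s) x\<bar> powr (\<alpha> + 1) = J (s, x) * z (s, x)"
          unfolding eqc_circ
        proof eventually_elim
          case (elim x)
          thus ?case using psi_mult_self[of \<alpha> "z (s, x)"] h_range(1)[of s x] cl_pos by (simp add: mult.assoc)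
        qed
      qed simp
    qed
  qed simp
  also have "\<dots> = (LINT s|Iv 0 T. indicator {0..t} s * JG s)" using integral_Iv_restrict[of t T JG] t by simp
  finally show ?thesis .
qed

lemma weak_solution: "weak_solution \<alpha> h0 T h"
  unfolding weak_solution_def
proof (intro conjI exI[of _ ht] ballI)
  fix \<phi>
  show "(LINT t:{0<..<T}|lebesgue. ht t (\<phi> t)) = (LINT t:{0<..<T}|lebesgue. LINT \<theta>:{0..2 * pi}|lebesgue.
              h t \<theta> powr (\<alpha> + 2) * \<psi> \<alpha> (weak_deriv 1 (h t) \<theta> + weak_deriv 3 (h t) \<theta>) * weak_deriv 1 (\<phi> t) \<theta>)"
    by (simp add: ht_def flux_fun_def)
qed (use h_bochner h_continuous_into ht_time_deriv ht_bochner h_0 in auto)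

end

theorem theorem3p1:
  fixes \<alpha> C0 :: real and h0 :: "real \<Rightarrow> real"
  assumes "\<alpha> > 0"
    and "h0 \<in> sobolev 1 2"
    and "0 < C0"
    and "\<And>\<theta>. C0 \<le> h0 \<theta>"
  shows "\<exists>(T::real) (C1::real) (C2::real) (h :: real \<Rightarrow> real \<Rightarrow> real).
    T > 0 \<and> 0 < C1 \<and> C1 \<le> C2 \<and>
    (\<forall>t\<in>{0..T}. \<forall>\<theta>. C1 \<le> h t \<theta> \<and> h t \<theta> \<le> C2) \<and>
    weak_solution \<alpha> h0 T h \<and>
    (\<forall>t\<in>{0..T}. Lp_circle_norm 1 (h t) = Lp_circle_norm 1 h0) \<and>
    (\<forall>t\<in>{0..T}.
       energy (h t) +
       (LINT s:{0..t}|lebesgue. LINT \<theta>:{0..2 * pi}|lebesgue.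
          \<bar>h s \<theta>\<bar> powr (\<alpha> + 2) *
          \<bar>weak_deriv 1 (h s) \<theta> + weak_deriv 3 (h s) \<theta>\<bar> powr (\<alpha> + 1))
       = energy h0)"
proof -
  obtain v0 where v0: "cper h0" "Lpc 2 v0" "prim v0 h0" by (rule sobolev_1_rep[OF assms(2)]) (simp, rule that)
  interpret film \<alpha> C0 h0 v0 by unfold_locales (use assms v0 in auto)
  obtain T e \<tau> h w z J where "film_weak \<alpha> C0 h0 v0 T e \<tau> h w z J" by (rule film_weak_exists, rule that)
  then interpret film_weak \<alpha> C0 h0 v0 T e \<tau> h w z J .
  show ?thesis
    by (intro exI[of _ T] exI[of _ cl] exI[of _ M] exI[of _ h] conjI ballI allI T(1) cl_pos cl_le_M h_range(1,2)
      weak_solution mass_conserved) (simp_all only: dissipation_eq energy_identity)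
qed

end
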